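(* Let $N\ge3$, $k>0$, $2<p<2^\ast$, $Q\in L^\infty_c(\mathbb{R}^N,\mathbb{R})\setminus\{0\}$ and $\varphi\in L^\infty(\mathbb{R}^N)$. Assume furthermore that $Q\le0$ a.e. in $\mathbb{R}^N$ and $$\operatorname{diam}(\operatorname{supp}Q)\le\frac{\mathbf{z}(N)}{k},$$ where $\mathbf{z}(N)$ denotes the first positive zero of the Bessel function $Y_{\frac{N-2}{2}}$ of the second kind of order $\frac{N-2}{2}$. Let $$\mathcal{S}_\varphi:=\{(\lambda,u):\ \lambda\ge0,\ u\in L^\infty(\mathbb{R}^N),\ u=\mathcal{R}_k(Q|u|^{p-2}u)+\lambda\varphi\}\subset[0,\infty)\times L^\infty(\mathbb{R}^N),$$ and let $\mathcal{C}_\varphi$ be the connected component of $\mathcal{S}_\varphi$ which contains $(0,0)$. Then $\mathcal{C}_\varphi$ intersects $\{\lambda\}\times L^\infty(\mathbb{R}^N)$ for every $\lambda>0$. In particular, the equation $u=\mathcal{R}_k(Q|u|^{p-2}u)+\lambda\varphi$ admits a solution $u\in L^\infty(\mathbb{R}^N)$ with $\lambda=1$.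
   Context: $L^\infty(\mathbb{R}^N)$ consists of complex-valued functions; $L^\infty_c(\mathbb{R}^N,\mathbb{R})$ is the set of real-valued functions in $L^\infty(\mathbb{R}^N)$ with compact support. $2^\ast=\frac{2N}{N-2}$ is the critical Sobolev exponent. The outgoing fundamental solution is $$\Phi_k(x)=\frac{i}{4}\Big(\frac{k}{2\pi|x|}\Big)^{\frac{N-2}{2}}H^{(1)}_{\frac{N-2}{2}}(k|x|),\qquad x\in\mathbb{R}^N\setminus\{0\},$$ where $H^{(1)}_\nu$ is the Hankel function of the first kind of order $\nu$, and $\mathcal{R}_kf=\Phi_k*f$. *)

theory Defs
  imports "HOL-Probability.Essential_Supremum"
begin

section \<open>The space of essentially bounded functions\<close>

definition ess_bounded :: "('a::euclidean_space \<Rightarrow> 'b::euclidean_space) \<Rightarrow> bool"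
  where "ess_bounded f \<longleftrightarrow>
    f \<in> borel_measurable lebesgue \<and> esssup lebesgue (\<lambda>x. ereal (norm (f x))) < \<infinity>"

lemma ess_bounded_iff:
  "ess_bounded f \<longleftrightarrow> f \<in> borel_measurable lebesgue \<and> (\<exists>C. AE x in lebesgue. norm (f x) \<le> C)"
proof safe
  assume "ess_bounded f"
  then have m: "f \<in> borel_measurable lebesgue"
    and s: "esssup lebesgue (\<lambda>x. ereal (norm (f x))) < \<infinity>"
    by (auto simp: ess_bounded_def)
  show "f \<in> borel_measurable lebesgue" by (fact m)
  obtain C :: real where C: "esssup lebesgue (\<lambda>x. ereal (norm (f x))) \<le> ereal C"
    using s by (cases "esssup lebesgue (\<lambda>x. ereal (norm (f x)))") auto
  have "AE x in lebesgue. norm (f x) \<le> C"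
    using esssup_AE[of "\<lambda>x. ereal (norm (f x))" lebesgue]
    by eventually_elim (use C order_trans in fastforce)
  then show "\<exists>C. AE x in lebesgue. norm (f x) \<le> C" ..
next
  fix C assume m: "f \<in> borel_measurable lebesgue" and C: "AE x in lebesgue. norm (f x) \<le> C"
  have "esssup lebesgue (\<lambda>x. ereal (norm (f x))) \<le> ereal C"
    using m C by (intro esssup_I) auto
  then show "ess_bounded f"
    using m by (auto simp: ess_bounded_def)
qed

lemma ess_bounded_zero: "ess_bounded (\<lambda>x. 0)"
  by (auto simp: ess_bounded_iff)

lemma ess_bounded_add: "ess_bounded (\<lambda>x. f x + g x)" if "ess_bounded f" "ess_bounded g"
proof -
  obtain C D where "AE x in lebesgue. norm (f x) \<le> C" "AE x in lebesgue. norm (g x) \<le> D"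
    using \<open>ess_bounded f\<close> \<open>ess_bounded g\<close> by (auto simp: ess_bounded_iff)
  then have "AE x in lebesgue. norm (f x + g x) \<le> C + D"
    by eventually_elim (meson add_mono norm_triangle_ineq order_trans)
  then show ?thesis
    using that by (auto simp: ess_bounded_iff)
qed

lemma ess_bounded_scaleR: "ess_bounded (\<lambda>x. c *\<^sub>R f x)" if "ess_bounded f"
proof -
  obtain C where "AE x in lebesgue. norm (f x) \<le> C"
    using \<open>ess_bounded f\<close> by (auto simp: ess_bounded_iff)
  then have "AE x in lebesgue. norm (c *\<^sub>R f x) \<le> \<bar>c\<bar> * C"
    by eventually_elim (simp add: mult_left_mono)
  then show ?thesis
    using that by (auto simp: ess_bounded_iff)
qed

lemma ess_bounded_minus: "ess_bounded (\<lambda>x. f x - g x)" if "ess_bounded f" "ess_bounded g"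
  using ess_bounded_add[OF that(1) ess_bounded_scaleR[OF that(2), of "-1"]] by simp

lemma ess_bounded_uminus: "ess_bounded (\<lambda>x. - f x)" if "ess_bounded f"
  using ess_bounded_scaleR[OF that, of "-1"] by simp

lemma esssup_norm_bounds:
  assumes "ess_bounded (f :: 'a::euclidean_space \<Rightarrow> 'b::euclidean_space)"
  shows "AE x in lebesgue. norm (f x) \<le> real_of_ereal (esssup lebesgue (\<lambda>x. ereal (norm (f x))))"
    and "0 \<le> real_of_ereal (esssup lebesgue (\<lambda>x. ereal (norm (f x))))"
    and "AE x in lebesgue. norm (f x) \<le> C
      \<Longrightarrow> real_of_ereal (esssup lebesgue (\<lambda>x. ereal (norm (f x)))) \<le> C"
proof -
  let ?s = "esssup lebesgue (\<lambda>x. ereal (norm (f x)))"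
  have m: "f \<in> borel_measurable lebesgue" and fin: "?s < \<infinity>"
    using assms by (auto simp: ess_bounded_def)
  have "esssup lebesgue (\<lambda>x::'a. 0::ereal) \<le> ?s"
    by (rule esssup_mono) auto
  then have s0: "0 \<le> ?s"
    by (subst (asm) esssup_const) (auto simp: emeasure_completion emeasure_lborel_UNIV)
  then have real: "ereal (real_of_ereal ?s) = ?s"
    using fin by (cases ?s) auto
  show "0 \<le> real_of_ereal ?s"
    using s0 by (rule real_of_ereal_pos)
  show "AE x in lebesgue. norm (f x) \<le> real_of_ereal ?s"
    using esssup_AE[of "\<lambda>x. ereal (norm (f x))" lebesgue]
    by eventually_elim (use real in \<open>metis ereal_less_eq(3)\<close>)
  assume "AE x in lebesgue. norm (f x) \<le> C"
  then have "?s \<le> ereal C"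
    using m by (intro esssup_I) auto
  then show "real_of_ereal ?s \<le> C"
    using real by (metis ereal_less_eq(3))
qed

text \<open>An element of \<open>('a, 'b) linfty\<close> is a class, modulo equality almost everywhere, of essentially
  bounded Lebesgue measurable functions \<open>'a \<Rightarrow> 'b\<close>; \<open>rep_linfty u\<close> is some representative of \<open>u\<close>.\<close>

quotient_type (overloaded) ('a, 'b) linfty = "'a::euclidean_space \<Rightarrow> 'b::euclidean_space"
  / partial: "\<lambda>f g. ess_bounded f \<and> ess_bounded g \<and> (AE x in lebesgue. f x = g x)"
proof (rule part_equivpI)
  show "\<exists>f :: 'a \<Rightarrow> 'b. ess_bounded f \<and> ess_bounded f \<and> (AE x in lebesgue. f x = f x)"
    using ess_bounded_zero by auto
  show "symp (\<lambda>f g :: 'a \<Rightarrow> 'b. ess_bounded f \<and> ess_bounded g \<and> (AE x in lebesgue. f x = g x))"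
    by (auto intro!: sympI simp: eq_commute)
  show "transp (\<lambda>f g :: 'a \<Rightarrow> 'b. ess_bounded f \<and> ess_bounded g \<and> (AE x in lebesgue. f x = g x))"
    by (rule transpI) (auto elim: eventually_elim2)
qed

lemma ess_bounded_rep_linfty: "ess_bounded (rep_linfty u)"
  using Quotient3_rep_reflp[OF Quotient3_linfty, of u] by simp

lemma linfty_eq_iff: "u = v \<longleftrightarrow> (AE x in lebesgue. rep_linfty u x = rep_linfty v x)"
  using Quotient3_rel_rep[OF Quotient3_linfty, of u v] by (auto simp: ess_bounded_rep_linfty)

lemma rep_abs_linfty: "AE x in lebesgue. rep_linfty (abs_linfty f) x = f x" if "ess_bounded f"
  using rep_abs_rsp_left[OF Quotient3_linfty, of f f] that by auto

instantiation linfty :: (euclidean_space, euclidean_space) real_vector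
begin

lift_definition zero_linfty :: "('a, 'b) linfty" is "\<lambda>x. 0"
  by (simp add: ess_bounded_zero)

lift_definition plus_linfty :: "('a, 'b) linfty \<Rightarrow> ('a, 'b) linfty \<Rightarrow> ('a, 'b) linfty"
  is "\<lambda>f g x. f x + g x"
  by (auto simp: ess_bounded_add elim: eventually_elim2)

lift_definition minus_linfty :: "('a, 'b) linfty \<Rightarrow> ('a, 'b) linfty \<Rightarrow> ('a, 'b) linfty"
  is "\<lambda>f g x. f x - g x"
  by (auto simp: ess_bounded_minus elim: eventually_elim2)

lift_definition uminus_linfty :: "('a, 'b) linfty \<Rightarrow> ('a, 'b) linfty"
  is "\<lambda>f x. - f x"
  by (auto simp: ess_bounded_uminus)

lift_definition scaleR_linfty :: "real \<Rightarrow> ('a, 'b) linfty \<Rightarrow> ('a, 'b) linfty"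
  is "\<lambda>c f x. c *\<^sub>R f x"
  by (auto simp: ess_bounded_scaleR)

instance
proof
  fix u v w :: "('a, 'b) linfty" and a b :: real
  show "u + v + w = u + (v + w)"
    by transfer (auto simp: ess_bounded_add add.assoc)
  show "u + v = v + u"
    by transfer (auto simp: ess_bounded_add add.commute)
  show "0 + u = u"
    by transfer auto
  show "- u + u = 0"
    by transfer (auto simp: ess_bounded_zero)
  show "u - v = u + - v"
    by transfer (auto simp: ess_bounded_minus)
  show "a *\<^sub>R (u + v) = a *\<^sub>R u + a *\<^sub>R v"
    by transfer (auto simp: ess_bounded_add ess_bounded_scaleR scaleR_right_distrib)
  show "(a + b) *\<^sub>R u = a *\<^sub>R u + b *\<^sub>R u"
    by transfer (auto simp: ess_bounded_add ess_bounded_scaleR scaleR_left_distrib)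
  show "a *\<^sub>R b *\<^sub>R u = (a * b) *\<^sub>R u"
    by transfer (auto simp: ess_bounded_scaleR)
  show "1 *\<^sub>R u = u"
    by transfer auto
qed

end

instantiation linfty :: (euclidean_space, euclidean_space) real_normed_vector
begin

lift_definition norm_linfty :: "('a, 'b) linfty \<Rightarrow> real"
  is "\<lambda>f. real_of_ereal (esssup lebesgue (\<lambda>x. ereal (norm (f x))))"
  by (auto simp: ess_bounded_def intro!: arg_cong[where f = real_of_ereal] esssup_AE_cong)

definition dist_linfty :: "('a, 'b) linfty \<Rightarrow> ('a, 'b) linfty \<Rightarrow> real"
  where "dist_linfty u v = norm (u - v)"

definition sgn_linfty :: "('a, 'b) linfty \<Rightarrow> ('a, 'b) linfty"
  where "sgn_linfty u = u /\<^sub>R norm u"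

definition uniformity_linfty :: "(('a, 'b) linfty \<times> ('a, 'b) linfty) filter"
  where "uniformity_linfty = (INF e\<in>{0<..}. principal {(u, v). dist u v < e})"

definition open_linfty :: "('a, 'b) linfty set \<Rightarrow> bool"
  where "open_linfty U \<longleftrightarrow> (\<forall>u\<in>U. \<forall>\<^sub>F (u', v) in uniformity. u' = u \<longrightarrow> v \<in> U)"

instance
proof
  fix u v :: "('a, 'b) linfty" and a :: real
  show "dist u v = norm (u - v)"
    by (fact dist_linfty_def)
  show "sgn u = u /\<^sub>R norm u"
    by (fact sgn_linfty_def)
  show "(uniformity :: (('a, 'b) linfty \<times> ('a, 'b) linfty) filter)
      = (INF e\<in>{0<..}. principal {(u, v). dist u v < e})"
    by (fact uniformity_linfty_def)
  show "open U \<longleftrightarrow> (\<forall>u\<in>U. \<forall>\<^sub>F (u', v) in uniformity. u' = u \<longrightarrow> v \<in> U)"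
    for U :: "('a, 'b) linfty set"
    by (fact open_linfty_def)
  show "norm u = 0 \<longleftrightarrow> u = 0"
  proof transfer
    fix f :: "'a \<Rightarrow> 'b"
    let ?s = "real_of_ereal (esssup lebesgue (\<lambda>x. ereal (norm (f x))))"
    assume "ess_bounded f \<and> ess_bounded f \<and> (AE x in lebesgue. f x = f x)"
    then have f: "ess_bounded f"
      by auto
    have "AE x in lebesgue. f x = 0" if s: "?s = 0"
      using esssup_norm_bounds(1)[OF f] unfolding s by simp
    moreover have "?s = 0" if z: "AE x in lebesgue. f x = 0"
    proof -
      have "AE x in lebesgue. norm (f x) \<le> 0"
        using z by simp
      then show ?thesis
        using esssup_norm_bounds(2,3)[OF f] by (meson antisym)
    qed
    ultimately show "?s = 0 \<longleftrightarrow>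
        ess_bounded f \<and> ess_bounded (\<lambda>x::'a. 0::'b) \<and> (AE x in lebesgue. f x = 0)"
      using f ess_bounded_zero by blast
  qed
  show "norm (u + v) \<le> norm u + norm v"
  proof transfer
    fix f g :: "'a \<Rightarrow> 'b"
    let ?s = "\<lambda>f. real_of_ereal (esssup lebesgue (\<lambda>x::'a. ereal (norm (f x :: 'b))))"
    assume "ess_bounded f \<and> ess_bounded f \<and> (AE x in lebesgue. f x = f x)"
      and "ess_bounded g \<and> ess_bounded g \<and> (AE x in lebesgue. g x = g x)"
    then have f: "ess_bounded f" and g: "ess_bounded g"
      by auto
    have "AE x in lebesgue. norm (f x + g x) \<le> ?s f + ?s g"
      using esssup_norm_bounds(1)[OF f] esssup_norm_bounds(1)[OF g]
      by eventually_elim (meson add_mono norm_triangle_ineq order_trans)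
    then show "?s (\<lambda>x. f x + g x) \<le> ?s f + ?s g"
      by (rule esssup_norm_bounds(3)[OF ess_bounded_add[OF f g]])
  qed
  show "norm (a *\<^sub>R u) = \<bar>a\<bar> * norm u"
  proof transfer
    fix a :: real and f :: "'a \<Rightarrow> 'b"
    let ?s = "\<lambda>f. real_of_ereal (esssup lebesgue (\<lambda>x::'a. ereal (norm (f x :: 'b))))"
    assume "ess_bounded f \<and> ess_bounded f \<and> (AE x in lebesgue. f x = f x)"
    then have f: "ess_bounded f"
      by auto
    have le: "?s (\<lambda>x. c *\<^sub>R g x) \<le> \<bar>c\<bar> * ?s g" if g: "ess_bounded g" for c and g :: "'a \<Rightarrow> 'b"
    proof (rule esssup_norm_bounds(3)[OF ess_bounded_scaleR[OF g]])
      show "AE x in lebesgue. norm (c *\<^sub>R g x) \<le> \<bar>c\<bar> * ?s g"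
        using esssup_norm_bounds(1)[OF g] by eventually_elim (simp add: mult_left_mono)
    qed
    show "?s (\<lambda>x. a *\<^sub>R f x) = \<bar>a\<bar> * ?s f"
    proof (cases "a = 0")
      case True
      then show ?thesis
        using le[OF f, of 0] esssup_norm_bounds(2)[OF ess_bounded_scaleR[OF f, of 0]]
        unfolding True by (metis antisym abs_zero mult_zero_left)
    next
      case False
      have "\<bar>a\<bar> * ?s (\<lambda>x. inverse a *\<^sub>R a *\<^sub>R f x) \<le> \<bar>a\<bar> * (\<bar>inverse a\<bar> * ?s (\<lambda>x. a *\<^sub>R f x))"
        by (intro mult_left_mono le ess_bounded_scaleR f) auto
      with False have "\<bar>a\<bar> * ?s f \<le> ?s (\<lambda>x. a *\<^sub>R f x)"
        by (simp add: mult.assoc[symmetric] abs_mult[symmetric])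
      with le[OF f, of a] show ?thesis
        by simp
    qed
  qed
qed

end

text \<open>The support of a class of functions: the complement of the largest open set on which it
  vanishes almost everywhere.\<close>

definition ess_support :: "('a::euclidean_space, 'b::euclidean_space) linfty \<Rightarrow> 'a set"
  where "ess_support f =
    - \<Union>{U. open U \<and> (AE x in lebesgue. x \<in> U \<longrightarrow> rep_linfty f x = 0)}"

section \<open>Bessel and Hankel functions of real order, for positive argument\<close>

text \<open>Since \<open>rGamma\<close> is the reciprocal of the Gamma function, continued by \<open>0\<close> to the poles, the
  series is also correct for negative integers \<open>\<nu>\<close>.\<close>

definition bessel_J :: "real \<Rightarrow> real \<Rightarrow> real"
  where "bessel_J \<nu> x =
    (\<Sum>m. (- 1) ^ m * rGamma (\<nu> + real m + 1) / fact m * (x / 2) powr (2 * real m + \<nu>))"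

definition bessel_Y :: "real \<Rightarrow> real \<Rightarrow> real"
  where "bessel_Y \<nu> x =
   (let W = (\<lambda>\<mu>. (bessel_J \<mu> x * cos (\<mu> * pi) - bessel_J (- \<mu>) x) / sin (\<mu> * pi))
    in if \<nu> \<in> \<int> then Lim (at \<nu>) W else W \<nu>)"

definition hankel_H1 :: "real \<Rightarrow> real \<Rightarrow> complex"
  where "hankel_H1 \<nu> x = of_real (bessel_J \<nu> x) + \<i> * of_real (bessel_Y \<nu> x)"

text \<open>The positive zeros of \<open>Y\<^sub>\<nu>\<close> with \<open>\<nu> \<ge> 0\<close> exist and form a set which is closed and bounded away from
  \<open>0\<close> (as \<open>Y\<^sub>\<nu>(x)\<close> tends to \<open>-\<infinity>\<close> for \<open>x\<close> to \<open>0\<close>), so the infimum is the first one.\<close>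

definition first_zero_bessel_Y :: "real \<Rightarrow> real"
  where "first_zero_bessel_Y \<nu> = Inf {x. 0 < x \<and> bessel_Y \<nu> x = 0}"

section \<open>The Helmholtz resolvent and the nonlinear problem\<close>

definition helmholtz_Phi :: "real \<Rightarrow> 'a::euclidean_space \<Rightarrow> complex"
  where "helmholtz_Phi k x =
    (let \<nu> = (real DIM('a) - 2) / 2
     in \<i> / 4 * of_real ((k / (2 * pi * norm x)) powr \<nu>) * hankel_H1 \<nu> (k * norm x))"

definition helmholtz_R :: "real \<Rightarrow> ('a::euclidean_space \<Rightarrow> complex) \<Rightarrow> 'a \<Rightarrow> complex"
  where "helmholtz_R k f x = (LINT y|lebesgue. helmholtz_Phi k (x - y) * f y)"

definition nl_helmholtz_solutions ::
  "real \<Rightarrow> real \<Rightarrow> ('a::euclidean_space, real) linfty \<Rightarrow> ('a, complex) linfty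
    \<Rightarrow> (real \<times> ('a, complex) linfty) set"
  where "nl_helmholtz_solutions k p Q \<phi> =
    {(lam, u). 0 \<le> lam \<and>
      (AE x in lebesgue. rep_linfty u x =
        helmholtz_R k (\<lambda>y. of_real (rep_linfty Q y * norm (rep_linfty u y) powr (p - 2)) * rep_linfty u y) x
        + of_real lam * rep_linfty \<phi> x)}"

end

theory Submission
  imports Defs "HOL-Complex_Analysis.Complex_Analysis" "HOL-Probability.Probability"
begin

text \<open>Let \<open>\<nu> = N/2 - 1\<close> and let \<open>z\<close> be the first zero of \<open>Y\<^sub>\<nu>\<close>. The real part of the fundamental solution
  is \<open>c |x|\<^sup>-\<^sup>\<nu> (-Y\<^sub>\<nu>(k |x|))\<close>, which is positive for \<open>|x| < R := z/k\<close>. Its truncation to \<open>|x| < R\<close> has a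
  nonnegative Fourier transform: with \<open>\<phi>\<^sub>s(r) = (s r)\<^sup>-\<^sup>\<nu> J\<^sub>\<nu>(s r)\<close> up to a constant factor, Lagrange's identity for
  the radial Helmholtz equations with frequencies \<open>s\<close> and \<open>k\<close> shows that the transform at \<open>|\<xi>| = s\<close> is a
  positive multiple of \<open>(1 - \<phi>\<^sub>s(R)/\<phi>\<^sub>k(R)) / (s\<^sup>2 - k\<^sup>2)\<close>. The sign of this is clear once
  \<open>t\<^sup>-\<^sup>\<nu> J\<^sub>\<nu>(t)\<close> is at least its value at \<open>z\<close> for \<open>t \<le> z\<close> and at most this value for \<open>t \<ge> z\<close>.
  The second fact holds because \<open>J\<^sub>\<nu>\<^sup>2 + Y\<^sub>\<nu>\<^sup>2\<close> is decreasing, and because \<open>Y\<^sub>\<nu>(z) = 0\<close>. This monotonicity is proved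
  for the orders \<open>n/2\<close> by induction in steps of \<open>1\<close>, in the stronger form of complete monotonicity,
  the cases \<open>1/2\<close> and \<open>1\<close> being explicit.

  Hence \<open>Re \<integral>\<integral> \<Phi>(x - y) f(y) cnj f(x) \<ge> 0\<close> for bounded \<open>f\<close> supported in \<open>supp Q\<close>. Testing
  \<open>u = t R(Q|u|\<^sup>p\<^sup>-\<^sup>2u) + \<lambda>\<phi>\<close> with the conjugate of \<open>Q|u|\<^sup>p\<^sup>-\<^sup>2u\<close> bounds \<open>\<integral>|Q||u|\<^sup>p\<close> for
  \<open>0 \<le> t \<le> 1\<close> and bounded \<open>\<lambda>\<close>. As \<open>p\<close> is subcritical, Young's inequality turns this into
  \<open>\<parallel>u\<parallel> \<le> C (1 + \<parallel>u\<parallel>)\<^sup>\<theta>\<close> with \<open>\<theta> < 1\<close>, hence into a bound in the sup norm. A global continuation theorem,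
  deduced from Schauder's fixed point theorem, now gives the component. It is applied to
  \<open>v = u - \<lambda>\<phi>\<close> in the space of bounded continuous functions and then mapped to \<open>L\<^sup>\<infinity>\<close>.\<close>

text \<open>The real part of the kernel is not positive definite as a whole: its Fourier transform
  changes sign at |\<xi>| = k. The quadratic form, however, only sees differences of points of supp
  Q, and by the diameter condition these stay in the ball to which the kernel is truncated.
  Truncation exactly at a zero of Y keeps the kernel continuous off the origin and leaves a single
  boundary term at R in Lagrange's identity.

  Monotonicity of the amplitude alone is not inductive, since raising the order brings in its first
  two derivatives; so the induction carries the signs of all derivatives. The coefficient \<nu> -
  1/2 in the step is negative at \<nu> = 0, hence integer orders start at 1, and there the amplitude
  is read off from Hankel's integral. Identifying that integral with J and Y takes its exact
  behaviour at 0, including Euler's constant.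

  The fundamental solution is not integrable at infinity. For sources in supp Q it acts near supp Q
  like an integrable kernel of compact support, for which the nonlinear map is compact; elsewhere
  the solution is recovered from the equation itself.\<close>

section \<open>Bessel functions\<close>

text \<open>The factor of \<open>J\<^sub>\<mu>(x) = (x/2)\<^sup>\<mu> bessel_ser \<mu> (x\<^sup>2/4)\<close> that is entire in \<open>x\<close> and in \<open>\<mu>\<close>. Its derivative
  \<open>bessel_dser\<close> in \<open>\<mu>\<close> enters \<open>Y\<^sub>\<mu>\<close> at integers \<open>\<mu>\<close>; it needs the derivative \<open>drGamma\<close> of \<open>rGamma\<close> also at the poles of
  \<open>Gamma\<close>.\<close>

definition bessel_ser :: "real \<Rightarrow> real \<Rightarrow> real"
  where "bessel_ser \<mu> u = (\<Sum>m. (-1) ^ m * rGamma (\<mu> + real m + 1) / fact m * u ^ m)"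

definition drGamma :: "real \<Rightarrow> real"
  where "drGamma x = Re (deriv rGamma (complex_of_real x))"

definition bessel_dser :: "real \<Rightarrow> real \<Rightarrow> real"
  where "bessel_dser \<mu> u = (\<Sum>m. (-1) ^ m * drGamma (\<mu> + real m + 1) / fact m * u ^ m)"

section \<open>The reciprocal Gamma function and the power series\<close>

lemma DERIV_rGamma: "(rGamma has_real_derivative drGamma x) (at x)"
proof -
  have "(rGamma has_field_derivative deriv rGamma (complex_of_real x)) (at (complex_of_real x))"
    using field_differentiable_derivI field_differentiable_rGamma by blast
  then have "((\<lambda>x. rGamma (complex_of_real x)) has_vector_derivative deriv rGamma (complex_of_real x)) (at x)"
    by (rule has_vector_derivative_real_field)
  then have "((\<lambda>x. Re (rGamma (complex_of_real x))) has_vector_derivative drGamma x) (at x)"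
    unfolding drGamma_def by (rule bounded_linear.has_vector_derivative[OF bounded_linear_Re])
  then show ?thesis
    by (simp add: rGamma_complex_of_real has_real_derivative_iff_has_vector_derivative)
qed

lemma continuous_drGamma: "continuous_on A drGamma"
proof -
  have "continuous_on UNIV (deriv (rGamma :: complex \<Rightarrow> complex))"
    by (intro holomorphic_on_imp_continuous_on holomorphic_deriv holomorphic_intros) auto
  then have "continuous_on A (\<lambda>x::real. deriv rGamma (complex_of_real x))"
    by (rule continuous_on_compose2) (auto intro!: continuous_intros)
  then show ?thesis unfolding drGamma_def by (intro continuous_intros)
qed

lemma drGamma_1: "drGamma 1 = euler_mascheroni"
proof -
  have "(rGamma has_real_derivative euler_mascheroni) (at 1)"
    by (rule derivative_eq_intros refl | simp)+
  then show ?thesis using DERIV_rGamma DERIV_unique by blast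
qed

text \<open>Comes from differentiating the functional equation
  \<open>x * rGamma (x + 1) = rGamma x\<close>. It carries the bound on \<open>drGamma\<close> from
  one unit interval to the next.\<close>

lemma drGamma_plus1: "rGamma (x + 1) + x * drGamma (x + 1) = drGamma x"
proof -
  have "((\<lambda>x. x * rGamma (x + 1)) has_real_derivative (rGamma (x + 1) + x * drGamma (x + 1))) (at x)"
    by (rule derivative_eq_intros DERIV_chain2[OF DERIV_rGamma] refl | simp)+
  then have "(rGamma has_real_derivative (rGamma (x + 1) + x * drGamma (x + 1))) (at x)"
    by (simp add: rGamma_plus1)
  then show ?thesis using DERIV_rGamma DERIV_unique by blast
qed

text \<open>Compactness gives a bound on \<open>{-M..2}\<close>. To the right of 1 the functional
  equation divides by x \<ge> 1 at each unit step, so \<open>rGamma\<close> does not grow, while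
  \<open>drGamma\<close> picks up one copy of the bound per step; hence the linear factor.\<close>

lemma rGamma_growth:
  assumes "M \<ge> 0"
  shows "\<exists>C\<ge>0. \<forall>y\<ge>-M. \<bar>rGamma y\<bar> \<le> C \<and> \<bar>drGamma y\<bar> \<le> C * (\<bar>y\<bar> + 1)"
proof -
  have "compact ((\<lambda>x. (rGamma x, drGamma x)) ` {-M..2})"
    by (intro compact_continuous_image continuous_intros continuous_drGamma) auto
  then obtain C where "\<forall>z\<in>(\<lambda>x. (rGamma x, drGamma x)) ` {-M..2}. norm z \<le> C"
    using bounded_iff compact_imp_bounded by meson
  then have C0: "\<bar>rGamma x\<bar> \<le> C \<and> \<bar>drGamma x\<bar> \<le> C" if "x \<in> {-M..2}" for x
    using that norm_fst_le[of "rGamma x" "drGamma x"] norm_snd_le[of "drGamma x" "rGamma x"]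
    by (auto simp del: norm_Pair_le dest!: bspec)
  define D where "D = max C 0"
  have step: "\<bar>rGamma (y + real n)\<bar> \<le> D \<and> \<bar>drGamma (y + real n)\<bar> \<le> D * (real n + 1)"
    if "1 \<le> y" "y \<le> 2" for y n
  proof (induction n)
    case 0 show ?case using C0[of y] that assms by (auto simp: D_def)
  next
    case (Suc n)
    let ?x = "y + real n"
    have x: "?x \<ge> 1" using that by simp
    have a: "?x * rGamma (?x + 1) = rGamma ?x" by (rule rGamma_plus1)
    have a': "\<bar>rGamma (?x+1)\<bar> \<le> \<bar>rGamma ?x\<bar>"
      unfolding a[symmetric] abs_mult using x by (simp add: mult_le_cancel_right1)
    have b: "?x * drGamma (?x + 1) = drGamma ?x - rGamma (?x+1)"
      using drGamma_plus1[of ?x] by simp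
    have "\<bar>drGamma (?x+1)\<bar> \<le> \<bar>?x\<bar> * \<bar>drGamma (?x+1)\<bar>" using x by (simp add: mult_le_cancel_right1)
    also have "\<dots> \<le> \<bar>drGamma ?x\<bar> + \<bar>rGamma (?x+1)\<bar>" unfolding abs_mult[symmetric] b by simp
    finally have "\<bar>drGamma (?x+1)\<bar> \<le> D * (real n + 1) + D" using Suc a' by linarith
    moreover have "y + real (Suc n) = ?x + 1" by simp
    ultimately show ?case using a' Suc by (auto simp: algebra_simps)
  qed
  show ?thesis
  proof (intro exI[of _ D] conjI allI impI)
    show "D \<ge> 0" by (simp add: D_def)
    fix y assume y: "y \<ge> -M"
    have "\<bar>rGamma y\<bar> \<le> D \<and> \<bar>drGamma y\<bar> \<le> D * (\<bar>y\<bar> + 1)"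
    proof (cases "y \<le> 2")
      case True
      then have "\<bar>rGamma y\<bar> \<le> D" "\<bar>drGamma y\<bar> \<le> D" using C0[of y] y by (auto simp: D_def)
      moreover have "D \<le> D * (\<bar>y\<bar> + 1)" by (simp add: D_def algebra_simps)
      ultimately show ?thesis by linarith
    next
      case False
      \<comment> \<open>Chosen so that \<open>y - real n\<close> lies in \<open>{1..2}\<close>,
        where \<open>step\<close> applies; y > 2 keeps the natural subtraction exact.\<close>
      define n where "n = nat \<lfloor>y\<rfloor> - 1"
      have n: "real n = of_int \<lfloor>y\<rfloor> - 1"
        using False unfolding n_def by (simp add: of_nat_diff le_floor_iff nat_le_iff) linarith
      have "1 \<le> y - real n" "y - real n \<le> 2" using n by linarith+
      then have "\<bar>rGamma y\<bar> \<le> D \<and> \<bar>drGamma y\<bar> \<le> D * (real n + 1)"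
        using step[of "y - real n" n] by simp
      moreover have "D * (real n + 1) \<le> D * (\<bar>y\<bar>+1)" using n False of_int_floor_le[of y]
        by (intro mult_left_mono) (auto simp: D_def simp del: of_int_floor_le)
      ultimately show ?thesis by linarith
    qed
    then show "\<bar>rGamma y\<bar> \<le> D" "\<bar>drGamma y\<bar> \<le> D * (\<bar>y\<bar> + 1)" by auto
  qed
qed

text \<open>The factor m + B is at most (1 + |B|) 2^m, which the exponential series absorbs.\<close>

lemma summable_linear_exp:
  fixes B u :: real
  shows "summable (\<lambda>m. (real m + B) / fact m * u ^ m)"
proof -
  have "summable (\<lambda>m. (1 + \<bar>B\<bar>) * ((2 * \<bar>u\<bar>) ^ m /\<^sub>R fact m))"
    by (intro summable_mult summable_exp_generic)
  then show ?thesis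
  proof (rule summable_comparison_test'[of _ 0])
    fix m :: nat
    have "real m \<le> 2 ^ m" by (metis less_exp less_imp_le of_nat_le_iff of_nat_numeral of_nat_power)
    moreover have "\<bar>B\<bar> \<le> \<bar>B\<bar> * 2 ^ m" by (simp add: mult_le_cancel_left1)
    ultimately have "\<bar>real m + B\<bar> \<le> (1 + \<bar>B\<bar>) * 2 ^ m"
      unfolding distrib_right using abs_triangle_ineq[of "real m" B] by linarith
    then have "\<bar>real m + B\<bar> * (\<bar>u\<bar> ^ m / fact m) \<le> (1 + \<bar>B\<bar>) * 2 ^ m * (\<bar>u\<bar> ^ m / fact m)"
      by (intro mult_right_mono) auto
    then show "norm ((real m + B) / fact m * u ^ m) \<le> (1 + \<bar>B\<bar>) * ((2 * \<bar>u\<bar>) ^ m /\<^sub>R fact m)"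
      by (simp add: abs_mult power_abs power_mult_distrib divide_inverse mult_ac del: distrib_right distrib_left)
  qed
qed

text \<open>Termwise differentiation in \<mu> needs a majorant that is uniform over |\<mu>| \<le> M;
  one majorant serves the coefficients with \<open>rGamma\<close> and with
  \<open>drGamma\<close>.\<close>

lemma bessel_ser_bounds:
  obtains C B where "\<And>m \<mu>. \<bar>\<mu>\<bar> \<le> M \<Longrightarrow> \<bar>(-1) ^ m * rGamma (\<mu> + real m + 1) / fact m * u ^ m\<bar> \<le> C * ((real m + B) / fact m * \<bar>u\<bar> ^ m)"
    and "\<And>m \<mu>. \<bar>\<mu>\<bar> \<le> M \<Longrightarrow> \<bar>(-1) ^ m * drGamma (\<mu> + real m + 1) / fact m * u ^ m\<bar> \<le> C * ((real m + B) / fact m * \<bar>u\<bar> ^ m)"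
proof -
  obtain C where C: "C \<ge> 0" "\<And>y. y \<ge> -\<bar>M\<bar> \<Longrightarrow> \<bar>rGamma y\<bar> \<le> C \<and> \<bar>drGamma y\<bar> \<le> C * (\<bar>y\<bar> + 1)"
    using rGamma_growth[of "\<bar>M\<bar>"] by auto
  show ?thesis
  proof (rule that[of C "\<bar>M\<bar> + 2"])
    fix m and \<mu> :: real assume \<mu>: "\<bar>\<mu>\<bar> \<le> M"
    have 1: "C \<le> C * (real m + (\<bar>M\<bar> + 2))" using C(1) by (simp add: mult_le_cancel_left1)
    have 2: "C * (\<bar>\<mu> + real m + 1\<bar> + 1) \<le> C * (real m + (\<bar>M\<bar> + 2))"
      using \<mu> C(1) by (intro mult_left_mono) auto
    have ge: "\<mu> + real m + 1 \<ge> - \<bar>M\<bar>" using \<mu> by linarith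
    have "\<bar>rGamma (\<mu> + real m + 1)\<bar> \<le> C * (real m + (\<bar>M\<bar> + 2))"
      "\<bar>drGamma (\<mu> + real m + 1)\<bar> \<le> C * (real m + (\<bar>M\<bar> + 2))"
      using C(2)[of "\<mu> + real m + 1"] ge 1 2 by (meson order_trans)+
    then have "\<bar>rGamma (\<mu> + real m + 1)\<bar> * (\<bar>u\<bar> ^ m / fact m) \<le> C * (real m + (\<bar>M\<bar> + 2)) * (\<bar>u\<bar> ^ m / fact m)"
      "\<bar>drGamma (\<mu> + real m + 1)\<bar> * (\<bar>u\<bar> ^ m / fact m) \<le> C * (real m + (\<bar>M\<bar> + 2)) * (\<bar>u\<bar> ^ m / fact m)"
      by (auto simp del: times_divide_eq_right intro!: mult_right_mono)
    then show "\<bar>(-1) ^ m * rGamma (\<mu> + real m + 1) / fact m * u ^ m\<bar> \<le> C * ((real m + (\<bar>M\<bar> + 2)) / fact m * \<bar>u\<bar> ^ m)"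
      "\<bar>(-1) ^ m * drGamma (\<mu> + real m + 1) / fact m * u ^ m\<bar> \<le> C * ((real m + (\<bar>M\<bar> + 2)) / fact m * \<bar>u\<bar> ^ m)"
      by (simp_all add: abs_mult power_abs)
  qed
qed

lemma summable_bessel_ser: "summable (\<lambda>m. (-1) ^ m * rGamma (\<mu> + real m + 1) / fact m * u ^ m)"
  and summable_bessel_dser: "summable (\<lambda>m. (-1) ^ m * drGamma (\<mu> + real m + 1) / fact m * u ^ m)"
proof -
  obtain C B where *: "\<And>m \<nu>. \<bar>\<nu>\<bar> \<le> \<bar>\<mu>\<bar> \<Longrightarrow> \<bar>(-1) ^ m * rGamma (\<nu> + real m + 1) / fact m * u ^ m\<bar> \<le> C * ((real m + B) / fact m * \<bar>u\<bar> ^ m)"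
    "\<And>m \<nu>. \<bar>\<nu>\<bar> \<le> \<bar>\<mu>\<bar> \<Longrightarrow> \<bar>(-1) ^ m * drGamma (\<nu> + real m + 1) / fact m * u ^ m\<bar> \<le> C * ((real m + B) / fact m * \<bar>u\<bar> ^ m)"
    by (rule bessel_ser_bounds[where M = "\<bar>\<mu>\<bar>" and u = u]) blast
  have s: "summable (\<lambda>m. C * ((real m + B) / fact m * \<bar>u\<bar> ^ m))"
    by (intro summable_mult summable_linear_exp)
  show "summable (\<lambda>m. (-1) ^ m * rGamma (\<mu> + real m + 1) / fact m * u ^ m)"
    by (rule summable_comparison_test'[OF s, of 0]) (use *(1)[of \<mu>] in simp)
  show "summable (\<lambda>m. (-1) ^ m * drGamma (\<mu> + real m + 1) / fact m * u ^ m)"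
    by (rule summable_comparison_test'[OF s, of 0]) (use *(2)[of \<mu>] in simp)
qed

text \<open>Differentiation in u shifts the order up by one and changes the sign. The coefficient
  function g is abstract so that \<open>rGamma\<close> and \<open>drGamma\<close> are treated
  together.\<close>

lemma diffs_alternating_shift:
  fixes g :: "real \<Rightarrow> real"
  shows "diffs (\<lambda>m. (-1) ^ m * g (\<mu> + real m + 1) / fact m) m * u ^ m
    = - ((-1) ^ m * g (\<mu> + 1 + real m + 1) / fact m * u ^ m)"
proof -
  have "a * (- s * c / (a * F)) * v = - (s * c / F * v)" if "a \<noteq> 0" for a s c F v :: real
    using that by simp
  from this[of "real (Suc m)" "(-1) ^ m" "g (\<mu> + 1 + real m + 1)" "fact m" "u ^ m"]
  show ?thesis
    by (simp add: diffs_def add_ac)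
qed

lemma DERIV_bessel_ser: "((\<lambda>u. bessel_ser \<mu> u) has_real_derivative - bessel_ser (\<mu> + 1) u) (at u)"
proof -
  have "((\<lambda>u. \<Sum>m. (-1) ^ m * rGamma (\<mu> + real m + 1) / fact m * u ^ m) has_real_derivative
    (\<Sum>m. diffs (\<lambda>m. (-1) ^ m * rGamma (\<mu> + real m + 1) / fact m) m * u ^ m)) (at u)"
    by (rule termdiffs_strong_converges_everywhere) (rule summable_bessel_ser)
  also have "(\<lambda>m. diffs (\<lambda>m. (-1) ^ m * rGamma (\<mu> + real m + 1) / fact m) m * u ^ m)
     = (\<lambda>m. - ((-1) ^ m * rGamma (\<mu> + 1 + real m + 1) / fact m * u ^ m))"
    by (rule ext) (rule diffs_alternating_shift)
  also have "(\<Sum>m. - ((-1) ^ m * rGamma (\<mu> + 1 + real m + 1) / fact m * u ^ m)) = - bessel_ser (\<mu> + 1) u"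
    unfolding bessel_ser_def by (rule suminf_minus[OF summable_bessel_ser])
  finally show ?thesis by (simp add: bessel_ser_def)
qed

lemma DERIV_bessel_dser: "((\<lambda>u. bessel_dser \<mu> u) has_real_derivative - bessel_dser (\<mu> + 1) u) (at u)"
proof -
  have "((\<lambda>u. \<Sum>m. (-1) ^ m * drGamma (\<mu> + real m + 1) / fact m * u ^ m) has_real_derivative
    (\<Sum>m. diffs (\<lambda>m. (-1) ^ m * drGamma (\<mu> + real m + 1) / fact m) m * u ^ m)) (at u)"
    by (rule termdiffs_strong_converges_everywhere) (rule summable_bessel_dser)
  also have "(\<lambda>m. diffs (\<lambda>m. (-1) ^ m * drGamma (\<mu> + real m + 1) / fact m) m * u ^ m)
     = (\<lambda>m. - ((-1) ^ m * drGamma (\<mu> + 1 + real m + 1) / fact m * u ^ m))"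
    by (rule ext) (rule diffs_alternating_shift)
  also have "(\<Sum>m. - ((-1) ^ m * drGamma (\<mu> + 1 + real m + 1) / fact m * u ^ m)) = - bessel_dser (\<mu> + 1) u"
    unfolding bessel_dser_def by (rule suminf_minus[OF summable_bessel_dser])
  finally show ?thesis by (simp add: bessel_dser_def)
qed

text \<open>Comparison of coefficients: \<open>rGamma_plus1\<close> cancels the constant terms, and
  after an index shift the remaining ones form the series of order \<mu> + 1.\<close>

lemma bessel_ser_rec: "bessel_ser (\<mu> - 1) u = \<mu> * bessel_ser \<mu> u - u * bessel_ser (\<mu> + 1) u"
proof -
  let ?a = "\<lambda>\<mu> m. (-1) ^ m * rGamma (\<mu> + real m + 1) / fact m * u ^ m"
  have s: "summable (?a \<mu>')" for \<mu>' by (rule summable_bessel_ser)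
  have sm: "summable (\<lambda>m. ?a (\<mu> - 1) m - \<mu> * ?a \<mu> m)"
    by (intro summable_diff summable_mult s)
  have zero: "?a (\<mu> - 1) 0 - \<mu> * ?a \<mu> 0 = 0"
    using rGamma_plus1[of \<mu>] by simp
  have "bessel_ser (\<mu> - 1) u - \<mu> * bessel_ser \<mu> u = (\<Sum>m. ?a (\<mu> - 1) m - \<mu> * ?a \<mu> m)"
    unfolding bessel_ser_def
    by (simp only: suminf_diff[OF s summable_mult[OF s], symmetric] suminf_mult[OF s])
  also have "\<dots> = (\<Sum>m. ?a (\<mu> - 1) (Suc m) - \<mu> * ?a \<mu> (Suc m))"
    using suminf_split_head[OF sm] zero by linarith
  also have "\<dots> = (\<Sum>m. - u * ?a (\<mu> + 1) m)"
  proof (rule suminf_cong)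
    fix m
    have r: "rGamma (\<mu> - 1 + real (Suc m) + 1) = (\<mu> + real m + 1) * rGamma (\<mu> + real m + 2)"
      using rGamma_plus1[of "\<mu> + real m + 1"] by (simp add: add_ac)
    show "?a (\<mu> - 1) (Suc m) - \<mu> * ?a \<mu> (Suc m) = - u * ?a (\<mu> + 1) m"
      unfolding r by (simp add: divide_simps) (simp add: algebra_simps)
  qed
  also have "\<dots> = - u * bessel_ser (\<mu> + 1) u"
    unfolding bessel_ser_def by (rule suminf_mult[OF s])
  finally show ?thesis by simp
qed

text \<open>Termwise differentiation; the differentiated series converges uniformly on
  \<open>{-M..M}\<close>, which has \<mu> in its interior.\<close>

lemma DERIV_bessel_ser_order: "((\<lambda>\<mu>. bessel_ser \<mu> u) has_real_derivative bessel_dser \<mu> u) (at \<mu>)"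
proof -
  define M where "M = \<bar>\<mu>\<bar> + 1"
  obtain C B where *: "\<And>m \<nu>. \<bar>\<nu>\<bar> \<le> M \<Longrightarrow> \<bar>(-1) ^ m * rGamma (\<nu> + real m + 1) / fact m * u ^ m\<bar> \<le> C * ((real m + B) / fact m * \<bar>u\<bar> ^ m)"
    "\<And>m \<nu>. \<bar>\<nu>\<bar> \<le> M \<Longrightarrow> \<bar>(-1) ^ m * drGamma (\<nu> + real m + 1) / fact m * u ^ m\<bar> \<le> C * ((real m + B) / fact m * \<bar>u\<bar> ^ m)"
    by (rule bessel_ser_bounds[where M = M and u = u]) blast
  have s: "summable (\<lambda>m. C * ((real m + B) / fact m * \<bar>u\<bar> ^ m))"
    by (intro summable_mult summable_linear_exp)
  have unif: "uniformly_convergent_on {-M..M} (\<lambda>n \<mu>. \<Sum>m<n. (-1) ^ m * drGamma (\<mu> + real m + 1) / fact m * u ^ m)"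
    by (rule Weierstrass_m_test'[OF _ s]) (use *(2) in \<open>auto simp: abs_le_iff\<close>)
  have d: "((\<lambda>\<mu>. (-1) ^ m * rGamma (\<mu> + real m + 1) / fact m * u ^ m) has_real_derivative
      (-1) ^ m * drGamma (\<mu> + real m + 1) / fact m * u ^ m) (at \<mu>)" for m \<mu>
    by (rule derivative_eq_intros DERIV_chain2[OF DERIV_rGamma] refl | simp)+
  have \<mu>: "\<mu> \<in> {-M..M}" "\<mu> \<in> interior {-M..M}" unfolding M_def by auto
  show ?thesis
    unfolding bessel_ser_def bessel_dser_def
    by (rule has_field_derivative_series'(2)[where S = "{-M..M}" and
          f = "\<lambda>m \<mu>. (-1) ^ m * rGamma (\<mu> + real m + 1) / fact m * u ^ m" and
          f' = "\<lambda>m \<mu>. (-1) ^ m * drGamma (\<mu> + real m + 1) / fact m * u ^ m",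
          OF _ _ unif \<mu>(1) summable_bessel_ser \<mu>(2)])
      (simp, rule has_field_derivative_at_within[OF d])
qed

section \<open>Bessel functions J and Y and their recurrences\<close>

lemma bessel_J_eq: "x > 0 \<Longrightarrow> bessel_J \<mu> x = (x / 2) powr \<mu> * bessel_ser \<mu> (x\<^sup>2 / 4)"
proof -
  assume x: "x > 0"
  have *: "(-1) ^ m * rGamma (\<mu> + real m + 1) / fact m * (x / 2) powr (2 * real m + \<mu>) =
      (x / 2) powr \<mu> * ((-1) ^ m * rGamma (\<mu> + real m + 1) / fact m * (x\<^sup>2 / 4) ^ m)" for m
  proof -
    have "(x / 2) powr (2 * real m + \<mu>) = (x / 2) powr \<mu> * (x / 2) powr (real (2 * m))"
      by (simp add: powr_add)
    also have "(x / 2) powr (real (2 * m)) = (x\<^sup>2 / 4) ^ m"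
      using x by (subst powr_realpow) (auto simp: power_mult power_divide)
    finally show ?thesis by simp
  qed
  show ?thesis
    unfolding bessel_J_def bessel_ser_def by (simp only: * suminf_mult[OF summable_bessel_ser])
qed

text \<open>The derivative of J in its order. The logarithm comes from the factor (x / 2) powr
  \<mu>; at integer orders Y is made of these derivatives.\<close>

definition dbessel_J :: "real \<Rightarrow> real \<Rightarrow> real"
  where "dbessel_J \<mu> x = (x / 2) powr \<mu> * (ln (x / 2) * bessel_ser \<mu> (x\<^sup>2 / 4) + bessel_dser \<mu> (x\<^sup>2 / 4))"

lemma DERIV_bessel_J_order:
  assumes "x > 0" shows "((\<lambda>\<mu>. bessel_J \<mu> x) has_real_derivative dbessel_J \<mu> x) (at \<mu>)"
proof -
  have "((\<lambda>\<mu>. (x / 2) powr \<mu> * bessel_ser \<mu> (x\<^sup>2 / 4)) has_real_derivative dbessel_J \<mu> x) (at \<mu>)"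
    unfolding dbessel_J_def using assms
    by (auto intro!: derivative_eq_intros DERIV_bessel_ser_order simp: algebra_simps)
  then show ?thesis using assms by (simp add: bessel_J_eq)
qed

lemma bessel_J_rec: "bessel_J (\<mu> - 1) x + bessel_J (\<mu> + 1) x = 2 * \<mu> / x * bessel_J \<mu> x" if "x > 0"
proof -
  have p: "(x / 2) powr (\<mu> - 1) = (x / 2) powr \<mu> / (x / 2)" "(x / 2) powr (\<mu> + 1) = (x / 2) powr \<mu> * (x / 2)"
    using that by (simp_all add: powr_diff powr_add)
  show ?thesis
    unfolding bessel_J_eq[OF that] bessel_ser_rec p using that
    by (simp add: field_simps power2_eq_square)
qed

text \<open>The recurrence \<open>bessel_J_rec\<close> differentiated in \<mu>; the factor 2 \<mu> /
  x contributes the extra J term.\<close>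

lemma dbessel_J_rec:
  assumes "x > 0"
  shows "dbessel_J (\<mu> - 1) x + dbessel_J (\<mu> + 1) x = 2 / x * bessel_J \<mu> x + 2 * \<mu> / x * dbessel_J \<mu> x"
proof -
  note D = DERIV_bessel_J_order[OF assms]
  have "((\<lambda>\<mu>. bessel_J (\<mu> - 1) x + bessel_J (\<mu> + 1) x) has_real_derivative
      dbessel_J (\<mu> - 1) x + dbessel_J (\<mu> + 1) x) (at \<mu>)"
    by (rule derivative_eq_intros DERIV_chain2[OF D] refl | simp)+
  moreover have "((\<lambda>\<mu>. 2 * \<mu> / x * bessel_J \<mu> x) has_real_derivative
      2 / x * bessel_J \<mu> x + 2 * \<mu> / x * dbessel_J \<mu> x) (at \<mu>)"
    by (rule derivative_eq_intros D refl | use assms in \<open>simp add: algebra_simps\<close>)+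
  ultimately show ?thesis
    unfolding bessel_J_rec[OF assms] by (rule DERIV_unique)
qed

lemma DERIV_pos_cong:
  assumes "(g has_real_derivative D) (at x)" "x > 0" "\<And>x. x > 0 \<Longrightarrow> f x = g x"
  shows "(f has_real_derivative D) (at x)"
  using assms(1)
  by (rule has_field_derivative_transform_within_open[where S = "{0<..}"]) (use assms in auto)

lemma DERIV_bessel_J:
  assumes "x > 0"
  shows "(bessel_J \<mu> has_real_derivative (\<mu> / x * bessel_J \<mu> x - bessel_J (\<mu> + 1) x)) (at x)"
proof (rule DERIV_pos_cong[OF _ assms bessel_J_eq])
  show "((\<lambda>x. (x / 2) powr \<mu> * bessel_ser \<mu> (x\<^sup>2 / 4)) has_real_derivative \<mu> / x * bessel_J \<mu> x - bessel_J (\<mu> + 1) x) (at x)"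
    using assms
    by (auto intro!: derivative_eq_intros DERIV_chain2[OF DERIV_bessel_ser]
        simp: bessel_J_eq powr_add powr_diff field_simps)
qed

lemma DERIV_dbessel_J:
  assumes "x > 0"
  shows "(dbessel_J \<mu> has_real_derivative (bessel_J \<mu> x / x + \<mu> / x * dbessel_J \<mu> x - dbessel_J (\<mu> + 1) x)) (at x)"
  unfolding dbessel_J_def
    using assms
    by (auto intro!: derivative_eq_intros DERIV_chain2[OF DERIV_bessel_ser] DERIV_chain2[OF DERIV_bessel_dser]
        simp: bessel_J_eq powr_add powr_diff field_simps)

lemma cos_nat_pi: "cos (real n * pi) = (-1) ^ n"
  by (simp add: mult.commute)

text \<open>Two-step induction on the recurrence. At order 0 its right-hand side vanishes, which
  gives the case n = 1.\<close>

lemma bessel_J_minus_nat: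
  assumes "x > 0" shows "bessel_J (- real n) x = (-1) ^ n * bessel_J (real n) x"
proof (induction n rule: induct_nat_012)
  case 1
  show ?case using bessel_J_rec[OF assms, of 0] by simp
next
  case (ge2 n)
  show ?case using bessel_J_rec[OF assms, of "- real (Suc n)"] bessel_J_rec[OF assms, of "real (Suc n)"] ge2
    by (cases "even n") (simp_all add: algebra_simps add_divide_distrib diff_divide_distrib)
qed simp

text \<open>L'Hopital's rule with derivatives at the point only; it resolves the 0/0 in the
  definition of Y at integers.\<close>

lemma tendsto_quotient_at_zeros:
  fixes f g :: "real \<Rightarrow> real"
  assumes "(f has_real_derivative a) (at x)" "(g has_real_derivative b) (at x)" "f x = 0" "g x = 0" "b \<noteq> 0"
  shows "((\<lambda>y. f y / g y) \<longlongrightarrow> a / b) (at x)"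
proof -
  have "((\<lambda>y. ((f y - f x) / (y - x)) / ((g y - g x) / (y - x))) \<longlongrightarrow> a / b) (at x)"
    using assms by (intro tendsto_divide) (auto simp: has_field_derivative_iff)
  then show ?thesis
    by (rule Lim_transform_eventually) (use assms in \<open>auto simp: eventually_at_filter\<close>)
qed

text \<open>The quotient in \<open>bessel_Y\<close> is 0/0 at n, its numerator by
  \<open>bessel_J_minus_nat\<close>. The limit is the quotient of the derivatives in the
  order.\<close>

lemma bessel_Y_nat:
  assumes "x > 0"
  shows "bessel_Y (real n) x = (dbessel_J (real n) x + (-1) ^ n * dbessel_J (- real n) x) / pi"
proof -
  define W where "W = (\<lambda>\<mu>. (bessel_J \<mu> x * cos (\<mu> * pi) - bessel_J (- \<mu>) x) / sin (\<mu> * pi))"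
  note D = DERIV_bessel_J_order[OF assms]
  have s: "sin (real n * pi) = 0" by (simp add: sin_times_pi_eq_0)
  have "((\<lambda>\<mu>. bessel_J \<mu> x * cos (\<mu> * pi) - bessel_J (- \<mu>) x) has_real_derivative
      (-1) ^ n * dbessel_J (real n) x + dbessel_J (- real n) x) (at (real n))"
    by (rule derivative_eq_intros DERIV_chain2[OF D] D refl | simp add: s cos_nat_pi)+
  moreover have "((\<lambda>\<mu>. sin (\<mu> * pi)) has_real_derivative (-1) ^ n * pi) (at (real n))"
    by (rule derivative_eq_intros refl | simp add: s cos_nat_pi)+
  ultimately have "(W \<longlongrightarrow> ((-1) ^ n * dbessel_J (real n) x + dbessel_J (- real n) x) / ((-1) ^ n * pi)) (at (real n))"
    unfolding W_def
    by (rule tendsto_quotient_at_zeros) (auto simp: s cos_nat_pi bessel_J_minus_nat[OF assms] mult.commute)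
  then have "Lim (at (real n)) W = ((-1) ^ n * dbessel_J (real n) x + dbessel_J (- real n) x) / ((-1) ^ n * pi)"
    by (intro tendsto_Lim) auto
  also have "\<dots> = (dbessel_J (real n) x + (-1) ^ n * dbessel_J (- real n) x) / pi"
    by (cases "even n") (auto simp: field_simps)
  finally show ?thesis unfolding bessel_Y_def Let_def W_def by simp
qed

text \<open>The recurrences that Bessel functions \<open>f\<close> of order \<open>\<nu>\<close> and \<open>g\<close> of order \<open>\<nu> + 1\<close> share, whatever their kind.\<close>

definition ladder :: "real \<Rightarrow> (real \<Rightarrow> real) \<Rightarrow> (real \<Rightarrow> real) \<Rightarrow> bool"
  where "ladder \<nu> f g \<longleftrightarrow> (\<forall>x>0. (f has_real_derivative (\<nu> / x * f x - g x)) (at x) \<and>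
    (g has_real_derivative (f x - (\<nu> + 1) / x * g x)) (at x))"

lemma ladder_bessel_J: "ladder \<nu> (bessel_J \<nu>) (bessel_J (\<nu> + 1))"
  unfolding ladder_def
proof safe
  fix x :: real assume x: "x > 0"
  show "(bessel_J \<nu> has_real_derivative \<nu> / x * bessel_J \<nu> x - bessel_J (\<nu> + 1) x) (at x)"
    by (rule DERIV_bessel_J[OF x])
  have "(\<nu> + 1) / x * bessel_J (\<nu> + 1) x - bessel_J (\<nu> + 1 + 1) x = bessel_J \<nu> x - (\<nu> + 1) / x * bessel_J (\<nu> + 1) x"
    using bessel_J_rec[OF x, of "\<nu> + 1"] by (simp add: field_simps)
  with DERIV_bessel_J[OF x, of "\<nu> + 1"]
  show "(bessel_J (\<nu> + 1) has_real_derivative bessel_J \<nu> x - (\<nu> + 1) / x * bessel_J (\<nu> + 1) x) (at x)"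
    by metis
qed

text \<open>Y is built from derivatives of J in the order, whose recurrences carry an inhomogeneous
  J term. The contributions of the orders n and - n cancel, because
  \<open>bessel_J_minus_nat\<close> relates the two J.\<close>

lemma ladder_bessel_Y_nat: "ladder (real n) (bessel_Y (real n)) (bessel_Y (real n + 1))"
  unfolding ladder_def
proof (intro allI impI)
  fix x :: real assume x: "x > 0"
  let ?c = "(-1) ^ n :: real"
  have cc: "?c * ?c = 1" by (metis minus_one_mult_self)
  have D: "(bessel_Y (real n) has_real_derivative
      real n / x * bessel_Y (real n) x - bessel_Y (real (Suc n)) x) (at x)" for n
  proof -
    have Y: "((\<lambda>x. (dbessel_J (real n) x + (-1) ^ n * dbessel_J (- real n) x) / pi) has_real_derivative
        (bessel_J (real n) x / x + real n / x * dbessel_J (real n) x - dbessel_J (real n + 1) x +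
         (-1) ^ n * (bessel_J (- real n) x / x - real n / x * dbessel_J (- real n) x - dbessel_J (- real n + 1) x)) / pi) (at x)"
      using x by (auto intro!: derivative_eq_intros DERIV_dbessel_J)
    \<comment> \<open>At order - n, the recurrence trades the order - n + 1 for - (n + 1), the one
      that occurs in Y of order n + 1.\<close>
    have r: "dbessel_J (- real n + 1) x = 2 / x * ((-1) ^ n * bessel_J (real n) x) - 2 * real n / x * dbessel_J (- real n) x
        - dbessel_J (- real (Suc n)) x"
    proof -
      have "- real (Suc n) = - real n - 1" by simp
      with dbessel_J_rec[OF x, of "- real n"] show ?thesis by (simp only: bessel_J_minus_nat[OF x])
    qed
    have "(bessel_J (real n) x / x + real n / x * dbessel_J (real n) x - dbessel_J (real n + 1) x +
         (-1) ^ n * (bessel_J (- real n) x / x - real n / x * dbessel_J (- real n) x - dbessel_J (- real n + 1) x)) / pi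
        = real n / x * bessel_Y (real n) x - bessel_Y (real (Suc n)) x"
      unfolding bessel_Y_nat[OF x] r bessel_J_minus_nat[OF x]
      by (cases "even n") (simp_all add: add_divide_distrib diff_divide_distrib algebra_simps)
    with DERIV_pos_cong[OF Y x bessel_Y_nat] show ?thesis by simp
  qed
  have "bessel_Y (real n) x + bessel_Y (real (Suc (Suc n))) x = 2 * real (Suc n) / x * bessel_Y (real (Suc n)) x"
  proof -
    \<comment> \<open>For c = (-1)^n the first summand on the right is the inhomogeneous part, and
      it vanishes by \<open>cc\<close>.\<close>
    have comb: "A + c * B = p * j * (1 - c * c) + q * (d - c * m)"
      if "A = p * j + q * d" "B = p * (- c * j) - q * m" for A B c p q j d m :: real
      unfolding that by (simp add: algebra_simps)
    have i: "real (Suc n) - 1 = real n" "real (Suc n) + 1 = real (Suc (Suc n))"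
      "- real (Suc n) - 1 = - real (Suc (Suc n))" "- real (Suc n) + 1 = - real n"
      by simp_all
    have "dbessel_J (real n) x + dbessel_J (real (Suc (Suc n))) x
        = 2 / x * bessel_J (real (Suc n)) x + 2 * real (Suc n) / x * dbessel_J (real (Suc n)) x"
      using dbessel_J_rec[OF x, of "real (Suc n)"] unfolding i .
    moreover have "dbessel_J (- real (Suc (Suc n))) x + dbessel_J (- real n) x
        = 2 / x * (- ?c * bessel_J (real (Suc n)) x) - 2 * real (Suc n) / x * dbessel_J (- real (Suc n)) x"
      using dbessel_J_rec[OF x, of "- real (Suc n)"] unfolding i bessel_J_minus_nat[OF x]
      by (simp del: of_nat_Suc add: add.commute)
    ultimately have "dbessel_J (real n) x + dbessel_J (real (Suc (Suc n))) x
        + ?c * (dbessel_J (- real (Suc (Suc n))) x + dbessel_J (- real n) x)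
        = 2 / x * bessel_J (real (Suc n)) x * (1 - ?c * ?c)
        + 2 * real (Suc n) / x * (dbessel_J (real (Suc n)) x - ?c * dbessel_J (- real (Suc n)) x)"
      using comb by blast
    then have "(dbessel_J (real n) x + dbessel_J (real (Suc (Suc n))) x
        + ?c * (dbessel_J (- real (Suc (Suc n))) x + dbessel_J (- real n) x)) / pi
        = 2 * real (Suc n) / x * ((dbessel_J (real (Suc n)) x - ?c * dbessel_J (- real (Suc n)) x) / pi)"
      unfolding cc by simp
    then show ?thesis
      unfolding bessel_Y_nat[OF x] by (simp add: add_divide_distrib diff_divide_distrib distrib_left)
  qed
  then have "real (Suc n) / x * bessel_Y (real (Suc n)) x - bessel_Y (real (Suc (Suc n))) x
      = bessel_Y (real n) x - real (Suc n) / x * bessel_Y (real (Suc n)) x"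
    by (simp add: field_simps)
  moreover have "real n + 1 = real (Suc n)" by simp
  ultimately show "(bessel_Y (real n) has_real_derivative (real n / x * bessel_Y (real n) x - bessel_Y (real n + 1) x)) (at x) \<and>
    (bessel_Y (real n + 1) has_real_derivative (bessel_Y (real n) x - (real n + 1) / x * bessel_Y (real n + 1) x)) (at x)"
    using D[of n] D[of "Suc n"] by metis
qed

text \<open>At half-odd orders the cosine in the definition of Y vanishes and the sine is a sign, so
  Y is J of the opposite order up to sign. The shift n - 1/2 lets n = 0 cover the order
  -1/2.\<close>

lemma bessel_Y_half: "bessel_Y (real n - 1 / 2) = (\<lambda>x. (-1) ^ n * bessel_J (1 / 2 - real n) x)"
proof -
  have c: "cos ((real n - 1 / 2) * pi) = 0" for n
    using sin_npi[of n] by (simp add: algebra_simps cos_diff)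
  have s: "sin ((real n - 1 / 2) * pi) = - ((-1) ^ n)" for n
    by (simp add: algebra_simps sin_diff)
  have N: "real n - 1 / 2 \<notin> \<int>" for n
  proof
    assume "real n - 1 / 2 \<in> \<int>"
    then obtain k where "real n - 1 / 2 = of_int k" by (auto elim: Ints_cases)
    then have "real_of_int (2 * int n - 1) = of_int (2 * k)" by simp
    then have "2 * int n - 1 = 2 * k" by (simp only: of_int_eq_iff)
    then show False by presburger
  qed
  show ?thesis
  proof
    fix x
    have "- (real n - 1 / 2) = 1 / 2 - real n" by simp
    then show "bessel_Y (real n - 1 / 2) x = (-1) ^ n * bessel_J (1 / 2 - real n) x"
      unfolding bessel_Y_def Let_def c s using N[of n] by (cases "even n") auto
  qed
qed

lemma ladder_bessel_Y_half: "ladder (real n - 1 / 2) (bessel_Y (real n - 1 / 2)) (bessel_Y (real n - 1 / 2 + 1))"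
proof -
  note Y = bessel_Y_half
  have Y': "bessel_Y (real n - 1 / 2 + 1) = (\<lambda>x. - ((-1) ^ n * bessel_J (1 / 2 - real n - 1) x))"
    using Y[of "Suc n"] by (simp add: algebra_simps)
  show ?thesis
    unfolding ladder_def Y Y'
  proof (intro allI impI conjI)
    fix x :: real assume x: "x > 0"
    have r: "bessel_J (1 / 2 - real n + 1) x = 2 * (1 / 2 - real n) / x * bessel_J (1 / 2 - real n) x - bessel_J (1 / 2 - real n - 1) x"
      using bessel_J_rec[OF x, of "1 / 2 - real n"] by simp
    have "(-1) ^ n * ((1 / 2 - real n) / x * bessel_J (1 / 2 - real n) x - bessel_J (1 / 2 - real n + 1) x)
        = (real n - 1 / 2) / x * ((-1) ^ n * bessel_J (1 / 2 - real n) x) - - ((-1) ^ n * bessel_J (1 / 2 - real n - 1) x)"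
      unfolding r by (simp add: algebra_simps diff_divide_distrib add_divide_distrib)
    then show "((\<lambda>x. (-1) ^ n * bessel_J (1 / 2 - real n) x) has_real_derivative
          (real n - 1 / 2) / x * ((-1) ^ n * bessel_J (1 / 2 - real n) x) - - ((-1) ^ n * bessel_J (1 / 2 - real n - 1) x)) (at x)"
      using DERIV_cmult[OF DERIV_bessel_J[OF x], of "(-1) ^ n" "1 / 2 - real n"] by metis
    have "- ((-1) ^ n * ((1 / 2 - real n - 1) / x * bessel_J (1 / 2 - real n - 1) x - bessel_J (1 / 2 - real n - 1 + 1) x))
        = (-1) ^ n * bessel_J (1 / 2 - real n) x - (real n - 1 / 2 + 1) / x * - ((-1) ^ n * bessel_J (1 / 2 - real n - 1) x)"
      by (simp add: algebra_simps diff_divide_distrib add_divide_distrib)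
    then show "((\<lambda>x. - ((-1) ^ n * bessel_J (1 / 2 - real n - 1) x)) has_real_derivative
          (-1) ^ n * bessel_J (1 / 2 - real n) x - (real n - 1 / 2 + 1) / x * - ((-1) ^ n * bessel_J (1 / 2 - real n - 1) x)) (at x)"
      using DERIV_minus[OF DERIV_cmult[OF DERIV_bessel_J[OF x], of "(-1) ^ n" "1 / 2 - real n - 1"]] by metis
  qed
qed

text \<open>Counting the orders as (n - 1)/2 starts them at -1/2, so that the two-step inductions
  below have their base cases at the orders -1/2 and 0.\<close>

lemma ladder_bessel_Y: "ladder ((real n - 1) / 2) (bessel_Y ((real n - 1) / 2)) (bessel_Y ((real n - 1) / 2 + 1))"
proof (cases "even n")
  case True
  then obtain m where "n = 2 * m" by (auto elim: evenE)
  then have "(real n - 1) / 2 = real m - 1 / 2" by simp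
  then show ?thesis using ladder_bessel_Y_half[of m] by metis
next
  case False
  then obtain m where "n = 2 * m + 1" by (auto elim: oddE)
  then have "(real n - 1) / 2 = real m" by simp
  then show ?thesis using ladder_bessel_Y_nat[of m] by metis
qed

section \<open>Consequences of the ladder equations\<close>

lemma ladderD:
  assumes "ladder \<nu> f g" "x > 0"
  shows "(f has_real_derivative (\<nu> / x * f x - g x)) (at x)"
    and "(g has_real_derivative (f x - (\<nu> + 1) / x * g x)) (at x)"
  using assms by (auto simp: ladder_def)

lemma ladder_isCont: "ladder \<nu> f g \<Longrightarrow> x > 0 \<Longrightarrow> isCont f x" "ladder \<nu> f g \<Longrightarrow> x > 0 \<Longrightarrow> isCont g x"
  by (blast dest: ladderD DERIV_isCont)+

lemma DERIV_zero_pos_const: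
  fixes f :: "real \<Rightarrow> real"
  assumes "\<And>x. x > 0 \<Longrightarrow> (f has_real_derivative 0) (at x)"
  obtains c where "\<And>x. x > 0 \<Longrightarrow> f x = c"
proof -
  have "\<exists>c. \<forall>x\<in>{0<..}. f x = c"
    by (rule has_field_derivative_zero_constant) (auto intro: has_field_derivative_at_within assms)
  then show ?thesis using that by auto
qed

text \<open>Abel's identity: by the two pairs of ladder equations all terms of the derivative
  cancel.\<close>

lemma ladder_wronskian:
  assumes "ladder \<nu> f g" "ladder \<nu> F G"
  obtains c where "\<And>x. x > 0 \<Longrightarrow> x * (g x * F x - f x * G x) = c"
proof (rule DERIV_zero_pos_const[of "\<lambda>x. x * (g x * F x - f x * G x)"])
  fix x :: real assume x: "x > 0"
  show "((\<lambda>x. x * (g x * F x - f x * G x)) has_real_derivative 0) (at x)"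
    by (rule derivative_eq_intros ladderD[OF assms(1) x] ladderD[OF assms(2) x] refl
        | use x in \<open>simp add: field_simps\<close>)+
qed (use that in blast)

text \<open>The middle function g has its derivative prescribed by both ladders.\<close>

lemma ladder_rec:
  assumes "ladder \<nu> f g" "ladder (\<nu> + 1) g h" "x > 0"
  shows "h x = 2 * (\<nu> + 1) / x * g x - f x"
  using DERIV_unique[OF ladderD(2)[OF assms(1,3)] ladderD(1)[OF assms(2,3)]] by (simp add: field_simps)

section \<open>Behaviour at the origin and the sign of the Wronskian\<close>

lemma bessel_ser_0 [simp]: "bessel_ser \<mu> 0 = rGamma (\<mu> + 1)" "bessel_dser \<mu> 0 = drGamma (\<mu> + 1)"
  unfolding bessel_ser_def bessel_dser_def by (subst powser_zero, simp)+

lemma isCont_bessel_ser [continuous_intros]: "isCont (bessel_ser \<mu>) u"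
  using DERIV_bessel_ser DERIV_isCont by blast

lemma isCont_bessel_dser [continuous_intros]: "isCont (bessel_dser \<mu>) u"
  using DERIV_bessel_dser DERIV_isCont by blast

lemma tendsto_bessel_ser_square: "((\<lambda>x. bessel_ser \<mu> (x\<^sup>2 / 4)) \<longlongrightarrow> rGamma (\<mu> + 1)) (at_right 0)"
  "((\<lambda>x. bessel_dser \<mu> (x\<^sup>2 / 4)) \<longlongrightarrow> drGamma (\<mu> + 1)) (at_right 0)"
proof -
  have "((\<lambda>x::real. x\<^sup>2 / 4) \<longlongrightarrow> 0) (at_right 0)" by real_asymp
  from isCont_tendsto_compose[OF isCont_bessel_ser this] isCont_tendsto_compose[OF isCont_bessel_dser this]
  show "((\<lambda>x. bessel_ser \<mu> (x\<^sup>2 / 4)) \<longlongrightarrow> rGamma (\<mu> + 1)) (at_right 0)"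
    "((\<lambda>x. bessel_dser \<mu> (x\<^sup>2 / 4)) \<longlongrightarrow> drGamma (\<mu> + 1)) (at_right 0)"
    by simp_all
qed

lemma rGamma_pos: "x > 0 \<Longrightarrow> rGamma x > (0::real)"
  by (simp add: rGamma_inverse_Gamma Gamma_real_pos)

text \<open>The logarithm that survives is multiplied by \<open>bessel_ser 0 (x^2 / 4) - 1\<close>,
  hence equals ln (x / 2) x^2 / 4 times a difference quotient and tends to 0. What is left is
  \<open>drGamma 1\<close>, Euler's constant.\<close>

lemma tendsto_dbessel_J_0: "((\<lambda>x. dbessel_J 0 x - ln (x / 2)) \<longlongrightarrow> euler_mascheroni) (at_right 0)"
proof -
  have d: "((\<lambda>u. (bessel_ser 0 u - bessel_ser 0 0) / u) \<longlongrightarrow> - bessel_ser 1 0) (at 0)"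
    using DERIV_bessel_ser[of 0 0] by (simp add: has_field_derivative_iff)
  have "filterlim (\<lambda>x::real. x\<^sup>2 / 4) (at 0) (at_right 0)" by real_asymp
  from filterlim_compose[OF d this]
  have 1: "((\<lambda>x. (bessel_ser 0 (x\<^sup>2 / 4) - 1) / (x\<^sup>2 / 4)) \<longlongrightarrow> -1) (at_right 0)"
    using rGamma_plus1[of "1::real"] by simp
  have 2: "((\<lambda>x::real. ln (x / 2) * (x\<^sup>2 / 4)) \<longlongrightarrow> 0) (at_right 0)" by real_asymp
  have "((\<lambda>x. ln (x / 2) * (x\<^sup>2 / 4) * ((bessel_ser 0 (x\<^sup>2 / 4) - 1) / (x\<^sup>2 / 4)) + bessel_dser 0 (x\<^sup>2 / 4))
      \<longlongrightarrow> 0 * -1 + euler_mascheroni) (at_right 0)"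
    using tendsto_bessel_ser_square(2)[of 0] by (intro tendsto_intros 1 2) (simp add: drGamma_1)
  then have "((\<lambda>x. ln (x / 2) * (x\<^sup>2 / 4) * ((bessel_ser 0 (x\<^sup>2 / 4) - 1) / (x\<^sup>2 / 4)) + bessel_dser 0 (x\<^sup>2 / 4))
      \<longlongrightarrow> euler_mascheroni) (at_right 0)" by simp
  then show ?thesis
    by (rule Lim_transform_eventually) (auto simp: eventually_at_filter dbessel_J_def field_simps)
qed

text \<open>Constancy is \<open>ladder_wronskian\<close>; the point is the sign. By
  \<open>ladder_rec\<close> the Wronskian does not change when the order rises by 1. At order -1/2
  it is x times a sum of two squares, and at order 0 its limit at the origin is 2/\<pi>.\<close>

lemma wronskian_JY:
  "\<exists>w>0. \<forall>x>0. x * (bessel_J ((real n - 1) / 2 + 1) x * bessel_Y ((real n - 1) / 2) x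
    - bessel_J ((real n - 1) / 2) x * bessel_Y ((real n - 1) / 2 + 1) x) = w"
proof (induction n rule: induct_nat_012)
  case 0
  obtain w where w: "\<And>x. x > 0 \<Longrightarrow> x * (bessel_J (1 / 2) x * bessel_Y (- (1 / 2)) x - bessel_J (- (1 / 2)) x * bessel_Y (1 / 2) x) = w"
    by (rule ladder_wronskian[OF ladder_bessel_J[of "- (1/2)", simplified] ladder_bessel_Y[of 0, simplified]]) auto
  have Y: "bessel_Y (- (1 / 2)) = bessel_J (1 / 2)" "bessel_Y (1 / 2) = (\<lambda>x. - bessel_J (- (1 / 2)) x)"
    using bessel_Y_half[of 0] bessel_Y_half[of 1] by auto
  have "\<forall>\<^sub>F x in at_right 0. bessel_ser (- (1 / 2)) (x\<^sup>2 / 4) > 0"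
    by (rule order_tendstoD(1)[OF tendsto_bessel_ser_square(1)]) (simp add: rGamma_pos)
  moreover have "\<forall>\<^sub>F x in at_right (0::real). x > 0" by (simp add: eventually_at_right_less)
  ultimately have "\<forall>\<^sub>F x in at_right 0. x > 0 \<and> bessel_ser (- (1 / 2)) (x\<^sup>2 / 4) > 0"
    by eventually_elim simp
  from eventually_happens'[OF trivial_limit_at_right_real this]
  obtain x where x: "x > 0" "bessel_ser (- (1 / 2)) (x\<^sup>2 / 4) \<noteq> 0" by auto
  then have "bessel_J (- (1 / 2)) x \<noteq> 0" by (simp add: bessel_J_eq)
  then have "w > 0" unfolding w[OF x(1), symmetric] Y using x
    by (auto intro!: mult_pos_pos add_nonneg_pos simp: power2_eq_square[symmetric])
  then show ?case using w by auto
next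
  case 1
  obtain w where w: "\<And>x. x > 0 \<Longrightarrow> x * (bessel_J 1 x * bessel_Y 0 x - bessel_J 0 x * bessel_Y 1 x) = w"
    by (rule ladder_wronskian[OF ladder_bessel_J[of "0"] ladder_bessel_Y[of 1, simplified]]) auto
  have Y0: "bessel_Y 0 x = 2 / pi * dbessel_J 0 x" if "x > 0" for x
    using bessel_Y_nat[OF that, of 0] by simp
  have Y1: "x * bessel_Y 1 x = 2 / pi * (x * dbessel_J 1 x - bessel_J 0 x)" if x: "x > 0" for x
  proof -
    have "(bessel_Y 0 has_real_derivative 2 / pi * (bessel_J 0 x / x - dbessel_J 1 x)) (at x)"
      using DERIV_cmult[OF DERIV_dbessel_J[OF x], of "2 / pi" 0] by (intro DERIV_pos_cong[OF _ x Y0]) auto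
    from DERIV_unique[OF this ladderD(1)[OF ladder_bessel_Y[of 1] x, simplified]] show ?thesis using x
      by (simp add: field_simps)
  qed
  have xln: "((\<lambda>x::real. x * (x / 2) * ln (x / 2)) \<longlongrightarrow> 0) (at_right 0)" by real_asymp
  have p: "(x / 2) powr 1 = x / 2" if "x > 0" for x :: real using that by simp
  \<comment> \<open>The Wronskian of order 0, expanded so that ln occurs only in products that tend
    to 0 or in the difference \<open>dbessel_J 0 x - ln (x / 2)\<close>.\<close>
  have "((\<lambda>x. (x * (x / 2) * ln (x / 2)) * bessel_ser 1 (x\<^sup>2 / 4) * (2 / pi) + x * (x / 2) * bessel_ser 1 (x\<^sup>2 / 4) * (2 / pi) * (dbessel_J 0 x - ln (x / 2))
      - bessel_ser 0 (x\<^sup>2 / 4) * (2 / pi) * ((x * (x / 2) * ln (x / 2)) * bessel_ser 1 (x\<^sup>2 / 4) + x * (x / 2) * bessel_dser 1 (x\<^sup>2 / 4) - bessel_ser 0 (x\<^sup>2 / 4)))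
     \<longlongrightarrow> 0 * rGamma (1 + 1) * (2 / pi) + 0 * (0 / 2) * rGamma (1 + 1) * (2 / pi) * euler_mascheroni
       - rGamma (0 + 1) * (2 / pi) * (0 * rGamma (1 + 1) + 0 * (0 / 2) * drGamma (1 + 1) - rGamma (0 + 1))) (at_right 0)"
    by (intro tendsto_intros xln tendsto_bessel_ser_square tendsto_dbessel_J_0) auto
  moreover have "\<forall>\<^sub>F x in at_right 0. (x * (x / 2) * ln (x / 2)) * bessel_ser 1 (x\<^sup>2 / 4) * (2 / pi) + x * (x / 2) * bessel_ser 1 (x\<^sup>2 / 4) * (2 / pi) * (dbessel_J 0 x - ln (x / 2))
      - bessel_ser 0 (x\<^sup>2 / 4) * (2 / pi) * ((x * (x / 2) * ln (x / 2)) * bessel_ser 1 (x\<^sup>2 / 4) + x * (x / 2) * bessel_dser 1 (x\<^sup>2 / 4) - bessel_ser 0 (x\<^sup>2 / 4)) = w"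
    unfolding eventually_at_filter
  proof (intro always_eventually allI impI)
    fix x :: real assume "x \<in> {0<..}" then have x: "x > 0" by simp
    have "w = x * bessel_J 1 x * bessel_Y 0 x - bessel_J 0 x * (x * bessel_Y 1 x)"
      using w[OF x] by (simp add: algebra_simps)
    then show "(x * (x / 2) * ln (x / 2)) * bessel_ser 1 (x\<^sup>2 / 4) * (2 / pi) + x * (x / 2) * bessel_ser 1 (x\<^sup>2 / 4) * (2 / pi) * (dbessel_J 0 x - ln (x / 2))
      - bessel_ser 0 (x\<^sup>2 / 4) * (2 / pi) * ((x * (x / 2) * ln (x / 2)) * bessel_ser 1 (x\<^sup>2 / 4) + x * (x / 2) * bessel_dser 1 (x\<^sup>2 / 4) - bessel_ser 0 (x\<^sup>2 / 4)) = w"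
      unfolding Y1[OF x] Y0[OF x] bessel_J_eq[OF x] dbessel_J_def p[OF x] using x
      by (simp add: algebra_simps)
  qed
  ultimately have "((\<lambda>_. w) \<longlongrightarrow> 0 * rGamma (1 + 1) * (2 / pi) + 0 * (0 / 2) * rGamma (1 + 1) * (2 / pi) * euler_mascheroni
       - rGamma (0 + 1) * (2 / pi) * (0 * rGamma (1 + 1) + 0 * (0 / 2) * drGamma (1 + 1) - rGamma (0 + 1))) (at_right (0::real))"
    by (rule Lim_transform_eventually)
  then have "w = 2 / pi" by (simp add: tendsto_const_iff)
  then show ?case using w by (intro exI[of _ w]) auto
next
  case (ge2 n)
  then obtain w where w: "w > 0" "\<And>x. x > 0 \<Longrightarrow> x * (bessel_J ((real n - 1) / 2 + 1) x * bessel_Y ((real n - 1) / 2) x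
    - bessel_J ((real n - 1) / 2) x * bessel_Y ((real n - 1) / 2 + 1) x) = w" by auto
  have e: "(real (Suc (Suc n)) - 1) / 2 = (real n - 1) / 2 + 1" by (simp add: field_simps)
  show ?case
  proof (intro exI[of _ w] conjI w allI impI)
    fix x :: real assume x: "x > 0"
    show "x * (bessel_J ((real (Suc (Suc n)) - 1) / 2 + 1) x * bessel_Y ((real (Suc (Suc n)) - 1) / 2) x
      - bessel_J ((real (Suc (Suc n)) - 1) / 2) x * bessel_Y ((real (Suc (Suc n)) - 1) / 2 + 1) x) = w"
      unfolding e w(2)[OF x, symmetric]
        ladder_rec[OF ladder_bessel_J[of "(real n - 1) / 2"] ladder_bessel_J[of "(real n - 1) / 2 + 1"] x]
        ladder_rec[OF ladder_bessel_Y[of n] ladder_bessel_Y[of "Suc (Suc n)", unfolded e] x]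
      by (simp add: algebra_simps)
  qed
qed

text \<open>The Wronskian gives x J_\<nu> Y_(\<nu>+1) = x J_(\<nu>+1) Y_\<nu> - w, where the first
  term on the right tends to 0. That limit at the next order rests on the growth of Y just found, so
  one induction carries both claims.\<close>

lemma tendsto_bessel_Y_0:
  "\<exists>A>0. ((\<lambda>x. x powr ((real n - 1) / 2 + 1) * bessel_Y ((real n - 1) / 2 + 1) x) \<longlongrightarrow> - A) (at_right 0)"
proof -
  have main: "((\<lambda>x. x * bessel_J ((real n - 1) / 2 + 1) x * bessel_Y ((real n - 1) / 2) x) \<longlongrightarrow> 0) (at_right 0)
    \<and> (\<exists>A>0. ((\<lambda>x. x powr ((real n - 1) / 2 + 1) * bessel_Y ((real n - 1) / 2 + 1) x) \<longlongrightarrow> - A) (at_right 0))"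
  proof (induction n rule: induct_nat_012)
    have step: "\<exists>A>0. ((\<lambda>x. x powr ((real n - 1) / 2 + 1) * bessel_Y ((real n - 1) / 2 + 1) x) \<longlongrightarrow> - A) (at_right 0)"
      if L: "((\<lambda>x. x * bessel_J ((real n - 1) / 2 + 1) x * bessel_Y ((real n - 1) / 2) x) \<longlongrightarrow> 0) (at_right 0)" for n
    proof -
      define \<nu> where "\<nu> = (real n - 1) / 2"
      obtain w where w: "w > 0" "\<And>x. x > 0 \<Longrightarrow> x * (bessel_J (\<nu> + 1) x * bessel_Y \<nu> x - bessel_J \<nu> x * bessel_Y (\<nu> + 1) x) = w"
        using wronskian_JY[of n] unfolding \<nu>_def by auto
      have r: "rGamma (\<nu> + 1) > 0" by (rule rGamma_pos) (simp add: \<nu>_def field_simps)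
      have "((\<lambda>x. (x * bessel_J (\<nu> + 1) x * bessel_Y \<nu> x - w) * 2 powr \<nu> / bessel_ser \<nu> (x\<^sup>2 / 4))
          \<longlongrightarrow> (0 - w) * 2 powr \<nu> / rGamma (\<nu> + 1)) (at_right 0)"
        using L r by (intro tendsto_intros tendsto_bessel_ser_square) (auto simp: \<nu>_def)
      moreover have "\<forall>\<^sub>F x in at_right 0. (x * bessel_J (\<nu> + 1) x * bessel_Y \<nu> x - w) * 2 powr \<nu> / bessel_ser \<nu> (x\<^sup>2 / 4)
          = x powr (\<nu> + 1) * bessel_Y (\<nu> + 1) x"
        using order_tendstoD(1)[OF tendsto_bessel_ser_square(1) r] eventually_at_right_less[of "0::real"]
      proof eventually_elim
        case (elim x)
        have "x * bessel_J (\<nu> + 1) x * bessel_Y \<nu> x - w = x * bessel_J \<nu> x * bessel_Y (\<nu> + 1) x"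
          using w(2)[OF elim(2)] by (simp add: algebra_simps)
        then show ?case using elim by (simp add: bessel_J_eq powr_divide powr_add)
      qed
      ultimately have "((\<lambda>x. x powr (\<nu> + 1) * bessel_Y (\<nu> + 1) x) \<longlongrightarrow> (0 - w) * 2 powr \<nu> / rGamma (\<nu> + 1)) (at_right 0)"
        by (rule Lim_transform_eventually)
      then show ?thesis using r w unfolding \<nu>_def[symmetric]
        by (intro exI[of _ "w * 2 powr \<nu> / rGamma (\<nu> + 1)"]) auto
    qed
    {
      case 0
      have Y: "bessel_Y (- (1 / 2)) = bessel_J (1 / 2)" using bessel_Y_half[of 0] by auto
      have "((\<lambda>x. x * (x / 2) * (bessel_ser (1 / 2) (x\<^sup>2 / 4))\<^sup>2) \<longlongrightarrow> 0 * (0 / 2) * (rGamma (1 / 2 + 1))\<^sup>2) (at_right 0)"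
        by (intro tendsto_intros tendsto_bessel_ser_square) auto
      then have "((\<lambda>x. x * (x / 2) * (bessel_ser (1 / 2) (x\<^sup>2 / 4))\<^sup>2) \<longlongrightarrow> 0) (at_right 0)" by simp
      then have "((\<lambda>x. x * bessel_J (1 / 2) x * bessel_Y (- (1 / 2)) x) \<longlongrightarrow> 0) (at_right 0)"
        by (rule Lim_transform_eventually)
           (auto simp: eventually_at_filter Y bessel_J_eq power2_eq_square powr_add[symmetric] mult_ac simp flip: powr_add)
      then show ?case using step[of 0] by simp
    next
      case 1
      have Y0: "bessel_Y 0 x = 2 / pi * dbessel_J 0 x" if "x > 0" for x
        using bessel_Y_nat[OF that, of 0] by simp
      have xln: "((\<lambda>x::real. x * (x / 2) * ln (x / 2)) \<longlongrightarrow> 0) (at_right 0)" by real_asymp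
      have "((\<lambda>x. (x * (x / 2) * ln (x / 2)) * bessel_ser 1 (x\<^sup>2 / 4) * (2 / pi) + x * (x / 2) * bessel_ser 1 (x\<^sup>2 / 4) * (2 / pi) * (dbessel_J 0 x - ln (x / 2)))
         \<longlongrightarrow> 0 * rGamma (1 + 1) * (2 / pi) + 0 * (0 / 2) * rGamma (1 + 1) * (2 / pi) * euler_mascheroni) (at_right 0)"
        by (intro tendsto_intros xln tendsto_bessel_ser_square tendsto_dbessel_J_0) auto
      then have "((\<lambda>x. (x * (x / 2) * ln (x / 2)) * bessel_ser 1 (x\<^sup>2 / 4) * (2 / pi) + x * (x / 2) * bessel_ser 1 (x\<^sup>2 / 4) * (2 / pi) * (dbessel_J 0 x - ln (x / 2)))
         \<longlongrightarrow> 0) (at_right 0)" by simp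
      then have "((\<lambda>x. x * bessel_J 1 x * bessel_Y 0 x) \<longlongrightarrow> 0) (at_right 0)"
        by (rule Lim_transform_eventually)
           (auto simp: eventually_at_filter Y0 bessel_J_eq algebra_simps diff_divide_distrib)
      then show ?case using step[of 1] by simp
    next
      case (ge2 n)
      define \<nu> where "\<nu> = (real n - 1) / 2"
      have e: "(real (Suc (Suc n)) - 1) / 2 = \<nu> + 1" by (simp add: \<nu>_def field_simps)
      from ge2 obtain A where A: "((\<lambda>x. x powr (\<nu> + 1) * bessel_Y (\<nu> + 1) x) \<longlongrightarrow> - A) (at_right 0)"
        unfolding \<nu>_def by blast
      have "((\<lambda>x. x * (x / 2) * inverse (2 powr (\<nu> + 1)) * bessel_ser (\<nu> + 2) (x\<^sup>2 / 4) * (x powr (\<nu> + 1) * bessel_Y (\<nu> + 1) x))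
          \<longlongrightarrow> 0 * (0 / 2) * inverse (2 powr (\<nu> + 1)) * rGamma (\<nu> + 2 + 1) * - A) (at_right 0)"
        by (intro tendsto_intros tendsto_bessel_ser_square A) auto
      then have "((\<lambda>x. x * (x / 2) * inverse (2 powr (\<nu> + 1)) * bessel_ser (\<nu> + 2) (x\<^sup>2 / 4) * (x powr (\<nu> + 1) * bessel_Y (\<nu> + 1) x))
          \<longlongrightarrow> 0) (at_right 0)" by simp
      then have "((\<lambda>x. x * bessel_J (\<nu> + 1 + 1) x * bessel_Y (\<nu> + 1) x) \<longlongrightarrow> 0) (at_right 0)"
      proof (rule Lim_transform_eventually)
        have "x * (x / 2) * inverse (2 powr (\<nu> + 1)) * bessel_ser (\<nu> + 2) (x\<^sup>2 / 4) * (x powr (\<nu> + 1) * bessel_Y (\<nu> + 1) x)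
          = x * bessel_J (\<nu> + 1 + 1) x * bessel_Y (\<nu> + 1) x" if x: "x > 0" for x
        proof -
          have "(x / 2) powr (\<nu> + 1 + 1) = (x / 2) powr (\<nu> + 1) * (x / 2)"
            using x by (subst powr_add) simp
          also have "(x / 2) powr (\<nu> + 1) = x powr (\<nu> + 1) * inverse (2 powr (\<nu> + 1))"
            unfolding divide_inverse[symmetric] using x by (subst powr_divide) simp_all
          finally have "bessel_J (\<nu> + 1 + 1) x
              = x powr (\<nu> + 1) * inverse (2 powr (\<nu> + 1)) * (x / 2) * bessel_ser (\<nu> + 2) (x\<^sup>2 / 4)"
            unfolding bessel_J_eq[OF x] by (simp only: add.assoc one_add_one)
          then show ?thesis by (simp only: mult_ac)
        qed
        then show "\<forall>\<^sub>F x in at_right 0. x * (x / 2) * inverse (2 powr (\<nu> + 1)) * bessel_ser (\<nu> + 2) (x\<^sup>2 / 4) * (x powr (\<nu> + 1) * bessel_Y (\<nu> + 1) x)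
          = x * bessel_J (\<nu> + 1 + 1) x * bessel_Y (\<nu> + 1) x"
          by (auto simp: eventually_at_filter)
      qed
      then show ?case using step[of "Suc (Suc n)"] unfolding e by blast
    }
  qed
  then show ?thesis ..
qed

section \<open>Oscillation: the first zero of Y, and positivity of J before it\<close>

lemma first_zero:
  fixes f :: "real \<Rightarrow> real"
  assumes cont: "\<And>x. x > 0 \<Longrightarrow> isCont f x" and ev: "\<forall>\<^sub>F x in at_right 0. f x > 0"
    and a: "a > 0" "f a = 0"
  defines "z \<equiv> Inf {x. 0 < x \<and> f x = 0}"
  shows "0 < z" "f z = 0" "z \<le> a" "\<And>x. 0 < x \<Longrightarrow> x < z \<Longrightarrow> f x > 0"
proof -
  let ?Z = "{x. 0 < x \<and> f x = 0}"
  obtain d where d: "d > 0" "\<And>x. 0 < x \<Longrightarrow> x < d \<Longrightarrow> f x > 0"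
    using ev by (auto simp: eventually_at_right_field)
  \<comment> \<open>Positivity on (0, d) removes the end point 0, where f need not be continuous,
    and makes the zero set closed.\<close>
  have Z: "?Z = {x \<in> {d..}. f x = 0}"
    using d by force
  have "closed {x \<in> {d..}. f x = 0}"
    using d by (intro continuous_closed_preimage_constant continuous_at_imp_continuous_on ballI cont) auto
  then have "closed ?Z" unfolding Z .
  moreover have bdd: "bdd_below ?Z" by (intro bdd_belowI[of _ 0]) auto
  moreover have "?Z \<noteq> {}" using a by auto
  ultimately have "z \<in> ?Z" unfolding z_def by (intro closed_contains_Inf)
  then show "0 < z" "f z = 0" by auto
  show "z \<le> a" unfolding z_def using a by (intro cInf_lower bdd) auto
  fix x assume x: "0 < x" "x < z"
  have no: "f y \<noteq> 0" if "0 < y" "y < z" for y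
    using cInf_lower[OF _ bdd, of y] that unfolding z_def[symmetric] by auto
  show "f x > 0"
  proof (rule ccontr)
    assume "\<not> f x > 0"
    with no x have fx: "f x < 0" by force
    define y where "y = min x (d / 2)"
    have y: "0 < y" "y \<le> x" "f y > 0" using d x by (auto simp: y_def)
    obtain t where "y \<le> t" "t \<le> x" "f t = 0"
      using IVT2[of f x 0 y] y fx cont by force
    then show False using no[of t] x y by auto
  qed
qed

lemma eventually_at_right_0_obtain:
  fixes x :: real
  assumes "\<forall>\<^sub>F t in at_right 0. P t" "x > 0"
  obtains t where "0 < t" "t < x" "P t"
proof -
  obtain b where "b > 0" "\<And>y. 0 < y \<Longrightarrow> y < b \<Longrightarrow> P y"
    using assms(1) by (auto simp: eventually_at_right_field)
  then show ?thesis using that[of "min b x / 2"] assms(2) by (auto simp: min_def)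
qed

lemma eventually_bessel_J_pos:
  assumes "\<nu> > -1" shows "\<forall>\<^sub>F x in at_right 0. bessel_J \<nu> x > 0"
proof -
  have "\<forall>\<^sub>F x in at_right 0. bessel_ser \<nu> (x\<^sup>2 / 4) > 0"
    by (rule order_tendstoD(1)[OF tendsto_bessel_ser_square(1)]) (use assms in \<open>simp add: rGamma_pos\<close>)
  then show ?thesis using eventually_at_right_less[of "0::real"]
    by eventually_elim (simp add: bessel_J_eq)
qed

lemma half_order_cases:
  assumes "\<nu> = real n / 2" "n \<ge> 1"
  obtains m where "\<nu> = (real m - 1) / 2 + 1" "n = Suc m"
  using assms by (intro that[of "n - 1"]) (auto simp: of_nat_diff field_simps)

lemma eventually_bessel_Y_neg:
  assumes "\<nu> = real n / 2" "n \<ge> 1" shows "\<forall>\<^sub>F x in at_right 0. bessel_Y \<nu> x < 0"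
proof -
  obtain m where m: "\<nu> = (real m - 1) / 2 + 1" using half_order_cases[OF assms] .
  obtain A where A: "A > 0" "((\<lambda>x. x powr \<nu> * bessel_Y \<nu> x) \<longlongrightarrow> - A) (at_right 0)"
    using tendsto_bessel_Y_0[of m] unfolding m by blast
  have "\<forall>\<^sub>F x in at_right 0. x powr \<nu> * bessel_Y \<nu> x < 0"
    by (rule order_tendstoD(2)[OF A(2)]) (use A in auto)
  then show ?thesis using eventually_at_right_less[of "0::real"]
    by eventually_elim (simp add: mult_less_0_iff)
qed

lemma ladder_bessel_Y': "ladder (real n / 2) (bessel_Y (real n / 2)) (bessel_Y (real n / 2 + 1))"
  using ladder_bessel_Y[of "Suc n"] by simp

lemma wronskian_JY':
  obtains w where "w > 0" "\<And>x. x > 0 \<Longrightarrow> x * (bessel_J (real n / 2 + 1) x * bessel_Y (real n / 2) x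
    - bessel_J (real n / 2) x * bessel_Y (real n / 2 + 1) x) = w"
  using wronskian_JY[of "Suc n"] that by auto

text \<open>At the first zero a of J the Wronskian reduces to a J_(\<nu>+1) Y_\<nu> > 0. With Y
  \<le> 0 this makes J' = - J_(\<nu>+1) positive at a, although J comes down to 0 from positive
  values.\<close>

lemma bessel_J_pos_before_zero_of_Y:
  assumes n: "n \<ge> 1" and b: "b > 0" "bessel_J (real n / 2) b = 0"
    and Y: "\<And>x. 0 < x \<Longrightarrow> x < b \<Longrightarrow> bessel_Y (real n / 2) x < 0" "bessel_Y (real n / 2) b \<le> 0"
  shows False
proof -
  let ?\<nu> = "real n / 2"
  let ?a = "Inf {x. 0 < x \<and> bessel_J ?\<nu> x = 0}"
  have L: "ladder ?\<nu> (bessel_J ?\<nu>) (bessel_J (?\<nu> + 1))" by (rule ladder_bessel_J)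
  note Z = first_zero[of "bessel_J ?\<nu>", OF ladder_isCont(1)[OF L] eventually_bessel_J_pos b]
  have a: "0 < ?a" "bessel_J ?\<nu> ?a = 0" "?a \<le> b" "\<And>x. 0 < x \<Longrightarrow> x < ?a \<Longrightarrow> bessel_J ?\<nu> x > 0"
    by (rule Z, auto)+
  obtain w where w: "w > 0" "\<And>x. x > 0 \<Longrightarrow> x * (bessel_J (?\<nu> + 1) x * bessel_Y ?\<nu> x - bessel_J ?\<nu> x * bessel_Y (?\<nu> + 1) x) = w"
    by (rule wronskian_JY'[of n]) blast
  have "bessel_Y ?\<nu> ?a \<le> 0" using Y a(1,3) by (cases "?a < b") (auto intro: less_imp_le)
  moreover have "?a * (bessel_J (?\<nu> + 1) ?a * bessel_Y ?\<nu> ?a) > 0" using w(1) w(2)[OF a(1)] a(2) by simp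
  ultimately have "bessel_J (?\<nu> + 1) ?a < 0" using a(1)
    by (simp add: zero_less_mult_iff)
  moreover have "(bessel_J ?\<nu> has_real_derivative - bessel_J (?\<nu> + 1) ?a) (at ?a)"
    using ladderD(1)[OF L a(1)] a(2) by simp
  ultimately obtain d where d: "d > 0" "\<And>h. h > 0 \<Longrightarrow> h < d \<Longrightarrow> bessel_J ?\<nu> (?a - h) < bessel_J ?\<nu> ?a"
    using DERIV_pos_inc_left[of "bessel_J ?\<nu>" "- bessel_J (?\<nu> + 1) ?a" ?a] by auto
  define h where "h = min (d / 2) (?a / 2)"
  have "bessel_J ?\<nu> (?a - h) < 0" using d(2)[of h] d(1) a(1,2) by (simp add: h_def)
  moreover have "bessel_J ?\<nu> (?a - h) > 0" using d(1) a(1) by (intro a(4)) (auto simp: h_def min_def)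
  ultimately show False by simp
qed

text \<open>Sturm's oscillation argument: y = sqrt x f x solves y'' = - (1 - (\<nu>^2 - 1/4) / x^2)
  y. From c on the coefficient is at least 1/2, so a positive y is concave and hence nondecreasing,
  and then y'' \<le> - y c / 2 drives y' below 0.\<close>

lemma ladder_pos_bounded_domain:
  assumes L: "ladder \<nu> f g" and pos: "\<And>x. x > 0 \<Longrightarrow> f x > 0"
  shows False
proof -
  define y where "y = (\<lambda>x. sqrt x * f x)"
  define y1 where "y1 = (\<lambda>x. sqrt x * ((\<nu> + 1 / 2) / x * f x - g x))"
  have inv: "inverse (sqrt x) = sqrt x / x" if "x > 0" for x using that by (simp add: field_simps)
  have D: "(y has_real_derivative y1 x) (at x)" if x: "x > 0" for x
  proof -
    have "(y has_real_derivative (inverse (sqrt x) / 2 * f x + (\<nu> / x * f x - g x) * sqrt x)) (at x)"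
      unfolding y_def by (rule DERIV_mult[OF DERIV_real_sqrt[OF x] ladderD(1)[OF L x]])
    then show ?thesis unfolding y1_def inv[OF x] by (simp add: algebra_simps add_divide_distrib)
  qed
  have D1: "(y1 has_real_derivative - ((1 - (\<nu>\<^sup>2 - 1 / 4) / x\<^sup>2) * y x)) (at x)" if x: "x > 0" for x
  proof -
    have q: "((\<lambda>x. (\<nu> + 1 / 2) / x) has_real_derivative - (\<nu> + 1 / 2) / x\<^sup>2) (at x)"
      using x by (auto intro!: derivative_eq_intros simp: power2_eq_square)
    have "(y1 has_real_derivative
       (inverse (sqrt x) / 2) * ((\<nu> + 1 / 2) / x * f x - g x) + (- (\<nu> + 1 / 2) / x\<^sup>2 * f x + (\<nu> / x * f x - g x) * ((\<nu> + 1 / 2) / x)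
         - (f x - (\<nu> + 1) / x * g x)) * sqrt x) (at x)"
      unfolding y1_def
      by (rule DERIV_mult[OF DERIV_real_sqrt[OF x] DERIV_diff[OF DERIV_mult[OF q ladderD(1)[OF L x]] ladderD(2)[OF L x]]])
    moreover have "(sqrt x / x / 2) * ((\<nu> + 1 / 2) / x * f x - g x) + (- (\<nu> + 1 / 2) / x\<^sup>2 * f x + (\<nu> / x * f x - g x) * ((\<nu> + 1 / 2) / x)
         - (f x - (\<nu> + 1) / x * g x)) * sqrt x = - ((1 - (\<nu>\<^sup>2 - 1 / 4) / x\<^sup>2) * (sqrt x * f x))"
      using x by (simp add: divide_simps power2_eq_square) (simp add: algebra_simps)
    ultimately show ?thesis unfolding y_def inv[OF x] by simp
  qed
  have y_pos: "y x > 0" if "x > 0" for x using pos that by (simp add: y_def)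
  \<comment> \<open>This gives c^2 \<ge> 2 \<nu>^2, hence the lower bound 1/2 for the
    coefficient.\<close>
  define c where "c = 2 * \<bar>\<nu>\<bar> + 1"
  have c: "c > 0" by (simp add: c_def)
  have q: "1 - (\<nu>\<^sup>2 - 1 / 4) / x\<^sup>2 \<ge> 1 / 2" if "x \<ge> c" for x
  proof -
    have "c\<^sup>2 \<le> x\<^sup>2" using that c by (intro power_mono) auto
    moreover have "2 * \<nu>\<^sup>2 \<le> c\<^sup>2"
      unfolding c_def power2_sum power_mult_distrib power2_abs using zero_le_power2[of \<nu>] by simp
    ultimately have "2 * (\<nu>\<^sup>2 - 1 / 4) \<le> x\<^sup>2" by simp
    moreover have "x\<^sup>2 > 0" using that c by simp
    ultimately show ?thesis by (simp add: field_simps)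
  qed
  have y1_decr: "y1 b \<le> y1 a" if "c \<le> a" "a \<le> b" for a b
  proof (rule DERIV_nonpos_imp_nonincreasing[OF that(2)])
    fix x assume "a \<le> x" "x \<le> b"
    then have x: "x \<ge> c" "x > 0" using that c by auto
    show "\<exists>y. (y1 has_real_derivative y) (at x) \<and> y \<le> 0"
    proof (intro exI conjI, rule D1[OF x(2)])
      have "(1 - (\<nu>\<^sup>2 - 1 / 4) / x\<^sup>2) * y x \<ge> 0"
        using q[OF x(1)] y_pos[OF x(2)] by (intro mult_nonneg_nonneg) linarith+
      then show "- ((1 - (\<nu>\<^sup>2 - 1 / 4) / x\<^sup>2) * y x) \<le> 0" by simp
    qed
  qed
  have y1_nonneg: "y1 a \<ge> 0" if ac: "a \<ge> c" for a
  proof (rule ccontr)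
    assume "\<not> y1 a \<ge> 0"
    then have neg: "y1 a < 0" by simp
    \<comment> \<open>The zero of the tangent to y at a; concavity forces y b \<le> 0.\<close>
    define b where "b = a + y a / (- y1 a)"
    have "y a / (- y1 a) > 0" using neg y_pos[of a] that c by (intro divide_pos_pos) auto
    then have ab: "a < b" unfolding b_def by linarith
    obtain t where t: "a < t" "t < b" "y b - y a = (b - a) * y1 t"
      using MVT2[OF ab, of y y1] D ac c by force
    have "y1 t \<le> y1 a" using t that by (intro y1_decr) auto
    then have "(b - a) * y1 t \<le> (b - a) * y1 a" using ab by (intro mult_left_mono) auto
    also have "\<dots> = - y a" using neg by (simp add: b_def field_simps)
    finally show False using t(3) y_pos[of b] ab that c by simp
  qed
  have y_incr: "y c \<le> y x" if "x \<ge> c" for x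
  proof (rule DERIV_nonneg_imp_nondecreasing[OF that])
    fix t assume "c \<le> t" "t \<le> x"
    then show "\<exists>d. (y has_real_derivative d) (at t) \<and> 0 \<le> d"
      using D[of t] y1_nonneg[of t] c by (intro exI[of _ "y1 t"]) auto
  qed
  \<comment> \<open>Long enough for y1 to fall from \<open>y1 c\<close> to at most -1 at the rate y
    c / 2.\<close>
  define b where "b = c + 2 * (y1 c + 1) / y c"
  have yc: "y c > 0" using y_pos c by simp
  have cb: "c < b" using y1_nonneg[of c] yc by (simp add: b_def)
  obtain t where t: "c < t" "t < b" "y1 b - y1 c = (b - c) * - ((1 - (\<nu>\<^sup>2 - 1 / 4) / t\<^sup>2) * y t)"
    using MVT2[OF cb, of y1 "\<lambda>t. - ((1 - (\<nu>\<^sup>2 - 1 / 4) / t\<^sup>2) * y t)"] D1 c by force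
  have "1 / 2 * y c \<le> (1 - (\<nu>\<^sup>2 - 1 / 4) / t\<^sup>2) * y t"
  proof (rule mult_mono)
    show qt: "1 / 2 \<le> 1 - (\<nu>\<^sup>2 - 1 / 4) / t\<^sup>2" by (rule q) (use t in simp)
    then show "0 \<le> 1 - (\<nu>\<^sup>2 - 1 / 4) / t\<^sup>2" by linarith
  qed (use t y_incr[of t] yc in auto)
  then have "(b - c) * (1 / 2 * y c) \<le> (b - c) * ((1 - (\<nu>\<^sup>2 - 1 / 4) / t\<^sup>2) * y t)"
    using cb by (intro mult_left_mono) auto
  moreover have "(b - c) * (1 / 2 * y c) = y1 c + 1" using yc by (simp add: b_def)
  ultimately have "y1 b \<le> -1" using t(3) by simp
  then show False using y1_nonneg[of b] cb by simp
qed

text \<open>Otherwise Y stays negative, so J has no zero by the Wronskian argument above, against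
  \<open>ladder_pos_bounded_domain\<close>.\<close>

lemma bessel_Y_zero_exists:
  assumes "n \<ge> 1" shows "\<exists>x>0. bessel_Y (real n / 2) x = 0"
proof (rule ccontr)
  assume no: "\<not> (\<exists>x>0. bessel_Y (real n / 2) x = 0)"
  have "\<forall>\<^sub>F x in at_right 0. x > 0 \<and> bessel_Y (real n / 2) x < 0"
    using eventually_bessel_Y_neg[OF refl assms] eventually_at_right_less[of "0::real"] by eventually_elim simp
  from eventually_happens'[OF trivial_limit_at_right_real this]
  obtain x0 where x0: "x0 > 0" "bessel_Y (real n / 2) x0 < 0" by auto
  have neg: "bessel_Y (real n / 2) x < 0" if "x > 0" for x
  proof (rule ccontr)
    assume "\<not> bessel_Y (real n / 2) x < 0"
    then have px: "bessel_Y (real n / 2) x > 0" using no that by force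
    have "\<exists>t. min x0 x \<le> t \<and> t \<le> max x0 x \<and> bessel_Y (real n / 2) t = 0"
    proof (cases "x0 \<le> x")
      case True
      then show ?thesis using IVT[of "bessel_Y (real n / 2)" x0 0 x] x0 px ladder_isCont(1)[OF ladder_bessel_Y'[of n]] by auto
    next
      case False
      then show ?thesis using IVT2[of "bessel_Y (real n / 2)" x0 0 x] x0 px that ladder_isCont(1)[OF ladder_bessel_Y'[of n]] by auto
    qed
    then show False using no x0 that by (auto simp: min_def max_def split: if_splits)
  qed
  have "bessel_J (real n / 2) x > 0" if x: "x > 0" for x
  proof (rule ccontr)
    assume "\<not> bessel_J (real n / 2) x > 0"
    then have nx: "bessel_J (real n / 2) x \<le> 0" by simp
    obtain x1 where x1: "0 < x1" "x1 < x" "bessel_J (real n / 2) x1 > 0"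
      using eventually_at_right_0_obtain[OF eventually_bessel_J_pos[of "real n / 2"] x] by auto
    obtain b where b: "x1 \<le> b" "b \<le> x" "bessel_J (real n / 2) b = 0"
      using IVT2[of "bessel_J (real n / 2)" x 0 x1] x1 nx ladder_isCont(1)[OF ladder_bessel_J[of "real n / 2"]] by force
    show False
      by (rule bessel_J_pos_before_zero_of_Y[of n b]) (use assms b x1 neg in \<open>auto intro: less_imp_le\<close>)
  qed
  then show False by (rule ladder_pos_bounded_domain[OF ladder_bessel_J])
qed

lemma first_zero_bessel_Y:
  assumes "n \<ge> 1"
  defines "z \<equiv> first_zero_bessel_Y (real n / 2)"
  shows "0 < z" "bessel_Y (real n / 2) z = 0" "\<And>x. 0 < x \<Longrightarrow> x < z \<Longrightarrow> bessel_Y (real n / 2) x < 0"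
proof -
  obtain a where a: "a > 0" "bessel_Y (real n / 2) a = 0" using bessel_Y_zero_exists[OF assms(1)] by auto
  have z: "z = Inf {x. 0 < x \<and> - bessel_Y (real n / 2) x = 0}"
    unfolding z_def first_zero_bessel_Y_def by simp
  have c: "isCont (\<lambda>x. - bessel_Y (real n / 2) x) x" if "x > 0" for x
    using ladder_isCont(1)[OF ladder_bessel_Y'[of n] that] by simp
  have e: "\<forall>\<^sub>F x in at_right 0. - bessel_Y (real n / 2) x > 0"
    using eventually_bessel_Y_neg[OF refl assms(1)] by simp
  note * = first_zero[of "\<lambda>x. - bessel_Y (real n / 2) x", OF c e a(1), folded z]
  show "0 < z" "bessel_Y (real n / 2) z = 0" using *(1,2) a by auto
  show "bessel_Y (real n / 2) x < 0" if "0 < x" "x < z" for x using *(4)[OF _ _ that] a by auto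
qed

lemma bessel_J_pos_before_first_zero_of_Y:
  assumes "n \<ge> 1" "0 < x" "x \<le> first_zero_bessel_Y (real n / 2)"
  shows "bessel_J (real n / 2) x > 0"
proof (rule ccontr)
  note z = first_zero_bessel_Y[OF assms(1)]
  assume "\<not> bessel_J (real n / 2) x > 0"
  then have nx: "bessel_J (real n / 2) x \<le> 0" by simp
  obtain x1 where x1: "0 < x1" "x1 < x" "bessel_J (real n / 2) x1 > 0"
    using eventually_at_right_0_obtain[OF eventually_bessel_J_pos[of "real n / 2"] assms(2)] by auto
  obtain b where b: "x1 \<le> b" "b \<le> x" "bessel_J (real n / 2) b = 0"
    using IVT2[of "bessel_J (real n / 2)" x 0 x1] x1 nx ladder_isCont(1)[OF ladder_bessel_J[of "real n / 2"]] by force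
  have "bessel_Y (real n / 2) b \<le> 0"
    using z(2) z(3)[of b] b x1 assms by (cases "b = first_zero_bessel_Y (real n / 2)") (auto intro: less_imp_le)
  then show False
    by (intro bessel_J_pos_before_zero_of_Y[of n b]) (use assms b x1 z in auto)
qed

lemma bessel_ser_eq_J: "x > 0 \<Longrightarrow> bessel_ser \<nu> (x\<^sup>2 / 4) = (x / 2) powr - \<nu> * bessel_J \<nu> x"
  by (simp add: bessel_J_eq powr_minus field_simps)

text \<open>The derivative of the series is minus the series of order \<nu> + 1. The latter is
  nonnegative because its product \<open>h\<close> with u powr (\<nu> + 1) vanishes at 0 and has the
  derivative u powr \<nu> times the series of order \<nu>, which has the sign of J.\<close>

lemma bessel_ser_before_first_zero:
  assumes n: "n \<ge> 1"
  defines "\<nu> \<equiv> real n / 2"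
  defines "z \<equiv> first_zero_bessel_Y \<nu>"
  shows "bessel_ser \<nu> (z\<^sup>2 / 4) > 0"
    and "\<And>t. 0 \<le> t \<Longrightarrow> t \<le> z \<Longrightarrow> bessel_ser \<nu> (z\<^sup>2 / 4) \<le> bessel_ser \<nu> (t\<^sup>2 / 4)"
proof -
  have z: "z > 0" using first_zero_bessel_Y(1)[OF n] by (simp add: z_def \<nu>_def)
  have pos: "bessel_J \<nu> x > 0" if "0 < x" "x \<le> z" for x
    using bessel_J_pos_before_first_zero_of_Y[OF n that(1)] that(2) by (simp add: \<nu>_def z_def)
  show "bessel_ser \<nu> (z\<^sup>2 / 4) > 0" unfolding bessel_ser_eq_J[OF z] using pos[of z] z by simp
  define h where "h = (\<lambda>u. u powr (\<nu> + 1) * bessel_ser (\<nu> + 1) u)"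
  have h: "(h has_real_derivative u powr \<nu> * bessel_ser \<nu> u) (at u)" if "u > 0" for u
  proof -
    have "(h has_real_derivative (\<nu> + 1) * u powr \<nu> * bessel_ser (\<nu> + 1) u - u powr (\<nu> + 1) * bessel_ser (\<nu> + 2) u) (at u)"
      unfolding h_def using that
      by (auto intro!: derivative_eq_intros DERIV_chain2[OF DERIV_bessel_ser] simp: add.assoc)
    moreover have "bessel_ser \<nu> u = (\<nu> + 1) * bessel_ser (\<nu> + 1) u - u * bessel_ser (\<nu> + 2) u"
      using bessel_ser_rec[of "\<nu> + 1" u] by (simp add: add.assoc)
    moreover have "(\<nu> + 1) * u powr \<nu> * bessel_ser (\<nu> + 1) u - u powr (\<nu> + 1) * bessel_ser (\<nu> + 2) u
        = u powr \<nu> * ((\<nu> + 1) * bessel_ser (\<nu> + 1) u - u * bessel_ser (\<nu> + 2) u)"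
      using that by (simp add: powr_add algebra_simps)
    ultimately show ?thesis by simp
  qed
  have h_lim: "(h \<longlongrightarrow> 0) (at_right 0)"
  proof -
    have "((\<lambda>u::real. u powr (\<nu> + 1)) \<longlongrightarrow> 0 powr (\<nu> + 1)) (at_right 0)"
      by (rule tendsto_powr2) (auto simp: \<nu>_def eventually_at_right_less eventually_mono[OF eventually_at_right_less[of 0]])
    moreover have "(bessel_ser (\<nu> + 1) \<longlongrightarrow> bessel_ser (\<nu> + 1) 0) (at_right 0)"
      using isCont_bessel_ser[where \<mu> = "\<nu> + 1" and u = 0] unfolding isCont_def by (rule filterlim_mono) (auto simp: at_le)
    ultimately have "(h \<longlongrightarrow> 0 powr (\<nu> + 1) * bessel_ser (\<nu> + 1) 0) (at_right 0)"
      unfolding h_def by (rule tendsto_mult)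
    then show ?thesis by simp
  qed
  have ser_pos: "bessel_ser \<nu> u \<ge> 0" if "0 < u" "u \<le> z\<^sup>2 / 4" for u
  proof -
    define x where "x = 2 * sqrt u"
    have "x\<^sup>2 / 4 = u" "x > 0" using that by (auto simp: x_def power_mult_distrib)
    moreover have "x\<^sup>2 \<le> z\<^sup>2" using that calculation by simp
    then have "x \<le> z" using z by (intro power2_le_imp_le[of x z]) auto
    ultimately show ?thesis using bessel_ser_eq_J[of x \<nu>] pos[of x] by simp
  qed
  have ser1: "bessel_ser (\<nu> + 1) u \<ge> 0" if u: "0 < u" "u \<le> z\<^sup>2 / 4" for u
  proof -
    have "h u \<ge> 0"
    proof (rule tendsto_upperbound[OF h_lim])
      show "\<forall>\<^sub>F t in at_right 0. h t \<le> h u"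
      proof (rule eventually_at_rightI[of 0 u])
        fix t assume t: "t \<in> {0<..<u}"
        show "h t \<le> h u"
        proof (rule DERIV_nonneg_imp_nondecreasing[of t u h])
          fix s assume "t \<le> s" "s \<le> u"
          then show "\<exists>y. (h has_real_derivative y) (at s) \<and> 0 \<le> y"
            using h[of s] ser_pos[of s] t u by (intro exI[of _ "s powr \<nu> * bessel_ser \<nu> s"]) auto
        qed (use t in auto)
      qed (use u in auto)
    qed auto
    then show ?thesis using u by (simp add: h_def zero_le_mult_iff)
  qed
  fix t assume t: "0 \<le> t" "t \<le> z"
  show "bessel_ser \<nu> (z\<^sup>2 / 4) \<le> bessel_ser \<nu> (t\<^sup>2 / 4)"
  proof (rule DERIV_nonpos_imp_nonincreasing[of "t\<^sup>2 / 4" "z\<^sup>2 / 4" "bessel_ser \<nu>"])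
    show "t\<^sup>2 / 4 \<le> z\<^sup>2 / 4" using t by (simp add: power_mono)
    fix u assume u: "t\<^sup>2 / 4 \<le> u" "u \<le> z\<^sup>2 / 4"
    then have "u \<ge> 0" using zero_le_power2[of t] by linarith
    have "bessel_ser (\<nu> + 1) u \<ge> 0"
    proof (cases "u = 0")
      case True then show ?thesis by (simp add: \<nu>_def rGamma_pos less_imp_le)
    next
      case False with \<open>u \<ge> 0\<close> u show ?thesis by (intro ser1) auto
    qed
    then show "\<exists>y. (bessel_ser \<nu> has_real_derivative y) (at u) \<and> y \<le> 0"
      by (intro exI[of _ "- bessel_ser (\<nu> + 1) u"]) (auto simp: DERIV_bessel_ser)
  qed
qed

section \<open>Complete monotonicity of the Bessel amplitude\<close>

text \<open>\<open>cm n f\<close> for all n is complete monotonicity of f on (0, \<infinity>), with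
  g playing the part of - f'. Cutting it off at a finite order turns the closure properties into
  inductions on n.\<close>

primrec cm :: "nat \<Rightarrow> (real \<Rightarrow> real) \<Rightarrow> bool" where
  "cm 0 f \<longleftrightarrow> (\<forall>x>0. 0 \<le> f x)"
| "cm (Suc n) f \<longleftrightarrow> (\<forall>x>0. 0 \<le> f x) \<and> (\<exists>g. cm n g \<and> (\<forall>x>0. (f has_real_derivative - g x) (at x)))"

lemma cm_nonneg: "cm n f \<Longrightarrow> x > 0 \<Longrightarrow> 0 \<le> f x"
  by (cases n) auto

lemma cm_SucE:
  assumes "cm (Suc n) f"
  obtains g where "cm n g" "\<And>x. x > 0 \<Longrightarrow> (f has_real_derivative - g x) (at x)"
  using assms by auto

lemma cm_mono: "cm n f \<Longrightarrow> m \<le> n \<Longrightarrow> cm m f"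
proof (induction n arbitrary: f m)
  case (Suc n)
  show ?case
  proof (cases m)
    case 0 then show ?thesis using cm_nonneg[OF Suc.prems(1)] by simp
  next
    case (Suc k)
    then show ?thesis using Suc.prems Suc.IH by auto
  qed
qed simp

lemma cm_cong: "cm n f \<Longrightarrow> (\<And>x. x > 0 \<Longrightarrow> f x = g x) \<Longrightarrow> cm n g"
proof (cases n)
  case (Suc k)
  assume *: "cm n f" "\<And>x. x > 0 \<Longrightarrow> f x = g x"
  then obtain h where h: "cm k h" "\<And>x. x > 0 \<Longrightarrow> (f has_real_derivative - h x) (at x)" using Suc by auto
  have "(g has_real_derivative - h x) (at x)" if "x > 0" for x
    by (rule DERIV_pos_cong[OF h(2)]) (use * that in auto)
  then show ?thesis using * h(1) unfolding Suc cm.simps by metis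
qed auto

lemma cm_add: "cm n f \<Longrightarrow> cm n g \<Longrightarrow> cm n (\<lambda>x. f x + g x)"
proof (induction n arbitrary: f g)
  case (Suc n)
  obtain f' g' where *: "cm n f'" "\<And>x. x > 0 \<Longrightarrow> (f has_real_derivative - f' x) (at x)"
    "cm n g'" "\<And>x. x > 0 \<Longrightarrow> (g has_real_derivative - g' x) (at x)"
    using Suc.prems by auto
  have "((\<lambda>x. f x + g x) has_real_derivative - (f' x + g' x)) (at x)" if "x > 0" for x
    using DERIV_add[OF *(2)[OF that] *(4)[OF that]] by simp
  then show ?case using Suc.prems Suc.IH[OF *(1,3)]
    by (auto intro!: add_nonneg_nonneg exI[of _ "\<lambda>x. f' x + g' x"])
qed auto

lemma cm_mult: "cm n f \<Longrightarrow> cm n g \<Longrightarrow> cm n (\<lambda>x. f x * g x)"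
proof (induction n arbitrary: f g)
  case (Suc n)
  obtain f' g' where *: "cm n f'" "\<And>x. x > 0 \<Longrightarrow> (f has_real_derivative - f' x) (at x)"
    "cm n g'" "\<And>x. x > 0 \<Longrightarrow> (g has_real_derivative - g' x) (at x)"
    using Suc.prems by auto
  have "cm n f" "cm n g" using Suc.prems cm_mono[of "Suc n"] by force+
  then have "cm n (\<lambda>x. f' x * g x + f x * g' x)" by (intro cm_add Suc.IH *)
  moreover have "((\<lambda>x. f x * g x) has_real_derivative - (f' x * g x + f x * g' x)) (at x)" if "x > 0" for x
    using DERIV_mult[OF *(2)[OF that] *(4)[OF that]] by (simp add: algebra_simps)
  ultimately show ?case using Suc.prems
    by (auto intro!: mult_nonneg_nonneg exI[of _ "\<lambda>x. f' x * g x + f x * g' x"])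
qed auto

lemma cm_power_inverse: "c \<ge> 0 \<Longrightarrow> cm n (\<lambda>x. c / x ^ k)"
proof (induction n arbitrary: c k)
  case (Suc n)
  have "((\<lambda>x. c / x ^ k) has_real_derivative - (c * real k / x ^ Suc k)) (at x)" if x: "x > 0" for x
  proof (cases k)
    case 0 then show ?thesis by simp
  next
    case (Suc m)
    have "((\<lambda>x. c / x ^ k) has_real_derivative - c * (real k * x ^ (k - 1)) / (x ^ k)\<^sup>2) (at x)"
      using x by (auto intro!: derivative_eq_intros simp: power2_eq_square)
    also have "- c * (real k * x ^ (k - 1)) / (x ^ k)\<^sup>2 = - (c * real k / x ^ Suc k)"
      using x Suc by (simp add: field_simps power2_eq_square)
    finally show ?thesis .
  qed
  then show ?case using Suc.prems Suc.IH[of "c * real k" "Suc k"]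
    by (auto intro!: exI[of _ "\<lambda>x. c * real k / x ^ Suc k"] simp del: power_Suc)
qed auto

lemma cm_cmult: "c \<ge> 0 \<Longrightarrow> cm n f \<Longrightarrow> cm n (\<lambda>x. c * f x)"
  using cm_mult[OF cm_power_inverse[of c n 0], of f] by simp

section \<open>Laplace transforms in the variable s^2\<close>

lemma exp_taylor2_bound: "\<bar>exp r - 1 - r\<bar> \<le> r\<^sup>2 * exp \<bar>r\<bar>" for r :: real
proof -
  obtain t where t: "\<bar>t\<bar> \<le> \<bar>r\<bar>" "exp r = (\<Sum>m<2. r ^ m / fact m) + exp t / fact 2 * r ^ 2"
    using Maclaurin_exp_le[of r 2] by auto
  then have "exp r - 1 - r = exp t * r\<^sup>2 / 2" by (simp add: numeral_2_eq_2 lessThan_Suc)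
  then have "\<bar>exp r - 1 - r\<bar> = exp t * r\<^sup>2 / 2" by (simp only:) simp
  also have "\<dots> \<le> exp t * r\<^sup>2" by simp
  also have "\<dots> \<le> exp \<bar>r\<bar> * r\<^sup>2" using t(1) by (intro mult_right_mono) auto
  finally show ?thesis by (simp add: mult.commute)
qed

text \<open>For |h| \<le> x / 2 the second-order remainder of the exponential is at most h^2 s^4
  times the weight at x / 2, which the moment hypothesis makes integrable.\<close>

lemma gauss_transform_deriv:
  fixes g :: "real \<Rightarrow> 'b::{banach, second_countable_topology}"
  assumes int: "\<And>x m. x > 0 \<Longrightarrow> integrable lborel (\<lambda>s. (exp (- x * s\<^sup>2) * s ^ (2 * m)) *\<^sub>R g s)" and x: "x > 0"
  shows "((\<lambda>x. LINT s|lborel. exp (- x * s\<^sup>2) *\<^sub>R g s) has_vector_derivative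
    - (LINT s|lborel. exp (- x * s\<^sup>2) *\<^sub>R s\<^sup>2 *\<^sub>R g s)) (at x)"
proof -
  let ?F = "\<lambda>x. LINT s|lborel. exp (- x * s\<^sup>2) *\<^sub>R g s"
  let ?D = "LINT s|lborel. exp (- x * s\<^sup>2) *\<^sub>R s\<^sup>2 *\<^sub>R g s"
  define K where "K = (LINT s|lborel. norm ((exp (- (x / 2) * s\<^sup>2) * s ^ (2 * 2)) *\<^sub>R g s))"
  have i0: "integrable lborel (\<lambda>s. exp (- x * s\<^sup>2) *\<^sub>R g s)" if "x > 0" for x
    using int[OF that, of 0] by simp
  have i1: "integrable lborel (\<lambda>s. exp (- x * s\<^sup>2) *\<^sub>R s\<^sup>2 *\<^sub>R g s)"
    using int[OF x, of 1] by simp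
  have est: "norm (?F (x + h) - ?F x - h *\<^sub>R - ?D) \<le> h\<^sup>2 * K" if h: "\<bar>h\<bar> \<le> x / 2" for h
  proof -
    have xh: "x + h > 0" using h x by linarith
    have i2: "integrable lborel (\<lambda>s. h *\<^sub>R (exp (- x * s\<^sup>2) *\<^sub>R s\<^sup>2 *\<^sub>R g s))"
      using i1 by (rule integrable_scaleR_right)
    have eq: "?F (x + h) - ?F x - h *\<^sub>R - ?D
        = (LINT s|lborel. exp (- (x + h) * s\<^sup>2) *\<^sub>R g s - exp (- x * s\<^sup>2) *\<^sub>R g s + h *\<^sub>R (exp (- x * s\<^sup>2) *\<^sub>R s\<^sup>2 *\<^sub>R g s))"
      unfolding Bochner_Integration.integral_add[OF Bochner_Integration.integrable_diff[OF i0[OF xh] i0[OF x]] i2]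
        Bochner_Integration.integral_diff[OF i0[OF xh] i0[OF x]] integral_scaleR_right by simp
    have "norm (?F (x + h) - ?F x - h *\<^sub>R - ?D) \<le> (LINT s|lborel. h\<^sup>2 * norm ((exp (- (x / 2) * s\<^sup>2) * s ^ (2 * 2)) *\<^sub>R g s))"
      unfolding eq
    proof (rule Bochner_Integration.integral_norm_bound_integral)
      show "integrable lborel (\<lambda>s. exp (- (x + h) * s\<^sup>2) *\<^sub>R g s - exp (- x * s\<^sup>2) *\<^sub>R g s + h *\<^sub>R exp (- x * s\<^sup>2) *\<^sub>R s\<^sup>2 *\<^sub>R g s)"
        by (intro Bochner_Integration.integrable_add Bochner_Integration.integrable_diff i0[OF xh] i0[OF x] i2)
      show "integrable lborel (\<lambda>s. h\<^sup>2 * norm ((exp (- (x / 2) * s\<^sup>2) * s ^ (2 * 2)) *\<^sub>R g s))"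
        using int[of "x / 2" 2] x by (intro integrable_mult_right integrable_norm) auto
      fix s :: real
      define r where "r = - h * s\<^sup>2"
      have r: "\<bar>r\<bar> \<le> x / 2 * s\<^sup>2" using mult_right_mono[OF h, of "s\<^sup>2"] by (simp add: r_def abs_mult)
      have "exp (- (x + h) * s\<^sup>2) = exp (- x * s\<^sup>2) * exp r"
        by (simp add: r_def exp_add[symmetric] algebra_simps)
      then have "exp (- (x + h) * s\<^sup>2) *\<^sub>R g s - exp (- x * s\<^sup>2) *\<^sub>R g s + h *\<^sub>R exp (- x * s\<^sup>2) *\<^sub>R s\<^sup>2 *\<^sub>R g s
          = (exp (- x * s\<^sup>2) * (exp r - 1 - r)) *\<^sub>R g s"
        by (simp add: r_def algebra_simps)
      moreover have "\<bar>exp (- x * s\<^sup>2) * (exp r - 1 - r)\<bar> \<le> h\<^sup>2 * (exp (- (x / 2) * s\<^sup>2) * s ^ (2 * 2))"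
      proof -
        have "\<bar>exp (- x * s\<^sup>2) * (exp r - 1 - r)\<bar> \<le> exp (- x * s\<^sup>2) * (r\<^sup>2 * exp (x / 2 * s\<^sup>2))"
          using exp_taylor2_bound[of r] r
          by (auto simp: abs_mult intro!: mult_left_mono elim!: order_trans)
        also have "\<dots> = r\<^sup>2 * exp (- (x / 2) * s\<^sup>2)"
          by (simp add: exp_add[symmetric] mult.left_commute[of "exp _"] algebra_simps)
        finally show ?thesis by (simp add: r_def power_mult_distrib power_mult mult_ac)
      qed
      ultimately show "norm (exp (- (x + h) * s\<^sup>2) *\<^sub>R g s - exp (- x * s\<^sup>2) *\<^sub>R g s + h *\<^sub>R exp (- x * s\<^sup>2) *\<^sub>R s\<^sup>2 *\<^sub>R g s)
          \<le> h\<^sup>2 * norm ((exp (- (x / 2) * s\<^sup>2) * s ^ (2 * 2)) *\<^sub>R g s)"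
        by (simp add: mult.assoc[symmetric] mult_right_mono del: mult_minus_left)
    qed
    then show ?thesis unfolding K_def integral_mult_right_zero .
  qed
  have "((\<lambda>h. norm (?F (x + h) - ?F x - h *\<^sub>R - ?D) / norm h) \<longlongrightarrow> 0) (at 0)"
  proof (rule Lim_null_comparison)
    show "((\<lambda>h. \<bar>h\<bar> * K) \<longlongrightarrow> 0) (at 0)" by (rule tendsto_eq_intros refl | simp)+
    have "\<forall>\<^sub>F h in at (0::real). \<bar>h\<bar> \<le> x / 2"
      using x by (auto simp: eventually_at intro!: exI[of _ "x / 2"])
    then show "\<forall>\<^sub>F h in at 0. norm (norm (?F (x + h) - ?F x - h *\<^sub>R - ?D) / norm h) \<le> \<bar>h\<bar> * K"
    proof eventually_elim
      case (elim h)
      then show ?case using est[of h]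
        by (cases "h = 0") (auto simp: divide_simps power2_eq_square mult_ac)
    qed
  qed
  with bounded_linear_scaleR_left show ?thesis
    unfolding has_vector_derivative_def has_derivative_at by (rule conjI)
qed

text \<open>The easy half of Bernstein's theorem: each derivative multiplies g by s^2 and changes
  the sign, and the hypotheses on g survive this.\<close>

lemma cm_gauss_transform:
  fixes g :: "real \<Rightarrow> real"
  assumes "\<And>x m. x > 0 \<Longrightarrow> integrable lborel (\<lambda>s. (exp (- x * s\<^sup>2) * s ^ (2 * m)) * g s)" "\<And>s. g s \<ge> 0"
  shows "cm n (\<lambda>x. LINT s|lborel. exp (- x * s\<^sup>2) * g s)"
  using assms
proof (induction n arbitrary: g)
  case (Suc n)
  let ?h = "\<lambda>x. LINT s|lborel. exp (- x * s\<^sup>2) * (s\<^sup>2 * g s)"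
  have "cm n ?h"
  proof (rule Suc.IH)
    show "integrable lborel (\<lambda>s. (exp (- x * s\<^sup>2) * s ^ (2 * m)) * (s\<^sup>2 * g s))" if "x > 0" for x m
      using Suc.prems(1)[OF that, of "Suc m"] by (simp add: mult_ac power2_eq_square)
  qed (use Suc.prems in auto)
  moreover have "((\<lambda>x. LINT s|lborel. exp (- x * s\<^sup>2) * g s) has_real_derivative - ?h x) (at x)" if "x > 0" for x
    using gauss_transform_deriv[of g, OF _ that] Suc.prems(1)
    by (simp add: has_real_derivative_iff_has_vector_derivative)
  ultimately show ?case using Suc.prems(2)
    by (auto intro!: integral_nonneg_AE exI[of _ ?h])
qed (auto intro!: integral_nonneg_AE)

text \<open>Eliminating the mixed term from the ladder equations of two solutions expresses
  \<open>f\<^sub>\<nu>\<^sub>+\<^sub>1\<^sup>2 + g\<^sub>\<nu>\<^sub>+\<^sub>1\<^sup>2\<close> through \<open>X = f\<^sub>\<nu>\<^sup>2 + g\<^sub>\<nu>\<^sup>2\<close> as \<open>X + X'' / 2 - (\<nu> - 1/2) X' / x\<close>, and every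
  term of this is completely monotone if \<open>X\<close> is.\<close>

lemma cm_ladder_step:
  assumes L: "ladder \<nu> f f1" "ladder \<nu> g g1" and \<nu>: "\<nu> \<ge> 1 / 2"
    and cm: "\<And>n. cm n (\<lambda>x. (f x)\<^sup>2 + (g x)\<^sup>2)"
  shows "cm n (\<lambda>x. (f1 x)\<^sup>2 + (g1 x)\<^sup>2)"
proof -
  define X where "X = (\<lambda>x. (f x)\<^sup>2 + (g x)\<^sup>2)"
  define c where "c = (\<lambda>x. f x * f1 x + g x * g1 x)"
  obtain E1 where E1: "cm (Suc n) E1" "\<And>x. x > 0 \<Longrightarrow> (X has_real_derivative - E1 x) (at x)"
    using cm_SucE[OF cm[of "Suc (Suc n)", folded X_def]] by blast
  obtain E2 where E2: "cm n E2" "\<And>x. x > 0 \<Longrightarrow> (E1 has_real_derivative - E2 x) (at x)"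
    using cm_SucE[OF E1(1)] by blast
  have X': "(X has_real_derivative 2 * \<nu> / x * X x - 2 * c x) (at x)" if x: "x > 0" for x
  proof -
    have "(X has_real_derivative 2 * f x * (\<nu> / x * f x - f1 x) + 2 * g x * (\<nu> / x * g x - g1 x)) (at x)"
      unfolding X_def by (auto intro!: derivative_eq_intros ladderD[OF L(1) x] ladderD[OF L(2) x])
    then show ?thesis by (simp add: X_def c_def power2_eq_square algebra_simps)
  qed
  have c: "c x = \<nu> / x * X x + E1 x / 2" if x: "x > 0" for x
    using DERIV_unique[OF X'[OF x] E1(2)[OF x]] by simp
  have cd: "((\<lambda>x. \<nu> / x * X x + E1 x / 2) has_real_derivative
      - \<nu> / x\<^sup>2 * X x - \<nu> / x * E1 x - E2 x / 2) (at x)" if x: "x > 0" for x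
    using x by (auto intro!: derivative_eq_intros E1(2)[OF x] E2(2)[OF x] simp: power2_eq_square field_simps)
  have c1: "(c has_real_derivative - \<nu> / x\<^sup>2 * X x - \<nu> / x * E1 x - E2 x / 2) (at x)" if x: "x > 0" for x
    by (rule DERIV_pos_cong[OF cd[OF x] x c])
  have c2: "(c has_real_derivative X x - ((f1 x)\<^sup>2 + (g1 x)\<^sup>2) - c x / x) (at x)" if x: "x > 0" for x
  proof -
    have "(c has_real_derivative (\<nu> / x * f x - f1 x) * f1 x + (f x - (\<nu> + 1) / x * f1 x) * f x
        + ((\<nu> / x * g x - g1 x) * g1 x + (g x - (\<nu> + 1) / x * g1 x) * g x)) (at x)"
      unfolding c_def
      by (rule DERIV_add[OF DERIV_mult[OF ladderD(1,2)[OF L(1) x]] DERIV_mult[OF ladderD(1,2)[OF L(2) x]]])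
    moreover have "(\<nu> / x * f x - f1 x) * f1 x + (f x - (\<nu> + 1) / x * f1 x) * f x
        + ((\<nu> / x * g x - g1 x) * g1 x + (g x - (\<nu> + 1) / x * g1 x) * g x)
        = X x - ((f1 x)\<^sup>2 + (g1 x)\<^sup>2) - c x / x"
      unfolding X_def c_def using x by (simp add: power2_eq_square field_simps)
    ultimately show ?thesis by simp
  qed
  have eq: "X x + (1 / 2 * E2 x + (\<nu> - 1 / 2) * (1 / x ^ 1 * E1 x)) = (f1 x)\<^sup>2 + (g1 x)\<^sup>2" if x: "x > 0" for x
  proof -
    have "(f1 x)\<^sup>2 + (g1 x)\<^sup>2 = X x - c x / x + \<nu> / x\<^sup>2 * X x + \<nu> / x * E1 x + E2 x / 2"
      using DERIV_unique[OF c1[OF x] c2[OF x]] by simp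
    moreover have "c x / x = \<nu> / x\<^sup>2 * X x + 1 / 2 * (1 / x * E1 x)"
      unfolding c[OF x] using x by (simp add: field_simps power2_eq_square)
    moreover have "(\<nu> - 1 / 2) * (1 / x ^ 1 * E1 x) = \<nu> / x * E1 x - 1 / 2 * (1 / x * E1 x)"
      by (simp add: left_diff_distrib diff_divide_distrib)
    ultimately show ?thesis by linarith
  qed
  have E1n: "cm n E1" using cm_mono[OF E1(1)] by simp
  have "cm n (\<lambda>x. X x + (1 / 2 * E2 x + (\<nu> - 1 / 2) * (1 / x ^ 1 * E1 x)))"
    unfolding X_def using \<nu> by (intro cm_add cm_cmult cm_mult cm E2(1) E1n cm_power_inverse) auto
  then show ?thesis by (rule cm_cong) (rule eq)
qed

section \<open>Hankel's integrals of orders 0 and 1\<close>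

lemma gauss_moment_integrable:
  assumes "x > 0" shows "integrable lborel (\<lambda>s::real. exp (- x * s\<^sup>2) * s ^ k)"
proof -
  define \<sigma> where "\<sigma> = sqrt (1 / (2 * x))"
  have \<sigma>: "\<sigma> > 0" "\<sigma>\<^sup>2 = 1 / (2 * x)" using assms by (auto simp: \<sigma>_def)
  have "integrable lborel (\<lambda>s. sqrt (2 * pi * \<sigma>\<^sup>2) * (normal_density 0 \<sigma> s * (s - 0) ^ k))"
    by (intro integrable_mult_right integrable_normal_moment \<sigma>)
  moreover have "sqrt (2 * pi * \<sigma>\<^sup>2) * (normal_density 0 \<sigma> s * (s - 0) ^ k) = exp (- x * s\<^sup>2) * s ^ k" for s
  proof -
    have "- (s - 0)\<^sup>2 / (2 * \<sigma>\<^sup>2) = - x * s\<^sup>2" unfolding \<sigma>(2) using assms by simp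
    moreover have "sqrt (2 * pi * \<sigma>\<^sup>2) \<noteq> 0" using \<sigma>(1) by simp
    ultimately show ?thesis unfolding normal_density_def by simp
  qed
  ultimately show ?thesis by (simp only:)
qed

lemma FTC_half_line:
  fixes f F :: "real \<Rightarrow> 'a::euclidean_space"
  assumes "\<And>s. s > 0 \<Longrightarrow> (F has_vector_derivative f s) (at s)" "\<And>s. s > 0 \<Longrightarrow> isCont f s"
    and "integrable lborel (\<lambda>s. indicator {0<..} s *\<^sub>R f s)"
    and "(F \<longlongrightarrow> A) (at_right 0)" "(F \<longlongrightarrow> B) at_top"
  shows "(LINT s|lborel. indicator {0<..} s *\<^sub>R f s) = B - A"
proof -
  have e: "einterval 0 \<infinity> = {0<..}" unfolding zero_ereal_def by (auto simp: einterval_iff)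
  have "(LBINT x=0..\<infinity>. f x) = B - A"
    by (rule interval_integral_FTC_integrable[where F = F])
       (use assms in \<open>auto simp: e set_integrable_def zero_ereal_def ereal_tendsto_simps\<close>)
  then show ?thesis
    by (simp add: interval_lebesgue_integral_def e set_lebesgue_integral_def)
qed

text \<open>Under t = s^2 the weight (t (t - 2 \<i>))^(-1/2) dt of Hankel's integral becomes 2 ds /
  \<open>hq s\<close>.\<close>

definition hq :: "real \<Rightarrow> complex" where "hq s = csqrt (of_real (s\<^sup>2) - 2 * \<i>)"

lemma hq_square: "(hq s)\<^sup>2 = of_real (s\<^sup>2) - 2 * \<i>"
  unfolding hq_def by (rule power2_csqrt)

text \<open>The equations are the two parts of \<open>hq_square\<close>. The principal branch makes
  the real part nonnegative, and the product - 1 then fixes both strict signs.\<close>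

lemma hq_parts:
  shows "(Re (hq s))\<^sup>2 - (Im (hq s))\<^sup>2 = s\<^sup>2" "Re (hq s) * Im (hq s) = - 1" "Re (hq s) > 0" "Im (hq s) < 0"
proof -
  have "Re ((hq s)\<^sup>2) = s\<^sup>2" "Im ((hq s)\<^sup>2) = -2" by (simp_all add: hq_square)
  then show 1: "(Re (hq s))\<^sup>2 - (Im (hq s))\<^sup>2 = s\<^sup>2" and 2: "Re (hq s) * Im (hq s) = - 1"
    by (simp_all add: power2_eq_square mult.commute)
  have "Re (hq s) \<ge> 0" unfolding hq_def using csqrt_principal by force
  with 2 show 3: "Re (hq s) > 0" by (cases "Re (hq s) = 0") auto
  show "Im (hq s) < 0" using 2 3 mult_nonneg_nonneg[of "Re (hq s)" "Im (hq s)"] by (cases "Im (hq s) < 0") auto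
qed

lemma hq_ge: "Re (hq s) \<ge> \<bar>s\<bar>" "Re (hq s) \<ge> 1" "norm (hq s) \<ge> 1" "norm (hq s) \<le> \<bar>s\<bar> + 2"
proof -
  note p = hq_parts[of s]
  have "s\<^sup>2 \<le> (Re (hq s))\<^sup>2" using p(1) zero_le_power2[of "Im (hq s)"] by linarith
  then show "Re (hq s) \<ge> \<bar>s\<bar>" using p(3) by (metis abs_le_square_iff abs_of_pos)
  have "(Im (hq s))\<^sup>2 \<le> (Re (hq s))\<^sup>2" using p(1) zero_le_power2[of s] by linarith
  then have "\<bar>Im (hq s)\<bar> \<le> Re (hq s)" using p(3) by (metis abs_le_square_iff abs_of_pos)
  then have "Re (hq s) * \<bar>Im (hq s)\<bar> \<le> Re (hq s) * Re (hq s)" using p(3) by (intro mult_left_mono) auto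
  then have "1\<^sup>2 \<le> (Re (hq s))\<^sup>2" using p(2,4) by (simp add: power2_eq_square)
  then show r: "Re (hq s) \<ge> 1" using p(3) power2_le_imp_le[of 1 "Re (hq s)"] by simp
  then show "norm (hq s) \<ge> 1" using abs_Re_le_cmod[of "hq s"] by linarith
  have "(norm (hq s))\<^sup>2 = norm (of_real (s\<^sup>2) - 2 * \<i>)" by (simp add: hq_square flip: norm_power)
  also have "\<dots> \<le> s\<^sup>2 + 2" by (rule order_trans[OF norm_triangle_ineq4]) (simp add: norm_power)
  also have "\<dots> \<le> (\<bar>s\<bar> + 2)\<^sup>2" by (simp add: power2_sum)
  finally show "norm (hq s) \<le> \<bar>s\<bar> + 2" by (rule power2_le_imp_le) simp
qed

lemma hq_nonzero [simp]: "hq s \<noteq> 0" using hq_parts(3)[of s] by auto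

lemma hq_deriv: "(hq has_vector_derivative (of_real s / hq s)) (at s)"
proof -
  have n: "of_real (s\<^sup>2) - 2 * \<i> \<notin> \<real>\<^sub>\<le>\<^sub>0" by (auto simp: complex_nonpos_Reals_iff)
  have "((\<lambda>z. csqrt (z\<^sup>2 - 2 * \<i>)) has_field_derivative (of_real s / hq s)) (at (of_real s))"
    unfolding hq_def using n
    by (auto intro!: derivative_eq_intros simp: field_simps)
  from has_vector_derivative_real_field[OF this] show ?thesis by (simp add: hq_def[abs_def])
qed

lemma hq_isCont [continuous_intros]: "isCont hq s"
  using hq_deriv has_vector_derivative_continuous by blast

lemma continuous_on_hq: "continuous_on A hq" by (simp add: continuous_at_imp_continuous_on hq_isCont)

lemma gauss_integrable_bounded:
  fixes g :: "real \<Rightarrow> 'b::{banach, second_countable_topology}"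
  assumes x: "x > 0" and [measurable]: "g \<in> borel_measurable borel" and b: "\<And>s. norm (g s) \<le> C * (1 + s\<^sup>2)"
  shows "integrable lborel (\<lambda>s. (exp (- x * s\<^sup>2) * s ^ (2 * m)) *\<^sub>R g s)"
proof (rule Bochner_Integration.integrable_bound)
  show "integrable lborel (\<lambda>s. C * (exp (- x * s\<^sup>2) * s ^ (2 * m) + exp (- x * s\<^sup>2) * s ^ (2 * m + 2)))"
    by (intro integrable_mult_right Bochner_Integration.integrable_add gauss_moment_integrable x)
  have "norm ((exp (- x * s\<^sup>2) * s ^ (2 * m)) *\<^sub>R g s)
      \<le> norm (C * (exp (- x * s\<^sup>2) * s ^ (2 * m) + exp (- x * s\<^sup>2) * s ^ (2 * m + 2)))" for s
  proof -
    have "norm ((exp (- x * s\<^sup>2) * s ^ (2 * m)) *\<^sub>R g s) \<le> (exp (- x * s\<^sup>2) * s ^ (2 * m)) * (C * (1 + s\<^sup>2))"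
      using b[of s] by (simp add: mult_left_mono abs_mult power_mult)
    also have "\<dots> = C * (exp (- x * s\<^sup>2) * s ^ (2 * m) + exp (- x * s\<^sup>2) * s ^ (2 * m + 2))"
      by (simp add: power_add power2_eq_square algebra_simps)
    finally show ?thesis by (simp only: real_norm_def)
  qed
  then show "AE s in lborel. norm ((exp (- x * s\<^sup>2) * s ^ (2 * m)) *\<^sub>R g s)
      \<le> norm (C * (exp (- x * s\<^sup>2) * s ^ (2 * m) + exp (- x * s\<^sup>2) * s ^ (2 * m + 2)))" by simp
qed measurable

text \<open>Up to the factor \<open>2 / (\<pi> \<i>) \<cdot> exp (\<i> x)\<close>, the integrals \<open>2 hV x\<close> and \<open>2 hV1 x\<close> are Hankel's
  representations \<open>\<integral> exp (- x t) (t (t - 2 \<i>)) powr (- 1/2) dt\<close> of \<open>H\<^sub>0\<close> and the corresponding one of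
  \<open>H\<^sub>1 = - H\<^sub>0'\<close>, with \<open>t = s\<^sup>2\<close> substituted.\<close>

definition hg :: "real \<Rightarrow> complex" where "hg s = indicator {0<..} s *\<^sub>R (1 / hq s)"
definition hg1 :: "real \<Rightarrow> complex" where "hg1 s = indicator {0<..} s *\<^sub>R ((of_real (s\<^sup>2) - \<i>) / hq s)"
definition hV :: "real \<Rightarrow> complex" where "hV x = (LINT s|lborel. exp (- x * s\<^sup>2) *\<^sub>R hg s)"
definition hV1 :: "real \<Rightarrow> complex" where "hV1 x = (LINT s|lborel. exp (- x * s\<^sup>2) *\<^sub>R hg1 s)"

lemma borel_measurable_hq [measurable]: "hq \<in> borel_measurable borel"
  by (intro borel_measurable_continuous_onI continuous_on_hq)

lemma borel_measurable_hg [measurable]: "hg \<in> borel_measurable borel" "hg1 \<in> borel_measurable borel"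
  unfolding hg_def[abs_def] hg1_def[abs_def] by measurable

lemma hg_bound: "norm (hg s) \<le> 1" "norm (hg1 s) \<le> 1 * (1 + s\<^sup>2)"
proof -
  have q: "norm (hq s) \<ge> 1" by (rule hq_ge)
  then have "norm (1 / hq s) \<le> 1" by (simp add: norm_divide field_simps)
  then show "norm (hg s) \<le> 1" by (simp add: hg_def indicator_def)
  have "norm (of_real (s\<^sup>2) - \<i>) \<le> 1 + s\<^sup>2" by (rule order_trans[OF norm_triangle_ineq4]) (simp add: norm_power)
  also have "\<dots> \<le> (1 + s\<^sup>2) * norm (hq s)" using mult_left_mono[OF q, of "1 + s\<^sup>2"] by simp
  finally have "norm ((of_real (s\<^sup>2) - \<i>) / hq s) \<le> 1 + s\<^sup>2"
    using q by (simp add: norm_divide divide_le_eq)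
  then show "norm (hg1 s) \<le> 1 * (1 + s\<^sup>2)" by (simp add: hg1_def indicator_def)
qed

lemma hg_integrable:
  assumes "x > 0"
  shows "integrable lborel (\<lambda>s. (exp (- x * s\<^sup>2) * s ^ (2 * m)) *\<^sub>R hg s)"
    "integrable lborel (\<lambda>s. (exp (- x * s\<^sup>2) * s ^ (2 * m)) *\<^sub>R hg1 s)"
proof -
  show "integrable lborel (\<lambda>s. (exp (- x * s\<^sup>2) * s ^ (2 * m)) *\<^sub>R hg s)"
    by (rule gauss_integrable_bounded[OF assms, of _ 1]) (auto intro: order_trans[OF hg_bound(1)])
  show "integrable lborel (\<lambda>s. (exp (- x * s\<^sup>2) * s ^ (2 * m)) *\<^sub>R hg1 s)"
    by (rule gauss_integrable_bounded[OF assms _ hg_bound(2)]) measurable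
qed

text \<open>The integrand has fixed signs: multiplication by the conjugate of \<open>hq s\<close>
  leaves the parts s^2 a - b and b^3 over the squared modulus, where a > 0 > b are the parts of
  \<open>hq s\<close>. This makes the squared modulus of \<open>hV1\<close> completely
  monotone.\<close>

lemma cm_hV1: "cm n (\<lambda>x. Re (hV1 x))" "cm n (\<lambda>x. - Im (hV1 x))"
proof -
  have pos: "Re (hg1 s) \<ge> 0" "- Im (hg1 s) \<ge> 0" for s
  proof -
    let ?a = "Re (hq s)" and ?b = "Im (hq s)"
    note p = hq_parts[of s]
    have n: "(norm (hq s))\<^sup>2 > 0" by simp
    have w: "(of_real (s\<^sup>2) - \<i>) / hq s = (of_real (s\<^sup>2) - \<i>) * cnj (hq s) / of_real ((norm (hq s))\<^sup>2)"
      using complex_div_cnj[of "of_real (s\<^sup>2) - \<i>" "hq s"] by simp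
    have re: "Re ((of_real (s\<^sup>2) - \<i>) / hq s) = (s\<^sup>2 * ?a - ?b) / (norm (hq s))\<^sup>2"
      unfolding w Re_divide_of_real by simp
    have "- s\<^sup>2 * ?b - ?a = ?b * ?b * ?b"
    proof -
      have "- s\<^sup>2 * ?b - ?a = - ?a * (?a * ?b) + ?b * ?b * ?b - ?a"
        unfolding p(1)[symmetric] by (simp add: power2_eq_square algebra_simps)
      then show ?thesis unfolding p(2) by simp
    qed
    then have im: "Im ((of_real (s\<^sup>2) - \<i>) / hq s) = ?b * ?b * ?b / (norm (hq s))\<^sup>2"
      unfolding w Im_divide_of_real by simp
    have "?b * ?b * ?b \<le> 0" using p(4) by (simp add: mult_le_0_iff zero_le_mult_iff)
    then have "Im ((of_real (s\<^sup>2) - \<i>) / hq s) \<le> 0" unfolding im using n by (intro divide_nonpos_pos)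
    moreover have "s\<^sup>2 * ?a \<ge> 0" using p(3) by simp
    then have "Re ((of_real (s\<^sup>2) - \<i>) / hq s) \<ge> 0"
      unfolding re using n p(4) by (intro divide_nonneg_pos) auto
    ultimately show "Re (hg1 s) \<ge> 0" "- Im (hg1 s) \<ge> 0"
      by (auto simp: hg1_def indicator_def simp del: of_real_power)
  qed
  have i: "integrable lborel (\<lambda>s. exp (- x * s\<^sup>2) *\<^sub>R hg1 s)" if "x > 0" for x
    using hg_integrable(2)[OF that, of 0] by simp
  have "cm n (\<lambda>x. LINT s|lborel. exp (- x * s\<^sup>2) * Re (hg1 s))"
  proof (rule cm_gauss_transform[OF _ pos(1)])
    show "integrable lborel (\<lambda>s. exp (- x * s\<^sup>2) * s ^ (2 * m) * Re (hg1 s))" if "x > 0" for x m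
      using integrable_Re[OF hg_integrable(2)[OF that, of m]] by simp
  qed
  then show "cm n (\<lambda>x. Re (hV1 x))"
    by (rule cm_cong) (use integral_Re[OF i] in \<open>simp add: hV1_def\<close>)
  have "cm n (\<lambda>x. LINT s|lborel. exp (- x * s\<^sup>2) * - Im (hg1 s))"
  proof (rule cm_gauss_transform[OF _ pos(2)])
    show "integrable lborel (\<lambda>s. exp (- x * s\<^sup>2) * s ^ (2 * m) * - Im (hg1 s))" if "x > 0" for x m
      using integrable_Im[OF hg_integrable(2)[OF that, of m]] by simp
  qed
  then show "cm n (\<lambda>x. - Im (hV1 x))"
    by (rule cm_cong) (use integral_Im[OF i] in \<open>simp add: hV1_def\<close>)
qed

lemma hV_deriv:
  assumes x: "x > 0"
  shows "(hV has_vector_derivative - (LINT s|lborel. exp (- x * s\<^sup>2) *\<^sub>R s\<^sup>2 *\<^sub>R hg s)) (at x)"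
    "(hV1 has_vector_derivative - (LINT s|lborel. exp (- x * s\<^sup>2) *\<^sub>R s\<^sup>2 *\<^sub>R hg1 s)) (at x)"
  unfolding hV_def[abs_def] hV1_def[abs_def]
  by (rule gauss_transform_deriv[OF hg_integrable(1) x], simp)
     (rule gauss_transform_deriv[OF hg_integrable(2) x], simp)

lemma tendsto_exp_minus_square_at_top:
  "x > 0 \<Longrightarrow> ((\<lambda>s::real. exp (- x * s\<^sup>2) * (s * (s + 2))) \<longlongrightarrow> 0) at_top" for x :: real
  by real_asymp

text \<open>The first identity already holds for the integrands, since \<i> - s^2 is minus the
  numerator in \<open>hg1\<close>. The second is an integration by parts: up to the factor 2 x, the
  difference of its sides is the integral of the derivative of \<open>W\<close>, which vanishes at 0
  and at infinity.\<close>

lemma hV_relations: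
  assumes x: "x > 0"
  shows "\<i> * hV x - (LINT s|lborel. exp (- x * s\<^sup>2) *\<^sub>R s\<^sup>2 *\<^sub>R hg s) = - hV1 x"
    and "\<i> * hV1 x - (LINT s|lborel. exp (- x * s\<^sup>2) *\<^sub>R s\<^sup>2 *\<^sub>R hg1 s) = hV x - hV1 x / of_real x"
proof -
  let ?e = "\<lambda>s. exp (- x * s\<^sup>2)"
  have i0: "integrable lborel (\<lambda>s. ?e s *\<^sub>R hg s)" using hg_integrable(1)[OF x, of 0] by simp
  have i1: "integrable lborel (\<lambda>s. ?e s *\<^sub>R s\<^sup>2 *\<^sub>R hg s)" using hg_integrable(1)[OF x, of 1] by simp
  have j0: "integrable lborel (\<lambda>s. ?e s *\<^sub>R hg1 s)" using hg_integrable(2)[OF x, of 0] by simp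
  have j1: "integrable lborel (\<lambda>s. ?e s *\<^sub>R s\<^sup>2 *\<^sub>R hg1 s)" using hg_integrable(2)[OF x, of 1] by simp
  have "\<i> * hV x - (LINT s|lborel. ?e s *\<^sub>R s\<^sup>2 *\<^sub>R hg s) = (LINT s|lborel. \<i> * (?e s *\<^sub>R hg s) - ?e s *\<^sub>R s\<^sup>2 *\<^sub>R hg s)"
    unfolding hV_def Bochner_Integration.integral_diff[OF integrable_mult_right[OF i0] i1] integral_mult_right_zero ..
  also have "\<dots> = (LINT s|lborel. - (?e s *\<^sub>R hg1 s))"
    by (rule Bochner_Integration.integral_cong) (auto simp: hg_def hg1_def indicator_def scaleR_conv_of_real field_simps)
  finally show "\<i> * hV x - (LINT s|lborel. ?e s *\<^sub>R s\<^sup>2 *\<^sub>R hg s) = - hV1 x" by (simp add: hV1_def)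
  define W where "W = (\<lambda>s. of_real (?e s * s) * hq s)"
  define w where "w = (\<lambda>s. of_real (?e s) / hq s * (- 2 * (of_real (x * s ^ 4) - (1 + 2 * \<i> * of_real x) * of_real (s\<^sup>2) + \<i>)))"
  have W: "(W has_vector_derivative w s) (at s)" for s
  proof -
    have "((\<lambda>s. ?e s * s) has_real_derivative ?e s - 2 * x * s\<^sup>2 * ?e s) (at s)"
      by (auto intro!: derivative_eq_intros simp: power2_eq_square algebra_simps)
    then have "((\<lambda>s. complex_of_real (?e s * s)) has_vector_derivative of_real (?e s - 2 * x * s\<^sup>2 * ?e s)) (at s)"
      by (intro has_vector_derivative_of_real) (simp add: has_real_derivative_iff_has_vector_derivative)
    from has_vector_derivative_mult[OF this hq_deriv]
    have "(W has_vector_derivative (of_real (?e s * s) * (of_real s / hq s) + of_real (?e s - 2 * x * s\<^sup>2 * ?e s) * hq s)) (at s)"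
      unfolding W_def .
    also have "of_real (?e s * s) * (of_real s / hq s) + of_real (?e s - 2 * x * s\<^sup>2 * ?e s) * hq s
        = of_real (?e s) / hq s * (of_real (s\<^sup>2) + of_real (1 - 2 * x * s\<^sup>2) * (hq s)\<^sup>2)"
      by (simp add: field_simps power2_eq_square)
    also have "\<dots> = w s"
      unfolding hq_square w_def by (simp add: algebra_simps power2_eq_square power4_eq_xxxx)
    finally show ?thesis .
  qed
  have wcont: "isCont w s" for s
    unfolding w_def by (intro continuous_intros hq_isCont) auto
  have weq: "indicator {0<..} s *\<^sub>R w s = (2 * of_real x) * (\<i> * (?e s *\<^sub>R hg1 s) - ?e s *\<^sub>R s\<^sup>2 *\<^sub>R hg1 s - ?e s *\<^sub>R hg s + (?e s *\<^sub>R hg1 s) / of_real x)" for s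
    using x unfolding w_def hg_def hg1_def
    by (simp add: indicator_def scaleR_conv_of_real field_simps power2_eq_square power4_eq_xxxx)
  note k1 = integrable_mult_right[OF j0, of "\<i>"]
  note k2 = Bochner_Integration.integrable_diff[OF k1 j1]
  note k3 = Bochner_Integration.integrable_diff[OF k2 i0]
  have k4: "integrable lborel (\<lambda>s. ?e s *\<^sub>R hg1 s / of_real x)" using j0 by (rule integrable_divide)
  have wint: "integrable lborel (\<lambda>s. indicator {0<..} s *\<^sub>R w s)"
    unfolding weq using i0 j0 j1 by (intro integrable_mult_right Bochner_Integration.integrable_add Bochner_Integration.integrable_diff integrable_divide) auto
  have "(LINT s|lborel. indicator {0<..} s *\<^sub>R w s) = 0 - 0"
  proof (rule FTC_half_line[OF W wcont wint])
    have "isCont W 0" using W has_vector_derivative_continuous by blast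
    then have "(W \<longlongrightarrow> W 0) (at_right 0)" unfolding isCont_def by (rule tendsto_mono[rotated]) (simp add: at_le)
    then show "(W \<longlongrightarrow> 0) (at_right 0)" by (simp add: W_def)
    show "(W \<longlongrightarrow> 0) at_top"
    proof (rule Lim_null_comparison[OF _ tendsto_exp_minus_square_at_top[OF x]])
      have "norm (W s) \<le> ?e s * (s * (s + 2))" if "s > 0" for s
        using that hq_ge(4)[of s] by (simp add: W_def norm_mult mult.assoc[symmetric] mult_left_mono)
      then show "\<forall>\<^sub>F s in at_top. norm (W s) \<le> ?e s * (s * (s + 2))"
        using eventually_gt_at_top[of "0::real"] by (rule eventually_mono[rotated]) simp
    qed
  qed
  also have "(LINT s|lborel. indicator {0<..} s *\<^sub>R w s)
     = (2 * of_real x) * (\<i> * hV1 x - (LINT s|lborel. ?e s *\<^sub>R s\<^sup>2 *\<^sub>R hg1 s) - hV x + hV1 x / of_real x)"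
    unfolding weq hV_def hV1_def integral_mult_right_zero Bochner_Integration.integral_add[OF k3 k4]
      Bochner_Integration.integral_diff[OF k2 i0] Bochner_Integration.integral_diff[OF k1 j1] integral_divide_zero ..
  finally have "\<i> * hV1 x - (LINT s|lborel. ?e s *\<^sub>R s\<^sup>2 *\<^sub>R hg1 s) - hV x + hV1 x / of_real x = 0"
    using x by auto
  then show "\<i> * hV1 x - (LINT s|lborel. ?e s *\<^sub>R s\<^sup>2 *\<^sub>R hg1 s) = hV x - hV1 x / of_real x"
    by (simp add: algebra_simps)
qed

text \<open>The factor exp (\<i> x) contributes the terms \<i> hV and \<i> hV1 to the derivatives;
  with these, \<open>hV_relations\<close> become the ladder equations of order 0.\<close>

lemma ladder_hV:
  "ladder 0 (\<lambda>x. Re (exp (\<i> * of_real x) * hV x)) (\<lambda>x. Re (exp (\<i> * of_real x) * hV1 x))"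
  "ladder 0 (\<lambda>x. Im (exp (\<i> * of_real x) * hV x)) (\<lambda>x. Im (exp (\<i> * of_real x) * hV1 x))"
proof -
  have e: "((\<lambda>x. exp (\<i> * of_real x)) has_vector_derivative \<i> * exp (\<i> * of_real x)) (at x)" for x :: real
  proof -
    have "((\<lambda>z. exp (\<i> * z)) has_field_derivative \<i> * exp (\<i> * of_real x)) (at (of_real x))"
      by (auto intro!: derivative_eq_intros)
    from has_vector_derivative_real_field[OF this] show ?thesis .
  qed
  have U: "((\<lambda>x. exp (\<i> * of_real x) * hV x) has_vector_derivative - (exp (\<i> * of_real x) * hV1 x)) (at x)" if x: "x > 0" for x
  proof -
    have "((\<lambda>x. exp (\<i> * of_real x) * hV x) has_vector_derivative exp (\<i> * of_real x) * (\<i> * hV x - (LINT s|lborel. exp (- x * s\<^sup>2) *\<^sub>R s\<^sup>2 *\<^sub>R hg s))) (at x)"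
      using has_vector_derivative_mult[OF e hV_deriv(1)[OF x]] by (simp add: algebra_simps)
    then show ?thesis unfolding hV_relations(1)[OF x] by simp
  qed
  have U1: "((\<lambda>x. exp (\<i> * of_real x) * hV1 x) has_vector_derivative exp (\<i> * of_real x) * hV x - exp (\<i> * of_real x) * hV1 x / of_real x) (at x)" if x: "x > 0" for x
  proof -
    have "((\<lambda>x. exp (\<i> * of_real x) * hV1 x) has_vector_derivative exp (\<i> * of_real x) * (\<i> * hV1 x - (LINT s|lborel. exp (- x * s\<^sup>2) *\<^sub>R s\<^sup>2 *\<^sub>R hg1 s))) (at x)"
      using has_vector_derivative_mult[OF e hV_deriv(2)[OF x]] by (simp add: algebra_simps)
    then show ?thesis unfolding hV_relations(2)[OF x] by (simp add: algebra_simps)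
  qed
  show "ladder 0 (\<lambda>x. Re (exp (\<i> * of_real x) * hV x)) (\<lambda>x. Re (exp (\<i> * of_real x) * hV1 x))"
    unfolding ladder_def
    using bounded_linear.has_vector_derivative[OF bounded_linear_Re U] bounded_linear.has_vector_derivative[OF bounded_linear_Re U1]
    by (simp add: has_real_derivative_iff_has_vector_derivative del: times_complex.sel)
  show "ladder 0 (\<lambda>x. Im (exp (\<i> * of_real x) * hV x)) (\<lambda>x. Im (exp (\<i> * of_real x) * hV1 x))"
    unfolding ladder_def
    using bounded_linear.has_vector_derivative[OF bounded_linear_Im U] bounded_linear.has_vector_derivative[OF bounded_linear_Im U1]
    by (simp add: has_real_derivative_iff_has_vector_derivative del: times_complex.sel)
qed

section \<open>Asymptotics of Hankel's integral at 0\<close>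

lemma powr_times_exp_integrable:
  assumes "\<bar>h\<bar> < 1 / 2"
  shows "integrable lborel (\<lambda>y::real. indicator {0<..} y *\<^sub>R (2 * y * exp (- y\<^sup>2) * (y\<^sup>2) powr h))"
proof (rule Bochner_Integration.integrable_bound)
  show "integrable lborel (\<lambda>y::real. 2 * (exp (- 1 * y\<^sup>2) * y ^ 0 + exp (- 1 * y\<^sup>2) * y ^ 2))"
    by (intro integrable_mult_right Bochner_Integration.integrable_add gauss_moment_integrable) auto
  have "norm (indicator {0<..} y *\<^sub>R (2 * y * exp (- y\<^sup>2) * (y\<^sup>2) powr h))
      \<le> norm (2 * (exp (- 1 * y\<^sup>2) * y ^ 0 + exp (- 1 * y\<^sup>2) * y ^ 2))" for y :: real
  proof (cases "y > 0")
    case True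
    have "y * (y\<^sup>2) powr h = y powr (1 + 2 * h)"
      using True by (simp add: powr_add powr_powr flip: powr_numeral)
    also have "\<dots> \<le> 1 + y\<^sup>2"
    proof (cases "y \<le> 1")
      case True
      then have "y powr (1 + 2 * h) \<le> 1" using \<open>y > 0\<close> assms by (intro powr_le1) auto
      then show ?thesis by (simp add: add_increasing2)
    next
      case False
      then have "y powr (1 + 2 * h) \<le> y powr 2" using assms by (intro powr_mono) auto
      then show ?thesis using True by simp
    qed
    finally have "2 * exp (- y\<^sup>2) * (y * (y\<^sup>2) powr h) \<le> 2 * exp (- y\<^sup>2) * (1 + y\<^sup>2)"
      by (intro mult_left_mono) auto
    then show ?thesis using True by (simp add: algebra_simps)
  qed (simp add: add_nonneg_nonneg)
  then show "AE y in lborel. norm (indicator {0<..} y *\<^sub>R (2 * y * exp (- y\<^sup>2) * (y\<^sup>2) powr h))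
      \<le> norm (2 * (exp (- 1 * y\<^sup>2) * y ^ 0 + exp (- 1 * y\<^sup>2) * y ^ 2))" by simp
qed measurable

text \<open>Euler's integral under t = a y^2. The case a = 1 serves the logarithmic integral, a =
  1/2 the radial moments of the Gaussian.\<close>

lemma Gamma_gauss_integral:
  fixes h a :: real
  assumes h: "h > -1" and a: "a > 0"
    and int: "integrable lborel (\<lambda>y::real. indicator {0<..} y *\<^sub>R (2 * a * y * exp (- a * y\<^sup>2) * (a * y\<^sup>2) powr h))"
  shows "(LINT y|lborel. indicator {0<..} y *\<^sub>R (2 * a * y * exp (- a * y\<^sup>2) * (a * y\<^sup>2) powr h)) = Gamma (1 + h)"
proof -
  define f where "f = (\<lambda>t::real. t powr h * exp (- t))"
  have e: "einterval 0 \<infinity> = {0<..}" unfolding zero_ereal_def by (auto simp: einterval_iff)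
  have sq: "((\<lambda>x::real. a * x\<^sup>2) \<longlongrightarrow> 0) (at_right 0)" by real_asymp
  have top: "filterlim (\<lambda>x::real. a * x\<^sup>2) at_top at_top" using a by real_asymp
  have int: "set_integrable lborel (einterval 0 \<infinity>) (\<lambda>x. f (a * x\<^sup>2) * (2 * a * x))"
    using int by (simp add: set_integrable_def e f_def mult_ac)
  note S = interval_integral_substitution_nonneg[of 0 \<infinity> "\<lambda>x. a * x\<^sup>2" "\<lambda>x. 2 * a * x" f 0 \<infinity>, OF _ _ _ _ _ _ _ _ int]
  have S1: "set_integrable lborel (einterval 0 \<infinity>) f" and S2: "(LBINT x=0..\<infinity>. f x) = (LBINT x=0..\<infinity>. f (a * x\<^sup>2) * (2 * a * x))"
    by (rule S; (use sq top a in \<open>auto intro!: derivative_eq_intros continuous_intros simp: f_def zero_ereal_def ereal_tendsto_simps tendsto_PInfty_eq_at_top\<close>); fail)+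
  have "(LBINT x=0..\<infinity>. f x) = integral {0<..} f"
    using set_borel_integral_eq_integral(2)[OF S1] by (simp add: interval_lebesgue_integral_def e)
  also have "((\<lambda>t. t powr (1 + h - 1) / exp t) has_integral Gamma (1 + h)) {0..}"
    using h by (intro Gamma_integral_real) auto
  then have "((\<lambda>t. t powr (1 + h - 1) / exp t) has_integral Gamma (1 + h)) {0<..}"
  proof (subst has_integral_spike_set_eq[of "{0<..}" "{0..}"])
    show "negligible {t \<in> {0<..} - {0..}. t powr (1 + h - 1) / exp t \<noteq> 0}"
      by (rule negligible_subset[of "{}"]) auto
    show "negligible {t \<in> {0..} - {0<..}. t powr (1 + h - 1) / exp t \<noteq> 0}"
      by (rule negligible_subset[of "{0}"]) auto
  qed
  then have "integral {0<..} f = Gamma (1 + h)"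
    by (simp add: f_def exp_minus divide_inverse integral_unique)
  finally show ?thesis using S2
    by (simp add: interval_lebesgue_integral_def e set_lebesgue_integral_def f_def mult_ac)
qed

lemma gauss_log_integrable:
  "integrable lborel (\<lambda>y::real. indicator {0<..} y *\<^sub>R (2 * y * exp (- y\<^sup>2) * ln y))"
proof (rule Bochner_Integration.integrable_bound)
  show "integrable lborel (\<lambda>y::real. 2 * (exp (- 1 * y\<^sup>2) * y ^ 0 + exp (- 1 * y\<^sup>2) * y ^ 2))"
    by (intro integrable_mult_right Bochner_Integration.integrable_add gauss_moment_integrable) auto
  have "norm (indicator {0<..} y *\<^sub>R (2 * y * exp (- y\<^sup>2) * ln y))
      \<le> norm (2 * (exp (- 1 * y\<^sup>2) * y ^ 0 + exp (- 1 * y\<^sup>2) * y ^ 2))" for y :: real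
  proof (cases "y > 0")
    case True
    have "ln y \<le> y" "ln (1 / y) \<le> 1 / y" using True by (auto intro!: ln_bound less_imp_le[OF ln_less_self])
    moreover have "1 / y > 0" using True by simp
    moreover have "ln (1 / y) = - ln y" using True by (simp add: ln_div)
    ultimately have "\<bar>ln y\<bar> \<le> y + 1 / y" using True by linarith
    then have "y * \<bar>ln y\<bar> \<le> y * (y + 1 / y)" using True by (intro mult_left_mono) auto
    also have "\<dots> = 1 + y\<^sup>2" using True by (simp add: field_simps power2_eq_square)
    finally have "2 * exp (- y\<^sup>2) * (y * \<bar>ln y\<bar>) \<le> 2 * exp (- y\<^sup>2) * (1 + y\<^sup>2)"
      by (intro mult_left_mono) auto
    then show ?thesis using True by (simp add: algebra_simps abs_mult)
  qed (simp add: add_nonneg_nonneg)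
  then show "AE y in lborel. norm (indicator {0<..} y *\<^sub>R (2 * y * exp (- y\<^sup>2) * ln y))
      \<le> norm (2 * (exp (- 1 * (y::real)\<^sup>2) * y ^ 0 + exp (- 1 * y\<^sup>2) * y ^ 2))" by simp
qed measurable

text \<open>No differentiation under the integral: exp r \<ge> 1 + r gives
  \<open>Gamma (1 + h) \<ge> 1 + 2 * h * ?L\<close> near 0, with equality at h = 0. So the
  difference has a minimum there, and its derivative - \<gamma> - 2 \<open>?L\<close> is 0, with
  Euler's constant \<gamma>.\<close>

lemma gauss_log_integral:
  "(LINT y|lborel. indicator {0<..} y *\<^sub>R (2 * y * exp (- y\<^sup>2) * ln (y :: real))) = - euler_mascheroni / 2"
proof -
  let ?L = "LINT y|lborel. indicator {0<..} (y :: real) *\<^sub>R (2 * y * exp (- y\<^sup>2) * ln y)"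
  have i1: "integrable lborel (\<lambda>y::real. indicator {0<..} y *\<^sub>R (2 * y * exp (- y\<^sup>2)))"
    using powr_times_exp_integrable[of 0]
    by (rule Bochner_Integration.integrable_cong[THEN iffD1, rotated 2]) (auto simp: indicator_def)
  have v1: "(LINT y|lborel. indicator {0<..} y *\<^sub>R (2 * y * exp (- y\<^sup>2))) = (1::real)"
  proof -
    have "(LINT y|lborel. indicator {0<..} y *\<^sub>R (2 * y * exp (- y\<^sup>2))) =
        (LINT y|lborel. indicator {0<..} y *\<^sub>R (2 * y * exp (- y\<^sup>2) * (y\<^sup>2) powr (0::real)))"
      by (rule Bochner_Integration.integral_cong) (auto simp: indicator_def)
    then show ?thesis using Gamma_gauss_integral[of 0 1] powr_times_exp_integrable[of 0] by simp
  qed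
  have ge: "Gamma (1 + h) - 2 * h * ?L \<ge> 1" if h: "\<bar>h\<bar> < 1 / 2" for h
  proof -
    have "1 + 2 * h * ?L = (LINT y|lborel. indicator {0<..} y *\<^sub>R (2 * y * exp (- y\<^sup>2)) + (2 * h) * (indicator {0<..} y *\<^sub>R (2 * y * exp (- y\<^sup>2) * ln y)))"
      by (subst Bochner_Integration.integral_add[OF i1 integrable_mult_right[OF gauss_log_integrable]]) (simp only: v1 integral_mult_right_zero)
    also have "\<dots> \<le> (LINT y|lborel. indicator {0<..} y *\<^sub>R (2 * y * exp (- y\<^sup>2) * (y\<^sup>2) powr h))"
    proof (rule integral_mono)
      fix y :: real
      show "indicator {0<..} y *\<^sub>R (2 * y * exp (- y\<^sup>2)) + (2 * h) * (indicator {0<..} y *\<^sub>R (2 * y * exp (- y\<^sup>2) * ln y))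
          \<le> indicator {0<..} y *\<^sub>R (2 * y * exp (- y\<^sup>2) * (y\<^sup>2) powr h)"
      proof (cases "y > 0")
        case True
        have "1 + 2 * h * ln y \<le> exp (2 * h * ln y)" by (rule exp_ge_add_one_self)
        also have "\<dots> = (y\<^sup>2) powr h" using True by (simp add: powr_def ln_realpow mult_ac)
        finally have "2 * y * exp (- y\<^sup>2) * (1 + 2 * h * ln y) \<le> 2 * y * exp (- y\<^sup>2) * (y\<^sup>2) powr h"
          using True by (intro mult_left_mono) auto
        then show ?thesis using True by (simp add: algebra_simps)
      qed simp
    qed (rule Bochner_Integration.integrable_add[OF i1 integrable_mult_right[OF gauss_log_integrable]],
         rule powr_times_exp_integrable[OF h])
    also have "\<dots> = Gamma (1 + h)" using Gamma_gauss_integral[of h 1] powr_times_exp_integrable[OF h] h by simp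
    finally show ?thesis by simp
  qed
  have D: "((\<lambda>h. Gamma (1 + h) - 2 * h * ?L) has_real_derivative - euler_mascheroni - 2 * ?L) (at 0)"
    by (rule derivative_eq_intros refl | simp)+
  have "- euler_mascheroni - 2 * ?L = 0"
    by (rule DERIV_local_min[OF D, of "1/2"]) (use ge in auto)
  then show ?thesis by simp
qed

text \<open>An antiderivative of 1 / \<open>hq\<close> on the half-line, for integrating
  \<open>hV\<close> by parts.\<close>

definition hL :: "real \<Rightarrow> complex" where "hL s = Ln (of_real s + hq s)"

lemma hL_deriv:
  assumes "s \<ge> 0" shows "(hL has_vector_derivative 1 / hq s) (at s)"
proof -
  have p: "Re (of_real s + hq s) > 0" using assms hq_parts(3)[of s] by simp
  then have n: "of_real s + hq s \<notin> \<real>\<^sub>\<le>\<^sub>0" by (auto simp: complex_nonpos_Reals_iff)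
  then have n0: "of_real s + hq s \<noteq> 0" using p by (metis less_irrefl zero_complex.simps(1))
  have "((\<lambda>s. of_real s + hq s) has_vector_derivative (1 + of_real s / hq s)) (at s)"
    by (intro has_vector_derivative_add hq_deriv) (auto intro!: derivative_eq_intros has_vector_derivative_real_field)
  from field_vector_diff_chain_at[OF this has_field_derivative_Ln[OF n]]
  have "(hL has_vector_derivative (1 + of_real s / hq s) * inverse (of_real s + hq s)) (at s)"
    by (simp add: o_def hL_def[abs_def])
  also have "(1 + of_real s / hq s) * inverse (of_real s + hq s) = 1 / hq s"
    using n0 by (simp add: field_simps)
  finally show ?thesis .
qed

lemma hL_0: "hL 0 = of_real (ln 2 / 2) - \<i> * of_real (pi / 4)"
proof -
  have "hq 0 = 1 - \<i>"
  proof -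
    have "(1 - \<i>)\<^sup>2 = of_real (0\<^sup>2) - 2 * \<i>" by (simp add: power2_eq_square algebra_simps)
    then have "csqrt (of_real (0\<^sup>2) - 2 * \<i>) = 1 - \<i>" by (rule csqrt_unique) simp
    then show ?thesis by (simp add: hq_def)
  qed
  moreover have "exp (of_real (ln 2 / 2) - \<i> * of_real (pi / 4)) = 1 - \<i>"
  proof -
    have "exp (ln 2 / 2) = sqrt (2::real)"
      by (simp add: powr_half_sqrt[symmetric] powr_def)
    then show ?thesis
      by (auto simp: complex_eq_iff exp_diff Re_exp Im_exp Re_divide Im_divide cos_45 sin_45 exp_eq_polar cis.sel)
  qed
  ultimately show ?thesis unfolding hL_def
    using pi_gt_zero by (intro Ln_unique) (auto simp del: pi_gt_zero)
qed

text \<open>What remains of \<open>hL\<close> after its logarithmic growth; splitting off ln (2 s)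
  isolates the term - ln x / 2 in \<open>hV\<close>.\<close>

definition hrem :: "real \<Rightarrow> complex" where "hrem s = hL s - of_real (ln (2 * s))"

text \<open>The bound provides an integrable majorant, because 1 / s is met by a factor s. The
  formula shows the limit at infinity, where \<open>hq s\<close> / s tends to 1.\<close>

lemma hrem_estimates:
  assumes s: "s > 0"
  shows "norm (hrem s) \<le> 1 / s + pi" and "hrem s = Ln ((1 + hq s / of_real s) / 2)"
proof -
  let ?z = "of_real s + hq s"
  note p = hq_parts[of s] and q = hq_ge[of s]
  have re: "Re ?z \<ge> 2 * s" using q(1) s by simp
  then have z: "?z \<noteq> 0" "norm ?z \<ge> 2 * s" using s complex_Re_le_cmod[of ?z] by (auto simp: complex_eq_iff)
  have n: "norm ?z \<le> 2 * s + 2" using norm_triangle_ineq[of "of_real s" "hq s"] q(4) s by simp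
  have "Re (hrem s) = ln (norm ?z) - ln (2 * s)" using z by (simp add: hrem_def hL_def)
  moreover have "ln (2 * s) \<le> ln (norm ?z)" using z s by simp
  moreover have "ln (norm ?z) - ln (2 * s) \<le> 1 / s"
  proof -
    have "ln (norm ?z) \<le> ln (2 * s + 2)" using n z s by (subst ln_le_cancel_iff) auto
    also have "2 * s + 2 = 2 * s * (1 + 1 / s)" using s by (simp add: field_simps)
    also have "ln \<dots> = ln (2 * s) + ln (1 + 1 / s)" using s add_pos_pos[of 1 "1 / s"] by (simp add: ln_mult)
    also have "ln (1 + 1 / s) \<le> 1 / s" using s by (intro ln_add_one_self_le_self) simp
    finally show ?thesis by simp
  qed
  ultimately have "\<bar>Re (hrem s)\<bar> \<le> 1 / s" by simp
  moreover have "\<bar>Im (hrem s)\<bar> \<le> pi"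
    using Im_Ln_le_pi[OF z(1)] mpi_less_Im_Ln[OF z(1)] by (auto simp: hrem_def hL_def abs_le_iff)
  ultimately show "norm (hrem s) \<le> 1 / s + pi" using cmod_le[of "hrem s"] by linarith
  have "Ln (of_real (1 / (2 * s)) * ?z) = of_real (ln (1 / (2 * s))) + Ln ?z"
    using s z(1) by (subst Ln_times_of_real) (auto simp: Ln_of_real simp del: of_real_divide)
  moreover have "of_real (1 / (2 * s)) * ?z = (1 + hq s / of_real s) / 2" using s by (simp add: field_simps)
  moreover have "ln (1 / (2 * s)) = - ln (2 * s)" using s by (subst ln_div) simp_all
  ultimately have "Ln ((1 + hq s / of_real s) / 2) = of_real (- ln (2 * s)) + Ln ?z" by (simp only:)
  then show "hrem s = Ln ((1 + hq s / of_real s) / 2)"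
    by (simp add: hrem_def hL_def del: ln_mult_pos)
qed

lemma hrem_tendsto: "(hrem \<longlongrightarrow> 0) at_top"
proof -
  have "((\<lambda>s. hq s / of_real s - 1) \<longlongrightarrow> 0) at_top"
  proof (rule Lim_null_comparison)
    show "((\<lambda>s::real. 2 / s\<^sup>2) \<longlongrightarrow> 0) at_top" by real_asymp
    show "\<forall>\<^sub>F s in at_top. norm (hq s / of_real s - 1) \<le> 2 / s\<^sup>2"
    proof (rule eventually_mono[OF eventually_gt_at_top[of "0::real"]])
      fix s :: real assume s: "s > 0"
      have "(hq s - of_real s) * (hq s + of_real s) = - 2 * \<i>"
        using hq_square[of s] by (simp add: algebra_simps power2_eq_square)
      then have "norm (hq s - of_real s) * norm (hq s + of_real s) = 2" by (simp flip: norm_mult)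
      moreover have "s \<le> norm (hq s + of_real s)"
        using hq_ge(1)[of s] s complex_Re_le_cmod[of "hq s + of_real s"] by simp
      ultimately have "norm (hq s - of_real s) * s \<le> 2"
        using mult_left_mono[of s "norm (hq s + of_real s)" "norm (hq s - of_real s)"] by simp
      moreover have "hq s / of_real s - 1 = (hq s - of_real s) / of_real s" using s by (simp add: field_simps)
      ultimately show "norm (hq s / of_real s - 1) \<le> 2 / s\<^sup>2" using s
        by (simp add: norm_divide field_simps power2_eq_square)
    qed
  qed
  from tendsto_divide[OF tendsto_add[OF tendsto_add[OF this tendsto_const[of 1]] tendsto_const[of 1]] tendsto_const[of 2]]
  have "((\<lambda>s. (1 + hq s / of_real s) / 2) \<longlongrightarrow> 1) at_top" by (simp add: algebra_simps)
  then have "((\<lambda>s. Ln ((1 + hq s / of_real s) / 2)) \<longlongrightarrow> Ln 1) at_top"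
    by (rule tendsto_Ln) simp
  then have "((\<lambda>s. Ln ((1 + hq s / of_real s) / 2)) \<longlongrightarrow> 0) at_top" by simp
  then show ?thesis
    by (rule Lim_transform_eventually)
       (use hrem_estimates(2) in \<open>auto intro: eventually_mono[OF eventually_gt_at_top[of "0::real"]]\<close>)
qed

text \<open>Dominated convergence. With T = 1 / sqrt x this is the remainder of \<open>hV\<close>
  after rescaling, so T at infinity describes x at 0.\<close>

lemma tendsto_hrem_integral:
  "((\<lambda>T. LINT y|lborel. indicator {0<..} y *\<^sub>R (of_real (2 * y * exp (- y\<^sup>2)) * hrem (y * T))) \<longlongrightarrow> 0) at_top"
proof -
  have m [measurable]: "hrem \<in> borel_measurable borel" unfolding hrem_def[abs_def] hL_def by measurable
  have i: "integrable lborel (\<lambda>y::real. 2 * exp (- 1 * y\<^sup>2) * y ^ 0 + 2 * pi * (exp (- 1 * y\<^sup>2) * y ^ 0 + exp (- 1 * y\<^sup>2) * y ^ 2))"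
    using gauss_moment_integrable[of 1 0] gauss_moment_integrable[of 1 2]
    by (intro integrable_mult_right Bochner_Integration.integrable_add) (auto simp: mult.assoc)
  have "((\<lambda>T. LINT y|lborel. indicator {0<..} y *\<^sub>R (of_real (2 * y * exp (- y\<^sup>2)) * hrem (y * T))) \<longlongrightarrow> (LINT y::real|lborel. 0)) at_top"
  proof (rule integral_dominated_convergence_at_top[OF _ _ i])
    have "((\<lambda>T. indicator {0<..} y *\<^sub>R (of_real (2 * y * exp (- y\<^sup>2)) * hrem (y * T))) \<longlongrightarrow> 0) at_top" for y :: real
    proof (cases "y > 0")
      case True
      then have "filterlim (\<lambda>T. y * T) at_top at_top"
        by (intro filterlim_tendsto_pos_mult_at_top[OF tendsto_const] filterlim_ident)
      from filterlim_compose[OF hrem_tendsto this] show ?thesis using True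
        by (auto intro!: tendsto_mult_right_zero)
    qed simp
    then show "AE y in lborel. ((\<lambda>T. indicator {0<..} y *\<^sub>R (of_real (2 * y * exp (- y\<^sup>2)) * hrem (y * T))) \<longlongrightarrow> 0) at_top"
      by simp
    have "norm (indicator {0<..} y *\<^sub>R (of_real (2 * y * exp (- y\<^sup>2)) * hrem (y * T)))
        \<le> 2 * exp (- 1 * y\<^sup>2) * y ^ 0 + 2 * pi * (exp (- 1 * y\<^sup>2) * y ^ 0 + exp (- 1 * y\<^sup>2) * y ^ 2)" if T: "T \<ge> 1" for T y :: real
    proof (cases "y > 0")
      case True
      have "norm (hrem (y * T)) \<le> 1 / (y * T) + pi" using True T by (intro hrem_estimates(1)) simp
      also have "1 / (y * T) \<le> 1 / y" using True T by (simp add: field_simps)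
      finally have "2 * exp (- y\<^sup>2) * (y * norm (hrem (y * T))) \<le> 2 * exp (- y\<^sup>2) * (y * (1 / y + pi))"
        using True by (intro mult_left_mono) auto
      also have "y * (1 / y + pi) = 1 + y * pi" using True by (simp add: field_simps)
      also have "2 * exp (- y\<^sup>2) * (1 + y * pi) \<le> 2 * exp (- y\<^sup>2) * (1 + (1 + y\<^sup>2) * pi)"
      proof (intro mult_left_mono add_mono mult_right_mono)
        have "0 \<le> (y - 1)\<^sup>2" by simp
        then show "y \<le> 1 + y\<^sup>2" using True by (simp add: power2_diff)
      qed auto
      finally show ?thesis using True by (simp add: norm_mult algebra_simps)
    qed (simp add: add_nonneg_nonneg)
    then show "\<forall>\<^sub>F T in at_top. AE y in lborel. norm (indicator {0<..} y *\<^sub>R (of_real (2 * y * exp (- y\<^sup>2)) * hrem (y * T)))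
        \<le> 2 * exp (- 1 * y\<^sup>2) * y ^ 0 + 2 * pi * (exp (- 1 * y\<^sup>2) * y ^ 0 + exp (- 1 * y\<^sup>2) * y ^ 2)"
      by (auto intro!: eventually_mono[OF eventually_ge_at_top[of "1::real"]])
  qed measurable
  then show ?thesis by simp
qed

text \<open>Integration by parts turns \<open>hV\<close> into the integral of 2 x s exp (- x s^2) hL
  s minus hL 0. After s = y / sqrt x, \<open>hL\<close> splits into ln (2 / sqrt x), ln y and
  \<open>hrem\<close>; the first two integrals are known, and - hL 0 supplies the imaginary part
  \<pi>/4.\<close>

lemma hV_eq_hrem_integral:
  assumes x: "x > 0"
  shows "integrable lborel (\<lambda>y. indicator {0<..} y *\<^sub>R (of_real (2 * y * exp (- y\<^sup>2)) * hrem (y * (1 / sqrt x))))"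
    and "2 * hV x + of_real (ln x) = of_real (ln 2 - euler_mascheroni) + \<i> * of_real (pi / 2)
      + 2 * (LINT y|lborel. indicator {0<..} y *\<^sub>R (of_real (2 * y * exp (- y\<^sup>2)) * hrem (y * (1 / sqrt x))))"
proof -
  have m [measurable]: "hrem \<in> borel_measurable borel" "hL \<in> borel_measurable borel"
    unfolding hrem_def[abs_def] hL_def[abs_def] by measurable
  define G where "G = (\<lambda>y. indicator {0<..} y *\<^sub>R (of_real (2 * y * exp (- y\<^sup>2)) * hrem (y * (1 / sqrt x))))"
  define E where "E = (\<lambda>y::real. complex_of_real (indicator {0<..} y *\<^sub>R (2 * y * exp (- y\<^sup>2))))"
  define El where "El = (\<lambda>y::real. complex_of_real (indicator {0<..} y *\<^sub>R (2 * y * exp (- y\<^sup>2) * ln y)))"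
  have iE0: "integrable lborel (\<lambda>y::real. indicator {0<..} y *\<^sub>R (2 * y * exp (- y\<^sup>2)))"
    using powr_times_exp_integrable[of 0]
    by (rule Bochner_Integration.integrable_cong[THEN iffD1, rotated 2]) (auto simp: indicator_def)
  have iE: "integrable lborel E" unfolding E_def by (rule integrable_of_real[OF iE0])
  have vE: "(LINT y|lborel. E y) = 1"
  proof -
    have "(LINT y|lborel. indicator {0<..} y *\<^sub>R (2 * y * exp (- y\<^sup>2))) =
        (LINT y|lborel. indicator {0<..} y *\<^sub>R (2 * y * exp (- y\<^sup>2) * (y\<^sup>2) powr (0::real)))"
      by (rule Bochner_Integration.integral_cong) (auto simp: indicator_def)
    then have "(LINT y|lborel. indicator {0<..} y *\<^sub>R (2 * y * exp (- y\<^sup>2))) = (1::real)"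
      using Gamma_gauss_integral[of 0 1] powr_times_exp_integrable[of 0] by simp
    then show ?thesis unfolding E_def integral_complex_of_real by simp
  qed
  have iEl: "integrable lborel El" unfolding El_def by (rule integrable_of_real[OF gauss_log_integrable])
  have vEl: "(LINT y|lborel. El y) = of_real (- euler_mascheroni / 2)"
    unfolding El_def integral_complex_of_real gauss_log_integral ..
  have iG: "integrable lborel G"
  proof (rule Bochner_Integration.integrable_bound)
    show "integrable lborel (\<lambda>y::real. 2 * sqrt x * (exp (- 1 * y\<^sup>2) * y ^ 0) + pi * (indicator {0<..} y *\<^sub>R (2 * y * exp (- y\<^sup>2))))"
      by (intro integrable_mult_right Bochner_Integration.integrable_add gauss_moment_integrable iE0) auto
    have "norm (G y) \<le> norm (2 * sqrt x * (exp (- 1 * y\<^sup>2) * y ^ 0) + pi * (indicator {0<..} y *\<^sub>R (2 * y * exp (- y\<^sup>2))))" for y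
    proof (cases "y > 0")
      case True
      have "norm (hrem (y * (1 / sqrt x))) \<le> 1 / (y * (1 / sqrt x)) + pi" using True x by (intro hrem_estimates(1)) simp
      also have "1 / (y * (1 / sqrt x)) = sqrt x / y" using x by simp
      finally have "2 * exp (- y\<^sup>2) * (y * norm (hrem (y * (1 / sqrt x)))) \<le> 2 * exp (- y\<^sup>2) * (y * (sqrt x / y + pi))"
        using True by (intro mult_left_mono) auto
      also have "\<dots> = 2 * sqrt x * exp (- y\<^sup>2) + pi * (2 * y * exp (- y\<^sup>2))" using True by (simp add: field_simps)
      finally show ?thesis using True x unfolding G_def by (simp add: norm_mult algebra_simps)
    qed (simp add: G_def)
    then show "AE y in lborel. norm (G y) \<le> norm (2 * sqrt x * (exp (- 1 * y\<^sup>2) * y ^ 0) + pi * (indicator {0<..} y *\<^sub>R (2 * y * exp (- y\<^sup>2))))"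
      by simp
  qed (simp add: G_def)
  then show "integrable lborel (\<lambda>y. indicator {0<..} y *\<^sub>R (of_real (2 * y * exp (- y\<^sup>2)) * hrem (y * (1 / sqrt x))))"
    by (simp add: G_def)
  define c where "c = 1 / sqrt x"
  have c: "c > 0" "x * c\<^sup>2 = 1" using x by (auto simp: c_def power_divide)
  define P where "P = (\<lambda>s. indicator {0<..} s *\<^sub>R (of_real (2 * x * s * exp (- x * s\<^sup>2)) * hL s))"
  have P: "of_real c * P (0 + c * y) = of_real (ln (2 * c)) * E y + El y + G y" for y
  proof (cases "y > 0")
    case True
    have "hL (c * y) = of_real (ln (2 * c)) + of_real (ln y) + hrem (y * c)"
      using True c by (simp add: hrem_def ln_mult mult_ac flip: of_real_add)
    moreover have "x * (c * y)\<^sup>2 = y\<^sup>2" using c by (simp add: power_mult_distrib flip: mult.assoc)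
    moreover have "c * (2 * x * (c * y) * exp (- y\<^sup>2)) = 2 * y * exp (- y\<^sup>2)"
      using c(2) by (simp add: power2_eq_square mult_ac)
    ultimately have "of_real c * (of_real (2 * x * (c * y) * exp (- x * (c * y)\<^sup>2)) * hL (c * y))
        = of_real (2 * y * exp (- y\<^sup>2)) * (of_real (ln (2 * c)) + of_real (ln y) + hrem (y * c))"
      by (simp only: mult_minus_left flip: of_real_mult mult.assoc)
    then show ?thesis using True c(1) unfolding P_def E_def El_def G_def c_def[symmetric]
      by (simp add: algebra_simps)
  qed (use c in \<open>simp add: P_def E_def El_def G_def zero_less_mult_iff\<close>)
  have iR: "integrable lborel (\<lambda>y. of_real (ln (2 * c)) * E y + El y + G y)"
    by (intro Bochner_Integration.integrable_add integrable_mult_right iE iEl iG)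
  then have "integrable lborel (\<lambda>y. of_real c * P (0 + c * y))" unfolding P .
  from integrable_mult_right[OF this, of "inverse (of_real c)"]
  have "integrable lborel (\<lambda>y. P (0 + c * y))" using c by (simp flip: mult.assoc)
  then have iP: "integrable lborel P" using c lborel_integrable_real_affine_iff[of c P 0] by simp
  have "(LINT s|lborel. P s) = c *\<^sub>R (LINT y|lborel. P (0 + c * y))"
    using lborel_integral_real_affine[of c P 0] c by simp
  also have "\<dots> = (LINT y|lborel. of_real c * P (0 + c * y))" by (simp add: scaleR_conv_of_real)
  also have "\<dots> = of_real (ln (2 * c)) * 1 + of_real (- euler_mascheroni / 2) + (LINT y|lborel. G y)"
    unfolding P vE[symmetric] vEl[symmetric]
    using iE iEl iG by (simp add: Bochner_Integration.integral_add integrable_mult_right)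
  finally have vP: "(LINT s|lborel. P s) = of_real (ln (2 * c)) + of_real (- euler_mascheroni / 2) + (LINT y|lborel. G y)"
    by simp
  define F where "F = (\<lambda>s. of_real (exp (- x * s\<^sup>2)) * hL s)"
  define f where "f = (\<lambda>s. of_real (exp (- x * s\<^sup>2)) * (1 / hq s) + of_real (- 2 * x * s * exp (- x * s\<^sup>2)) * hL s)"
  have F: "(F has_vector_derivative f s) (at s)" if "s \<ge> 0" for s
  proof -
    have "((\<lambda>s. exp (- x * s\<^sup>2)) has_real_derivative - 2 * x * s * exp (- x * s\<^sup>2)) (at s)"
      by (auto intro!: derivative_eq_intros)
    then have "((\<lambda>s. complex_of_real (exp (- x * s\<^sup>2))) has_vector_derivative of_real (- 2 * x * s * exp (- x * s\<^sup>2))) (at s)"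
      by (intro has_vector_derivative_of_real) (simp add: has_real_derivative_iff_has_vector_derivative)
    from has_vector_derivative_mult[OF this hL_deriv[OF that]] show ?thesis unfolding F_def f_def .
  qed
  have fc: "isCont f s" if "s > 0" for s
  proof -
    have "isCont hL s" using hL_deriv[of s] that has_vector_derivative_continuous by force
    then show ?thesis unfolding f_def by (intro continuous_intros hq_isCont) auto
  qed
  have feq: "indicator {0<..} s *\<^sub>R f s = exp (- x * s\<^sup>2) *\<^sub>R hg s - P s" for s
    by (simp add: f_def P_def hg_def indicator_def scaleR_conv_of_real)
  have ih: "integrable lborel (\<lambda>s. exp (- x * s\<^sup>2) *\<^sub>R hg s)" using hg_integrable(1)[OF x, of 0] by simp
  have "(LINT s|lborel. indicator {0<..} s *\<^sub>R f s) = 0 - hL 0"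
  proof (rule FTC_half_line[OF F fc])
    show "integrable lborel (\<lambda>s. indicator {0<..} s *\<^sub>R f s)"
      unfolding feq by (intro Bochner_Integration.integrable_diff ih iP)
    have "isCont F 0" using F[of 0] has_vector_derivative_continuous by force
    then have "(F \<longlongrightarrow> F 0) (at_right 0)" unfolding isCont_def by (rule tendsto_mono[rotated]) (simp add: at_le)
    then show "(F \<longlongrightarrow> hL 0) (at_right 0)" by (simp add: F_def)
    show "(F \<longlongrightarrow> 0) at_top"
    proof (rule Lim_null_comparison)
      show "((\<lambda>s. exp (- x * s\<^sup>2) * (1 / s + pi + \<bar>ln (2 * s)\<bar>)) \<longlongrightarrow> 0) at_top"
        using x by real_asymp
      have "norm (F s) \<le> exp (- x * s\<^sup>2) * (1 / s + pi + \<bar>ln (2 * s)\<bar>)" if s: "s > 0" for s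
      proof -
        have "hL s = hrem s + of_real (ln (2 * s))" by (simp add: hrem_def)
        then have "norm (hL s) \<le> norm (hrem s) + \<bar>ln (2 * s)\<bar>"
          using norm_triangle_ineq[of "hrem s" "of_real (ln (2 * s))"] by simp
        then show ?thesis using hrem_estimates(1)[OF s] by (auto simp: F_def norm_mult intro!: mult_left_mono)
      qed
      then show "\<forall>\<^sub>F s in at_top. norm (F s) \<le> exp (- x * s\<^sup>2) * (1 / s + pi + \<bar>ln (2 * s)\<bar>)"
        by (auto intro: eventually_mono[OF eventually_gt_at_top[of "0::real"]])
    qed
  qed auto
  then have hV: "hV x = (LINT s|lborel. P s) - hL 0"
    unfolding feq Bochner_Integration.integral_diff[OF ih iP] hV_def by (simp add: algebra_simps)
  have "ln (2 * c) = ln 2 - ln x / 2" using x by (simp add: c_def ln_div ln_sqrt)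
  then have hv: "hV x = of_real (ln 2 - ln x / 2) + of_real (- euler_mascheroni / 2) + (LINT y|lborel. G y)
      - (of_real (ln 2 / 2) - \<i> * of_real (pi / 4))"
    unfolding hV vP hL_0 by simp
  show "2 * hV x + of_real (ln x) = of_real (ln 2 - euler_mascheroni) + \<i> * of_real (pi / 2)
      + 2 * (LINT y|lborel. indicator {0<..} y *\<^sub>R (of_real (2 * y * exp (- y\<^sup>2)) * hrem (y * (1 / sqrt x))))"
    unfolding G_def[symmetric] hv by (simp add: field_simps)
qed

text \<open>Passing from \<open>hV\<close> to exp (\<i> x) hV costs the term (1 - exp (\<i> x)) ln
  x, which tends to 0.\<close>

lemma tendsto_hV_0:
  "((\<lambda>x. 2 * exp (\<i> * of_real x) * hV x + of_real (ln x)) \<longlongrightarrow> of_real (ln 2 - euler_mascheroni) + \<i> * of_real (pi / 2)) (at_right 0)"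
proof -
  let ?c = "of_real (ln 2 - euler_mascheroni) + \<i> * of_real (pi / 2)"
  let ?I = "\<lambda>T. LINT y|lborel. indicator {0<..} y *\<^sub>R (of_real (2 * y * exp (- y\<^sup>2)) * hrem (y * T))"
  have "filterlim (\<lambda>x::real. 1 / sqrt x) at_top (at_right 0)" by real_asymp
  from filterlim_compose[OF tendsto_hrem_integral this]
  have "((\<lambda>x. ?c + 2 * ?I (1 / sqrt x)) \<longlongrightarrow> ?c + 2 * 0) (at_right 0)" by (intro tendsto_intros)
  then have "((\<lambda>x. ?c + 2 * ?I (1 / sqrt x)) \<longlongrightarrow> ?c) (at_right 0)" by simp
  then have V: "((\<lambda>x. 2 * hV x + of_real (ln x)) \<longlongrightarrow> ?c) (at_right 0)"
    by (rule Lim_transform_eventually)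
       (auto simp: eventually_at_filter hV_eq_hrem_integral(2) simp del: of_real_diff of_real_divide)
  have "isCont (\<lambda>x. exp (\<i> * complex_of_real x)) 0" by (intro continuous_intros)
  then have e: "((\<lambda>x. exp (\<i> * complex_of_real x)) \<longlongrightarrow> 1) (at_right 0)"
    unfolding isCont_def using tendsto_mono[OF at_le[of "{0<..}" UNIV "0::real"]] by fastforce
  have r: "((\<lambda>x. (1 - exp (\<i> * complex_of_real x)) * of_real (ln x)) \<longlongrightarrow> 0) (at_right 0)"
  proof (rule Lim_null_comparison)
    show "((\<lambda>x::real. x * \<bar>ln x\<bar>) \<longlongrightarrow> 0) (at_right 0)" by real_asymp
    have "norm (1 - exp (\<i> * complex_of_real x)) \<le> x" if "x > 0" for x
      using dist_exp_i_1[of x] abs_sin_x_le_abs_x[of "x / 2"] that by (simp add: norm_minus_commute)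
    then have "norm ((1 - exp (\<i> * complex_of_real x)) * of_real (ln x)) \<le> x * \<bar>ln x\<bar>" if "x > 0" for x
      using that by (simp add: norm_mult mult_right_mono)
    then show "\<forall>\<^sub>F x in at_right 0. norm ((1 - exp (\<i> * complex_of_real x)) * of_real (ln x)) \<le> x * \<bar>ln x\<bar>"
      by (auto simp: eventually_at_filter)
  qed
  have "((\<lambda>x. exp (\<i> * of_real x) * (2 * hV x + of_real (ln x)) + (1 - exp (\<i> * complex_of_real x)) * of_real (ln x)) \<longlongrightarrow> 1 * ?c + 0) (at_right 0)"
    by (intro tendsto_intros V e r)
  then show ?thesis by (simp add: algebra_simps)
qed

text \<open>Cramer's rule: the Wronskians of (f, g) with J and with Y are constants, and that of J
  with Y is not 0.\<close>

lemma ladder_0_span: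
  assumes "ladder 0 f g"
  obtains \<alpha> \<beta> where "\<And>x. x > 0 \<Longrightarrow> f x = \<alpha> * bessel_J 0 x + \<beta> * bessel_Y 0 x"
    "\<And>x. x > 0 \<Longrightarrow> g x = \<alpha> * bessel_J 1 x + \<beta> * bessel_Y 1 x"
proof -
  have J: "ladder 0 (bessel_J 0) (bessel_J 1)" and Y: "ladder 0 (bessel_Y 0) (bessel_Y 1)"
    using ladder_bessel_J[of 0] ladder_bessel_Y[of 1] by simp_all
  obtain w where w: "w > 0" "\<And>x. x > 0 \<Longrightarrow> x * (bessel_J 1 x * bessel_Y 0 x - bessel_J 0 x * bessel_Y 1 x) = w"
    using wronskian_JY[of 1] by auto
  obtain a where a: "\<And>x. x > 0 \<Longrightarrow> x * (g x * bessel_J 0 x - f x * bessel_J 1 x) = a"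
    by (rule ladder_wronskian[OF assms J]) blast
  obtain b where b: "\<And>x. x > 0 \<Longrightarrow> x * (g x * bessel_Y 0 x - f x * bessel_Y 1 x) = b"
    by (rule ladder_wronskian[OF assms Y]) blast
  show ?thesis
  proof (rule that[of "b / w" "- a / w"])
    fix x :: real assume x: "x > 0"
    have "f x * w = b * bessel_J 0 x - a * bessel_Y 0 x" "g x * w = b * bessel_J 1 x - a * bessel_Y 1 x"
      unfolding w(2)[OF x, symmetric] a[OF x, symmetric] b[OF x, symmetric] by (simp_all add: algebra_simps)
    then show "f x = b / w * bessel_J 0 x + - a / w * bessel_Y 0 x" "g x = b / w * bessel_J 1 x + - a / w * bessel_Y 1 x"
      using w(1) by (simp_all add: field_simps)
  qed
qed

text \<open>At 0 the functions J and Y of order 0 behave like 1 and (2/\<pi>) (ln (x / 2) +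
  \<gamma>). Since ln is unbounded, its coefficients must agree, which gives \<beta>; the constant
  terms then give \<alpha>.\<close>

lemma ladder_0_coefficients:
  assumes f: "\<And>x. x > 0 \<Longrightarrow> f x = \<alpha> * bessel_J 0 x + \<beta> * bessel_Y 0 x"
    and lim: "((\<lambda>x. f x + c * ln x) \<longlongrightarrow> d) (at_right 0)"
  shows "\<beta> = - pi / 2 * c" "\<alpha> = d - c * (ln 2 - euler_mascheroni)"
proof -
  let ?k = "\<beta> * 2 / pi + c"
  have Y0: "bessel_Y 0 x = 2 / pi * dbessel_J 0 x" if "x > 0" for x
    using bessel_Y_nat[OF that, of 0] by simp
  have A: "((\<lambda>x. f x + c * ln x - \<alpha> * bessel_ser 0 (x\<^sup>2 / 4) - \<beta> * (2 / pi) * (dbessel_J 0 x - ln (x / 2))) \<longlongrightarrow>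
      d - \<alpha> * rGamma (0 + 1) - \<beta> * (2 / pi) * euler_mascheroni) (at_right 0)"
    by (intro tendsto_intros lim tendsto_bessel_ser_square tendsto_dbessel_J_0)
  have "((\<lambda>x. ?k * ln x - \<beta> * (2 / pi) * ln 2) \<longlongrightarrow> d - \<alpha> * rGamma (0 + 1) - \<beta> * (2 / pi) * euler_mascheroni) (at_right 0)"
  proof (rule Lim_transform_eventually[OF A])
    have "f x + c * ln x - \<alpha> * bessel_ser 0 (x\<^sup>2 / 4) - \<beta> * (2 / pi) * (dbessel_J 0 x - ln (x / 2))
        = ?k * ln x - \<beta> * (2 / pi) * ln 2" if x: "x > 0" for x
      using x by (simp add: f Y0 bessel_J_eq ln_div algebra_simps diff_divide_distrib)
    then show "\<forall>\<^sub>F x in at_right 0. f x + c * ln x - \<alpha> * bessel_ser 0 (x\<^sup>2 / 4) - \<beta> * (2 / pi) * (dbessel_J 0 x - ln (x / 2))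
        = ?k * ln x - \<beta> * (2 / pi) * ln 2"
      by (auto simp: eventually_at_filter)
  qed
  then have L: "((\<lambda>x. ?k * ln x - \<beta> * (2 / pi) * ln 2) \<longlongrightarrow> d - \<alpha> - \<beta> * (2 / pi) * euler_mascheroni) (at_right 0)"
    by (simp only: add_0 rGamma_1 mult_1_right)
  have "((\<lambda>x. (?k * ln x - \<beta> * (2 / pi) * ln 2) + \<beta> * (2 / pi) * ln 2) \<longlongrightarrow> d - \<alpha> - \<beta> * (2 / pi) * euler_mascheroni + \<beta> * (2 / pi) * ln 2) (at_right 0)"
    by (rule tendsto_add[OF L tendsto_const])
  then have L2: "((\<lambda>x. ?k * ln x) \<longlongrightarrow> d - \<alpha> - \<beta> * (2 / pi) * euler_mascheroni + \<beta> * (2 / pi) * ln 2) (at_right 0)"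
    by simp
  have "((\<lambda>x::real. 1 / ln x) \<longlongrightarrow> 0) (at_right 0)" by real_asymp
  from tendsto_mult[OF L2 this] have "((\<lambda>x. ?k * ln x * (1 / ln x)) \<longlongrightarrow> 0) (at_right 0)" by simp
  moreover have "\<forall>\<^sub>F x in at_right 0. ?k * ln x * (1 / ln x) = ?k"
    by (rule eventually_at_rightI[of 0 1]) auto
  ultimately have "((\<lambda>x::real. ?k) \<longlongrightarrow> 0) (at_right 0)" by (rule Lim_transform_eventually)
  then have k: "?k = 0" by (rule tendsto_unique[OF trivial_limit_at_right_real tendsto_const])
  then show b: "\<beta> = - pi / 2 * c" by (simp add: field_simps)
  have "((\<lambda>x::real. 0) \<longlongrightarrow> d - \<alpha> - \<beta> * (2 / pi) * euler_mascheroni + \<beta> * (2 / pi) * ln 2) (at_right (0::real))"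
    using L2 unfolding k by simp
  then have "0 = d - \<alpha> - \<beta> * (2 / pi) * euler_mascheroni + \<beta> * (2 / pi) * ln 2"
    by (rule tendsto_unique[OF trivial_limit_at_right_real tendsto_const])
  then show "\<alpha> = d - c * (ln 2 - euler_mascheroni)" unfolding b by (simp add: field_simps)
qed

text \<open>The behaviour at 0 identifies exp (\<i> x) hV1 with (\<pi>/4) (- Y_1 + \<i> J_1). The
  exponential has modulus 1, so the amplitude is a multiple of the squared modulus of
  \<open>hV1\<close>.\<close>

lemma cm_amplitude_1: "cm n (\<lambda>x. (bessel_J 1 x)\<^sup>2 + (bessel_Y 1 x)\<^sup>2)"
proof -
  obtain \<alpha> \<beta> where R: "\<And>x. x > 0 \<Longrightarrow> Re (exp (\<i> * of_real x) * hV x) = \<alpha> * bessel_J 0 x + \<beta> * bessel_Y 0 x"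
    "\<And>x. x > 0 \<Longrightarrow> Re (exp (\<i> * of_real x) * hV1 x) = \<alpha> * bessel_J 1 x + \<beta> * bessel_Y 1 x"
    by (rule ladder_0_span[OF ladder_hV(1)]) blast
  obtain \<alpha>' \<beta>' where I: "\<And>x. x > 0 \<Longrightarrow> Im (exp (\<i> * of_real x) * hV x) = \<alpha>' * bessel_J 0 x + \<beta>' * bessel_Y 0 x"
    "\<And>x. x > 0 \<Longrightarrow> Im (exp (\<i> * of_real x) * hV1 x) = \<alpha>' * bessel_J 1 x + \<beta>' * bessel_Y 1 x"
    by (rule ladder_0_span[OF ladder_hV(2)]) blast
  have re_im: "Re (2 * e * v + of_real l) / 2 = Re (e * v) + 1 / 2 * l" "Im (2 * e * v + of_real l) / 2 = Im (e * v) + 0 * l"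
    for e v :: complex and l :: real by simp_all
  have "((\<lambda>x. Re (2 * exp (\<i> * of_real x) * hV x + of_real (ln x)) / 2) \<longlongrightarrow> (ln 2 - euler_mascheroni) / 2) (at_right 0)"
    using tendsto_Re[OF tendsto_hV_0]
    by (intro tendsto_divide tendsto_const) (auto simp del: of_real_euler_mascheroni)
  then have "((\<lambda>x. Re (exp (\<i> * of_real x) * hV x) + 1 / 2 * ln x) \<longlongrightarrow> (ln 2 - euler_mascheroni) / 2) (at_right 0)"
    unfolding re_im .
  note r = ladder_0_coefficients[OF R(1) this]
  have "((\<lambda>x. Im (2 * exp (\<i> * of_real x) * hV x + of_real (ln x)) / 2) \<longlongrightarrow> pi / 2 / 2) (at_right 0)"
    using tendsto_Im[OF tendsto_hV_0]
    by (intro tendsto_divide tendsto_const) (auto simp del: of_real_euler_mascheroni)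
  then have "((\<lambda>x. Im (exp (\<i> * of_real x) * hV x) + 0 * ln x) \<longlongrightarrow> pi / 4) (at_right 0)"
    unfolding re_im by simp
  note i = ladder_0_coefficients[OF I(1) this]
  have r': "\<beta> = - pi / 4" "\<alpha> = 0" and i': "\<beta>' = 0" "\<alpha>' = pi / 4" using r i by simp_all
  have eq: "16 / pi\<^sup>2 * (Re (hV1 x) * Re (hV1 x) + - Im (hV1 x) * - Im (hV1 x)) = (bessel_J 1 x)\<^sup>2 + (bessel_Y 1 x)\<^sup>2"
    if x: "x > 0" for x
  proof -
    have "(norm (exp (\<i> * of_real x) * hV1 x))\<^sup>2 = (pi / 4)\<^sup>2 * ((bessel_J 1 x)\<^sup>2 + (bessel_Y 1 x)\<^sup>2)"
      unfolding cmod_power2 R(2)[OF x] I(2)[OF x] r' i' by (simp add: power2_eq_square algebra_simps)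
    moreover have "(norm (exp (\<i> * of_real x) * hV1 x))\<^sup>2 = Re (hV1 x) * Re (hV1 x) + - Im (hV1 x) * - Im (hV1 x)"
      unfolding norm_mult norm_exp_i_times mult_1 cmod_power2 by (simp add: power2_eq_square)
    ultimately have S: "Re (hV1 x) * Re (hV1 x) + - Im (hV1 x) * - Im (hV1 x)
        = (pi / 4)\<^sup>2 * ((bessel_J 1 x)\<^sup>2 + (bessel_Y 1 x)\<^sup>2)" by (simp only:)
    show ?thesis unfolding S by (simp add: power_divide)
  qed
  have "cm n (\<lambda>x. 16 / pi\<^sup>2 * (Re (hV1 x) * Re (hV1 x) + - Im (hV1 x) * - Im (hV1 x)))"
    by (intro cm_cmult cm_add cm_mult cm_hV1) auto
  then show ?thesis by (rule cm_cong) (rule eq)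
qed

text \<open>At order 1/2 the amplitude is w / x by the Wronskian. The step from \<nu> requires \<nu>
  \<ge> 1/2, so order 1 cannot come from order 0 and enters as a second base case.\<close>

lemma cm_amplitude:
  assumes "n \<ge> 1" shows "cm m (\<lambda>x. (bessel_J (real n / 2) x)\<^sup>2 + (bessel_Y (real n / 2) x)\<^sup>2)"
  using assms
proof (induction n arbitrary: m rule: induct_nat_012)
  case 1
  obtain w where w: "w > 0" "\<And>x. x > 0 \<Longrightarrow> x * (bessel_J (1 / 2) x * bessel_Y (- (1 / 2)) x - bessel_J (- (1 / 2)) x * bessel_Y (1 / 2) x) = w"
    using wronskian_JY[of 0] by auto
  have Y: "bessel_Y (- (1 / 2)) = bessel_J (1 / 2)" "bessel_Y (1 / 2) = (\<lambda>x. - bessel_J (- (1 / 2)) x)"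
    using bessel_Y_half[of 0] bessel_Y_half[of 1] by auto
  have "w / x ^ 1 = (bessel_J (real (Suc 0) / 2) x)\<^sup>2 + (bessel_Y (real (Suc 0) / 2) x)\<^sup>2" if "x > 0" for x
    using w(2)[OF that] that by (simp add: Y power2_eq_square field_simps)
  then show ?case using cm_power_inverse[of w m 1] w(1) by (auto elim: cm_cong)
next
  case (ge2 n)
  have e: "real (Suc (Suc n)) / 2 = real n / 2 + 1" by simp
  show ?case
  proof (cases "n = 0")
    case True then show ?thesis using cm_amplitude_1 by simp
  next
    case False
    show ?thesis unfolding e
      by (rule cm_ladder_step[OF ladder_bessel_J ladder_bessel_Y']) (use False ge2 in auto)
  qed
qed auto

lemma amplitude_decreasing:
  assumes "n \<ge> 1" "0 < a" "a \<le> b"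
  defines "\<nu> \<equiv> real n / 2"
  shows "b powr (- 2 * \<nu>) * ((bessel_J \<nu> b)\<^sup>2 + (bessel_Y \<nu> b)\<^sup>2) \<le> a powr (- 2 * \<nu>) * ((bessel_J \<nu> a)\<^sup>2 + (bessel_Y \<nu> a)\<^sup>2)"
proof (rule mult_mono)
  show "b powr (- 2 * \<nu>) \<le> a powr (- 2 * \<nu>)" using assms by (intro powr_mono2') (auto simp: \<nu>_def)
  obtain g where g: "cm 0 g" "\<And>x. x > 0 \<Longrightarrow> ((\<lambda>x. (bessel_J \<nu> x)\<^sup>2 + (bessel_Y \<nu> x)\<^sup>2) has_real_derivative - g x) (at x)"
    using cm_SucE[OF cm_amplitude[OF assms(1), of "Suc 0"]] unfolding \<nu>_def by blast
  show "(bessel_J \<nu> b)\<^sup>2 + (bessel_Y \<nu> b)\<^sup>2 \<le> (bessel_J \<nu> a)\<^sup>2 + (bessel_Y \<nu> a)\<^sup>2"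
  proof (rule DERIV_nonpos_imp_nonincreasing[OF assms(3)])
    fix x assume "a \<le> x" "x \<le> b"
    then have "x > 0" using assms by simp
    then show "\<exists>y. ((\<lambda>x. (bessel_J \<nu> x)\<^sup>2 + (bessel_Y \<nu> x)\<^sup>2) has_real_derivative y) (at x) \<and> y \<le> 0"
      using g by (intro exI[of _ "- g x"]) auto
  qed
qed auto

lemma bessel_ser_after_first_zero:
  assumes n: "n \<ge> 1"
  defines "\<nu> \<equiv> real n / 2"
  defines "z \<equiv> first_zero_bessel_Y \<nu>"
  assumes t: "z \<le> t"
  shows "bessel_ser \<nu> (t\<^sup>2 / 4) \<le> bessel_ser \<nu> (z\<^sup>2 / 4)"
proof -
  have z: "z > 0" "bessel_Y \<nu> z = 0" using first_zero_bessel_Y(1,2)[OF n] by (simp_all add: z_def \<nu>_def)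
  have S: "(bessel_ser \<nu> (x\<^sup>2 / 4))\<^sup>2 = 4 powr \<nu> * (x powr (- 2 * \<nu>) * (bessel_J \<nu> x)\<^sup>2)" if "x > 0" for x
  proof -
    have "((x / 2) powr - \<nu>)\<^sup>2 = (x / 2) powr (- 2 * \<nu>)"
      using that by (simp add: power2_eq_square flip: powr_add)
    also have "\<dots> = 2 powr (2 * \<nu>) * x powr (- 2 * \<nu>)"
      using that by (simp add: powr_divide powr_minus field_simps)
    also have "2 powr (2 * \<nu>) = 4 powr \<nu>" by (simp flip: powr_powr)
    finally show ?thesis unfolding bessel_ser_eq_J[OF that] power_mult_distrib by simp
  qed
  have "t powr (- 2 * \<nu>) * (bessel_J \<nu> t)\<^sup>2 \<le> t powr (- 2 * \<nu>) * ((bessel_J \<nu> t)\<^sup>2 + (bessel_Y \<nu> t)\<^sup>2)"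
    by (intro mult_left_mono) auto
  also have "\<dots> \<le> z powr (- 2 * \<nu>) * ((bessel_J \<nu> z)\<^sup>2 + (bessel_Y \<nu> z)\<^sup>2)"
    using amplitude_decreasing[OF n z(1) t] by (simp add: \<nu>_def)
  finally have "(bessel_ser \<nu> (t\<^sup>2 / 4))\<^sup>2 \<le> (bessel_ser \<nu> (z\<^sup>2 / 4))\<^sup>2"
    using S[of t] S[of z] z t by (simp add: mult_left_mono)
  moreover have "bessel_ser \<nu> (z\<^sup>2 / 4) > 0"
    using bessel_ser_before_first_zero(1)[OF n] by (simp add: z_def \<nu>_def)
  ultimately show ?thesis by (meson abs_le_square_iff abs_ge_self abs_of_pos order_trans power2_le_imp_le less_imp_le)
qed

section \<open>Fourier transforms of radial functions\<close>

lemma integral_prod_Basis: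
  fixes f :: "'a::euclidean_space \<Rightarrow> real \<Rightarrow> complex"
  assumes int: "\<And>b. b \<in> Basis \<Longrightarrow> integrable lborel (f b)"
  shows "integrable lborel (\<lambda>x::'a. \<Prod>b\<in>Basis. f b (x \<bullet> b))"
    and "(LINT x|lborel. (\<Prod>b\<in>Basis. f b ((x::'a) \<bullet> b))) = (\<Prod>b\<in>Basis. (LINT t|lborel. f b t))"
proof -
  interpret P: product_sigma_finite "\<lambda>b::'a. lborel :: real measure"
    by standard
  let ?T = "\<lambda>g. \<Sum>b\<in>Basis. g b *\<^sub>R (b::'a)"
  have T: "?T \<in> (\<Pi>\<^sub>M b\<in>Basis. lborel) \<rightarrow>\<^sub>M borel" by measurable
  have fbm: "(\<lambda>x::'a. f b (x \<bullet> b)) \<in> borel_measurable borel" if "b \<in> Basis" for b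
  proof (rule measurable_compose[of "\<lambda>x. x \<bullet> b" borel borel "f b"])
    show "f b \<in> borel_measurable borel" using borel_measurable_integrable[OF int[OF that]] by simp
  qed simp
  have M: "(\<lambda>x. \<Prod>b\<in>Basis. f b (x \<bullet> b)) \<in> borel_measurable borel"
    by (rule borel_measurable_prod[OF fbm])
  have eq: "(\<Prod>b\<in>Basis. f b (?T g \<bullet> b)) = (\<Prod>b\<in>Basis. f b (g b))" for g
    by (intro prod.cong) auto
  show "integrable lborel (\<lambda>x::'a. \<Prod>b\<in>Basis. f b (x \<bullet> b))"
    unfolding lborel_eq[where 'a='a]
    by (subst integrable_distr_eq[OF T M], unfold eq, rule P.product_integrable_prod) (auto intro: int)
  show "(LINT x|lborel. (\<Prod>b\<in>Basis. f b ((x::'a) \<bullet> b))) = (\<Prod>b\<in>Basis. (LINT t|lborel. f b t))"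
    unfolding lborel_eq[where 'a='a]
    by (subst integral_distr[OF T M], unfold eq, rule P.product_integral_prod) (auto intro: int)
qed

lemma gauss_FT_1:
  shows "integrable lborel (\<lambda>t::real. exp (- t\<^sup>2 / 2) *\<^sub>R iexp (c * t))"
    and "(LINT t|lborel. exp (- t\<^sup>2 / 2) *\<^sub>R iexp (c * t)) = of_real (sqrt (2 * pi) * exp (- c\<^sup>2 / 2))"
proof -
  have i: "integrable lborel (\<lambda>t::real. exp (- t\<^sup>2 / 2))"
    using gauss_moment_integrable[of "1/2" 0] by simp
  show int: "integrable lborel (\<lambda>t::real. exp (- t\<^sup>2 / 2) *\<^sub>R iexp (c * t))"
    by (rule Bochner_Integration.integrable_bound[OF i]) auto
  have "(CLINT t|std_normal_distribution. iexp (c * t)) = of_real (exp (- c\<^sup>2 / 2))"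
    using fun_cong[OF char_std_normal_distribution, of c] by (simp add: char_def)
  moreover have "(CLINT t|std_normal_distribution. iexp (c * t)) = (LINT t|lborel. std_normal_density t *\<^sub>R iexp (c * t))"
    by (subst integral_density) (auto simp: normal_density_nonneg)
  moreover have "std_normal_density t *\<^sub>R iexp (c * t) = (1 / sqrt (2 * pi)) *\<^sub>R (exp (- t\<^sup>2 / 2) *\<^sub>R iexp (c * t))" for t
    by (simp add: normal_density_def)
  ultimately have "of_real (exp (- c\<^sup>2 / 2)) = (LINT t|lborel. (1 / sqrt (2 * pi)) *\<^sub>R (exp (- t\<^sup>2 / 2) *\<^sub>R iexp (c * t)))"
    by (simp only:)
  then have "(1 / sqrt (2 * pi)) *\<^sub>R (LINT t|lborel. exp (- t\<^sup>2 / 2) *\<^sub>R iexp (c * t)) = of_real (exp (- c\<^sup>2 / 2))"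
    by (simp only: integral_scaleR_right)
  then have "sqrt (2 * pi) *\<^sub>R (1 / sqrt (2 * pi)) *\<^sub>R (LINT t|lborel. exp (- t\<^sup>2 / 2) *\<^sub>R iexp (c * t)) = sqrt (2 * pi) *\<^sub>R of_real (exp (- c\<^sup>2 / 2))"
    by simp
  then show "(LINT t|lborel. exp (- t\<^sup>2 / 2) *\<^sub>R iexp (c * t)) = of_real (sqrt (2 * pi) * exp (- c\<^sup>2 / 2))"
    by (simp add: scaleR_conv_of_real)
qed

lemma gauss_FT:
  fixes v :: "'a::euclidean_space"
  shows "integrable lborel (\<lambda>x. exp (- (norm x)\<^sup>2 / 2) *\<^sub>R iexp (v \<bullet> x))"
    and "(LINT x|lborel. exp (- (norm x)\<^sup>2 / 2) *\<^sub>R iexp (v \<bullet> x)) = of_real (sqrt (2 * pi) ^ DIM('a) * exp (- (norm v)\<^sup>2 / 2))"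
proof -
  let ?f = "\<lambda>b t. exp (- t\<^sup>2 / 2) *\<^sub>R iexp (v \<bullet> b * t)"
  have n: "(\<Sum>b\<in>Basis. - (x \<bullet> b)\<^sup>2 / 2) = - (norm x)\<^sup>2 / 2" for x :: 'a
  proof -
    have "(norm x)\<^sup>2 = (\<Sum>b\<in>Basis. (x \<bullet> b)\<^sup>2)"
      unfolding power2_norm_eq_inner by (subst euclidean_inner) (simp add: power2_eq_square)
    then show ?thesis by (simp add: sum_negf sum_divide_distrib)
  qed
  have eq: "exp (- (norm x)\<^sup>2 / 2) *\<^sub>R iexp (v \<bullet> x) = (\<Prod>b\<in>Basis. ?f b (x \<bullet> b))" for x
  proof -
    have "(\<Prod>b\<in>Basis. ?f b (x \<bullet> b)) = of_real (\<Prod>b\<in>Basis. exp (- (x \<bullet> b)\<^sup>2 / 2)) * (\<Prod>b\<in>Basis. iexp (v \<bullet> b * (x \<bullet> b)))"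
      by (simp add: scaleR_conv_of_real prod.distrib)
    also have "(\<Prod>b\<in>Basis. exp (- (x \<bullet> b)\<^sup>2 / 2)) = exp (- (norm x)\<^sup>2 / 2)"
      by (simp only: exp_sum[OF finite_Basis, symmetric] n)
    also have "(\<Prod>b\<in>Basis. iexp (v \<bullet> b * (x \<bullet> b))) = iexp (v \<bullet> x)"
      by (simp only: exp_sum[OF finite_Basis, symmetric] euclidean_inner[of v x] of_real_sum sum_distrib_left)
    finally show ?thesis by (simp add: scaleR_conv_of_real)
  qed
  show "integrable lborel (\<lambda>x. exp (- (norm x)\<^sup>2 / 2) *\<^sub>R iexp (v \<bullet> x))"
    unfolding eq by (rule integral_prod_Basis(1)) (rule gauss_FT_1)
  have "(LINT x|lborel. exp (- (norm x)\<^sup>2 / 2) *\<^sub>R iexp (v \<bullet> x)) = (\<Prod>b\<in>Basis. of_real (sqrt (2 * pi) * exp (- (v \<bullet> b)\<^sup>2 / 2)))"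
    unfolding eq by (subst integral_prod_Basis(2)) (simp_all only: gauss_FT_1)
  also have "\<dots> = of_real (sqrt (2 * pi) ^ DIM('a) * (\<Prod>b\<in>Basis. exp (- (v \<bullet> b)\<^sup>2 / 2)))"
    by (simp only: of_real_prod[symmetric] prod.distrib prod_constant)
  also have "(\<Prod>b\<in>Basis. exp (- (v \<bullet> b)\<^sup>2 / 2)) = exp (- (norm v)\<^sup>2 / 2)"
    by (simp only: exp_sum[OF finite_Basis, symmetric] n)
  finally show "(LINT x|lborel. exp (- (norm x)\<^sup>2 / 2) *\<^sub>R iexp (v \<bullet> x)) = of_real (sqrt (2 * pi) ^ DIM('a) * exp (- (norm v)\<^sup>2 / 2))" .
qed

lemma gauss_integrable_euclidean:
  "integrable lborel (\<lambda>x::'a::euclidean_space. exp (- (norm x)\<^sup>2 / 2))"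
  using integrable_norm[OF gauss_FT(1)[of "0::'a"]] by simp

text \<open>Under the normalised Gaussian the inner product with \<xi> is distributed like |\<xi>|
  times a standard normal variable, because the characteristic functions agree. The moments are then
  one-dimensional.\<close>

lemma gauss_directional_moments:
  fixes \<xi> :: "'a::euclidean_space"
  shows "integrable lborel (\<lambda>x. exp (- (norm x)\<^sup>2 / 2) * (\<xi> \<bullet> x) ^ (2 * m))"
    and "(LINT x|lborel. exp (- (norm x)\<^sup>2 / 2) * (\<xi> \<bullet> x) ^ (2 * m))
      = sqrt (2 * pi) ^ DIM('a) * (norm \<xi> ^ (2 * m) * (fact (2 * m) / (2 ^ m * fact m)))"
proof -
  let ?Z = "sqrt (2 * pi) ^ DIM('a)"
  define g where "g = (\<lambda>x::'a. exp (- (norm x)\<^sup>2 / 2) / ?Z)"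
  have Z: "?Z > 0" by simp
  have g0: "g x \<ge> 0" for x by (simp add: g_def)
  have gm [measurable]: "g \<in> borel_measurable borel" unfolding g_def by measurable
  define M where "M = density lborel (\<lambda>x. ennreal (g x))"
  have sM [measurable_cong]: "sets M = sets borel" "space M = UNIV" by (simp_all add: M_def)
  have ig: "integrable lborel g" unfolding g_def by (intro integrable_divide gauss_integrable_euclidean)
  have chr: "(CLINT x|M. iexp (v \<bullet> x)) = of_real (exp (- (norm v)\<^sup>2 / 2))" for v
  proof -
    have "(CLINT x|M. iexp (v \<bullet> x)) = (LINT x|lborel. g x *\<^sub>R iexp (v \<bullet> x))"
      unfolding M_def by (subst integral_density) (auto simp: g0)
    also have "\<dots> = (LINT x|lborel. (1 / ?Z) *\<^sub>R (exp (- (norm x)\<^sup>2 / 2) *\<^sub>R iexp (v \<bullet> x)))"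
      by (intro Bochner_Integration.integral_cong) (auto simp: g_def)
    also have "\<dots> = (1 / ?Z) *\<^sub>R of_real (?Z * exp (- (norm v)\<^sup>2 / 2))"
      by (simp only: integral_scaleR_right gauss_FT(2))
    finally show ?thesis using Z by (simp add: scaleR_conv_of_real)
  qed
  have "integral\<^sup>L lborel g = 1"
  proof -
    have "(CLINT x|M. iexp (0 \<bullet> x)) = (LINT x|lborel. g x *\<^sub>R (1::complex))"
      unfolding M_def by (subst integral_density) (auto simp: g0)
    then have "complex_of_real (integral\<^sup>L lborel g) = 1"
      using chr[of 0] ig by (simp add: scaleR_conv_of_real)
    then show ?thesis by (simp only: of_real_eq_1_iff)
  qed
  then have "emeasure M (space M) = 1"
    using nn_integral_eq_integral[OF ig] g0 by (simp add: M_def emeasure_density)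
  then interpret M: prob_space M by (rule prob_spaceI)
  interpret S: prob_space std_normal_distribution by (rule real_distribution.axioms(1)) (rule real_dist_normal_dist)
  let ?D1 = "distr M borel (\<lambda>x. \<xi> \<bullet> x)" and ?D2 = "distr std_normal_distribution borel (\<lambda>t. norm \<xi> * t)"
  have D: "?D1 = ?D2"
  proof (rule Levy_uniqueness)
    show "real_distribution ?D1" by (rule M.real_distribution_distr) measurable
    show "real_distribution ?D2" by (rule S.real_distribution_distr) measurable
    show "char ?D1 = char ?D2"
    proof
      fix t
      have "char ?D1 t = (CLINT x|M. iexp ((t *\<^sub>R \<xi>) \<bullet> x))"
        unfolding char_def by (subst integral_distr) (auto simp: inner_commute)
      also have "\<dots> = of_real (exp (- (t * norm \<xi>)\<^sup>2 / 2))" unfolding chr by (simp add: power_mult_distrib)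
      also have "\<dots> = char std_normal_distribution (t * norm \<xi>)" by (simp add: char_std_normal_distribution)
      also have "\<dots> = char ?D2 t"
        unfolding char_def by (subst integral_distr) (auto simp: mult.assoc)
      finally show "char ?D1 t = char ?D2 t" .
    qed
  qed
  have mom: "integrable std_normal_distribution (\<lambda>t. (norm \<xi> * t) ^ (2 * m))"
    "(LINT t|std_normal_distribution. (norm \<xi> * t) ^ (2 * m)) = norm \<xi> ^ (2 * m) * (fact (2 * m) / (2 ^ m * fact m))"
    using std_normal_distribution_even_moments[of m] by (simp_all add: power_mult_distrib)
  have i2: "integrable ?D1 (\<lambda>y. y ^ (2 * m))" unfolding D by (subst integrable_distr_eq) (auto intro: mom)
  then have "integrable M (\<lambda>x. (\<xi> \<bullet> x) ^ (2 * m))" by (subst (asm) integrable_distr_eq) auto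
  then have "integrable lborel (\<lambda>x. g x *\<^sub>R (\<xi> \<bullet> x) ^ (2 * m))"
    unfolding M_def by (subst (asm) integrable_density) (auto simp: g0)
  from integrable_mult_right[OF this, of ?Z]
  show "integrable lborel (\<lambda>x. exp (- (norm x)\<^sup>2 / 2) * (\<xi> \<bullet> x) ^ (2 * m))"
    by (simp add: g_def)
  have "(LINT y|?D1. y ^ (2 * m)) = norm \<xi> ^ (2 * m) * (fact (2 * m) / (2 ^ m * fact m))"
    unfolding D by (subst integral_distr) (auto simp: mom)
  moreover have "(LINT y|?D1. y ^ (2 * m)) = (LINT x|lborel. g x *\<^sub>R (\<xi> \<bullet> x) ^ (2 * m))"
    unfolding M_def by (subst integral_distr, simp, simp, subst integral_density) (auto simp: g0)
  moreover have "(LINT x|lborel. exp (- (norm x)\<^sup>2 / 2) * (\<xi> \<bullet> x) ^ (2 * m)) = ?Z * (LINT x|lborel. g x *\<^sub>R (\<xi> \<bullet> x) ^ (2 * m))"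
    by (subst integral_mult_right_zero[symmetric], rule Bochner_Integration.integral_cong) (auto simp: g_def)
  ultimately show "(LINT x|lborel. exp (- (norm x)\<^sup>2 / 2) * (\<xi> \<bullet> x) ^ (2 * m))
      = ?Z * (norm \<xi> ^ (2 * m) * (fact (2 * m) / (2 ^ m * fact m)))" by simp
qed

text \<open>A substitute for polar coordinates: homogeneity of h and the scaling of Lebesgue measure
  give the ball of radius r the mass c r^D, and these masses determine the law of the norm.\<close>

lemma radial_measure:
  fixes h :: "'a::euclidean_space \<Rightarrow> real"
  assumes hm [measurable]: "h \<in> borel_measurable borel" and h0: "\<And>x. h x \<ge> 0"
    and hom: "\<And>r x. r > 0 \<Longrightarrow> h (r *\<^sub>R x) = r ^ d * h x"
    and int: "integrable lborel (\<lambda>x. indicator (cball 0 1) x *\<^sub>R h x)"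
  defines "D \<equiv> DIM('a) + d"
  defines "c \<equiv> (LINT x|lborel. indicator (cball 0 1) x *\<^sub>R h x)"
  shows "distr (density lborel (\<lambda>x. ennreal (h x))) borel norm
    = density lborel (\<lambda>r. ennreal (indicator {0<..} r * (real D * c * r ^ (D - 1))))" (is "?M1 = ?M2")
proof -
  have c0: "c \<ge> 0" unfolding c_def by (intro integral_nonneg_AE) (simp add: h0)
  have D0: "D > 0" by (simp add: D_def)
  have [measurable]: "cball (0::'a) r \<in> sets borel" for r by simp
  have [measurable]: "(\<lambda>x. ennreal (indicator (cball 0 1) x * h x)) \<in> borel_measurable borel" by measurable
  have v: "norm -` {..r} = (cball 0 r :: 'a set)" for r by auto
  have nn: "(\<integral>\<^sup>+x. ennreal (indicator (cball 0 1) x * h x) \<partial>lborel) = ennreal c"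
    unfolding c_def using nn_integral_eq_integral[OF int] by (simp add: h0)
  have M1: "emeasure ?M1 {..r} = ennreal (c * r ^ D)" if r: "r > 0" for r
  proof -
    have "emeasure ?M1 {..r} = (\<integral>\<^sup>+x. ennreal (h x) * indicator (cball 0 r) x \<partial>lborel)"
      by (subst emeasure_distr, simp, simp, subst emeasure_density)
         (auto simp: v)
    also have "\<dots> = (\<integral>\<^sup>+x. ennreal (h x) * indicator (cball 0 r) x \<partial>density (distr lborel borel (\<lambda>x. 0 + r *\<^sub>R x)) (\<lambda>_. \<bar>r\<bar> ^ DIM('a)))"
      using lborel_affine[of r "0::'a"] r by simp
    also have "\<dots> = (\<integral>\<^sup>+x. ennreal (\<bar>r\<bar> ^ DIM('a)) * (ennreal (h (r *\<^sub>R x)) * indicator (cball 0 r) (r *\<^sub>R x)) \<partial>lborel)"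
    proof -
      have [measurable]: "(\<lambda>x. ennreal (h x) * indicator (cball 0 r) x) \<in> borel_measurable borel" by measurable
      show ?thesis by (simp add: nn_integral_density nn_integral_distr)
    qed
    also have "\<dots> = (\<integral>\<^sup>+x. ennreal (r ^ D) * ennreal (indicator (cball 0 1) x * h x) \<partial>lborel)"
    proof (rule nn_integral_cong)
      fix x :: 'a
      show "ennreal (\<bar>r\<bar> ^ DIM('a)) * (ennreal (h (r *\<^sub>R x)) * indicator (cball 0 r) (r *\<^sub>R x)) =
          ennreal (r ^ D) * ennreal (indicator (cball 0 1) x * h x)"
        using r h0[of x] by (auto simp: hom D_def power_add mult_le_cancel_left1 mult_ac split: split_indicator simp flip: ennreal_mult)
    qed
    also have "\<dots> = ennreal (r ^ D) * ennreal c" by (subst nn_integral_cmult) (simp_all add: nn)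
    finally show ?thesis using r c0 by (simp add: mult.commute flip: ennreal_mult)
  qed
  have M2: "emeasure ?M2 {..r} = ennreal (c * r ^ D)" if r: "r > 0" for r
  proof -
    have "emeasure ?M2 {..r} = (\<integral>\<^sup>+t. ennreal (indicator {0<..} t * (real D * c * t ^ (D - 1))) * indicator {..r} t \<partial>lborel)"
      by (subst emeasure_density) auto
    also have "\<dots> = (\<integral>\<^sup>+t. ennreal (real D * c * t ^ (D - 1)) * indicator {0..r} t \<partial>lborel)"
      by (rule nn_integral_cong_AE, rule AE_mp[OF AE_lborel_singleton[of 0]]) (auto split: split_indicator)
    also have "\<dots> = ennreal (c * r ^ D - c * 0 ^ D)"
    proof (rule nn_integral_FTC_Icc[where F = "\<lambda>t. c * t ^ D"])
      fix x assume x: "x \<in> {0..r}"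
      show "((\<lambda>t. c * t ^ D) has_real_derivative real D * c * x ^ (D - 1)) (at x)"
        by (auto intro!: derivative_eq_intros)
      show "0 \<le> real D * c * x ^ (D - 1)" using x c0 by simp
    qed (use r in auto)
    finally show ?thesis using D0 by (simp add: power_0_left)
  qed
  have zero: "emeasure ?M1 {..r} = emeasure ?M2 {..r}" if r: "r \<le> 0" for r
  proof -
    have "emeasure ?M1 {..r} = (\<integral>\<^sup>+x. ennreal (h x) * indicator (cball 0 r) x \<partial>lborel)"
      by (subst emeasure_distr, simp, simp, subst emeasure_density)
         (auto simp: v)
    also have "\<dots> = (\<integral>\<^sup>+(x::'a). 0 \<partial>lborel)"
    proof (rule nn_integral_cong_AE)
      have "ennreal (h x) * indicator (cball 0 r) x = 0" if "x \<noteq> 0" for x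
      proof -
        have "\<not> norm x \<le> r" using that r by (metis norm_le_zero_iff order_trans)
        then show ?thesis by simp
      qed
      then show "AE x in lborel. ennreal (h x) * indicator (cball 0 r) x = 0"
        by (rule AE_mp[OF AE_lborel_singleton[of "0::'a"], OF AE_I2, OF impI])
    qed
    also have "\<dots> = (\<integral>\<^sup>+t. ennreal (indicator {0<..} t * (real D * c * t ^ (D - 1))) * indicator {..r} t \<partial>lborel)"
    proof -
      have "(\<lambda>t. ennreal (indicator {0<..} t * (real D * c * t ^ (D - 1))) * indicator {..r} t) = (\<lambda>_. 0)"
        using r by (auto simp: fun_eq_iff split: split_indicator)
      then show ?thesis by (simp only: nn_integral_const mult_zero_left)
    qed
    also have "\<dots> = emeasure ?M2 {..r}" by (subst emeasure_density) auto
    finally show ?thesis .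
  qed
  show ?thesis
  proof (rule measure_eqI_generator_eq[where E = "range (\<lambda>a::real. {..a})" and \<Omega> = UNIV and A = "\<lambda>i. {..real i}"])
    show "Int_stable (range (\<lambda>a::real. {..a}))" by (auto simp: Int_stable_def)
    show "emeasure ?M1 X = emeasure ?M2 X" if X: "X \<in> range (\<lambda>a::real. {..a})" for X
    proof -
      obtain r where "X = {..r}" using X by auto
      then show ?thesis using M1[of r] M2[of r] zero[of r] by (cases "r > 0") (simp_all only: linorder_not_less)
    qed
    show "sets ?M1 = sigma_sets UNIV (range (\<lambda>a::real. {..a}))" "sets ?M2 = sigma_sets UNIV (range (\<lambda>a::real. {..a}))"
      by (simp_all add: borel_eq_atMost)
    show "(\<Union>i. {..real i}) = UNIV" using real_arch_simple by auto
    show "emeasure ?M1 {..real i} \<noteq> \<infinity>" for i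
    proof (cases "i = 0")
      case True
      have "emeasure ?M1 {..0} \<le> emeasure ?M1 {..1}" by (intro emeasure_mono) auto
      then show ?thesis using M1[of 1] True by (auto simp: top_unique)
    qed (use M1[of "real i"] in simp)
  qed auto
qed

lemma radial_integral:
  fixes h :: "'a::euclidean_space \<Rightarrow> real" and \<kappa> :: "real \<Rightarrow> real"
  assumes hm [measurable]: "h \<in> borel_measurable borel" and h0: "\<And>x. h x \<ge> 0"
    and hom: "\<And>r x. r > 0 \<Longrightarrow> h (r *\<^sub>R x) = r ^ d * h x"
    and int: "integrable lborel (\<lambda>x. indicator (cball 0 1) x *\<^sub>R h x)"
    and \<kappa> [measurable]: "\<kappa> \<in> borel_measurable borel"
  defines "D \<equiv> DIM('a) + d"
  defines "c \<equiv> (LINT x|lborel. indicator (cball 0 1) x *\<^sub>R h x)"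
  shows "(LINT x|lborel. h x * \<kappa> (norm x)) = real D * c * (LINT r|lborel. indicator {0<..} r *\<^sub>R (r ^ (D - 1) * \<kappa> r))"
    and "integrable lborel (\<lambda>x. h x * \<kappa> (norm x)) \<longleftrightarrow>
      integrable lborel (\<lambda>r. real D * c * (indicator {0<..} r *\<^sub>R (r ^ (D - 1) * \<kappa> r)))"
proof -
  have M: "distr (density lborel (\<lambda>x. ennreal (h x))) borel norm
    = density lborel (\<lambda>r. ennreal (indicator {0<..} r * (real D * c * r ^ (D - 1))))"
    unfolding D_def c_def by (rule radial_measure[OF hm h0 hom int])
  have c0: "c \<ge> 0" unfolding c_def by (intro integral_nonneg_AE) (simp add: h0)
  have e: "(indicator {0<..} r * (real D * c * r ^ (D - 1))) *\<^sub>R \<kappa> r = real D * c * (indicator {0<..} r *\<^sub>R (r ^ (D - 1) * \<kappa> r))" for r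
    by (simp add: mult_ac)
  have nn: "0 \<le> indicator {0<..} r * (real D * c * r ^ (D - 1))" for r :: real
    using c0 by (auto split: split_indicator)
  have "(LINT x|lborel. h x * \<kappa> (norm x)) = integral\<^sup>L (distr (density lborel (\<lambda>x. ennreal (h x))) borel norm) \<kappa>"
    by (subst integral_distr, simp, simp, subst integral_density) (auto simp: h0)
  also have "\<dots> = (LINT r|lborel. real D * c * (indicator {0<..} r *\<^sub>R (r ^ (D - 1) * \<kappa> r)))"
    unfolding M by (subst integral_density, measurable, rule AE_I2, rule nn, simp only: e)
  finally show "(LINT x|lborel. h x * \<kappa> (norm x)) = real D * c * (LINT r|lborel. indicator {0<..} r *\<^sub>R (r ^ (D - 1) * \<kappa> r))"
    by (simp only: integral_mult_right_zero)
  have "integrable lborel (\<lambda>x. h x * \<kappa> (norm x)) \<longleftrightarrow> integrable (distr (density lborel (\<lambda>x. ennreal (h x))) borel norm) \<kappa>"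
    by (subst integrable_distr_eq, simp, simp, subst integrable_density) (auto simp: h0)
  also have "\<dots> \<longleftrightarrow> integrable lborel (\<lambda>r. real D * c * (indicator {0<..} r *\<^sub>R (r ^ (D - 1) * \<kappa> r)))"
    unfolding M by (subst integrable_density, measurable, rule AE_I2, rule nn, simp only: e)
  finally show "integrable lborel (\<lambda>x. h x * \<kappa> (norm x)) \<longleftrightarrow>
      integrable lborel (\<lambda>r. real D * c * (indicator {0<..} r *\<^sub>R (r ^ (D - 1) * \<kappa> r)))" .
qed

lemma inner_power_unit_ball_integrable:
  fixes \<xi> :: "'a::euclidean_space"
  shows "integrable lborel (\<lambda>x. indicator (cball 0 1) x *\<^sub>R (\<xi> \<bullet> x) ^ (2 * m))"
  by (intro borel_integrable_compact continuous_intros) auto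

text \<open>The constant is found by comparing with the moments of the Gaussian.\<close>

definition sphere_const :: "'a::euclidean_space itself \<Rightarrow> real"
  where "sphere_const _ = sqrt (2 * pi) ^ DIM('a) / 2 powr (real DIM('a) / 2 - 1)"

text \<open>The weight is homogeneous of degree 2 m, so the radial formula applies; testing it with
  exp (- r^2 / 2) eliminates the integral c over the unit ball. The factor (2 m)! will cancel
  against the cosine series and leave the coefficients of \<open>bessel_ser\<close>.\<close>

lemma radial_power_integral:
  fixes \<xi> :: "'a::euclidean_space" and \<kappa> :: "real \<Rightarrow> real"
  assumes [measurable]: "\<kappa> \<in> borel_measurable borel" and N: "DIM('a) \<ge> 2"
  shows "(LINT x|lborel. (\<xi> \<bullet> x) ^ (2 * m) * \<kappa> (norm x))
    = sphere_const TYPE('a) * (norm \<xi> ^ (2 * m) * fact (2 * m) / (4 ^ m * fact m) * rGamma (real DIM('a) / 2 + real m))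
      * (LINT r|lborel. indicator {0<..} r *\<^sub>R (r ^ (DIM('a) + 2 * m - 1) * \<kappa> r))"
proof -
  define N where "N = DIM('a)"
  define c where "c = (LINT x|lborel. indicator (cball 0 1) x *\<^sub>R (\<xi> \<bullet> x) ^ (2 * m))"
  define h where "h = real N / 2 + real m - 1"
  have h: "h \<ge> 0" using N by (simp add: h_def N_def)
  have hom: "(\<xi> \<bullet> (r *\<^sub>R x)) ^ (2 * m) = r ^ (2 * m) * (\<xi> \<bullet> x) ^ (2 * m)" for r x
    by (simp add: power_mult_distrib)
  have R: "(LINT x|lborel. (\<xi> \<bullet> x) ^ (2 * m) * \<kappa> (norm x))
      = real (N + 2 * m) * c * (LINT r|lborel. indicator {0<..} r *\<^sub>R (r ^ (N + 2 * m - 1) * \<kappa> r))"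
    if [measurable]: "\<kappa> \<in> borel_measurable borel" for \<kappa>
    unfolding N_def c_def
    by (rule radial_integral(1)[OF _ _ hom inner_power_unit_ball_integrable]) (auto intro: zero_le_even_power)
  have eq: "indicator {0<..} y *\<^sub>R (2 * (1 / 2) * y * exp (- (1 / 2) * y\<^sup>2) * (1 / 2 * y\<^sup>2) powr h)
      = (1 / 2 powr h) * (indicator {0<..} y *\<^sub>R (y ^ (N + 2 * m - 1) * exp (- y\<^sup>2 / 2)))" for y :: real
  proof (cases "y > 0")
    case True
    have "(1 / 2 * y\<^sup>2) powr h = y powr (2 * h) / 2 powr h"
      using True by (simp add: powr_divide powr_powr flip: powr_numeral)
    moreover have "y * y powr (2 * h) = y powr real (N + 2 * m - 1)"
      using True N by (simp add: h_def N_def of_nat_diff powr_mult_base algebra_simps)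
    moreover have "y powr real (N + 2 * m - 1) = y ^ (N + 2 * m - 1)" using True by (rule powr_realpow)
    ultimately show ?thesis using True by (simp add: field_simps)
  qed simp
  have G: "(1 / 2 powr h) * (LINT y|lborel. indicator {0<..} y *\<^sub>R (y ^ (N + 2 * m - 1) * exp (- y\<^sup>2 / 2))) = Gamma (1 + h)"
  proof -
    have "integrable lborel (\<lambda>y::real. indicator {0<..} y *\<^sub>R (exp (- (1/2) * y\<^sup>2) * y ^ (N + 2 * m - 1)))"
      by (intro integrable_mult_indicator gauss_moment_integrable) auto
    then have "integrable lborel (\<lambda>y::real. (1 / 2 powr h) * (indicator {0<..} y *\<^sub>R (y ^ (N + 2 * m - 1) * exp (- y\<^sup>2 / 2))))"
      by (intro integrable_mult_right) (simp add: mult_ac)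
    then show ?thesis
      using Gamma_gauss_integral[of h "1/2"] h unfolding eq by (simp only: integral_mult_right_zero)
  qed
  have "sqrt (2 * pi) ^ N * (norm \<xi> ^ (2 * m) * (fact (2 * m) / (2 ^ m * fact m)))
      = real (N + 2 * m) * c * (LINT r|lborel. indicator {0<..} r *\<^sub>R (r ^ (N + 2 * m - 1) * exp (- r\<^sup>2 / 2)))"
    using R[of "\<lambda>r. exp (- r\<^sup>2 / 2)"] gauss_directional_moments(2)[of \<xi> m] by (simp add: N_def mult.commute)
  also have "(LINT r|lborel. indicator {0<..} r *\<^sub>R (r ^ (N + 2 * m - 1) * exp (- r\<^sup>2 / 2))) = 2 powr h * Gamma (1 + h)"
    using G by (simp add: field_simps)
  also have "2 powr h = 2 ^ m * 2 powr (real N / 2 - 1)"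
    by (simp add: h_def powr_add powr_diff powr_realpow)
  finally have *: "sqrt (2 * pi) ^ N * (norm \<xi> ^ (2 * m) * (fact (2 * m) / (2 ^ m * fact m)))
      = real (N + 2 * m) * c * (2 ^ m * 2 powr (real N / 2 - 1) * Gamma (1 + h))" .
  have four: "(4::real) ^ m = 2 ^ m * 2 ^ m" by (simp flip: power_mult_distrib)
  from * have "real (N + 2 * m) * c * Gamma (1 + h) = sqrt (2 * pi) ^ N / 2 powr (real N / 2 - 1) * (norm \<xi> ^ (2 * m) * fact (2 * m) / (4 ^ m * fact m))"
    by (simp add: field_simps four)
  moreover have G0: "Gamma (1 + h) > 0" using h by (intro Gamma_real_pos) simp
  moreover have "P = B * inverse G" if "P * G = B" "G > 0" for P B G :: real
    using that by auto
  ultimately have "real (N + 2 * m) * c = sphere_const TYPE('a) * (norm \<xi> ^ (2 * m) * fact (2 * m) / (4 ^ m * fact m)) * rGamma (1 + h)"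
    unfolding sphere_const_def N_def[symmetric] rGamma_inverse_Gamma by blast
  then show ?thesis unfolding R[OF assms(1)] by (simp add: N_def h_def)
qed

lemma radial_integrable_iff:
  fixes \<kappa> :: "real \<Rightarrow> real"
  assumes [measurable]: "\<kappa> \<in> borel_measurable borel"
  shows "integrable lborel (\<lambda>x::'a::euclidean_space. \<kappa> (norm x)) \<longleftrightarrow>
    integrable lborel (\<lambda>r. indicator {0<..} r *\<^sub>R (r ^ (DIM('a) - 1) * \<kappa> r))"
proof -
  have int: "integrable lborel (\<lambda>x::'a. indicator (cball 0 1) x *\<^sub>R (1::real))"
    by (intro borel_integrable_compact) auto
  have c: "(LINT x|lborel. indicator (cball (0::'a) 1) x *\<^sub>R (1::real)) = measure lborel (cball (0::'a) 1)"
    by simp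
  have pos: "measure lborel (cball (0::'a) 1) > 0" by (rule content_cball_pos) simp
  have "integrable lborel (\<lambda>x::'a. \<kappa> (norm x)) \<longleftrightarrow> integrable lborel (\<lambda>r. real DIM('a) * measure lborel (cball (0::'a) 1)
      * (indicator {0<..} r *\<^sub>R (r ^ (DIM('a) - 1) * \<kappa> r)))"
    using radial_integral(2)[of "\<lambda>_::'a. 1" 0 \<kappa>, OF _ _ _ int] unfolding c by simp
  also have "\<dots> \<longleftrightarrow> integrable lborel (\<lambda>r. indicator {0<..} r *\<^sub>R (r ^ (DIM('a) - 1) * \<kappa> r))"
  proof
    assume *: "integrable lborel (\<lambda>r. real DIM('a) * measure lborel (cball (0::'a) 1) * (indicator {0<..} r *\<^sub>R (r ^ (DIM('a) - 1) * \<kappa> r)))"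
    have "(1 / (real DIM('a) * measure lborel (cball (0::'a) 1))) * (real DIM('a) * measure lborel (cball (0::'a) 1) * w) = w" for w
      using pos by simp
    then show "integrable lborel (\<lambda>r. indicator {0<..} r *\<^sub>R (r ^ (DIM('a) - 1) * \<kappa> r))"
      using integrable_mult_right[OF *, of "1 / (real DIM('a) * measure lborel (cball (0::'a) 1))"] by (simp only:)
  qed (rule integrable_mult_right)
  finally show ?thesis .
qed

lemma summable_even_exp: "summable (\<lambda>m. y ^ (2 * m) / fact (2 * m))" for y :: real
proof (rule summable_comparison_test')
  show "summable (\<lambda>m. (y\<^sup>2) ^ m /\<^sub>R fact m)" by (rule summable_exp_generic)
  show "norm (y ^ (2 * m) / fact (2 * m)) \<le> (y\<^sup>2) ^ m /\<^sub>R fact m" for m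
  proof -
    have "(fact m :: real) \<le> fact (2 * m)" by (intro fact_mono) auto
    then have "(y\<^sup>2) ^ m / fact (2 * m) \<le> (y\<^sup>2) ^ m / fact m" by (intro divide_left_mono) auto
    moreover have "norm (y ^ (2 * m) / fact (2 * m)) = (y\<^sup>2) ^ m / fact (2 * m)"
      unfolding power_mult by simp
    ultimately show ?thesis by (simp add: divide_inverse mult.commute)
  qed
qed

text \<open>The cosine is expanded and integrated term by term, and the resulting series is the
  termwise integral of \<open>bessel_ser\<close>. Both interchanges are dominated because \<kappa>
  vanishes beyond R.\<close>

lemma radial_cos_integral:
  fixes \<xi> :: "'a::euclidean_space" and \<kappa> :: "real \<Rightarrow> real"
  assumes \<kappa>m [measurable]: "\<kappa> \<in> borel_measurable borel" and N: "DIM('a) \<ge> 2"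
    and R: "\<And>r. r > R \<Longrightarrow> \<kappa> r = 0" and int: "integrable lborel (\<lambda>x::'a. \<kappa> (norm x))"
  shows "(LINT x|lborel. cos (\<xi> \<bullet> x) * \<kappa> (norm x)) = sphere_const TYPE('a) *
    (LINT r|lborel. indicator {0<..} r *\<^sub>R (r ^ (DIM('a) - 1) * \<kappa> r * bessel_ser (real DIM('a) / 2 - 1) ((norm \<xi> * r)\<^sup>2 / 4)))"
proof -
  define N where "N = DIM('a)"
  define \<nu> where "\<nu> = real N / 2 - 1"
  have \<nu>: "\<nu> + real m + 1 = real N / 2 + real m" "\<nu> + real m + 1 > 0" for m using N by (auto simp: \<nu>_def N_def)
  \<comment> \<open>A bound for |\<xi> \<bullet> x| wherever \<kappa> does not vanish; the absolute
    value covers a negative R.\<close>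
  define y where "y = norm \<xi> * \<bar>R\<bar>"
  define f where "f = (\<lambda>m x. (-1) ^ m / fact (2 * m) * ((\<xi> \<bullet> x) ^ (2 * m) * \<kappa> (norm x)))"
  have fm [measurable]: "f m \<in> borel_measurable borel" for m unfolding f_def by measurable
  have fb: "norm (f m x) \<le> y ^ (2 * m) / fact (2 * m) * norm (\<kappa> (norm x))" for m x
  proof (cases "norm x > R")
    case False
    have "\<bar>\<xi> \<bullet> x\<bar> \<le> norm \<xi> * norm x" by (rule Cauchy_Schwarz_ineq2)
    also have "\<dots> \<le> y" unfolding y_def using False by (intro mult_left_mono) auto
    finally have "\<bar>\<xi> \<bullet> x\<bar> ^ (2 * m) \<le> y ^ (2 * m)" by (intro power_mono) auto
    then have "\<bar>\<xi> \<bullet> x\<bar> ^ (2 * m) / fact (2 * m) * \<bar>\<kappa> (norm x)\<bar> \<le> y ^ (2 * m) / fact (2 * m) * \<bar>\<kappa> (norm x)\<bar>"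
      by (intro mult_right_mono divide_right_mono) auto
    then show ?thesis by (simp add: f_def abs_mult power_abs)
  qed (simp add: f_def R y_def)
  have fint: "integrable lborel (f m)" for m
    by (rule Bochner_Integration.integrable_bound[OF integrable_mult_right[OF integrable_norm[OF int], of "y ^ (2 * m) / fact (2 * m)"]])
       (use fb in \<open>auto simp: abs_mult\<close>)
  have fsum: "summable (\<lambda>m. LINT x|lborel. norm (f m x))"
  proof (rule summable_comparison_test')
    show "summable (\<lambda>m. y ^ (2 * m) / fact (2 * m) * (LINT x|lborel. norm (\<kappa> (norm (x::'a)))))"
      by (intro summable_mult2 summable_even_exp)
    show "norm (LINT x|lborel. norm (f m x)) \<le> y ^ (2 * m) / fact (2 * m) * (LINT x|lborel. norm (\<kappa> (norm (x::'a))))" for m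
    proof -
      have "(LINT x|lborel. norm (f m x)) \<le> (LINT x|lborel. y ^ (2 * m) / fact (2 * m) * norm (\<kappa> (norm (x::'a))))"
        by (intro integral_mono integrable_norm fint integrable_mult_right int fb)
      moreover have "0 \<le> (LINT x|lborel. norm (f m x))" by (intro integral_nonneg_AE) simp
      ultimately show ?thesis by simp
    qed
  qed
  have fsums: "(\<lambda>m. f m x) sums (cos (\<xi> \<bullet> x) * \<kappa> (norm x))" for x
    using sums_mult2[OF cos_paired[of "\<xi> \<bullet> x"], of "\<kappa> (norm x)"] by (simp add: f_def mult.assoc)
  have fabs: "summable (\<lambda>m. norm (f m x))" for x
    by (rule summable_comparison_test'[OF summable_mult2[OF summable_even_exp[of y], of "norm (\<kappa> (norm x))"], of 0]) (use fb in simp)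
  define I where "I = (\<lambda>m. LINT r|lborel. indicator {0<..} r *\<^sub>R (r ^ (N + 2 * m - 1) * \<kappa> r))"
  have "(LINT x|lborel. cos (\<xi> \<bullet> x) * \<kappa> (norm x)) = (LINT x|lborel. (\<Sum>m. f m x))"
    using fsums by (simp add: sums_iff)
  also have "\<dots> = (\<Sum>m. LINT x|lborel. f m x)"
    by (rule integral_suminf[OF fint _ fsum]) (rule AE_I2, rule fabs)
  also have "\<dots> = (\<Sum>m. sphere_const TYPE('a) * ((-1) ^ m * rGamma (\<nu> + real m + 1) / fact m * (((norm \<xi>)\<^sup>2 / 4) ^ m * I m)))"
  proof (rule suminf_cong)
    fix m
    have "(LINT x|lborel. f m x) = (-1) ^ m / fact (2 * m) * (LINT x|lborel. (\<xi> \<bullet> x) ^ (2 * m) * \<kappa> (norm x))"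
      unfolding f_def by simp
    then show "(LINT x|lborel. f m x) = sphere_const TYPE('a) * ((-1) ^ m * rGamma (\<nu> + real m + 1) / fact m * (((norm \<xi>)\<^sup>2 / 4) ^ m * I m))"
      unfolding radial_power_integral[OF \<kappa>m N] \<nu> I_def N_def power_mult[of "norm \<xi>" 2 m] by (simp add: power_divide power_mult mult_ac)
  qed
  finally have L: "(LINT x|lborel. cos (\<xi> \<bullet> x) * \<kappa> (norm x)) =
    (\<Sum>m. sphere_const TYPE('a) * ((-1) ^ m * rGamma (\<nu> + real m + 1) / fact m * (((norm \<xi>)\<^sup>2 / 4) ^ m * I m)))" .
  define b where "b = (\<lambda>r. indicator {0<..} r *\<^sub>R (r ^ (N - 1) * \<kappa> r))"
  have bint: "integrable lborel b" using int unfolding radial_integrable_iff[OF \<kappa>m] b_def N_def .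
  have [measurable]: "b \<in> borel_measurable borel" using borel_measurable_integrable[OF bint] by simp
  define g where "g = (\<lambda>m r. b r * ((-1) ^ m * rGamma (\<nu> + real m + 1) / fact m * ((norm \<xi> * r)\<^sup>2 / 4) ^ m))"
  define t where "t = (\<lambda>m. rGamma (\<nu> + real m + 1) / fact m * (y\<^sup>2 / 4) ^ m)"
  have rG: "rGamma (\<nu> + real m + 1) > 0" for m by (rule rGamma_pos) (rule \<nu>)
  have gb: "norm (g m r) \<le> t m * norm (b r)" for m r
  proof (cases "0 < r \<and> r \<le> R")
    case True
    then have "(norm \<xi> * r)\<^sup>2 \<le> y\<^sup>2" unfolding y_def by (intro power_mono mult_left_mono) auto
    then have "((norm \<xi> * r)\<^sup>2 / 4) ^ m \<le> (y\<^sup>2 / 4) ^ m" by (intro power_mono) auto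
    then have "rGamma (\<nu> + real m + 1) / fact m * ((norm \<xi> * r)\<^sup>2 / 4) ^ m \<le> t m"
      unfolding t_def using rG[of m] by (intro mult_left_mono) auto
    from mult_right_mono[OF this, of "\<bar>b r\<bar>"] show ?thesis
      using rG[of m] by (simp add: g_def abs_mult mult_ac power_abs power_mult_distrib)
  next
    case False
    then have "b r = 0" unfolding b_def using R[of r] by (cases "r > 0") auto
    then show ?thesis by (simp add: g_def)
  qed
  \<comment> \<open>The series of t is the Bessel series at the negative argument - y^2 / 4, where
    all terms have the same sign.\<close>
  have tsum: "summable t"
  proof -
    have "summable (\<lambda>m. (-1) ^ m * rGamma (\<nu> + real m + 1) / fact m * (- (y\<^sup>2 / 4)) ^ m)"
      by (rule summable_bessel_ser)
    also have "(\<lambda>m. (-1) ^ m * rGamma (\<nu> + real m + 1) / fact m * (- (y\<^sup>2 / 4)) ^ m) = t"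
    proof
      fix m
      have "(- (y\<^sup>2 / 4)) ^ m = (-1) ^ m * (y\<^sup>2 / 4) ^ m" by (rule power_minus)
      then show "(-1) ^ m * rGamma (\<nu> + real m + 1) / fact m * (- (y\<^sup>2 / 4)) ^ m = t m"
        by (simp add: t_def mult_ac flip: mult.assoc power_mult_distrib)
    qed
    finally show ?thesis .
  qed
  have t0: "t m \<ge> 0" for m unfolding t_def using rG[of m] by simp
  have gm [measurable]: "g m \<in> borel_measurable borel" for m unfolding g_def by measurable
  have gint: "integrable lborel (g m)" for m
    by (rule Bochner_Integration.integrable_bound[OF integrable_mult_right[OF integrable_norm[OF bint], of "t m"]])
       (use gb t0 in \<open>auto simp: abs_mult\<close>)
  have gsum: "summable (\<lambda>m. LINT r|lborel. norm (g m r))"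
  proof (rule summable_comparison_test')
    show "summable (\<lambda>m. t m * (LINT r|lborel. norm (b r)))" by (intro summable_mult2 tsum)
    show "norm (LINT r|lborel. norm (g m r)) \<le> t m * (LINT r|lborel. norm (b r))" for m
    proof -
      have "(LINT r|lborel. norm (g m r)) \<le> (LINT r|lborel. t m * norm (b r))"
        by (intro integral_mono integrable_norm gint integrable_mult_right bint gb)
      moreover have "0 \<le> (LINT r|lborel. norm (g m r))" by (intro integral_nonneg_AE) simp
      ultimately show ?thesis by simp
    qed
  qed
  have gabs: "summable (\<lambda>m. norm (g m r))" for r
    by (rule summable_comparison_test'[OF summable_mult2[OF tsum, of "norm (b r)"], of 0]) (use gb in simp)
  have gs: "(\<Sum>m. g m r) = b r * bessel_ser \<nu> ((norm \<xi> * r)\<^sup>2 / 4)" for r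
    unfolding g_def bessel_ser_def by (rule suminf_mult[OF summable_bessel_ser])
  have gterm: "(LINT r|lborel. g m r) = (-1) ^ m * rGamma (\<nu> + real m + 1) / fact m * (((norm \<xi>)\<^sup>2 / 4) ^ m * I m)" for m
  proof -
    have "g m r = (-1) ^ m * rGamma (\<nu> + real m + 1) / fact m * ((norm \<xi>)\<^sup>2 / 4) ^ m * (indicator {0<..} r *\<^sub>R (r ^ (N + 2 * m - 1) * \<kappa> r))" for r
    proof -
      have "r ^ (N + 2 * m - 1) = r ^ (N - 1) * (r\<^sup>2) ^ m"
        using N by (simp add: N_def flip: power_mult power_add)
      then show ?thesis by (simp add: g_def b_def power_mult_distrib power_divide)
    qed
    then show "(LINT r|lborel. g m r) = (-1) ^ m * rGamma (\<nu> + real m + 1) / fact m * (((norm \<xi>)\<^sup>2 / 4) ^ m * I m)"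
      unfolding I_def by (simp only: integral_mult_right_zero mult.assoc)
  qed
  have "(LINT r|lborel. b r * bessel_ser \<nu> ((norm \<xi> * r)\<^sup>2 / 4)) = (\<Sum>m. LINT r|lborel. g m r)"
    unfolding gs[symmetric] by (rule integral_suminf[OF gint _ gsum]) (rule AE_I2, rule gabs)
  also have "\<dots> = (\<Sum>m. (-1) ^ m * rGamma (\<nu> + real m + 1) / fact m * (((norm \<xi>)\<^sup>2 / 4) ^ m * I m))"
    by (simp only: gterm)
  finally have Rr: "(LINT r|lborel. b r * bessel_ser \<nu> ((norm \<xi> * r)\<^sup>2 / 4)) =
    (\<Sum>m. (-1) ^ m * rGamma (\<nu> + real m + 1) / fact m * (((norm \<xi>)\<^sup>2 / 4) ^ m * I m))" .
  have sm: "summable (\<lambda>m. (-1) ^ m * rGamma (\<nu> + real m + 1) / fact m * (((norm \<xi>)\<^sup>2 / 4) ^ m * I m))"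
    unfolding gterm[symmetric] by (rule summable_integral[OF gint _ gsum]) (rule AE_I2, rule gabs)
  show ?thesis unfolding L suminf_mult[OF sm] Rr[symmetric]
    by (simp add: b_def \<nu>_def N_def mult.assoc)
qed

lemma FTC_open_interval:
  fixes f F :: "real \<Rightarrow> 'a::euclidean_space" and a b :: real
  assumes "a < b" "\<And>s. a < s \<Longrightarrow> s < b \<Longrightarrow> (F has_vector_derivative f s) (at s)" "\<And>s. a < s \<Longrightarrow> s < b \<Longrightarrow> isCont f s"
    and "integrable lborel (\<lambda>s. indicator {a<..<b} s *\<^sub>R f s)"
    and "(F \<longlongrightarrow> A) (at_right a)" "(F \<longlongrightarrow> B) (at_left b)"
  shows "(LINT s|lborel. indicator {a<..<b} s *\<^sub>R f s) = B - A"
proof -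
  have e: "einterval a b = {a<..<b}" by (auto simp: einterval_iff)
  have "(LBINT x=a..b. f x) = B - A"
    by (rule interval_integral_FTC_integrable[where F = F])
       (use assms in \<open>auto simp: e set_integrable_def ereal_tendsto_simps\<close>)
  then show ?thesis using assms(1)
    by (simp add: interval_lebesgue_integral_def e set_lebesgue_integral_def)
qed

text \<open>Near 0 the bounds come from the limits of x powr \<nu> Y and of the series. Away from 0
  the decreasing weighted amplitude bounds J and Y at once.\<close>

lemma bessel_kernel_bound:
  assumes n: "n \<ge> 1"
  defines "\<nu> \<equiv> real n / 2"
  obtains C where "C > 0" "\<And>x. x > 0 \<Longrightarrow> x powr - \<nu> * \<bar>bessel_Y \<nu> x\<bar> \<le> C * (x powr (- 2 * \<nu>) + 1)"
    "\<And>x. x > 0 \<Longrightarrow> x powr - \<nu> * \<bar>bessel_J \<nu> x\<bar> \<le> C * (x powr (- 2 * \<nu>) + 1)"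
proof -
  obtain m where m: "\<nu> = (real m - 1) / 2 + 1" using half_order_cases[OF \<nu>_def[THEN meta_eq_to_obj_eq] n] .
  obtain A where A: "A > 0" "((\<lambda>x. x powr \<nu> * bessel_Y \<nu> x) \<longlongrightarrow> - A) (at_right 0)"
    using tendsto_bessel_Y_0[of m] unfolding m by blast
  have "\<forall>\<^sub>F x in at_right 0. \<bar>x powr \<nu> * bessel_Y \<nu> x\<bar> < A + 1"
    by (rule order_tendstoD(2)[OF tendsto_rabs[OF A(2)]]) (use A in auto)
  moreover have "\<forall>\<^sub>F x in at_right 0. \<bar>bessel_ser \<nu> (x\<^sup>2 / 4)\<bar> < \<bar>rGamma (\<nu> + 1)\<bar> + 1"
    by (rule order_tendstoD(2)[OF tendsto_rabs[OF tendsto_bessel_ser_square(1)]]) auto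
  ultimately have "\<forall>\<^sub>F x in at_right 0. \<bar>x powr \<nu> * bessel_Y \<nu> x\<bar> < A + 1 \<and> \<bar>bessel_ser \<nu> (x\<^sup>2 / 4)\<bar> < \<bar>rGamma (\<nu> + 1)\<bar> + 1"
    by eventually_elim simp
  then obtain d where d: "d > 0" "\<And>x. 0 < x \<Longrightarrow> x < d \<Longrightarrow> \<bar>x powr \<nu> * bessel_Y \<nu> x\<bar> < A + 1"
    "\<And>x. 0 < x \<Longrightarrow> x < d \<Longrightarrow> \<bar>bessel_ser \<nu> (x\<^sup>2 / 4)\<bar> < \<bar>rGamma (\<nu> + 1)\<bar> + 1"
    by (auto simp: eventually_at_right_field)
  define P where "P = (\<lambda>x. x powr (- 2 * \<nu>) * ((bessel_J \<nu> x)\<^sup>2 + (bessel_Y \<nu> x)\<^sup>2))"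
  define B where "B = sqrt (P (d / 2))"
  have far: "x powr - \<nu> * \<bar>bessel_Y \<nu> x\<bar> \<le> B" "x powr - \<nu> * \<bar>bessel_J \<nu> x\<bar> \<le> B" if "d / 2 \<le> x" for x
  proof -
    have le: "P x \<le> P (d / 2)" using amplitude_decreasing[OF n _ that] d(1) by (simp add: P_def \<nu>_def)
    have sq: "(x powr - \<nu>)\<^sup>2 = x powr (- 2 * \<nu>)" using that d(1) by (simp add: power2_eq_square flip: powr_add)
    have "(x powr - \<nu> * \<bar>bessel_Y \<nu> x\<bar>)\<^sup>2 \<le> P x" "(x powr - \<nu> * \<bar>bessel_J \<nu> x\<bar>)\<^sup>2 \<le> P x"
      unfolding power_mult_distrib sq P_def by (auto intro!: mult_left_mono)
    then show "x powr - \<nu> * \<bar>bessel_Y \<nu> x\<bar> \<le> B" "x powr - \<nu> * \<bar>bessel_J \<nu> x\<bar> \<le> B"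
      unfolding B_def using le by (auto intro!: real_le_rsqrt)
  qed
  have near: "x powr - \<nu> * \<bar>bessel_Y \<nu> x\<bar> \<le> (A + 1) * x powr (- 2 * \<nu>)"
    "x powr - \<nu> * \<bar>bessel_J \<nu> x\<bar> \<le> \<bar>rGamma (\<nu> + 1)\<bar> + 1" if x: "0 < x" "x < d" for x
  proof -
    have e: "x powr - \<nu> = x powr (- 2 * \<nu>) * x powr \<nu>" using x by (simp flip: powr_add)
    have "x powr - \<nu> * \<bar>bessel_Y \<nu> x\<bar> = x powr (- 2 * \<nu>) * \<bar>x powr \<nu> * bessel_Y \<nu> x\<bar>"
      unfolding e by (simp add: abs_mult)
    also have "\<dots> \<le> x powr (- 2 * \<nu>) * (A + 1)" using d(2)[OF x] by (intro mult_left_mono) auto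
    finally show "x powr - \<nu> * \<bar>bessel_Y \<nu> x\<bar> \<le> (A + 1) * x powr (- 2 * \<nu>)" by (simp add: mult.commute)
    have "2 powr - \<nu> \<le> (1::real)" by (subst powr_minus, rule inverse_le_1_iff[THEN iffD2]) (auto simp: \<nu>_def ge_one_powr_ge_zero)
    have "x powr - \<nu> * bessel_J \<nu> x = 2 powr - \<nu> * bessel_ser \<nu> (x\<^sup>2 / 4)"
      using x by (simp add: bessel_J_eq powr_divide powr_minus field_simps)
    then have "x powr - \<nu> * \<bar>bessel_J \<nu> x\<bar> = 2 powr - \<nu> * \<bar>bessel_ser \<nu> (x\<^sup>2 / 4)\<bar>"
      by (metis abs_mult abs_of_nonneg powr_ge_zero)
    also have "\<dots> \<le> 1 * (\<bar>rGamma (\<nu> + 1)\<bar> + 1)"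
      using d(3)[OF x] \<open>2 powr - \<nu> \<le> 1\<close> by (intro mult_mono) auto
    finally show "x powr - \<nu> * \<bar>bessel_J \<nu> x\<bar> \<le> \<bar>rGamma (\<nu> + 1)\<bar> + 1" by simp
  qed
  define C where "C = A + 1 + \<bar>rGamma (\<nu> + 1)\<bar> + 1 + B"
  have B0: "B \<ge> 0" unfolding B_def P_def by simp
  have C: "A + 1 \<le> C" "\<bar>rGamma (\<nu> + 1)\<bar> + 1 \<le> C" "B \<le> C" "C > 0" using A(1) B0 by (auto simp: C_def)
  have CC: "C * x powr (- 2 * \<nu>) \<le> C * (x powr (- 2 * \<nu>) + 1)" "C \<le> C * (x powr (- 2 * \<nu>) + 1)" for x
    using C(4) by (auto simp: distrib_left)
  show ?thesis
  proof (rule that[of C])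
    fix x :: real assume x: "x > 0"
    show "x powr - \<nu> * \<bar>bessel_Y \<nu> x\<bar> \<le> C * (x powr (- 2 * \<nu>) + 1)"
    proof (cases "x < d")
      case True
      have "(A + 1) * x powr (- 2 * \<nu>) \<le> C * x powr (- 2 * \<nu>)" using C by (intro mult_right_mono) auto
      then show ?thesis using near(1)[OF x True] CC(1)[of x] by linarith
    next
      case False
      then have "d / 2 \<le> x" using d(1) by linarith
      then show ?thesis using far(1)[of x] CC(2)[of x] C(3) by linarith
    qed
    show "x powr - \<nu> * \<bar>bessel_J \<nu> x\<bar> \<le> C * (x powr (- 2 * \<nu>) + 1)"
    proof (cases "x < d")
      case True
      then show ?thesis using near(2)[OF x True] CC(2)[of x] C by linarith
    next
      case False
      then have "d / 2 \<le> x" using d(1) by linarith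
      then show ?thesis using far(2)[of x] CC(2)[of x] C(3) by linarith
    qed
  qed (rule C)
qed

section \<open>Positive definiteness of the truncated resolvent kernel\<close>

text \<open>The radial profile of the truncated kernel, up to a positive constant; n is the
  dimension minus 2, so that n/2 is \<nu>.\<close>

definition bessel_kernel :: "nat \<Rightarrow> real \<Rightarrow> real \<Rightarrow> real"
  where "bessel_kernel n k r = (if 0 < r \<and> k * r < first_zero_bessel_Y (real n / 2)
    then - (r powr - (real n / 2) * bessel_Y (real n / 2) (k * r)) else 0)"

lemma bessel_kernel_nonneg:
  assumes "n \<ge> 1" "k > 0" shows "bessel_kernel n k r \<ge> 0"
proof (cases "0 < r \<and> k * r < first_zero_bessel_Y (real n / 2)")
  case True
  then have "bessel_Y (real n / 2) (k * r) < 0" using first_zero_bessel_Y(3)[OF assms(1)] assms(2) by simp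
  then show ?thesis using True by (simp add: bessel_kernel_def mult_nonneg_nonpos)
qed (auto simp: bessel_kernel_def)

lemma isCont_bessel_Y_half_order: "x > 0 \<Longrightarrow> isCont (bessel_Y (real n / 2)) x"
  by (rule ladder_isCont(1)[OF ladder_bessel_Y'])

text \<open>Since Y vanishes at z, freezing its argument at z has the same effect as the truncation,
  and in this form continuity is visible.\<close>

lemma isCont_bessel_kernel:
  assumes n: "n \<ge> 1" and k: "k > 0" and r: "r > 0" shows "isCont (bessel_kernel n k) r"
proof -
  define z where "z = first_zero_bessel_Y (real n / 2)"
  have z: "z > 0" "bessel_Y (real n / 2) z = 0" unfolding z_def by (rule first_zero_bessel_Y[OF n])+
  have eq: "bessel_kernel n k t = - (t powr - (real n / 2) * bessel_Y (real n / 2) (min (k * t) z))" if "t > 0" for t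
    using that z(2) by (auto simp: bessel_kernel_def z_def[symmetric] min_def)
  have m: "min (k * r) z > 0" using k r z(1) by simp
  have "isCont (\<lambda>t. bessel_Y (real n / 2) (min (k * t) z)) r"
    by (rule isCont_o2[where g = "bessel_Y (real n / 2)" and f = "\<lambda>t. min (k * t) z", OF _ isCont_bessel_Y_half_order[OF m]]) (intro continuous_intros)
  then have "isCont (\<lambda>t. - (t powr - (real n / 2) * bessel_Y (real n / 2) (min (k * t) z))) r"
    using r by (intro continuous_intros) auto
  moreover have "\<forall>\<^sub>F t in nhds r. bessel_kernel n k t = - (t powr - (real n / 2) * bessel_Y (real n / 2) (min (k * t) z))"
    using eventually_nhds_in_open[of "{0<..}" r] r by (auto elim!: eventually_mono simp: eq)
  ultimately show ?thesis using isCont_cong by fast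
qed

lemma borel_measurable_bessel_kernel [measurable]:
  assumes n: "n \<ge> 1" and k: "k > 0" shows "bessel_kernel n k \<in> borel_measurable borel"
proof -
  have c: "continuous_on {0<..} (bessel_kernel n k)"
    by (intro continuous_at_imp_continuous_on ballI isCont_bessel_kernel n k) auto
  have "(\<lambda>x. if x \<in> {0<..} then bessel_kernel n k x else 0) \<in> borel_measurable borel"
    by (rule borel_measurable_continuous_on_if[OF _ c]) auto
  moreover have "(\<lambda>x. if x \<in> {0<..} then bessel_kernel n k x else 0) = bessel_kernel n k"
    by (auto simp: bessel_kernel_def)
  ultimately show ?thesis by simp
qed

text \<open>Against the volume factor r^(n + 1) the singularity r^(- n) leaves r, which is bounded
  on the support.\<close>

lemma bessel_kernel_integrable:
  assumes n: "n \<ge> 1" and k: "k > 0" and N: "DIM('a::euclidean_space) = n + 2"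
  shows "integrable lborel (\<lambda>x::'a. bessel_kernel n k (norm x))"
proof -
  note [measurable] = borel_measurable_bessel_kernel[OF n k]
  define \<nu> where "\<nu> = real n / 2"
  define R where "R = first_zero_bessel_Y \<nu> / k"
  obtain C where C: "C > 0" "\<And>x. x > 0 \<Longrightarrow> x powr - \<nu> * \<bar>bessel_Y \<nu> x\<bar> \<le> C * (x powr (- 2 * \<nu>) + 1)"
    using bessel_kernel_bound[OF n] unfolding \<nu>_def by metis
  define D where "D = k powr \<nu> * (C * (k powr (- 2 * \<nu>) * \<bar>R\<bar> + \<bar>R\<bar> ^ (n + 1)))"
  have D0: "D \<ge> 0" using C(1) by (simp add: D_def)
  have bd: "norm (indicator {0<..} r *\<^sub>R (r ^ (n + 1) * bessel_kernel n k r)) \<le> norm (indicator {0..R} r *\<^sub>R D)" for r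
  proof (cases "0 < r \<and> k * r < first_zero_bessel_Y \<nu>")
    case True
    then have r: "0 < r" "r \<le> R" using k by (auto simp: R_def field_simps)
    have e: "r powr - \<nu> = k powr \<nu> * (k * r) powr - \<nu>" using r k by (simp add: powr_mult powr_minus)
    have "\<bar>bessel_kernel n k r\<bar> = r powr - \<nu> * \<bar>bessel_Y \<nu> (k * r)\<bar>"
      using True by (simp add: bessel_kernel_def \<nu>_def[symmetric] abs_mult)
    also have "\<dots> = k powr \<nu> * ((k * r) powr - \<nu> * \<bar>bessel_Y \<nu> (k * r)\<bar>)" unfolding e by simp
    also have "\<dots> \<le> k powr \<nu> * (C * ((k * r) powr (- 2 * \<nu>) + 1))" using C(2)[of "k * r"] k r by (intro mult_left_mono) auto
    finally have "r ^ (n + 1) * \<bar>bessel_kernel n k r\<bar> \<le> r ^ (n + 1) * (k powr \<nu> * (C * ((k * r) powr (- 2 * \<nu>) + 1)))"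
      using r by (intro mult_left_mono) auto
    also have "\<dots> = k powr \<nu> * (C * (k powr (- 2 * \<nu>) * (r ^ (n + 1) * r powr (- 2 * \<nu>)) + r ^ (n + 1)))"
      using k r by (simp add: powr_mult algebra_simps)
    also have "r ^ (n + 1) * r powr (- 2 * \<nu>) = r"
    proof -
      have "r powr (- 2 * \<nu>) = inverse (r ^ n)" using r by (simp add: \<nu>_def powr_minus powr_realpow)
      then show ?thesis using r by simp
    qed
    also have "k powr \<nu> * (C * (k powr (- 2 * \<nu>) * r + r ^ (n + 1))) \<le> D"
      unfolding D_def using r C(1) by (intro mult_left_mono add_mono power_mono) auto
    finally show ?thesis using r by (simp add: abs_mult)
  next
    case False
    then have "indicator {0<..} r *\<^sub>R (r ^ (n + 1) * bessel_kernel n k r) = 0"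
      by (auto simp: bessel_kernel_def \<nu>_def[symmetric])
    then show ?thesis by (simp only: norm_zero norm_ge_zero)
  qed
  have "integrable lborel (\<lambda>r::real. indicator {0..R} r *\<^sub>R D)" by (rule borel_integrable_compact) auto
  then have "integrable lborel (\<lambda>r. indicator {0<..} r *\<^sub>R (r ^ (n + 1) * bessel_kernel n k r))"
    by (rule Bochner_Integration.integrable_bound[OF _ _ AE_I2[OF bd]]) simp
  then show ?thesis unfolding radial_integrable_iff[OF borel_measurable_bessel_kernel[OF n k]] N by simp
qed

lemma bessel_kernel_lagrange:
  fixes s k :: real
  assumes n: "n \<ge> 1" and k: "k > 0" and s: "s \<ge> 0"
  defines "\<nu> \<equiv> real n / 2"
  defines "f \<equiv> \<lambda>r. indicator {0<..} r *\<^sub>R (r ^ (n + 1) * bessel_kernel n k r * bessel_ser \<nu> ((s * r)\<^sup>2 / 4))"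
  assumes int: "integrable lborel f"
  shows "integral\<^sup>L lborel f \<ge> 0"
proof -
  define z where "z = first_zero_bessel_Y \<nu>"
  have z: "z > 0" "bessel_Y \<nu> z = 0" unfolding z_def \<nu>_def by (rule first_zero_bessel_Y[OF n])+
  define R where "R = z / k"
  have R: "R > 0" "k * R = z" using z k by (auto simp: R_def)
  define F where "F = (\<lambda>s r. bessel_ser \<nu> ((s * r)\<^sup>2 / 4))"
  define y where "y = (\<lambda>r. - (r powr - \<nu> * bessel_Y \<nu> (k * r)))"
  \<comment> \<open>P and \<open>Q s\<close> are r^(n + 1) times the derivatives of y and
    \<open>F s\<close>, so that the radial equations read P' = - k^2 r^(n + 1) y and Q' = - s^2 r^(n
    + 1) F.\<close>
  define P where "P = (\<lambda>r. k * r powr (\<nu> + 1) * bessel_Y (\<nu> + 1) (k * r))"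
  define Q where "Q = (\<lambda>s r. - (s\<^sup>2 / 2) * r ^ (n + 2) * bessel_ser (\<nu> + 1) ((s * r)\<^sup>2 / 4))"
  have L: "ladder \<nu> (bessel_Y \<nu>) (bessel_Y (\<nu> + 1))" unfolding \<nu>_def by (rule ladder_bessel_Y')
  have rn: "r ^ (n + 1) = r powr (2 * \<nu> + 1)" if "r > 0" for r
    using that powr_realpow[OF that, of "n + 1"] by (simp add: \<nu>_def add.commute)
  have DY: "((\<lambda>r. bessel_Y \<nu> (k * r)) has_real_derivative (\<nu> / (k * r) * bessel_Y \<nu> (k * r) - bessel_Y (\<nu> + 1) (k * r)) * k) (at r)"
    "((\<lambda>r. bessel_Y (\<nu> + 1) (k * r)) has_real_derivative (bessel_Y \<nu> (k * r) - (\<nu> + 1) / (k * r) * bessel_Y (\<nu> + 1) (k * r)) * k) (at r)"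
    if r: "r > 0" for r
  proof -
    have d: "((\<lambda>r. k * r) has_real_derivative k) (at r)" by (auto intro!: derivative_eq_intros)
    show "((\<lambda>r. bessel_Y \<nu> (k * r)) has_real_derivative (\<nu> / (k * r) * bessel_Y \<nu> (k * r) - bessel_Y (\<nu> + 1) (k * r)) * k) (at r)"
      "((\<lambda>r. bessel_Y (\<nu> + 1) (k * r)) has_real_derivative (bessel_Y \<nu> (k * r) - (\<nu> + 1) / (k * r) * bessel_Y (\<nu> + 1) (k * r)) * k) (at r)"
      using DERIV_chain2[OF ladderD(1)[OF L] d] DERIV_chain2[OF ladderD(2)[OF L] d] k r by simp_all
  qed
  have DF: "(F s has_real_derivative Q s r / r ^ (n + 1)) (at r)" if r: "r > 0" for s r
  proof -
    have d: "((\<lambda>r. (s * r)\<^sup>2 / 4) has_real_derivative s\<^sup>2 * r / 2) (at r)"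
      by (auto intro!: derivative_eq_intros simp: power2_eq_square)
    have "- bessel_ser (\<nu> + 1) ((s * r)\<^sup>2 / 4) * (s\<^sup>2 * r / 2) = Q s r / r ^ (n + 1)"
      using r by (simp add: Q_def)
    then show ?thesis using DERIV_chain2[OF DERIV_bessel_ser d, of \<nu>] unfolding F_def by simp
  qed
  have DQ: "(Q s has_real_derivative - (s\<^sup>2 * r ^ (n + 1) * F s r)) (at r)" if r: "r > 0" for s r
  proof -
    have d: "((\<lambda>r. (s * r)\<^sup>2 / 4) has_real_derivative s\<^sup>2 * r / 2) (at r)"
      by (auto intro!: derivative_eq_intros simp: power2_eq_square)
    note D = DERIV_chain2[OF DERIV_bessel_ser d, of "\<nu> + 1"]
    have n2: "real (n + 2) = 2 * (\<nu> + 1)" by (simp add: \<nu>_def)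
    have d2: "((\<lambda>r. - (s\<^sup>2 / 2) * r ^ (n + 2)) has_real_derivative - (s\<^sup>2 / 2) * (2 * (\<nu> + 1) * r ^ (n + 1))) (at r)"
      unfolding n2[symmetric] by (rule DERIV_cmult) (rule derivative_eq_intros refl | simp)+
    define G1 G2 where "G1 = bessel_ser (\<nu> + 1) ((s * r)\<^sup>2 / 4)" and "G2 = bessel_ser (\<nu> + 1 + 1) ((s * r)\<^sup>2 / 4)"
    have rec: "F s r = (\<nu> + 1) * G1 - (s * r)\<^sup>2 / 4 * G2"
      using bessel_ser_rec[of "\<nu> + 1" "(s * r)\<^sup>2 / 4"] by (simp add: F_def G1_def G2_def)
    have "- (s\<^sup>2 / 2) * (2 * (\<nu> + 1) * r ^ (n + 1)) * G1 + - G2 * (s\<^sup>2 * r / 2) * (- (s\<^sup>2 / 2) * r ^ (n + 2))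
        = - (s\<^sup>2 * r ^ (n + 1) * F s r)"
      unfolding rec by (simp add: algebra_simps power2_eq_square)
    then show ?thesis using DERIV_mult[OF d2 D] unfolding Q_def G1_def G2_def by simp
  qed
  have Dy: "(y has_real_derivative P r / r ^ (n + 1)) (at r)" if r: "r > 0" for r
  proof -
    have p: "((\<lambda>r. r powr - \<nu>) has_real_derivative - \<nu> * r powr (- \<nu> - 1)) (at r)" by (rule has_real_derivative_powr[OF r])
    have p1: "r powr (- \<nu> - 1) = r powr - \<nu> / r" using r by (simp add: powr_diff)
    have p2: "r powr (\<nu> + 1) / r ^ (n + 1) = r powr - \<nu>" unfolding rn[OF r] by (simp flip: powr_diff)
    have "P r / r ^ (n + 1) = k * (r powr (\<nu> + 1) / r ^ (n + 1)) * bessel_Y (\<nu> + 1) (k * r)" by (simp add: P_def)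
    also have "\<dots> = - (- \<nu> * r powr (- \<nu> - 1) * bessel_Y \<nu> (k * r) + (\<nu> / (k * r) * bessel_Y \<nu> (k * r) - bessel_Y (\<nu> + 1) (k * r)) * k * r powr - \<nu>)"
      unfolding p1 p2 using k r by (simp add: field_simps)
    finally show ?thesis using DERIV_minus[OF DERIV_mult[OF p DY(1)[OF r]]] unfolding y_def by simp
  qed
  have DP: "(P has_real_derivative - (k\<^sup>2 * r ^ (n + 1) * y r)) (at r)" if r: "r > 0" for r
  proof -
    have p: "((\<lambda>r. k * r powr (\<nu> + 1)) has_real_derivative k * ((\<nu> + 1) * r powr \<nu>)) (at r)"
      using DERIV_cmult[OF has_real_derivative_powr[OF r, of "\<nu> + 1"], of k] by simp
    have p1: "r powr (\<nu> + 1) = r * r powr \<nu>" using r by (simp add: powr_add)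
    have "2 * \<nu> + 1 + - \<nu> = \<nu> + 1" by simp
    then have p2: "r ^ (n + 1) * r powr - \<nu> = r * r powr \<nu>" unfolding rn[OF r] by (metis powr_add p1)
    have "k * ((\<nu> + 1) * r powr \<nu>) * bessel_Y (\<nu> + 1) (k * r) + (bessel_Y \<nu> (k * r) - (\<nu> + 1) / (k * r) * bessel_Y (\<nu> + 1) (k * r)) * k * (k * r powr (\<nu> + 1))
       = k\<^sup>2 * (r * r powr \<nu>) * bessel_Y \<nu> (k * r)"
      unfolding p1 using k r by (simp add: field_simps power2_eq_square)
    also have "\<dots> = - (k\<^sup>2 * r ^ (n + 1) * y r)" unfolding p2[symmetric] y_def by simp
    finally show ?thesis using DERIV_mult[OF p DY(2)[OF r]] unfolding P_def by simp
  qed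
  \<comment> \<open>The Lagrange bracket of the two equations; its derivative is s^2 - k^2 times the
    integrand.\<close>
  define W where "W = (\<lambda>s r. P r * F s r - y r * Q s r)"
  have DW: "(W s has_real_derivative (s\<^sup>2 - k\<^sup>2) * (r ^ (n + 1) * y r * F s r)) (at r)" if r: "r > 0" for s r
  proof -
    have "- (k\<^sup>2 * r ^ (n + 1) * y r) * F s r + Q s r / r ^ (n + 1) * P r - (P r / r ^ (n + 1) * Q s r + - (s\<^sup>2 * r ^ (n + 1) * F s r) * y r)
      = (s\<^sup>2 - k\<^sup>2) * (r ^ (n + 1) * y r * F s r)" by (simp add: algebra_simps)
    from DERIV_diff[OF DERIV_mult[OF DP[OF r] DF[OF r, of s]] DERIV_mult[OF Dy[OF r] DQ[OF r, of s]], unfolded this]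
    show ?thesis unfolding W_def .
  qed
  obtain A where A: "A > 0" "((\<lambda>x. x powr (\<nu> + 1) * bessel_Y (\<nu> + 1) x) \<longlongrightarrow> - A) (at_right 0)"
    using tendsto_bessel_Y_0[of "Suc n"] by (auto simp: \<nu>_def)
  obtain m where m: "\<nu> = (real m - 1) / 2 + 1" using half_order_cases[OF \<nu>_def[THEN meta_eq_to_obj_eq] n] .
  obtain B where B: "((\<lambda>x. x powr \<nu> * bessel_Y \<nu> x) \<longlongrightarrow> - B) (at_right 0)"
    using tendsto_bessel_Y_0[of m] unfolding m by blast
  have kr: "filterlim (\<lambda>r. k * r) (at_right 0) (at_right 0)"
    using k by real_asymp
  have P0: "(P \<longlongrightarrow> - (A * k powr - \<nu>)) (at_right 0)"
  proof -
    have "((\<lambda>r. k powr - \<nu> * ((k * r) powr (\<nu> + 1) * bessel_Y (\<nu> + 1) (k * r))) \<longlongrightarrow> k powr - \<nu> * - A) (at_right 0)"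
      by (intro tendsto_mult_left filterlim_compose[OF A(2) kr])
    moreover have "\<forall>\<^sub>F r in at_right 0. k powr - \<nu> * ((k * r) powr (\<nu> + 1) * bessel_Y (\<nu> + 1) (k * r)) = P r"
      using eventually_at_right_less
    proof eventually_elim
      case (elim r)
      have "(k * r) powr (\<nu> + 1) = k * k powr \<nu> * r powr (\<nu> + 1)" using k elim by (simp add: powr_mult powr_add)
      then show ?case using k by (simp add: P_def powr_minus field_simps)
    qed
    ultimately show ?thesis using Lim_transform_eventually by (fastforce simp: mult.commute)
  qed
  have F0: "(F s \<longlongrightarrow> rGamma (\<nu> + 1)) (at_right 0)" for s
  proof -
    have "((\<lambda>r::real. (s * r)\<^sup>2 / 4) \<longlongrightarrow> 0) (at_right 0)" by (auto intro!: tendsto_eq_intros)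
    from isCont_tendsto_compose[OF isCont_bessel_ser this] show ?thesis by (simp add: F_def)
  qed
  have yQ0: "((\<lambda>r. y r * Q s r) \<longlongrightarrow> 0) (at_right 0)" for s
  proof -
    have s0: "((\<lambda>r::real. (s * r)\<^sup>2 / 4) \<longlongrightarrow> 0) (at_right 0)" by (auto intro!: tendsto_eq_intros)
    have "((\<lambda>r. k powr - \<nu> * (s\<^sup>2 / 2) * (r\<^sup>2) * ((k * r) powr \<nu> * bessel_Y \<nu> (k * r)) * bessel_ser (\<nu> + 1) ((s * r)\<^sup>2 / 4))
      \<longlongrightarrow> k powr - \<nu> * (s\<^sup>2 / 2) * (0\<^sup>2) * - B * bessel_ser (\<nu> + 1) 0) (at_right 0)"
      by (intro tendsto_intros filterlim_compose[OF B kr] isCont_tendsto_compose[OF isCont_bessel_ser s0])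
    moreover have "\<forall>\<^sub>F r in at_right 0. k powr - \<nu> * (s\<^sup>2 / 2) * (r\<^sup>2) * ((k * r) powr \<nu> * bessel_Y \<nu> (k * r)) * bessel_ser (\<nu> + 1) ((s * r)\<^sup>2 / 4) = y r * Q s r"
      using eventually_at_right_less
    proof eventually_elim
      case (elim r)
      have p1: "k powr - \<nu> * (k * r) powr \<nu> = r powr \<nu>" using k elim by (simp add: powr_mult powr_minus)
      have "2 * \<nu> + 1 + - \<nu> = \<nu> + 1" by simp
      then have "r powr (2 * \<nu> + 1) * r powr - \<nu> = r powr (\<nu> + 1)" by (metis powr_add)
      then have "r ^ (n + 1) * r powr - \<nu> = r * r powr \<nu>" unfolding rn[OF elim] using elim by (simp add: powr_add)
      then have p2: "r ^ (n + 2) * r powr - \<nu> = r\<^sup>2 * r powr \<nu>" by (simp add: power2_eq_square)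
      have "y r * Q s r = (s\<^sup>2 / 2) * (r ^ (n + 2) * r powr - \<nu>) * bessel_Y \<nu> (k * r) * bessel_ser (\<nu> + 1) ((s * r)\<^sup>2 / 4)"
        by (simp add: y_def Q_def)
      also have "\<dots> = (s\<^sup>2 / 2) * (r\<^sup>2 * (k powr - \<nu> * (k * r) powr \<nu>)) * bessel_Y \<nu> (k * r) * bessel_ser (\<nu> + 1) ((s * r)\<^sup>2 / 4)"
        unfolding p1 p2 ..
      finally show ?case by (simp add: mult_ac)
    qed
    ultimately show ?thesis by (auto dest: Lim_transform_eventually)
  qed
  \<comment> \<open>Minus the limit of \<open>W s\<close> at 0. It stems from the singularity of the
    kernel and is the same for all s.\<close>
  define a where "a = A * k powr - \<nu> * rGamma (\<nu> + 1)"
  have a: "a > 0" using A(1) k rGamma_pos[of "\<nu> + 1"] by (simp add: a_def \<nu>_def)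
  have W0: "(W s \<longlongrightarrow> - a) (at_right 0)" for s
    using tendsto_diff[OF tendsto_mult[OF P0 F0[of s]] yQ0[of s]] unfolding W_def a_def by simp
  have WR: "(W s \<longlongrightarrow> P R * F s R) (at_left R)" for s
  proof -
    have "isCont (W s) R" by (rule DERIV_isCont[OF DW[OF R(1)]])
    moreover have "W s R = P R * F s R" unfolding W_def y_def R(2) z(2) by simp
    ultimately show ?thesis by (metis isCont_def filterlim_at_split)
  qed
  have ffs: "f r = indicator {0<..<R} r *\<^sub>R (r ^ (n + 1) * y r * F s r)" for r
  proof -
    have "k * r < z \<longleftrightarrow> r < R" using k by (simp add: R_def pos_less_divide_eq mult.commute)
    then show ?thesis by (auto simp: f_def bessel_kernel_def \<nu>_def[symmetric] z_def[symmetric] y_def F_def split: split_indicator)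
  qed
  have cont: "isCont (\<lambda>r. (s\<^sup>2 - k\<^sup>2) * (r ^ (n + 1) * y r * F s r)) r" if "r > 0" for s r
    by (intro continuous_intros DERIV_isCont[OF Dy] DERIV_isCont[OF DF] that)
  have main: "(LINT r|lborel. indicator {0<..<R} r *\<^sub>R ((s\<^sup>2 - k\<^sup>2) * (r ^ (n + 1) * y r * F s r))) = P R * F s R + a"
    if i: "integrable lborel (\<lambda>r. indicator {0<..<R} r *\<^sub>R ((s\<^sup>2 - k\<^sup>2) * (r ^ (n + 1) * y r * F s r)))" for s
    using FTC_open_interval[OF R(1) DW[THEN has_real_derivative_iff_has_vector_derivative[THEN iffD1]] cont i W0 WR] by simp
  \<comment> \<open>At s = k the integrand vanishes, so the identity itself evaluates the flux P at
    R, without a value of Y_(\<nu>+1) at z.\<close>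
  have PR: "P R * F k R + a = 0" using main[of k] by simp
  have Fk: "F k R > 0" using bessel_ser_before_first_zero(1)[OF n] unfolding F_def R(2) z_def \<nu>_def .
  have eq: "(s\<^sup>2 - k\<^sup>2) * integral\<^sup>L lborel f = P R * F s R + a"
  proof -
    have e: "indicator {0<..<R} r *\<^sub>R ((s\<^sup>2 - k\<^sup>2) * (r ^ (n + 1) * y r * F s r)) = (s\<^sup>2 - k\<^sup>2) * f r" for r
      unfolding ffs by simp
    have "integrable lborel (\<lambda>r. indicator {0<..<R} r *\<^sub>R ((s\<^sup>2 - k\<^sup>2) * (r ^ (n + 1) * y r * F s r)))"
      unfolding e by (intro integrable_mult_right int)
    from main[OF this] show ?thesis unfolding e by simp
  qed
  also have "\<dots> * F k R = a * (F k R - F s R)"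
  proof -
    have "P R * F k R = - a" using PR by linarith
    then have "P R * F k R * F s R = - a * F s R" by simp
    then show ?thesis by (simp add: algebra_simps)
  qed
  finally have eq2: "(s\<^sup>2 - k\<^sup>2) * integral\<^sup>L lborel f * F k R = a * (F k R - F s R)" .
  consider "s < k" | "s = k" | "s > k" by linarith
  then show ?thesis
  proof cases
    case 1
    have "s * R \<le> z" using 1 R by (metis less_imp_le mult_right_mono)
    then have "F k R \<le> F s R" unfolding F_def R(2) z_def \<nu>_def using s R(1)
      by (intro bessel_ser_before_first_zero(2)[OF n]) auto
    then have "(s\<^sup>2 - k\<^sup>2) * integral\<^sup>L lborel f * F k R \<le> 0" unfolding eq2 using a by (simp add: mult_le_0_iff)
    then have "(s\<^sup>2 - k\<^sup>2) * integral\<^sup>L lborel f \<le> 0" using Fk by (simp add: mult_le_0_iff)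
    moreover have "s\<^sup>2 - k\<^sup>2 < 0" using 1 s by (simp add: power_strict_mono)
    ultimately show ?thesis by (simp add: mult_le_0_iff)
  next
    case 2
    \<comment> \<open>For s = k the identity is void. Here the integrand is nonnegative, since the
      series stays above its positive value at z.\<close>
    show ?thesis
    proof (rule integral_nonneg_AE[OF AE_I2])
      fix r
      show "0 \<le> f r"
      proof (cases "0 < r \<and> r < R")
        case True
        have "k * r \<le> z" using True k R by (metis less_imp_le mult_left_mono)
        then have "F k R \<le> F k r" unfolding F_def R(2) z_def \<nu>_def using k True
          by (intro bessel_ser_before_first_zero(2)[OF n]) auto
        then show ?thesis using True bessel_kernel_nonneg[OF n k, of r] Fk unfolding f_def 2 by (simp add: F_def)
      qed (auto simp: ffs)
    qed
  next
    case 3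
    have "z \<le> s * R" using 3 R by (metis less_imp_le mult_right_mono)
    then have "F s R \<le> F k R" unfolding F_def R(2) z_def \<nu>_def
      by (intro bessel_ser_after_first_zero[OF n]) auto
    then have "(s\<^sup>2 - k\<^sup>2) * integral\<^sup>L lborel f * F k R \<ge> 0" unfolding eq2 using a by simp
    then have "(s\<^sup>2 - k\<^sup>2) * integral\<^sup>L lborel f \<ge> 0" using Fk by (simp add: zero_le_mult_iff)
    moreover have "s\<^sup>2 - k\<^sup>2 > 0" using 3 k by (simp add: power_strict_mono)
    ultimately show ?thesis by (simp add: zero_le_mult_iff)
  qed
qed

lemma bessel_kernel_FT_nonneg:
  fixes \<xi> :: "'a::euclidean_space"
  assumes n: "n \<ge> 1" and k: "k > 0" and N: "DIM('a) = n + 2"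
  shows "0 \<le> (LINT x|lborel. cos (\<xi> \<bullet> x) * bessel_kernel n k (norm x))"
proof -
  note km = borel_measurable_bessel_kernel[OF n k]
  define z where "z = first_zero_bessel_Y (real n / 2)"
  define b where "b = (\<lambda>r. indicator {0<..} r *\<^sub>R (r ^ (n + 1) * bessel_kernel n k r * bessel_ser (real n / 2) ((norm \<xi> * r)\<^sup>2 / 4)))"
  have out: "bessel_kernel n k r = 0" if "r > z / k" for r
    using that k by (auto simp: bessel_kernel_def z_def divide_less_eq mult.commute)
  have int: "integrable lborel (\<lambda>r. indicator {0<..} r *\<^sub>R (r ^ (n + 1) * bessel_kernel n k r))"
    using bessel_kernel_integrable[OF n k N] unfolding radial_integrable_iff[OF km] N by simp
  have c: "continuous_on {0..z/k} (\<lambda>r. bessel_ser (real n / 2) ((norm \<xi> * r)\<^sup>2 / 4))"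
    by (intro continuous_at_imp_continuous_on ballI isCont_o2[OF _ isCont_bessel_ser] continuous_intros) auto
  obtain B where B: "\<And>r. r \<in> {0..z/k} \<Longrightarrow> \<bar>bessel_ser (real n / 2) ((norm \<xi> * r)\<^sup>2 / 4)\<bar> \<le> B"
    using compact_imp_bounded[OF compact_continuous_image[OF c compact_Icc]] unfolding bounded_iff by fastforce
  have cc: "continuous_on UNIV (\<lambda>r. bessel_ser (real n / 2) ((norm \<xi> * r)\<^sup>2 / 4))"
    by (intro continuous_at_imp_continuous_on ballI isCont_o2[OF _ isCont_bessel_ser] continuous_intros) auto
  have [measurable]: "(\<lambda>r. bessel_ser (real n / 2) ((norm \<xi> * r)\<^sup>2 / 4)) \<in> borel_measurable borel"
    by (rule borel_measurable_continuous_onI[OF cc])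
  have bint: "integrable lborel b"
  proof (rule Bochner_Integration.integrable_bound[OF integrable_mult_right[OF int, of B] _ AE_I2])
    show "b \<in> borel_measurable lborel" unfolding b_def using km by measurable
    fix r
    show "norm (b r) \<le> norm (B * (indicator {0<..} r *\<^sub>R (r ^ (n + 1) * bessel_kernel n k r)))"
    proof (cases "0 < r \<and> r \<le> z / k")
      case True
      have "\<bar>r ^ (n + 1) * bessel_kernel n k r\<bar> * \<bar>bessel_ser (real n / 2) ((norm \<xi> * r)\<^sup>2 / 4)\<bar> \<le> \<bar>r ^ (n + 1) * bessel_kernel n k r\<bar> * \<bar>B\<bar>"
        using B[of r] True by (intro mult_left_mono) auto
      then show ?thesis using True by (simp add: b_def abs_mult mult_ac)
    next
      case False
      then have "b r = 0" using out[of r] by (auto simp: b_def)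
      then show ?thesis by simp
    qed
  qed
  have "(LINT x|lborel. cos (\<xi> \<bullet> x) * bessel_kernel n k (norm x)) = sphere_const TYPE('a) * integral\<^sup>L lborel b"
    using radial_cos_integral[OF km _ out bessel_kernel_integrable[OF n k N], where \<xi> = \<xi>] N
    by (simp add: b_def add_divide_distrib)
  moreover have "integral\<^sup>L lborel b \<ge> 0"
    using bessel_kernel_lagrange[OF n k norm_ge_zero[of \<xi>]] bint unfolding b_def by blast
  moreover have "sphere_const TYPE('a) \<ge> 0" by (simp add: sphere_const_def)
  ultimately show ?thesis by simp
qed

section \<open>From a nonnegative Fourier transform to a positive definite kernel\<close>

lemma lborel_affine_integral:
  fixes f :: "'a::euclidean_space \<Rightarrow> 'b::{banach, second_countable_topology}"
  assumes [measurable]: "f \<in> borel_measurable borel" and c: "c \<noteq> 0"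
  shows "integrable lborel (\<lambda>x. f (t + c *\<^sub>R x)) \<longleftrightarrow> integrable lborel f"
    and "\<bar>c\<bar> ^ DIM('a) *\<^sub>R (LINT x|lborel. f (t + c *\<^sub>R x)) = integral\<^sup>L lborel f"
proof -
  define K where "K = \<bar>c\<bar> ^ DIM('a)"
  have K: "K > 0" using c by (simp add: K_def)
  have L: "lborel = density (distr lborel borel (\<lambda>x::'a. t + c *\<^sub>R x)) (\<lambda>_. ennreal K)"
    using lborel_affine[OF c, of t] c by (simp add: K_def)
  have "integrable lborel f \<longleftrightarrow> integrable (density (distr lborel borel (\<lambda>x::'a. t + c *\<^sub>R x)) (\<lambda>_. ennreal K)) f"
    using L by simp
  also have "\<dots> \<longleftrightarrow> integrable lborel (\<lambda>x. K *\<^sub>R f (t + c *\<^sub>R x))"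
    using K by (subst integrable_density, simp, simp, simp, subst integrable_distr_eq, simp, simp, simp)
  also have "\<dots> \<longleftrightarrow> integrable lborel (\<lambda>x. f (t + c *\<^sub>R x))"
  proof
    assume "integrable lborel (\<lambda>x. K *\<^sub>R f (t + c *\<^sub>R x))"
    from integrable_scaleR_right[OF this, of "1 / K"] show "integrable lborel (\<lambda>x. f (t + c *\<^sub>R x))"
      using K by simp
  qed (rule integrable_scaleR_right)
  finally show "integrable lborel (\<lambda>x. f (t + c *\<^sub>R x)) \<longleftrightarrow> integrable lborel f" by simp
  have "integral\<^sup>L lborel f = integral\<^sup>L (density (distr lborel borel (\<lambda>x::'a. t + c *\<^sub>R x)) (\<lambda>_. ennreal K)) f"
    using L by simp
  also have "\<dots> = (LINT x|lborel. K *\<^sub>R f (t + c *\<^sub>R x))"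
    using K by (subst integral_density, simp, simp, simp, subst integral_distr, simp, simp, simp)
  finally show "K *\<^sub>R (LINT x|lborel. f (t + c *\<^sub>R x)) = integral\<^sup>L lborel f" by simp
qed

lemma lborel_translate_integral:
  fixes f :: "'a::euclidean_space \<Rightarrow> 'b::{banach, second_countable_topology}"
  assumes [measurable]: "f \<in> borel_measurable borel"
  shows "integrable lborel (\<lambda>x. f (x + t)) \<longleftrightarrow> integrable lborel f" "(LINT x|lborel. f (x + t)) = integral\<^sup>L lborel f"
    and "integrable lborel (\<lambda>x. f (t - x)) \<longleftrightarrow> integrable lborel f" "(LINT x|lborel. f (t - x)) = integral\<^sup>L lborel f"
  using lborel_affine_integral[OF assms, of 1 t] lborel_affine_integral[OF assms, of "-1" t] by (simp_all add: add.commute)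

text \<open>Scheffe's lemma: the translates converge almost everywhere, and all have the same
  norm.\<close>

lemma tendsto_translate_L1:
  fixes \<kappa> :: "'a::euclidean_space \<Rightarrow> 'b::{banach, second_countable_topology}"
  assumes [measurable]: "\<kappa> \<in> borel_measurable borel" and int: "integrable lborel \<kappa>"
    and c: "\<And>x. x \<noteq> 0 \<Longrightarrow> isCont \<kappa> x" and v: "v \<longlonglongrightarrow> 0"
  shows "(\<lambda>n. LINT x|lborel. norm (\<kappa> (x + v n) - \<kappa> x)) \<longlonglongrightarrow> 0"
proof -
  have tint: "integrable lborel (\<lambda>x. \<kappa> (x + t))" for t using lborel_translate_integral(1)[OF assms(1)] int by simp
  have "(\<lambda>n. \<integral>\<^sup>+ x. norm (\<kappa> (x + v n) - \<kappa> x) \<partial>lborel) \<longlonglongrightarrow> 0"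
  proof (rule Scheffe_lemma2)
    show "AE x in lborel. (\<lambda>n. \<kappa> (x + v n)) \<longlonglongrightarrow> \<kappa> x"
    proof (rule AE_mp[OF AE_lborel_singleton[of "0::'a"] AE_I2[OF impI]])
      fix x :: 'a assume "x \<noteq> 0"
      have "(\<lambda>n. x + v n) \<longlonglongrightarrow> x" using tendsto_add[OF tendsto_const v, of x] by simp
      from isCont_tendsto_compose[OF c[OF \<open>x \<noteq> 0\<close>] this] show "(\<lambda>n. \<kappa> (x + v n)) \<longlonglongrightarrow> \<kappa> x" .
    qed
    show "(\<integral>\<^sup>+ x. norm (\<kappa> (x + v n)) \<partial>lborel) \<le> (\<integral>\<^sup>+ x. norm (\<kappa> x) \<partial>lborel)" for n
    proof -
      have "(\<lambda>x. norm (\<kappa> x)) \<in> borel_measurable borel" by measurable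
      from lborel_translate_integral(2)[OF this, of "v n"] show ?thesis
        by (simp add: nn_integral_eq_integral integrable_norm[OF int] integrable_norm[OF tint])
    qed
  qed (simp_all add: int)
  moreover have "(\<integral>\<^sup>+ x. norm (\<kappa> (x + v n) - \<kappa> x) \<partial>lborel) = ennreal (LINT x|lborel. norm (\<kappa> (x + v n) - \<kappa> x))" for n
    by (rule nn_integral_eq_integral) (simp_all add: tint int)
  ultimately show ?thesis by (simp add: tendsto_ennreal_iff flip: ennreal_0)
qed

definition cross_corr :: "('a::euclidean_space \<Rightarrow> real) \<Rightarrow> ('a \<Rightarrow> real) \<Rightarrow> 'a \<Rightarrow> real"
  where "cross_corr f g v = (LINT w|lborel. f w * g (w + v))"

text \<open>The last two formulas are the real and the imaginary part of the product of the
  conjugate transform of f with the transform of g.\<close>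

lemma cross_corr:
  fixes f g :: "'a::euclidean_space \<Rightarrow> real"
  assumes [measurable]: "f \<in> borel_measurable borel" "g \<in> borel_measurable borel"
    and f: "integrable lborel f" and g: "integrable lborel g"
  shows "integrable lborel (cross_corr f g)" "cross_corr f g \<in> borel_measurable borel"
    and "(LINT v|lborel. cos (\<xi> \<bullet> v) * cross_corr f g v) =
      (LINT v|lborel. cos (\<xi> \<bullet> v) * f v) * (LINT v|lborel. cos (\<xi> \<bullet> v) * g v)
      + (LINT v|lborel. sin (\<xi> \<bullet> v) * f v) * (LINT v|lborel. sin (\<xi> \<bullet> v) * g v)" (is ?C)
    and "(LINT v|lborel. sin (\<xi> \<bullet> v) * cross_corr f g v) =
      (LINT v|lborel. cos (\<xi> \<bullet> v) * f v) * (LINT v|lborel. sin (\<xi> \<bullet> v) * g v)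
      - (LINT v|lborel. sin (\<xi> \<bullet> v) * f v) * (LINT v|lborel. cos (\<xi> \<bullet> v) * g v)" (is ?S)
proof -
  show "cross_corr f g \<in> borel_measurable borel"
    unfolding cross_corr_def by measurable
  have gt: "integrable lborel (\<lambda>v. g (w + v))" for w
    using lborel_translate_integral(1)[OF assms(2), of w] g by (simp add: add.commute)
  have P: "integrable (lborel \<Otimes>\<^sub>M lborel) (\<lambda>(w, v). e v * (f w * g (w + v)))"
    if [measurable]: "e \<in> borel_measurable borel" and e: "\<And>v. \<bar>e v\<bar> \<le> 1" for e :: "'a \<Rightarrow> real"
  proof (rule Bochner_Integration.integrable_bound)
    show "integrable (lborel \<Otimes>\<^sub>M lborel) (\<lambda>(w::'a, v). f w * g (w + v))"
    proof (rule lborel_pair.Fubini_integrable)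
      show "(\<lambda>(w::'a, v). f w * g (w + v)) \<in> borel_measurable (lborel \<Otimes>\<^sub>M lborel)" by measurable
      have "(LINT v|lborel. \<bar>g (w + v)\<bar>) = (LINT v|lborel. \<bar>g v\<bar>)" for w
        using lborel_translate_integral(2)[of "\<lambda>v. \<bar>g v\<bar>" w] by (simp add: add.commute)
      then show "integrable lborel (\<lambda>w. LINT v|lborel. norm (case (w, v) of (w, v) \<Rightarrow> f w * g (w + v)))"
        using f by (simp add: abs_mult)
      show "AE w in lborel. integrable lborel (\<lambda>v. case (w, v) of (w, v) \<Rightarrow> f w * g (w + v))"
        using gt by simp
    qed
    show "AE x in lborel \<Otimes>\<^sub>M lborel. norm (case x of (w, v) \<Rightarrow> e v * (f w * g (w + v))) \<le> norm (case x of (w, v) \<Rightarrow> f w * g (w + v))"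
      using e by (auto simp: abs_mult mult_le_cancel_right1 intro!: AE_I2 mult_left_le_one_le)
  qed measurable
  have "integrable lborel (\<lambda>v. LINT w|lborel. f w * g (w + v))"
    using lborel_pair.integrable_snd[OF P[of "\<lambda>_. 1"]] by simp
  then show "integrable lborel (cross_corr f g)" unfolding cross_corr_def .
  have cm: "(\<lambda>v. cos (\<xi> \<bullet> v)) \<in> borel_measurable borel" and sm: "(\<lambda>v. sin (\<xi> \<bullet> v)) \<in> borel_measurable borel" by measurable
  have ci: "integrable lborel (\<lambda>v. cos (\<xi> \<bullet> v) * h v)" "integrable lborel (\<lambda>v. sin (\<xi> \<bullet> v) * h v)"
    if h: "integrable lborel h" "h \<in> borel_measurable borel" for h :: "'a \<Rightarrow> real"
    by (rule Bochner_Integration.integrable_bound[OF h(1)], use h(2) in measurable, auto simp: abs_mult intro!: AE_I2 mult_left_le_one_le)+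
  have swap: "(LINT v|lborel. e v * cross_corr f g v) = (LINT w|lborel. f w * (LINT u|lborel. e (u - w) * g u))"
    if em [measurable]: "e \<in> borel_measurable borel" and e: "\<And>v. \<bar>e v\<bar> \<le> 1" for e :: "'a \<Rightarrow> real"
  proof -
    have "(LINT v|lborel. e v * cross_corr f g v) = (LINT v|lborel. LINT w|lborel. e v * (f w * g (w + v)))"
      unfolding cross_corr_def by simp
    also have "\<dots> = (LINT w|lborel. LINT v|lborel. e v * (f w * g (w + v)))"
      by (rule lborel_pair.Fubini_integral[OF P[OF em e]])
    also have "\<dots> = (LINT w|lborel. f w * (LINT u|lborel. e (u - w) * g u))"
    proof (rule Bochner_Integration.integral_cong[OF refl])
      fix w
      have "(\<lambda>u. e (u - w) * g u) \<in> borel_measurable borel" by measurable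
      from lborel_translate_integral(2)[OF this, of w]
      have "(LINT u|lborel. e (u - w) * g u) = (LINT v|lborel. e v * g (w + v))" by (simp add: add.commute)
      then show "(LINT v|lborel. e v * (f w * g (w + v))) = f w * (LINT u|lborel. e (u - w) * g u)"
        by (simp only: mult.left_commute[of "e _"] integral_mult_right_zero)
    qed
    finally show ?thesis .
  qed
  have c: "(LINT u|lborel. cos (\<xi> \<bullet> (u - w)) * g u) = cos (\<xi> \<bullet> w) * (LINT u|lborel. cos (\<xi> \<bullet> u) * g u)
      + sin (\<xi> \<bullet> w) * (LINT u|lborel. sin (\<xi> \<bullet> u) * g u)" for w
  proof -
    have "cos (\<xi> \<bullet> (u - w)) * g u = cos (\<xi> \<bullet> w) * (cos (\<xi> \<bullet> u) * g u) + sin (\<xi> \<bullet> w) * (sin (\<xi> \<bullet> u) * g u)" for u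
      by (simp add: inner_diff_right cos_diff algebra_simps)
    then show ?thesis using ci[OF g assms(2)] by simp
  qed
  have s: "(LINT u|lborel. sin (\<xi> \<bullet> (u - w)) * g u) = cos (\<xi> \<bullet> w) * (LINT u|lborel. sin (\<xi> \<bullet> u) * g u)
      - sin (\<xi> \<bullet> w) * (LINT u|lborel. cos (\<xi> \<bullet> u) * g u)" for w
  proof -
    have "sin (\<xi> \<bullet> (u - w)) * g u = cos (\<xi> \<bullet> w) * (sin (\<xi> \<bullet> u) * g u) - sin (\<xi> \<bullet> w) * (cos (\<xi> \<bullet> u) * g u)" for u
      by (simp add: inner_diff_right sin_diff algebra_simps)
    then show ?thesis using ci[OF g assms(2)] by simp
  qed
  have e1: "f w * (cos (\<xi> \<bullet> w) * G + sin (\<xi> \<bullet> w) * H) = cos (\<xi> \<bullet> w) * f w * G + sin (\<xi> \<bullet> w) * f w * H"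
    "f w * (cos (\<xi> \<bullet> w) * G - sin (\<xi> \<bullet> w) * H) = cos (\<xi> \<bullet> w) * f w * G - sin (\<xi> \<bullet> w) * f w * H" for w G H
    by (simp_all add: algebra_simps)
  show ?C using ci[OF f assms(1)] by (simp add: swap[OF cm] c e1)
  show ?S using ci[OF f assms(1)] by (simp add: swap[OF sm] s e1)
qed

text \<open>By Fubini and the Gaussian transform, averaging \<Theta> against a Gaussian of width
  \<epsilon> is a Gaussian average of its transform, hence nonnegative. For \<epsilon> to 0 these
  averages tend to a positive multiple of \<Theta> 0. The transform need not be integrable, as it
  would for Fourier inversion.\<close>

lemma nonneg_at_0_if_FT_nonneg:
  fixes \<Theta> :: "'a::euclidean_space \<Rightarrow> real"
  assumes [measurable]: "\<Theta> \<in> borel_measurable borel" and int: "integrable lborel \<Theta>"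
    and B: "\<And>v. \<bar>\<Theta> v\<bar> \<le> B" and c: "\<And>v. v \<longlonglongrightarrow> 0 \<Longrightarrow> (\<lambda>n. \<Theta> (v n)) \<longlonglongrightarrow> \<Theta> 0"
    and pos: "\<And>\<xi>. 0 \<le> (LINT v|lborel. cos (\<xi> \<bullet> v) * \<Theta> v)"
  shows "\<Theta> 0 \<ge> 0"
proof -
  define Z where "Z = sqrt (2 * pi) ^ DIM('a)"
  have Z: "Z > 0" by (simp add: Z_def)
  define G where "G = (\<lambda>x::'a. exp (- (norm x)\<^sup>2 / 2))"
  have [measurable]: "G \<in> borel_measurable borel" unfolding G_def by measurable
  have G0: "G x > 0" for x by (simp add: G_def)
  have Gint: "integrable lborel G" unfolding G_def by (rule gauss_integrable_euclidean)
  have FT: "(LINT \<xi>|lborel. G \<xi> * cos (v \<bullet> \<xi>)) = Z * G v" for v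
  proof -
    have "(LINT \<xi>|lborel. G \<xi> * cos (v \<bullet> \<xi>)) = (LINT \<xi>|lborel. Re (G \<xi> *\<^sub>R iexp (v \<bullet> \<xi>)))"
      by (simp add: cis_conv_exp[symmetric])
    also have "\<dots> = Re (of_real (Z * G v))"
      by (subst integral_Re) (simp_all only: gauss_FT G_def Z_def)
    finally show ?thesis by simp
  qed
  have pos_eps: "0 \<le> (LINT \<eta>|lborel. G \<eta> * \<Theta> (\<epsilon> *\<^sub>R \<eta>))" if \<epsilon>: "\<epsilon> > 0" for \<epsilon>
  proof -
    have P: "integrable (lborel \<Otimes>\<^sub>M lborel) (\<lambda>(v::'a, \<xi>). \<Theta> v * (G \<xi> * cos ((inverse \<epsilon> *\<^sub>R v) \<bullet> \<xi>)))"
    proof (rule Bochner_Integration.integrable_bound)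
      show "integrable (lborel \<Otimes>\<^sub>M lborel) (\<lambda>(v::'a, \<xi>). \<Theta> v * G \<xi>)"
      proof (rule lborel_pair.Fubini_integrable)
        show "(\<lambda>(v::'a, \<xi>). \<Theta> v * G \<xi>) \<in> borel_measurable (lborel \<Otimes>\<^sub>M lborel)" by measurable
        show "integrable lborel (\<lambda>v. LINT \<xi>|lborel. norm (case (v, \<xi>) of (v, \<xi>) \<Rightarrow> \<Theta> v * G \<xi>))"
          using int by (simp add: abs_mult)
        show "AE v in lborel. integrable lborel (\<lambda>\<xi>. case (v, \<xi>) of (v, \<xi>) \<Rightarrow> \<Theta> v * G \<xi>)"
          using Gint by simp
      qed
      show "AE x in lborel \<Otimes>\<^sub>M lborel. norm (case x of (v, \<xi>) \<Rightarrow> \<Theta> v * (G \<xi> * cos ((inverse \<epsilon> *\<^sub>R v) \<bullet> \<xi>))) \<le> norm (case x of (v, \<xi>) \<Rightarrow> \<Theta> v * G \<xi>)"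
        by (auto simp: abs_mult intro!: AE_I2 mult_left_mono mult_right_le_one_le)
    qed measurable
    have m: "(\<lambda>v. \<Theta> v * (Z * G (inverse \<epsilon> *\<^sub>R v))) \<in> borel_measurable borel" by measurable
    have "\<bar>\<epsilon>\<bar> ^ DIM('a) *\<^sub>R (LINT \<eta>|lborel. Z * (G \<eta> * \<Theta> (\<epsilon> *\<^sub>R \<eta>))) = (LINT v|lborel. \<Theta> v * (Z * G (inverse \<epsilon> *\<^sub>R v)))"
      using lborel_affine_integral(2)[OF m, of \<epsilon> 0] \<epsilon> by (simp add: mult_ac)
    also have "\<dots> = (LINT v|lborel. LINT \<xi>|lborel. \<Theta> v * (G \<xi> * cos ((inverse \<epsilon> *\<^sub>R v) \<bullet> \<xi>)))"
      unfolding FT[symmetric] by simp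
    also have "\<dots> = (LINT \<xi>|lborel. LINT v|lborel. \<Theta> v * (G \<xi> * cos ((inverse \<epsilon> *\<^sub>R v) \<bullet> \<xi>)))"
      by (rule lborel_pair.Fubini_integral[OF P, symmetric])
    also have "\<dots> = (LINT \<xi>|lborel. G \<xi> * (LINT v|lborel. cos ((inverse \<epsilon> *\<^sub>R \<xi>) \<bullet> v) * \<Theta> v))"
      by (simp add: mult_ac inner_commute flip: integral_mult_right_zero)
    also have "\<dots> \<ge> 0"
      by (intro integral_nonneg_AE AE_I2 mult_nonneg_nonneg pos) (simp add: G_def)
    finally have "0 \<le> \<bar>\<epsilon>\<bar> ^ DIM('a) *\<^sub>R (LINT \<eta>|lborel. Z * (G \<eta> * \<Theta> (\<epsilon> *\<^sub>R \<eta>)))" .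
    moreover have "\<bar>\<epsilon>\<bar> ^ DIM('a) > 0" using \<epsilon> by simp
    ultimately show ?thesis using Z by (simp add: zero_le_mult_iff)
  qed
  have "(\<lambda>n. LINT \<eta>|lborel. G \<eta> * \<Theta> (inverse (real (Suc n)) *\<^sub>R \<eta>)) \<longlonglongrightarrow> (LINT \<eta>|lborel. G \<eta> * \<Theta> 0)"
  proof (rule integral_dominated_convergence)
    show "integrable lborel (\<lambda>\<eta>. G \<eta> * B)" using Gint by simp
    show "AE \<eta> in lborel. (\<lambda>n. G \<eta> * \<Theta> (inverse (real (Suc n)) *\<^sub>R \<eta>)) \<longlonglongrightarrow> G \<eta> * \<Theta> 0"
    proof (intro AE_I2 tendsto_mult_left c)
      fix \<eta> :: 'a
      show "(\<lambda>n. inverse (real (Suc n)) *\<^sub>R \<eta>) \<longlonglongrightarrow> 0"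
        using tendsto_scaleR[OF LIMSEQ_inverse_real_of_nat tendsto_const, of \<eta>] by simp
    qed
    show "AE \<eta> in lborel. norm (G \<eta> * \<Theta> (inverse (real (Suc n)) *\<^sub>R \<eta>)) \<le> G \<eta> * B" for n
      using mult_left_mono[OF B less_imp_le[OF G0]] G0 by (simp add: abs_mult less_imp_le)
  qed measurable
  then have "0 \<le> (LINT \<eta>|lborel. G \<eta> * \<Theta> 0)"
    by (rule LIMSEQ_le_const) (use pos_eps in auto)
  moreover have "(LINT \<eta>|lborel. G \<eta>) = Z" using FT[of 0] by (simp add: G_def)
  ultimately show ?thesis using Z by (simp add: zero_le_mult_iff)
qed

text \<open>The form is \<Theta> 0 for the correlation \<Theta> of \<kappa> with the autocorrelation
  h of g. The sine transform of h vanishes and its cosine transform is the squared modulus of the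
  transform of g, so the cosine transform of \<Theta> is that of \<kappa> times a square.\<close>

lemma positive_definite_kernel:
  fixes \<kappa> g :: "'a::euclidean_space \<Rightarrow> real"
  assumes km [measurable]: "\<kappa> \<in> borel_measurable borel" and int: "integrable lborel \<kappa>"
    and c: "\<And>x. x \<noteq> 0 \<Longrightarrow> isCont \<kappa> x"
    and pos: "\<And>\<xi>. 0 \<le> (LINT v|lborel. cos (\<xi> \<bullet> v) * \<kappa> v)"
    and gm [measurable]: "g \<in> borel_measurable borel" and g: "integrable lborel g" and B: "\<And>x. \<bar>g x\<bar> \<le> B"
  shows "0 \<le> (LINT w|lborel. \<kappa> w * cross_corr g g w)"
proof -
  define h where "h = cross_corr g g"
  note h = cross_corr[OF gm gm g g, folded h_def]
  have hm [measurable]: "h \<in> borel_measurable borel" by (rule h(2))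
  have gt: "integrable lborel (\<lambda>w. g (w + v))" for v using lborel_translate_integral(1)[OF gm] g by simp
  define H where "H = B * (LINT w|lborel. \<bar>g w\<bar>)"
  have B0: "B \<ge> 0" using B[of 0] by linarith
  have hB: "\<bar>h v\<bar> \<le> H" for v
  proof -
    have "\<bar>h v\<bar> \<le> (LINT w|lborel. \<bar>g w * g (w + v)\<bar>)" unfolding h_def cross_corr_def by (rule integral_abs_bound)
    also have "\<dots> \<le> (LINT w|lborel. B * \<bar>g w\<bar>)"
    proof (rule integral_mono')
      show "integrable lborel (\<lambda>w. B * \<bar>g w\<bar>)" using g by simp
      show "\<bar>g w * g (w + v)\<bar> \<le> B * \<bar>g w\<bar>" for w
        unfolding abs_mult mult.commute[of B] by (rule mult_left_mono[OF B abs_ge_zero])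
    qed (simp add: B0)
    finally show ?thesis by (simp add: H_def)
  qed
  have H0: "H \<ge> 0" using hB[of 0] by linarith
  define \<Theta> where "\<Theta> = cross_corr \<kappa> h"
  note T = cross_corr[OF km hm int h(1), folded \<Theta>_def]
  have bi: "integrable lborel (\<lambda>w. q w * h w)" if q: "integrable lborel q" for q
  proof (rule Bochner_Integration.integrable_bound[OF integrable_mult_left[OF integrable_norm[OF q], of H]])
    show "(\<lambda>w. q w * h w) \<in> borel_measurable lborel" using borel_measurable_integrable[OF q] by measurable
    show "AE x in lborel. norm (q x * h x) \<le> norm (norm (q x) * H)"
      using hB H0 by (auto simp: abs_mult intro!: AE_I2 mult_left_mono)
  qed
  have "\<Theta> 0 \<ge> 0"
  proof (rule nonneg_at_0_if_FT_nonneg[OF T(2,1)])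
    show "\<bar>\<Theta> v\<bar> \<le> H * (LINT w|lborel. \<bar>\<kappa> w\<bar>)" for v
    proof -
      have "\<bar>\<Theta> v\<bar> \<le> (LINT w|lborel. \<bar>\<kappa> w * h (w + v)\<bar>)" unfolding \<Theta>_def cross_corr_def by (rule integral_abs_bound)
      also have "\<dots> \<le> (LINT w|lborel. H * \<bar>\<kappa> w\<bar>)"
      proof (rule integral_mono')
        show "integrable lborel (\<lambda>w. H * \<bar>\<kappa> w\<bar>)" using int by simp
        show "\<bar>\<kappa> w * h (w + v)\<bar> \<le> H * \<bar>\<kappa> w\<bar>" for w
          unfolding abs_mult mult.commute[of H] by (rule mult_left_mono[OF hB abs_ge_zero])
      qed (simp add: H0)
      finally show ?thesis by simp
    qed
    show "0 \<le> (LINT v|lborel. cos (\<xi> \<bullet> v) * \<Theta> v)" for \<xi>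
      unfolding T(3) h(3) h(4) using pos[of \<xi>] by (simp add: mult.commute)
    fix v :: "nat \<Rightarrow> 'a" assume v: "v \<longlonglongrightarrow> 0"
    have \<Theta>: "\<Theta> v = (LINT w|lborel. \<kappa> (w + - v) * h w)" for v
    proof -
      have "(\<lambda>w. \<kappa> (w + - v) * h w) \<in> borel_measurable borel" by measurable
      from lborel_translate_integral(2)[OF this, of v] show ?thesis by (simp add: \<Theta>_def cross_corr_def)
    qed
    have ti: "integrable lborel (\<lambda>w. \<kappa> (w + v))" for v using lborel_translate_integral(1)[OF km] int by simp
    have "(\<lambda>n. H * (LINT x|lborel. norm (\<kappa> (x + - v n) - \<kappa> x))) \<longlonglongrightarrow> H * 0"
      using v by (intro tendsto_mult_left tendsto_translate_L1[OF km int c]) (auto intro!: tendsto_eq_intros)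
    then have lim: "(\<lambda>n. H * (LINT x|lborel. norm (\<kappa> (x + - v n) - \<kappa> x))) \<longlonglongrightarrow> 0" by simp
    have "norm (\<Theta> (v n) - \<Theta> 0) \<le> H * (LINT x|lborel. norm (\<kappa> (x + - v n) - \<kappa> x))" for n
    proof -
      have d: "integrable lborel (\<lambda>w. \<kappa> (w + - v n) - \<kappa> w)" using ti[of "- v n"] int by simp
      have "\<Theta> (v n) - \<Theta> 0 = (LINT w|lborel. (\<kappa> (w + - v n) - \<kappa> w) * h w)"
        unfolding \<Theta> using bi[OF ti[of "- v n"]] bi[OF int] by (simp add: left_diff_distrib)
      also have "norm \<dots> \<le> (LINT w|lborel. norm ((\<kappa> (w + - v n) - \<kappa> w) * h w))" by (rule integral_norm_bound)
      also have "\<dots> \<le> (LINT w|lborel. H * norm (\<kappa> (w + - v n) - \<kappa> w))"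
      proof (rule integral_mono')
        show "integrable lborel (\<lambda>w. H * norm (\<kappa> (w + - v n) - \<kappa> w))" using integrable_norm[OF d] by simp
        show "norm ((\<kappa> (w + - v n) - \<kappa> w) * h w) \<le> H * norm (\<kappa> (w + - v n) - \<kappa> w)" for w
          unfolding real_norm_def abs_mult mult.commute[of H] by (rule mult_left_mono[OF hB abs_ge_zero])
      qed (simp add: H0)
      finally show ?thesis by simp
    qed
    then have "(\<lambda>n. \<Theta> (v n) - \<Theta> 0) \<longlonglongrightarrow> 0"
      by (intro Lim_null_comparison[OF always_eventually lim]) blast
    then show "(\<lambda>n. \<Theta> (v n)) \<longlonglongrightarrow> \<Theta> 0" by (rule LIM_zero_cancel)
  qed
  then show ?thesis by (simp add: \<Theta>_def cross_corr_def h_def)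
qed

section \<open>Schauder fixed points and continuation\<close>

text \<open>Kuhn's lemma is used directly, since the number \<open>m\<close> of points in the Schauder projection is not the
  dimension of a type.\<close>

lemma approximate_brouwer_cube:
  fixes g :: "(nat \<Rightarrow> real) \<Rightarrow> nat \<Rightarrow> real" and m :: nat
  defines "cube \<equiv> {\<theta>. \<forall>i<m. 0 \<le> \<theta> i \<and> \<theta> i \<le> 1}"
  assumes g: "\<And>\<theta> i. \<theta> \<in> cube \<Longrightarrow> i < m \<Longrightarrow> 0 \<le> g \<theta> i \<and> g \<theta> i \<le> 1"
    and uc: "\<And>e. e > 0 \<Longrightarrow> \<exists>d>0. \<forall>\<theta>\<in>cube. \<forall>\<theta>'\<in>cube. (\<forall>i<m. \<bar>\<theta> i - \<theta>' i\<bar> \<le> d) \<longrightarrow> (\<forall>i<m. \<bar>g \<theta> i - g \<theta>' i\<bar> \<le> e)"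
    and e: "e > 0"
  obtains \<theta> where "\<theta> \<in> cube" "\<And>i. i < m \<Longrightarrow> \<bar>g \<theta> i - \<theta> i\<bar> \<le> e"
proof -
  obtain d where d: "d > 0" "\<And>\<theta> \<theta>' i. \<theta> \<in> cube \<Longrightarrow> \<theta>' \<in> cube \<Longrightarrow> (\<forall>i<m. \<bar>\<theta> i - \<theta>' i\<bar> \<le> d) \<Longrightarrow> i < m \<Longrightarrow> \<bar>g \<theta> i - g \<theta>' i\<bar> \<le> e / 2"
    using uc[of "e / 2"] e by (metis half_gt_zero)
  obtain p :: nat where p: "p > 0" "1 / real p < min d (e / 2)"
    using reals_Archimedean[of "min d (e / 2)"] d(1) e by (metis inverse_eq_divide min_less_iff_conj half_gt_zero zero_less_Suc)
  define s where "s = (\<lambda>x::nat \<Rightarrow> nat. \<lambda>i. real (x i) / real p)"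
  have s: "s x \<in> cube" if "\<forall>i<m. x i \<le> p" for x using that p by (auto simp: s_def cube_def)
  \<comment> \<open>Label 1 marks a coordinate that g moves down. The face x i = p carries 1 by
    force, which is consistent because g \<le> 1 there.\<close>
  define label :: "(nat \<Rightarrow> nat) \<Rightarrow> nat \<Rightarrow> nat" where "label = (\<lambda>x i. if x i = p \<or> g (s x) i < s x i then 1 else 0)"
  have l1: "label x i = 1 \<Longrightarrow> g (s x) i \<le> s x i" if "\<forall>i<m. x i \<le> p" "i < m" for x i
    using g[OF s[OF that(1)] that(2)] p by (auto simp: label_def s_def split: if_splits)
  have l0: "label x i = 0 \<Longrightarrow> g (s x) i \<ge> s x i" if "\<forall>i<m. x i \<le> p" "i < m" for x i
    by (auto simp: label_def split: if_splits)
  obtain q where q: "\<forall>i<m. q i < p"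
    "\<forall>i<m. \<exists>r t. (\<forall>j<m. q j \<le> r j \<and> r j \<le> q j + 1) \<and> (\<forall>j<m. q j \<le> t j \<and> t j \<le> q j + 1) \<and> label r i \<noteq> label t i"
  proof (rule kuhn_lemma[of p m label])
    show "\<forall>x. (\<forall>i<m. x i \<le> p) \<longrightarrow> (\<forall>i<m. x i = 0 \<longrightarrow> label x i = 0)"
    proof (intro allI impI)
      fix x i assume x: "\<forall>i<m. x i \<le> p" "i < m" "x i = 0"
      then have "s x i = 0" by (simp add: s_def)
      then show "label x i = 0" using g[OF s[OF x(1)] x(2)] x(3) p(1) by (simp add: label_def)
    qed
  qed (use p(1) in \<open>auto simp: label_def\<close>)
  have qp: "\<forall>i<m. q i \<le> p" using q(1) by (auto intro: less_imp_le)
  show ?thesis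
  proof (rule that[OF s[OF qp]])
    fix i assume i: "i < m"
    obtain r t where r: "\<forall>j<m. q j \<le> r j \<and> r j \<le> q j + 1" and t: "\<forall>j<m. q j \<le> t j \<and> t j \<le> q j + 1" and ne: "label r i \<noteq> label t i"
      using q(2) i by blast
    have near: "(\<forall>j<m. x j \<le> p) \<and> (\<forall>j<m. \<bar>s x j - s q j\<bar> \<le> 1 / real p)" if x: "\<forall>j<m. q j \<le> x j \<and> x j \<le> q j + 1" for x
    proof (intro conjI allI impI)
      fix j assume j: "j < m"
      then show "x j \<le> p" using x q(1) by (metis Suc_eq_plus1 Suc_leI le_trans)
      have "\<bar>real (x j) - real (q j)\<bar> \<le> 1" using x j by (auto simp: abs_le_iff)
      then show "\<bar>s x j - s q j\<bar> \<le> 1 / real p" using p(1)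
        by (simp add: s_def abs_divide divide_right_mono flip: diff_divide_distrib)
    qed
    \<comment> \<open>Within a grid cell the displacement g - s differs by at most e from that at q,
      and opposite labels give displacements of both signs.\<close>
    have main: "\<bar>(g (s x) i - s x i) - (g (s q) i - s q i)\<bar> \<le> e" if x: "\<forall>j<m. q j \<le> x j \<and> x j \<le> q j + 1" for x
    proof -
      have "\<forall>j<m. \<bar>s x j - s q j\<bar> \<le> d" using near[OF x] p(2) by (auto intro: order_trans)
      then have "\<bar>g (s x) i - g (s q) i\<bar> \<le> e / 2" using d(2)[of "s x" "s q" i] s[OF qp] s near[OF x] i by blast
      moreover have "\<bar>s x i - s q i\<bar> \<le> e / 2" using near[OF x] i p(2) by (metis less_imp_le min_less_iff_conj order_trans)
      ultimately show ?thesis by linarith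
    qed
    have "label r i = 0 \<and> label t i = 1 \<or> label r i = 1 \<and> label t i = 0"
      using ne by (auto simp: label_def split: if_splits)
    then show "\<bar>g (s q) i - s q i\<bar> \<le> e"
    proof
      assume "label r i = 0 \<and> label t i = 1"
      then show ?thesis using main[OF r] main[OF t] l0[of r i] l1[of t i] near[OF r] near[OF t] i by (auto simp: abs_le_iff)
    next
      assume "label r i = 1 \<and> label t i = 0"
      then show ?thesis using main[OF r] main[OF t] l1[of r i] l0[of t i] near[OF r] near[OF t] i by (auto simp: abs_le_iff)
    qed
  qed
qed

text \<open>The Schauder projection replaces f by convex weights on a finite e/4-net, continuous in
  x. Read as a map of coefficient vectors it has approximate fixed points by the cube lemma.
  Approximate ones suffice, as compactness of K supplies the limit.\<close>

lemma approximate_schauder: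
  fixes f :: "'b::real_normed_vector \<Rightarrow> 'b"
  assumes C: "convex C" and K: "compact K" "K \<subseteq> C" "K \<noteq> {}" and f: "continuous_on C f" "f ` C \<subseteq> K" and e: "e > 0"
  obtains x where "x \<in> C" "norm (f x - x) < e"
proof -
  obtain T where T: "finite T" "T \<subseteq> K" "K \<subseteq> (\<Union>y\<in>T. ball y (e / 4))"
  proof (rule compactE_image[OF K(1), of K "\<lambda>y. ball y (e / 4)"])
    show "K \<subseteq> (\<Union>y\<in>K. ball y (e / 4))" using e by force
  qed auto
  obtain ys :: "nat \<Rightarrow> 'b" and m where ys: "T = ys ` {i. i < m}" using finite_imp_nat_seg_image_inj_on[OF T(1)] by blast
  have yT: "ys i \<in> T" if "i < m" for i using that ys by auto
  have m0: "m > 0" using T(3) K(3) ys by (cases m) auto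
  define H where "H = convex hull T"
  have H: "compact H" "convex H" "H \<subseteq> C"
    unfolding H_def using finite_imp_compact_convex_hull[OF T(1)] convex_convex_hull
      hull_minimal[of T C convex, OF subset_trans[OF T(2) K(2)] C] by blast+
  have HK: "f x \<in> K" if "x \<in> H" for x using that H(3) f(2) by blast
  \<comment> \<open>Schauder weights before normalisation: y sees only the net points closer than
    e/4, and at least one of them if it lies in K.\<close>
  define a where "a = (\<lambda>i y. max 0 (e / 4 - dist y (ys i)))"
  define A where "A = (\<lambda>y. \<Sum>i<m. a i y)"
  have a0: "a i y \<ge> 0" for i y by (simp add: a_def)
  have A: "A y > 0" if yK: "y \<in> K" for y
  proof -
    obtain i where i: "i < m" "y \<in> ball (ys i) (e / 4)" using T(3) yK ys by auto
    then have "a i y > 0" by (simp add: a_def dist_commute)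
    then show ?thesis unfolding A_def using i a0 by (intro sum_pos2[of _ i]) auto
  qed
  define W where "W = (\<lambda>i x. a i (f x) / A (f x))"
  have W: "0 \<le> W i x" "W i x \<le> 1" "(\<Sum>i<m. W i x) = 1" if x: "x \<in> H" "i < m" for i x
  proof -
    have "a i (f x) \<le> A (f x)" unfolding A_def using x a0 by (intro member_le_sum) auto
    then show "0 \<le> W i x" "W i x \<le> 1" using A[OF HK[OF x(1)]] a0 by (auto simp: W_def divide_le_eq)
    show "(\<Sum>i<m. W i x) = 1" using A[OF HK[OF x(1)]] by (simp add: W_def A_def flip: sum_divide_distrib)
  qed
  have Wc: "continuous_on H (W i)" for i
  proof -
    have fc: "continuous_on H f" using f(1) H(3) by (rule continuous_on_subset)
    show ?thesis unfolding W_def a_def A_def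
      using A[OF HK] by (intro continuous_intros fc) (auto simp: A_def a_def less_le)
  qed
  have proj: "norm ((\<Sum>i<m. W i x *\<^sub>R ys i) - f x) \<le> e / 4" if x: "x \<in> H" for x
  proof -
    have "(\<Sum>i<m. W i x *\<^sub>R ys i) - f x = (\<Sum>i<m. W i x *\<^sub>R (ys i - f x))"
      using W(3)[OF x m0] by (simp add: scaleR_diff_right sum_subtractf flip: scaleR_left.sum)
    also have "norm \<dots> \<le> (\<Sum>i<m. W i x * (e / 4))"
    proof (rule sum_norm_le)
      fix i assume i: "i \<in> {..<m}"
      show "norm (W i x *\<^sub>R (ys i - f x)) \<le> W i x * (e / 4)"
      proof (cases "dist (f x) (ys i) < e / 4")
        case True
        then have "norm (ys i - f x) \<le> e / 4" by (simp add: dist_norm norm_minus_commute)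
        moreover have "W i x \<ge> 0" using W(1)[OF x] i by simp
        ultimately show ?thesis unfolding norm_scaleR by (simp add: mult_left_mono del: times_divide_eq_right)
      next
        case False
        then have "a i (f x) = 0" by (simp add: a_def)
        then show ?thesis by (simp add: W_def)
      qed
    qed
    also have "\<dots> = e / 4" unfolding sum_distrib_right[symmetric] using W(3)[OF x m0] by simp
    finally show ?thesis .
  qed
  define cube where "cube = {\<theta>::nat \<Rightarrow> real. \<forall>i<m. 0 \<le> \<theta> i \<and> \<theta> i \<le> 1}"
  \<comment> \<open>Division by D makes the coefficients of any point of the cube sum to at most 1,
    and v gives the missing mass to \<open>ys 0\<close>. So v maps the whole cube into the hull and
    is the usual convex combination when the sum is 1.\<close>
  define D where "D = (\<lambda>\<theta>::nat \<Rightarrow> real. max 1 (\<Sum>i<m. \<theta> i))"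
  define v where "v = (\<lambda>\<theta>. (\<Sum>i<m. (\<theta> i / D \<theta>) *\<^sub>R ys i) + (1 - (\<Sum>i<m. \<theta> i / D \<theta>)) *\<^sub>R ys 0)"
  have D1: "D \<theta> \<ge> 1" for \<theta> by (simp add: D_def)
  have vH: "v \<theta> \<in> H" if \<theta>: "\<theta> \<in> cube" for \<theta>
  proof -
    have S: "(\<Sum>i<m. \<theta> i / D \<theta>) \<le> 1" using D1[of \<theta>] by (simp add: D_def flip: sum_divide_distrib)
    have "(\<Sum>i<m. (\<theta> i / D \<theta> + (if i = 0 then 1 - (\<Sum>i<m. \<theta> i / D \<theta>) else 0)) *\<^sub>R ys i) \<in> H"
    proof (rule convex_sum[OF _ H(2)])
      show "(\<Sum>i<m. \<theta> i / D \<theta> + (if i = 0 then 1 - (\<Sum>i<m. \<theta> i / D \<theta>) else 0)) = 1"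
        using m0 by (simp add: sum.distrib)
      show "0 \<le> \<theta> i / D \<theta> + (if i = 0 then 1 - (\<Sum>i<m. \<theta> i / D \<theta>) else 0)" if "i \<in> {..<m}" for i
        using that \<theta> D1[of \<theta>] S by (auto simp: cube_def intro!: add_nonneg_nonneg divide_nonneg_nonneg)
      show "ys i \<in> H" if "i \<in> {..<m}" for i using yT that by (auto simp: H_def intro: hull_inc)
    qed simp
    also have "(\<Sum>i<m. (\<theta> i / D \<theta> + (if i = 0 then 1 - (\<Sum>i<m. \<theta> i / D \<theta>) else 0)) *\<^sub>R ys i) = v \<theta>"
    proof -
      have "(\<Sum>i<m. (if i = 0 then t else 0) *\<^sub>R ys i) = t *\<^sub>R ys 0" for t
        using m0 by (subst sum.remove[of _ 0]) auto
      then show ?thesis by (simp add: v_def scaleR_left_distrib sum.distrib)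
    qed
    finally show ?thesis .
  qed
  define Y where "Y = (\<Sum>i<m. norm (ys i))"
  have Y: "norm (ys i) \<le> Y" if "i < m" for i unfolding Y_def using that by (intro member_le_sum) auto
  have Y0: "Y \<ge> 0" unfolding Y_def by (intro sum_nonneg) auto
  have vdist: "norm ((\<Sum>i<m. \<alpha> i *\<^sub>R ys i) + (1 - (\<Sum>i<m. \<alpha> i)) *\<^sub>R ys 0 - ((\<Sum>i<m. \<beta> i *\<^sub>R ys i) + (1 - (\<Sum>i<m. \<beta> i)) *\<^sub>R ys 0))
      \<le> real m * d * (2 * Y)" if ab: "\<And>i. i < m \<Longrightarrow> \<bar>\<alpha> i - \<beta> i\<bar> \<le> d" for \<alpha> \<beta> d
  proof -
    have "(\<Sum>i<m. \<alpha> i *\<^sub>R ys i) + (1 - (\<Sum>i<m. \<alpha> i)) *\<^sub>R ys 0 - ((\<Sum>i<m. \<beta> i *\<^sub>R ys i) + (1 - (\<Sum>i<m. \<beta> i)) *\<^sub>R ys 0)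
      = (\<Sum>i<m. (\<alpha> i - \<beta> i) *\<^sub>R (ys i - ys 0))"
      by (simp add: scaleR_diff_left scaleR_diff_right sum_subtractf flip: scaleR_left.sum)
    also have "norm \<dots> \<le> (\<Sum>i<m. d * (2 * Y))"
    proof (rule sum_norm_le)
      fix i assume i: "i \<in> {..<m}"
      have "norm (ys i - ys 0) \<le> 2 * Y" using norm_triangle_ineq4[of "ys i" "ys 0"] Y[of i] Y[OF m0] i by simp
      then show "norm ((\<alpha> i - \<beta> i) *\<^sub>R (ys i - ys 0)) \<le> d * (2 * Y)"
        unfolding norm_scaleR using ab[of i] i by (intro mult_mono) auto
    qed
    finally show ?thesis by simp
  qed
  have Dd: "\<bar>D \<theta> - D \<theta>'\<bar> \<le> real m * d" if "\<And>i. i < m \<Longrightarrow> \<bar>\<theta> i - \<theta>' i\<bar> \<le> d" for \<theta> \<theta>' d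
  proof -
    have "\<bar>(\<Sum>i<m. \<theta> i) - (\<Sum>i<m. \<theta>' i)\<bar> \<le> (\<Sum>i<m. d)"
      unfolding sum_subtractf[symmetric] by (rule order_trans[OF sum_abs sum_mono]) (use that in auto)
    then show ?thesis by (auto simp: D_def max_def)
  qed
  have quot: "\<bar>\<theta> i / D \<theta> - \<theta>' i / D \<theta>'\<bar> \<le> (1 + real m) * d"
    if th: "\<theta> \<in> cube" "\<theta>' \<in> cube" "\<And>i. i < m \<Longrightarrow> \<bar>\<theta> i - \<theta>' i\<bar> \<le> d" "i < m" for \<theta> \<theta>' d i
  proof -
    have D: "D \<theta> \<ge> 1" "D \<theta>' \<ge> 1" by (rule D1)+
    have t1: "\<bar>\<theta>' i\<bar> \<le> 1" using th(2,4) by (auto simp: cube_def)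
    have "\<theta> i / D \<theta> - \<theta>' i / D \<theta>' = (\<theta> i - \<theta>' i) / D \<theta> + \<theta>' i / D \<theta>' * ((D \<theta>' - D \<theta>) / D \<theta>)"
      using D by (simp add: field_simps)
    also have "\<bar>\<dots>\<bar> \<le> \<bar>(\<theta> i - \<theta>' i) / D \<theta>\<bar> + \<bar>\<theta>' i / D \<theta>'\<bar> * \<bar>(D \<theta>' - D \<theta>) / D \<theta>\<bar>"
      by (metis abs_mult abs_triangle_ineq)
    also have "\<bar>(\<theta> i - \<theta>' i) / D \<theta>\<bar> \<le> d"
    proof -
      have "\<bar>\<theta> i - \<theta>' i\<bar> \<le> d * 1" using th(3)[OF th(4)] by simp
      also have "\<dots> \<le> d * D \<theta>" using th(3)[OF th(4)] D by (intro mult_left_mono) auto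
      finally show ?thesis using D by (simp add: abs_divide divide_le_eq)
    qed
    also have "\<bar>\<theta>' i / D \<theta>'\<bar> * \<bar>(D \<theta>' - D \<theta>) / D \<theta>\<bar> \<le> 1 * (real m * d)"
    proof (rule mult_mono)
      show "\<bar>\<theta>' i / D \<theta>'\<bar> \<le> 1" using D t1 by (simp add: abs_divide divide_le_eq)
      have md: "\<bar>D \<theta>' - D \<theta>\<bar> \<le> real m * d" using Dd[OF th(3)] by (simp add: abs_minus_commute)
      also have "\<dots> \<le> real m * d * D \<theta>" using D order_trans[OF abs_ge_zero md]
        by (metis mult.right_neutral mult_left_mono)
      finally show "\<bar>(D \<theta>' - D \<theta>) / D \<theta>\<bar> \<le> real m * d" using D by (simp add: abs_divide divide_le_eq)
    qed auto
    finally show ?thesis by (simp add: distrib_right)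
  qed
  define g where "g = (\<lambda>\<theta> i. W i (v \<theta>))"
  \<comment> \<open>U bounds the Lipschitz constant of v on the cube in the maximum distance; the 1
    added to 2 Y keeps it positive.\<close>
  define U where "U = real m * ((1 + real m) * (2 * Y + 1))"
  have U: "U > 0" using m0 Y0 by (simp add: U_def)
  have Ueq: "real m * ((1 + real m) * t) * (2 * Y + 1) = U * t" for t by (simp add: U_def)
  define dd where "dd = e / (8 * U)"
  have dd: "dd > 0" using e U by (simp add: dd_def)
  obtain \<theta> where \<theta>: "\<theta> \<in> cube" "\<And>i. i < m \<Longrightarrow> \<bar>g \<theta> i - \<theta> i\<bar> \<le> dd"
  proof (rule approximate_brouwer_cube[of m g dd, folded cube_def])
    show "0 \<le> g \<theta> i \<and> g \<theta> i \<le> 1" if "\<theta> \<in> cube" "i < m" for \<theta> i using W(1,2)[OF vH[OF that(1)] that(2)] by (simp add: g_def)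
    fix e' :: real assume e': "e' > 0"
    have "\<exists>d>0. \<forall>i<m. \<forall>x\<in>H. \<forall>x'\<in>H. dist x' x < d \<longrightarrow> dist (W i x') (W i x) < e'"
    proof -
      have "\<forall>i. \<exists>d>0. \<forall>x\<in>H. \<forall>x'\<in>H. dist x' x < d \<longrightarrow> dist (W i x') (W i x) < e'"
        using compact_uniformly_continuous[OF Wc H(1)] e' unfolding uniformly_continuous_on_def by blast
      then obtain d where d: "\<And>i. d i > 0" "\<And>i x x'. x \<in> H \<Longrightarrow> x' \<in> H \<Longrightarrow> dist x' x < d i \<Longrightarrow> dist (W i x') (W i x) < e'" by metis
      have "Min (d ` {..<m}) > 0" using d(1) m0 by (subst Min_gr_iff) auto
      moreover have "Min (d ` {..<m}) \<le> d i" if "i < m" for i using that by simp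
      ultimately show ?thesis using d(2) by (metis less_le_trans)
    qed
    then obtain d where d: "d > 0" "\<And>i x x'. i < m \<Longrightarrow> x \<in> H \<Longrightarrow> x' \<in> H \<Longrightarrow> dist x' x < d \<Longrightarrow> dist (W i x') (W i x) < e'" by blast
    define d' where "d' = d / U"
    have d': "d' > 0" using d(1) U by (simp add: d'_def)
    show "\<exists>d>0. \<forall>\<theta>\<in>cube. \<forall>\<theta>'\<in>cube. (\<forall>i<m. \<bar>\<theta> i - \<theta>' i\<bar> \<le> d) \<longrightarrow> (\<forall>i<m. \<bar>g \<theta> i - g \<theta>' i\<bar> \<le> e')"
    proof (intro exI[of _ d'] conjI d' ballI impI allI)
      fix \<theta> \<theta>' i assume th: "\<theta> \<in> cube" "\<theta>' \<in> cube" "\<forall>i<m. \<bar>\<theta> i - \<theta>' i\<bar> \<le> d'" "i < m"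
      have "norm (v \<theta> - v \<theta>') \<le> real m * ((1 + real m) * d') * (2 * Y)"
        unfolding v_def using th by (intro vdist quot) auto
      also have "\<dots> < real m * ((1 + real m) * d') * (2 * Y + 1)" using m0 d' by (intro mult_strict_left_mono) auto
      also have "\<dots> = d" unfolding Ueq using U by (simp add: d'_def)
      finally have "dist (v \<theta>) (v \<theta>') < d" by (simp add: dist_norm)
      from d(2)[OF th(4) vH[OF th(2)] vH[OF th(1)] this]
      show "\<bar>g \<theta> i - g \<theta>' i\<bar> \<le> e'" by (simp add: g_def dist_real_def)
    qed
  qed (use dd in auto)
  have x: "v \<theta> \<in> H" using vH \<theta>(1) by blast
  have Ds: "D \<theta> \<le> 1 + real m * dd"
  proof -
    have g1: "(\<Sum>i<m. g \<theta> i) = 1" using W(3)[OF x m0] by (simp add: g_def)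
    have "\<bar>D \<theta> - D (g \<theta>)\<bar> \<le> real m * dd" by (rule Dd) (use \<theta>(2) in \<open>simp add: abs_minus_commute\<close>)
    moreover have "D (g \<theta>) = 1" by (simp add: D_def g1)
    ultimately show ?thesis by linarith
  qed
  have close: "\<bar>\<theta> i / D \<theta> - g \<theta> i\<bar> \<le> (1 + real m) * dd" if i: "i < m" for i
  proof -
    have D: "D \<theta> \<ge> 1" by (rule D1)
    have t: "0 \<le> \<theta> i" "\<theta> i \<le> 1" using \<theta>(1) i by (auto simp: cube_def)
    have "\<theta> i / D \<theta> - \<theta> i = - (\<theta> i / D \<theta>) * (D \<theta> - 1)" using D by (simp add: field_simps)
    then have "\<bar>\<theta> i / D \<theta> - \<theta> i\<bar> = (\<theta> i / D \<theta>) * (D \<theta> - 1)" using D t by (simp add: abs_mult)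
    also have "\<dots> \<le> 1 * (real m * dd)" using D t Ds by (intro mult_mono) (auto simp: divide_le_eq)
    finally show ?thesis using \<theta>(2)[OF i] by (simp add: distrib_right)
  qed
  have "norm (v \<theta> - ((\<Sum>i<m. g \<theta> i *\<^sub>R ys i) + (1 - (\<Sum>i<m. g \<theta> i)) *\<^sub>R ys 0)) \<le> real m * ((1 + real m) * dd) * (2 * Y)"
    unfolding v_def by (intro vdist close)
  also have "\<dots> \<le> real m * ((1 + real m) * dd) * (2 * Y + 1)" using dd by (intro mult_left_mono) auto
  also have "\<dots> = e / 8" unfolding Ueq using U by (simp add: dd_def)
  finally have "norm (v \<theta> - (\<Sum>i<m. W i (v \<theta>) *\<^sub>R ys i)) \<le> e / 8"
    using W(3)[OF x m0] by (simp add: g_def)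
  moreover have "norm (f (v \<theta>) - v \<theta>) \<le> norm ((\<Sum>i<m. W i (v \<theta>) *\<^sub>R ys i) - f (v \<theta>)) + norm (v \<theta> - (\<Sum>i<m. W i (v \<theta>) *\<^sub>R ys i))"
    by norm
  ultimately have "norm (f (v \<theta>) - v \<theta>) < e" using proj[OF x] e by linarith
  then show ?thesis using that x H(3) by blast
qed

text \<open>Along a subsequence f (x n) converges in K, and the approximate fixed points x n follow
  it.\<close>

theorem schauder_fixed_point:
  fixes f :: "'b::real_normed_vector \<Rightarrow> 'b"
  assumes C: "convex C" and K: "compact K" "K \<subseteq> C" "K \<noteq> {}" and f: "continuous_on C f" "f ` C \<subseteq> K"
  obtains x where "x \<in> C" "f x = x"
proof -
  have "\<exists>x. x \<in> C \<and> norm (f x - x) < inverse (real (Suc n))" for n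
    by (rule approximate_schauder[OF assms, of "inverse (real (Suc n))"]) auto
  then obtain x where x: "\<And>n. x n \<in> C" "\<And>n. norm (f (x n) - x n) < inverse (real (Suc n))" by metis
  have "\<forall>n. f (x n) \<in> K" using x(1) f(2) by blast
  then obtain y r where y: "y \<in> K" "strict_mono (r :: nat \<Rightarrow> nat)" "((\<lambda>n. f (x n)) \<circ> r) \<longlonglongrightarrow> y"
    using K(1) unfolding compact_def by metis
  have d: "(\<lambda>n. f (x n) - x n) \<longlonglongrightarrow> 0"
    by (rule Lim_null_comparison[OF always_eventually LIMSEQ_inverse_real_of_nat]) (use x(2) in \<open>auto intro: less_imp_le\<close>)
  have "(\<lambda>n. (f (x (r n))) - (f (x (r n)) - x (r n))) \<longlonglongrightarrow> y - 0"
    using y(3) LIMSEQ_subseq_LIMSEQ[OF d y(2)] by (intro tendsto_diff) (simp_all add: o_def)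
  then have xr: "(\<lambda>n. x (r n)) \<longlonglongrightarrow> y" by simp
  have yC: "y \<in> C" using y(1) K(2) by blast
  have "(\<lambda>n. f (x (r n))) \<longlonglongrightarrow> f y"
    by (rule continuous_on_tendsto_compose[OF f(1) xr yC]) (simp add: x(1))
  then have "f y = y" using y(3) LIMSEQ_unique by (auto simp: o_def)
  then show ?thesis using that yC by blast
qed

section \<open>Leray-Schauder continuation\<close>

definition radial_retraction :: "real \<Rightarrow> 'b::real_normed_vector \<Rightarrow> 'b"
  where "radial_retraction R w = (R / max R (norm w)) *\<^sub>R w"

lemma radial_retraction:
  assumes "R > 0"
  shows "norm (radial_retraction R w) \<le> R" "continuous_on UNIV (radial_retraction R)"
    and "norm (radial_retraction R w) < R \<Longrightarrow> radial_retraction R w = w"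
    and "\<exists>t\<in>{0..1}. radial_retraction R w = t *\<^sub>R w"
proof -
  have n: "norm (radial_retraction R w) = R * norm w / max R (norm w)"
    using assms by (simp add: radial_retraction_def)
  show "norm (radial_retraction R w) \<le> R" unfolding n using assms by (simp add: divide_le_eq)
  show "continuous_on UNIV (radial_retraction R)"
    unfolding radial_retraction_def using assms by (intro continuous_intros) (auto simp: max_def)
  show "norm (radial_retraction R w) < R \<Longrightarrow> radial_retraction R w = w"
    unfolding n using assms by (cases "norm w \<le> R") (auto simp: radial_retraction_def max_def split: if_splits)
  show "\<exists>t\<in>{0..1}. radial_retraction R w = t *\<^sub>R w"
    unfolding radial_retraction_def using assms by (intro bexI[of _ "R / max R (norm w)"]) auto
qed

text \<open>Works without degree theory. If the component missed the level \<Lambda>, the compact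
  set \<Sigma> would split into disjoint closed sets, U containing the origin and V containing all
  solutions at \<Lambda>. With a Urysohn function \<psi>, equal to 1 on U and 0 on V, Schauder's
  theorem applies to \<open>G\<close>. A fixed point is a solution whose parameter is \<Lambda> if
  it lies in U and 0 if it lies in V, and both are impossible.\<close>

theorem fixed_point_continuation:
  fixes F :: "real \<times> 'b::real_normed_vector \<Rightarrow> 'b" and \<Lambda> R :: real
  defines "D \<equiv> {0..\<Lambda>} \<times> cball 0 R"
  defines "\<Sigma> \<equiv> {x \<in> D. snd x = F x}"
  assumes \<Lambda>: "\<Lambda> > 0" and R: "R > 0" and cont: "continuous_on D F"
    and K: "compact K" "F ` D \<subseteq> K"
    and apriori: "\<And>lam t v. lam \<in> {0..\<Lambda>} \<Longrightarrow> t \<in> {0..1} \<Longrightarrow> norm v \<le> R \<Longrightarrow> v = t *\<^sub>R F (lam, v) \<Longrightarrow> norm v < R"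
    and start: "F (0, 0) = 0" "\<And>v. norm v \<le> R \<Longrightarrow> v = F (0, v) \<Longrightarrow> v = 0"
  obtains v where "(\<Lambda>, v) \<in> connected_component_set \<Sigma> (0, 0)"
proof -
  have Dcl: "closed D" unfolding D_def by (intro closed_Times) auto
  have \<Sigma>D: "\<Sigma> \<subseteq> D" by (auto simp: \<Sigma>_def)
  have \<Sigma>0: "(0, 0) \<in> \<Sigma>" using start(1) \<Lambda> R by (auto simp: \<Sigma>_def D_def)
  have \<Sigma>cl: "closed \<Sigma>"
  proof -
    have "\<Sigma> = D \<inter> (\<lambda>x. snd x - F x) -` {0}" by (auto simp: \<Sigma>_def)
    moreover have "continuous_on D (\<lambda>x. snd x - F x)" by (intro continuous_intros cont)
    ultimately show ?thesis using continuous_closed_preimage[OF _ Dcl closed_singleton] by metis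
  qed
  have \<Sigma>c: "compact \<Sigma>"
  proof -
    have "\<Sigma> \<subseteq> {0..\<Lambda>} \<times> K"
    proof
      fix x assume x: "x \<in> \<Sigma>"
      then have "fst x \<in> {0..\<Lambda>}" "snd x = F x" "x \<in> D" by (auto simp: \<Sigma>_def D_def)
      then show "x \<in> {0..\<Lambda>} \<times> K" using K(2) by (metis image_subset_iff mem_Times_iff)
    qed
    then have "\<Sigma> = ({0..\<Lambda>} \<times> K) \<inter> \<Sigma>" by blast
    then show ?thesis using compact_Int_closed[OF compact_Times[OF compact_Icc K(1)] \<Sigma>cl] by metis
  qed
  have "\<exists>v. (\<Lambda>, v) \<in> connected_component_set \<Sigma> (0, 0)"
  proof (rule ccontr)
    assume no: "\<not> ?thesis"
    define T where "T = \<Sigma> \<inter> {x. fst x = \<Lambda>}"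
    have Tcl: "closed T" unfolding T_def using \<Sigma>cl
      by (intro closed_Int closed_Collect_eq continuous_intros) auto
    \<comment> \<open>In a compact Hausdorff space, two closed sets that no connected set joins are
      separated by a partition into two open sets.\<close>
    have "separated_between (top_of_set \<Sigma>) {(0, 0)} T"
    proof (rule cut_wire_fence_theorem)
      show "compact_space (top_of_set \<Sigma>)" using \<Sigma>c by (simp add: compact_space_subtopology)
      show "Hausdorff_space (top_of_set \<Sigma>)" by (simp add: Hausdorff_space_subtopology)
      show "closedin (top_of_set \<Sigma>) {(0, 0)}" using \<Sigma>0 by (simp add: closedin_closed_subset)
      show "closedin (top_of_set \<Sigma>) T" using Tcl by (auto simp: T_def intro!: closed_subset)
      fix C assume C: "connectedin (top_of_set \<Sigma>) C"
      then have C': "connected C" "C \<subseteq> \<Sigma>" by (auto simp: connectedin_subtopology)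
      show "disjnt C {(0, 0)} \<or> disjnt C T"
      proof (rule disjCI)
        assume "\<not> disjnt C T"
        then obtain x where x: "x \<in> C" "fst x = \<Lambda>" by (auto simp: disjnt_iff T_def)
        show "disjnt C {(0, 0)}"
        proof (rule ccontr)
          assume "\<not> disjnt C {(0, 0)}"
          then have "(0, 0) \<in> C" by (auto simp: disjnt_iff)
          then have "connected_component \<Sigma> (0, 0) x" unfolding connected_component_def using C' x by blast
          then show False using no x(2) by (metis mem_Collect_eq prod.collapse)
        qed
      qed
    qed
    then obtain U V where UV: "openin (top_of_set \<Sigma>) U" "openin (top_of_set \<Sigma>) V" "U \<union> V = \<Sigma>" "disjnt U V" "(0, 0) \<in> U" "T \<subseteq> V"
      unfolding separated_between_def by auto
    have clUV: "closed U" "closed V"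
    proof -
      have "\<Sigma> - V = U" "\<Sigma> - U = V" using UV(3,4) by (auto simp: disjnt_def)
      then have "closedin (top_of_set \<Sigma>) U" "closedin (top_of_set \<Sigma>) V"
        using openin_closedin_eq[of "top_of_set \<Sigma>" U] openin_closedin_eq[of "top_of_set \<Sigma>" V] UV(1,2)
        by auto
      then show "closed U" "closed V" using \<Sigma>cl closedin_closed_trans by blast+
    qed
    \<comment> \<open>V may be empty, and \<open>infdist\<close> to the empty set is 0 by
      convention; the case distinction keeps \<psi> = 1 then.\<close>
    define \<psi> where "\<psi> = (\<lambda>x. if V = {} then 1 else infdist x V / (infdist x U + infdist x V))"
    have U0: "U \<noteq> {}" using UV(5) by blast
    have sum0: "infdist x U + infdist x V > 0" if "V \<noteq> {}" for x
    proof -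
      have "\<not> (infdist x U = 0 \<and> infdist x V = 0)"
        using in_closed_iff_infdist_zero[OF clUV(1) U0, of x] in_closed_iff_infdist_zero[OF clUV(2) that, of x] UV(4)
        unfolding disjnt_def by blast
      then show ?thesis using infdist_nonneg[of x U] infdist_nonneg[of x V] by linarith
    qed
    have \<psi>01: "0 \<le> \<psi> x" "\<psi> x \<le> 1" for x
      using sum0[of x] infdist_nonneg[of x U] infdist_nonneg[of x V] by (auto simp: \<psi>_def divide_le_eq)
    have \<psi>U: "\<psi> x = 1" if "x \<in> U" for x
      using that sum0[of x] by (cases "V = {}") (auto simp: \<psi>_def)
    have \<psi>V: "\<psi> x = 0" if "x \<in> V" for x
      using that by (auto simp: \<psi>_def)
    have \<psi>c: "continuous_on S \<psi>" for S
    proof (cases "V = {}")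
      case True
      then have "\<psi> = (\<lambda>_. 1)" by (simp add: \<psi>_def)
      then show ?thesis by simp
    next
      case False
      then show ?thesis unfolding \<psi>_def using sum0[OF False]
        by (simp add: less_imp_neq[symmetric] continuous_intros)
    qed
    define G where "G = (\<lambda>x. (\<Lambda> * \<psi> x, radial_retraction R (F x)))"
    have Gc: "continuous_on D G"
      unfolding G_def
      by (intro continuous_intros \<psi>c continuous_on_compose2[OF radial_retraction(2)[OF R] cont]) auto
    define K' where "K' = {0..\<Lambda>} \<times> radial_retraction R ` K"
    have K': "compact K'" unfolding K'_def
      by (intro compact_Times compact_continuous_image K continuous_on_subset[OF radial_retraction(2)[OF R]]) auto
    have sub: "K' \<subseteq> D" unfolding K'_def D_def using radial_retraction(1)[OF R] by auto
    have "(0, 0) \<in> D" using \<Sigma>0 \<Sigma>D by blast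
    then have Kne: "K' \<noteq> {}" using K(2) \<Lambda> by (auto simp: K'_def)
    have GK: "G ` D \<subseteq> K'" using K(2) \<Lambda> \<psi>01 by (auto simp: G_def K'_def mult_le_cancel_left2)
    have "convex D" unfolding D_def by (intro convex_Times) auto
    then obtain x where x: "x \<in> D" "G x = x"
      using schauder_fixed_point[OF _ K' sub Kne Gc GK] by blast
    obtain lam v where xv: "x = (lam, v)" by (cases x)
    have lam: "lam = \<Lambda> * \<psi> x" "lam \<in> {0..\<Lambda>}" and v: "v = radial_retraction R (F x)" "norm v \<le> R"
      using x by (auto simp: G_def xv D_def)
    \<comment> \<open>The retraction has scaled \<open>F x\<close> by some t, which is the situation
      of the a priori bound. So v lies in the open ball, where the retraction is the
      identity.\<close>
    obtain t where t: "t \<in> {0..1}" "v = t *\<^sub>R F x" using radial_retraction(4)[OF R, of "F x"] v(1) by auto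
    have "norm v < R" by (rule apriori[OF lam(2) t(1) v(2)]) (use t(2) xv in simp)
    then have vF: "v = F x" using radial_retraction(3)[OF R, of "F x"] v(1) by simp
    then have x\<Sigma>: "x \<in> \<Sigma>" using x(1) by (simp add: \<Sigma>_def xv)
    then consider "x \<in> U" | "x \<in> V" using UV(3) by blast
    then show False
    proof cases
      case 1
      then have "lam = \<Lambda>" using lam(1) \<psi>U by simp
      then have "x \<in> T" using x\<Sigma> by (simp add: T_def xv)
      then show False using UV(4,6) 1 unfolding disjnt_def by blast
    next
      case 2
      then have l0: "lam = 0" using lam(1) \<psi>V by simp
      have x0: "x = (0, v)" unfolding xv l0 ..
      have "v = 0" by (rule start(2)[OF v(2) vF[unfolded x0]])
        then show False using UV(4,5) 2 l0 xv by (auto simp: disjnt_def)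
    qed
  qed
  then show ?thesis using that by blast
qed

section \<open>The outgoing fundamental solution\<close>

lemma helmholtz_Phi_eq:
  fixes x :: "'a::euclidean_space"
  assumes n: "n \<ge> 1" and k: "k > 0" and N: "DIM('a) = n + 2"
  shows "helmholtz_Phi k x = of_real ((k / (2 * pi)) powr (real n / 2) / 4 * norm x powr - (real n / 2))
    * (\<i> * of_real (bessel_J (real n / 2) (k * norm x)) - of_real (bessel_Y (real n / 2) (k * norm x)))"
proof -
  have \<nu>: "(real DIM('a) - 2) / 2 = real n / 2" using N by simp
  have p: "(k / (2 * pi * norm x)) powr (real n / 2) = (k / (2 * pi)) powr (real n / 2) * norm x powr - (real n / 2)"
  \<comment> \<open>At x = 0 both sides vanish, as division by 0 gives 0 and 0 powr a is 0.\<close>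
  proof (cases "x = 0")
    case False
    have "k / (2 * pi * norm x) = k / (2 * pi) * inverse (norm x)" by (simp only: divide_inverse inverse_mult_distrib mult.assoc)
    also have "\<dots> powr (real n / 2) = (k / (2 * pi)) powr (real n / 2) * inverse (norm x) powr (real n / 2)"
      by (rule powr_mult)
    also have "inverse (norm x) powr (real n / 2) = norm x powr - (real n / 2)"
      using False by (simp add: inverse_powr powr_minus)
    finally show ?thesis .
  qed (use n in simp)
  have e: "\<i> / 4 * of_real A * (of_real J + \<i> * of_real Y) = of_real (a / 4 * b) * (\<i> * of_real J - of_real Y)"
    if "A = a * b" for A a b J Y :: real using that by (simp add: complex_eq_iff)
  show ?thesis unfolding helmholtz_Phi_def Let_def hankel_H1_def \<nu> by (rule e[OF p])
qed

lemma helmholtz_Phi_minus: "helmholtz_Phi k (- x) = helmholtz_Phi k x"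
  by (simp add: helmholtz_Phi_def)

text \<open>At k |x| = z both sides vanish together with Y, so the non-strict diameter condition is
  enough.\<close>

lemma Re_helmholtz_Phi:
  fixes x :: "'a::euclidean_space"
  assumes n: "n \<ge> 1" and k: "k > 0" and N: "DIM('a) = n + 2" and x: "k * norm x \<le> first_zero_bessel_Y (real n / 2)"
  shows "Re (helmholtz_Phi k x) = (k / (2 * pi)) powr (real n / 2) / 4 * bessel_kernel n k (norm x)"
  unfolding helmholtz_Phi_eq[OF n k N] using x first_zero_bessel_Y(2)[OF n]
  by (cases "k * norm x = first_zero_bessel_Y (real n / 2)") (auto simp: bessel_kernel_def)

lemma helmholtz_Phi_bound:
  assumes n: "n \<ge> 1" and k: "k > 0" and N: "DIM('a::euclidean_space) = n + 2"
  obtains C where "C > 0" "\<And>x::'a. x \<noteq> 0 \<Longrightarrow> norm (helmholtz_Phi k x) \<le> C * (norm x powr - real n + 1)"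
proof -
  define \<nu> where "\<nu> = real n / 2"
  obtain C where C: "C > 0" "\<And>x. x > 0 \<Longrightarrow> x powr - \<nu> * \<bar>bessel_Y \<nu> x\<bar> \<le> C * (x powr (- 2 * \<nu>) + 1)"
    "\<And>x. x > 0 \<Longrightarrow> x powr - \<nu> * \<bar>bessel_J \<nu> x\<bar> \<le> C * (x powr (- 2 * \<nu>) + 1)"
    using bessel_kernel_bound[OF n] unfolding \<nu>_def by metis
  define a where "a = (k / (2 * pi)) powr \<nu> / 4"
  have a: "a > 0" using k by (simp add: a_def)
  define D where "D = a * k powr \<nu> * (2 * C) * (k powr (- 2 * \<nu>) + 1)"
  show ?thesis
  proof (rule that[of D])
    show "D > 0" using a k C(1) by (simp add: D_def add_pos_pos)
    fix x :: 'a assume x: "x \<noteq> 0"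
    define r where "r = norm x"
    have r: "r > 0" using x by (simp add: r_def)
    have e: "r powr - \<nu> = k powr \<nu> * (k * r) powr - \<nu>" using r k by (simp add: powr_mult powr_minus)
    have "norm (helmholtz_Phi k x) \<le> a * r powr - \<nu> * (\<bar>bessel_J \<nu> (k * r)\<bar> + \<bar>bessel_Y \<nu> (k * r)\<bar>)"
    proof -
      have "norm (helmholtz_Phi k x) = a * r powr - \<nu> * norm (\<i> * of_real (bessel_J \<nu> (k * r)) - of_real (bessel_Y \<nu> (k * r)))"
        unfolding helmholtz_Phi_eq[OF n k N] norm_mult norm_of_real using a by (simp add: a_def \<nu>_def r_def abs_mult)
      also have "norm (\<i> * of_real (bessel_J \<nu> (k * r)) - of_real (bessel_Y \<nu> (k * r))) \<le> \<bar>bessel_J \<nu> (k * r)\<bar> + \<bar>bessel_Y \<nu> (k * r)\<bar>"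
        by (rule order_trans[OF norm_triangle_ineq4]) (simp add: norm_mult)
      finally show ?thesis using a by (simp add: mult_left_mono)
    qed
    also have "\<dots> = a * k powr \<nu> * ((k * r) powr - \<nu> * \<bar>bessel_J \<nu> (k * r)\<bar> + (k * r) powr - \<nu> * \<bar>bessel_Y \<nu> (k * r)\<bar>)"
      unfolding e by (simp add: algebra_simps)
    also have "\<dots> \<le> a * k powr \<nu> * (2 * (C * ((k * r) powr (- 2 * \<nu>) + 1)))"
      using C(2,3)[of "k * r"] k r a by (intro mult_left_mono) auto
    also have "\<dots> = a * k powr \<nu> * (2 * C) * (k powr (- 2 * \<nu>) * r powr (- 2 * \<nu>) + 1)"
      using k r by (simp add: powr_mult)
    also have "\<dots> \<le> a * k powr \<nu> * (2 * C) * ((k powr (- 2 * \<nu>) + 1) * (r powr (- 2 * \<nu>) + 1))"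
      using a C(1) by (intro mult_left_mono) (auto simp: algebra_simps)
    finally show "norm (helmholtz_Phi k x) \<le> D * (norm x powr - real n + 1)"
      by (simp add: D_def r_def \<nu>_def mult.assoc)
  qed
qed

lemma isCont_helmholtz_Phi:
  fixes x :: "'a::euclidean_space"
  assumes n: "n \<ge> 1" and k: "k > 0" and N: "DIM('a) = n + 2" and x: "x \<noteq> 0"
  shows "isCont (helmholtz_Phi k) x"
proof -
  define \<nu> where "\<nu> = real n / 2"
  have J: "isCont (bessel_J \<nu>) (k * norm x)" using k x by (intro ladder_isCont(1)[OF ladder_bessel_J]) auto
  have Y: "isCont (bessel_Y \<nu>) (k * norm x)" unfolding \<nu>_def using k x by (intro isCont_bessel_Y_half_order) auto
  have c: "isCont (\<lambda>x::'a. k * norm x) x" by (intro continuous_intros)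
  have "isCont (\<lambda>x. of_real ((k / (2 * pi)) powr \<nu> / 4 * norm x powr - \<nu>)
    * (\<i> * of_real (bessel_J \<nu> (k * norm x)) - of_real (bessel_Y \<nu> (k * norm x)))) x"
    using x by (intro continuous_intros isCont_o2[OF c J] isCont_o2[OF c Y]) auto
  then show ?thesis unfolding helmholtz_Phi_eq[OF n k N, abs_def] \<nu>_def .
qed

lemma borel_measurable_helmholtz_Phi:
  assumes n: "n \<ge> 1" and k: "k > 0" and N: "DIM('a::euclidean_space) = n + 2"
  shows "(helmholtz_Phi k :: 'a \<Rightarrow> complex) \<in> borel_measurable borel"
proof -
  have c: "continuous_on (- {0::'a}) (helmholtz_Phi k)"
    by (intro continuous_at_imp_continuous_on ballI isCont_helmholtz_Phi[OF n k N]) auto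
  have "(\<lambda>x::'a. if x \<in> - {0} then helmholtz_Phi k x else 0) \<in> borel_measurable borel"
    by (rule borel_measurable_continuous_on_if[OF _ c]) auto
  moreover have "(\<lambda>x::'a. if x \<in> - {0} then helmholtz_Phi k x else 0) = helmholtz_Phi k"
    by (auto simp: fun_eq_iff helmholtz_Phi_eq[OF n k N])
  ultimately show ?thesis by simp
qed

lemma powr_integrable_near_0:
  assumes "\<beta> > -1" "T \<ge> 0"
  shows "integrable lborel (\<lambda>r::real. indicator {0<..T} r *\<^sub>R r powr \<beta>)"
proof -
  have "(\<lambda>x. x powr \<beta>) absolutely_integrable_on {0..T}"
    using assms by (intro nonnegative_absolutely_integrable_1 integrable_on_powr_from_0) auto
  then have "integrable lebesgue (\<lambda>r. indicator {0..T} r *\<^sub>R r powr \<beta>)" by (simp add: set_integrable_def)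
  then have i: "integrable lborel (\<lambda>r. indicator {0..T} r *\<^sub>R r powr \<beta>)" by (subst (asm) integrable_completion) auto
  show ?thesis by (rule Bochner_Integration.integrable_bound[OF i]) (auto split: split_indicator)
qed

text \<open>The condition on s says s < N / (N - 2) for N = n + 2: the singularity r^(- n s) has to
  be integrable against r^(n + 1).\<close>

lemma riesz_power_integrable:
  fixes s T :: real
  assumes s: "s \<ge> 1" "real n * s < real n + 2" and T: "T \<ge> 0" and N: "DIM('a::euclidean_space) = n + 2"
  shows "integrable lborel (\<lambda>x::'a. indicator {0<..T} (norm x) * (norm x powr - real n + 1) powr s)"
proof -
  define h where "h = (\<lambda>r. indicator {0<..T} r * (r powr - real n + 1) powr s)"
  have hm: "h \<in> borel_measurable borel" unfolding h_def by measurable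
  have i: "integrable lborel (\<lambda>r. 2 powr s * (indicator {0<..T} r *\<^sub>R r powr (real n + 1 - real n * s) + indicator {0<..T} r *\<^sub>R r powr (real n + 1)))"
    using s T by (intro integrable_mult_right Bochner_Integration.integrable_add powr_integrable_near_0) auto
  have "integrable lborel (\<lambda>r. indicator {0<..} r *\<^sub>R (r ^ (DIM('a) - 1) * h r))"
  proof (rule Bochner_Integration.integrable_bound[OF i _ AE_I2])
    show "(\<lambda>r. indicator {0<..} r *\<^sub>R (r ^ (DIM('a) - 1) * h r)) \<in> borel_measurable lborel" using hm by measurable
    fix r :: real
    show "norm (indicator {0<..} r *\<^sub>R (r ^ (DIM('a) - 1) * h r)) \<le>
      norm (2 powr s * (indicator {0<..T} r *\<^sub>R r powr (real n + 1 - real n * s) + indicator {0<..T} r *\<^sub>R r powr (real n + 1)))"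
    proof (cases "0 < r \<and> r \<le> T")
      case True
      define m where "m = max (r powr - real n) 1"
      have "(r powr - real n + 1) powr s \<le> (2 * m) powr s" using s by (intro powr_mono2) (auto simp: m_def)
      also have "\<dots> = 2 powr s * m powr s" by (rule powr_mult)
      also have "m powr s \<le> r powr (- real n * s) + 1"
        by (cases "r powr - real n \<le> 1") (auto simp: m_def max_def powr_powr)
      finally have "(r powr - real n + 1) powr s \<le> 2 powr s * (r powr (- real n * s) + 1)" by simp
      then have "r powr (real n + 1) * (r powr - real n + 1) powr s \<le> r powr (real n + 1) * (2 powr s * (r powr (- real n * s) + 1))"
        by (intro mult_left_mono) auto
      also have "\<dots> = 2 powr s * (r powr (real n + 1) * r powr (- real n * s) + r powr (real n + 1))" by (simp add: algebra_simps)
      also have "r powr (real n + 1) * r powr (- real n * s) = r powr (real n + 1 - real n * s)"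
        by (simp flip: powr_add)
      finally have "r powr (real n + 1) * (r powr - real n + 1) powr s \<le> 2 powr s * (r powr (real n + 1 - real n * s) + r powr (real n + 1))" .
      moreover have "r ^ (DIM('a) - 1) = r powr (real n + 1)"
        using True N powr_realpow[of r "n + 1"] by (simp add: add.commute)
      ultimately show ?thesis using True by (simp add: h_def)
    next
      case False
      then have "indicator {0<..} r *\<^sub>R (r ^ (DIM('a) - 1) * h r) = 0" by (auto simp: h_def)
      then show ?thesis by (simp only: norm_zero norm_ge_zero)
    qed
  qed
  then show ?thesis using radial_integrable_iff[OF hm, where 'a = 'a] by (simp add: h_def)
qed

text \<open>Integrable, unlike the fundamental solution, but equal to it on the ball of radius T.
  The cutoff is gradual so that the kernel stays continuous off the origin, from which the modulus
  of continuity of its convolutions is derived.\<close>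

definition cutoff_Phi :: "real \<Rightarrow> real \<Rightarrow> 'a::euclidean_space \<Rightarrow> complex"
  where "cutoff_Phi k T x = max 0 (min 1 (T + 1 - norm x)) *\<^sub>R helmholtz_Phi k x"

lemma cutoff_Phi:
  assumes n: "n \<ge> 1" and k: "k > 0" and N: "DIM('a::euclidean_space) = n + 2" and T: "T > 0"
  shows "(cutoff_Phi k T :: 'a \<Rightarrow> complex) \<in> borel_measurable borel"
    and "\<And>x::'a. x \<noteq> 0 \<Longrightarrow> isCont (cutoff_Phi k T) x"
    and "\<And>x::'a. norm x \<le> T \<Longrightarrow> cutoff_Phi k T x = helmholtz_Phi k x"
    and "\<And>x::'a. norm x > T + 1 \<Longrightarrow> cutoff_Phi k T x = 0"
    and "\<And>s. s \<ge> 1 \<Longrightarrow> real n * s < real n + 2 \<Longrightarrow> integrable lborel (\<lambda>x::'a. norm (cutoff_Phi k T x) powr s)"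
    and "integrable lborel (cutoff_Phi k T :: 'a \<Rightarrow> complex)"
proof -
  note [measurable] = borel_measurable_helmholtz_Phi[OF n k N]
  show m [measurable]: "(cutoff_Phi k T :: 'a \<Rightarrow> complex) \<in> borel_measurable borel"
    unfolding cutoff_Phi_def by measurable
  show "isCont (cutoff_Phi k T) x" if "x \<noteq> 0" for x :: 'a
    unfolding cutoff_Phi_def by (intro continuous_intros isCont_helmholtz_Phi[OF n k N that])
  show "cutoff_Phi k T x = helmholtz_Phi k x" if "norm x \<le> T" for x :: 'a using that by (simp add: cutoff_Phi_def)
  show out: "cutoff_Phi k T x = 0" if "norm x > T + 1" for x :: 'a using that by (simp add: cutoff_Phi_def)
  obtain C where C: "C > 0" "\<And>x::'a. x \<noteq> 0 \<Longrightarrow> norm (helmholtz_Phi k x) \<le> C * (norm x powr - real n + 1)"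
    using helmholtz_Phi_bound[OF n k N] by metis
  show pw: "integrable lborel (\<lambda>x::'a. norm (cutoff_Phi k T x) powr s)" if s: "s \<ge> 1" "real n * s < real n + 2" for s
  proof (rule Bochner_Integration.integrable_bound[OF integrable_mult_right[OF riesz_power_integrable[OF s _ N, of "T + 1"], of "C powr s"] _ AE_I2])
    fix x :: 'a
    show "norm (norm (cutoff_Phi k T x) powr s) \<le> norm (C powr s * (indicator {0<..T + 1} (norm x) * (norm x powr - real n + 1) powr s))"
    proof (cases "x \<noteq> 0 \<and> norm x \<le> T + 1")
      case True
      have "norm (cutoff_Phi k T x) \<le> 1 * norm (helmholtz_Phi k x)"
        unfolding cutoff_Phi_def norm_scaleR by (intro mult_right_mono) auto
      also have "\<dots> \<le> C * (norm x powr - real n + 1)" using C(2) True by simp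
      finally have "norm (cutoff_Phi k T x) powr s \<le> (C * (norm x powr - real n + 1)) powr s" using s by (intro powr_mono2) auto
      also have "\<dots> = C powr s * (norm x powr - real n + 1) powr s" by (rule powr_mult)
      finally show ?thesis using True by simp
    next
      case False
      then have "cutoff_Phi k T x = 0" using out[of x] by (auto simp: cutoff_Phi_def helmholtz_Phi_eq[OF n k N])
      then show ?thesis by simp
    qed
  qed (use T in auto)
  have "integrable lborel (\<lambda>x::'a. norm (cutoff_Phi k T x))" using pw[of 1] by simp
  then show "integrable lborel (cutoff_Phi k T :: 'a \<Rightarrow> complex)"
    by (subst (asm) integrable_norm_iff) simp_all
qed

section \<open>Hammerstein equations with a positive definite kernel\<close>

lemma integrable_bounded_support:
  fixes f :: "'a::euclidean_space \<Rightarrow> 'b::{banach, second_countable_topology}"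
  assumes [measurable]: "f \<in> borel_measurable borel" and B: "\<And>x. norm (f x) \<le> B" and r: "\<And>x. norm x > r \<Longrightarrow> f x = 0"
  shows "integrable lborel f"
proof (rule Bochner_Integration.integrable_bound)
  show "integrable lborel (\<lambda>x::'a. indicator (cball 0 r) x *\<^sub>R B)" by (rule borel_integrable_compact) auto
  have "norm (f x) \<le> norm (indicator (cball 0 r) x *\<^sub>R B)" for x
    using B[of x] r[of x] by (cases "norm x > r") auto
  then show "AE x in lborel. norm (f x) \<le> norm (indicator (cball 0 r) x *\<^sub>R B)" by simp
qed simp

definition pow_map :: "real \<Rightarrow> complex \<Rightarrow> complex"
  where "pow_map p w = of_real (norm w powr (p - 2)) * w"

lemma norm_pow_map: "p > 2 \<Longrightarrow> norm (pow_map p w) = norm w powr (p - 1)"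
proof (cases "w = 0")
  case False
  then have "norm w powr (p - 2) * norm w powr 1 = norm w powr (p - 1)" by (simp only: powr_add[symmetric]) simp
  then show ?thesis using False by (simp add: pow_map_def norm_mult)
qed (simp add: pow_map_def)

lemma continuous_on_pow_map: "p > 2 \<Longrightarrow> continuous_on S (pow_map p)"
  unfolding pow_map_def by (intro continuous_intros continuous_on_powr') auto

lemma mult_cnj_pow_map: "p > 2 \<Longrightarrow> w * cnj (pow_map p w) = of_real (norm w powr p)"
proof -
  assume p: "p > 2"
  have "w * cnj (pow_map p w) = of_real (norm w powr (p - 2)) * (w * cnj w)" by (simp add: pow_map_def)
  also have "w * cnj w = of_real ((norm w)\<^sup>2)" by (rule complex_norm_square[symmetric])
  also have "of_real (norm w powr (p - 2)) * of_real ((norm w)\<^sup>2) = (of_real (norm w powr p) :: complex)"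
  proof (cases "w = 0")
    case False
    then have "(norm w)\<^sup>2 = norm w powr 2" by simp
    then show ?thesis by (simp only: of_real_mult[symmetric] powr_add[symmetric]) simp
  qed (use p in simp)
  finally show ?thesis .
qed

definition kernel_conv :: "('a::euclidean_space \<Rightarrow> complex) \<Rightarrow> ('a \<Rightarrow> complex) \<Rightarrow> 'a \<Rightarrow> complex"
  where "kernel_conv \<kappa> f x = (LINT y|lborel. \<kappa> (x - y) * f y)"

text \<open>The third claim gives convolutions with bounded sources a common modulus of continuity:
  that of the kernel under translation in L^1, times the bound of the source.\<close>

lemma kernel_conv:
  fixes \<kappa> f :: "'a::euclidean_space \<Rightarrow> complex"
  assumes km [measurable]: "\<kappa> \<in> borel_measurable borel" and kint: "integrable lborel \<kappa>"
    and fm [measurable]: "f \<in> borel_measurable borel" and B: "\<And>x. norm (f x) \<le> B"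
  shows "integrable lborel (\<lambda>y. \<kappa> (x - y) * f y)"
    and "norm (kernel_conv \<kappa> f x) \<le> B * (LINT y|lborel. norm (\<kappa> y))"
    and "norm (kernel_conv \<kappa> f x - kernel_conv \<kappa> f x') \<le> B * (LINT y|lborel. norm (\<kappa> (y + (x - x')) - \<kappa> y))"
    and "kernel_conv \<kappa> f \<in> borel_measurable borel"
proof -
  have B0: "B \<ge> 0" using B[of undefined] norm_ge_zero order_trans by blast
  have kx: "integrable lborel (\<lambda>y. \<kappa> (x - y))" for x using lborel_translate_integral(3)[OF km] kint by simp
  have est: "integrable lborel (\<lambda>y. h y * f y)" "norm (LINT y|lborel. h y * f y) \<le> B * (LINT y|lborel. norm (h y))"
    if h: "integrable lborel h" for h
  proof -
    have [measurable]: "h \<in> borel_measurable borel" using borel_measurable_integrable[OF h] by simp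
    have bd: "norm (h y * f y) \<le> norm (B * norm (h y))" for y
      using mult_right_mono[OF B norm_ge_zero[of "h y"]] B0 by (simp add: norm_mult mult.commute)
    show i: "integrable lborel (\<lambda>y. h y * f y)"
      by (rule Bochner_Integration.integrable_bound[OF integrable_mult_right[OF integrable_norm[OF h], of B] _ AE_I2[OF bd]]) simp
    have "norm (LINT y|lborel. h y * f y) \<le> (LINT y|lborel. norm (h y * f y))" by (rule integral_norm_bound)
    also have "\<dots> \<le> (LINT y|lborel. B * norm (h y))"
      by (rule integral_mono[OF integrable_norm[OF i] integrable_mult_right[OF integrable_norm[OF h]]])
         (use bd B0 in simp)
    finally show "norm (LINT y|lborel. h y * f y) \<le> B * (LINT y|lborel. norm (h y))" by simp
  qed
  show i: "integrable lborel (\<lambda>y. \<kappa> (x - y) * f y)" for x by (rule est(1)[OF kx])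
  have nm: "(\<lambda>y. norm (\<kappa> y)) \<in> borel_measurable borel" by measurable
  show "norm (kernel_conv \<kappa> f x) \<le> B * (LINT y|lborel. norm (\<kappa> y))"
    using est(2)[OF kx[of x]] lborel_translate_integral(4)[OF nm, of x] by (simp add: kernel_conv_def)
  have "kernel_conv \<kappa> f x - kernel_conv \<kappa> f x' = (LINT y|lborel. (\<kappa> (x - y) - \<kappa> (x' - y)) * f y)"
    unfolding kernel_conv_def by (simp add: i left_diff_distrib)
  also have "norm \<dots> \<le> B * (LINT y|lborel. norm (\<kappa> (x - y) - \<kappa> (x' - y)))"
    by (rule est(2)) (intro Bochner_Integration.integrable_diff kx)
  also have "(LINT y|lborel. norm (\<kappa> (x - y) - \<kappa> (x' - y))) = (LINT y|lborel. norm (\<kappa> (y + (x - x')) - \<kappa> y))"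
  proof -
    have "(\<lambda>y. norm (\<kappa> (y + (x - x')) - \<kappa> y)) \<in> borel_measurable borel" by measurable
    from lborel_translate_integral(4)[OF this, of x'] show ?thesis by (simp add: algebra_simps)
  qed
  finally show "norm (kernel_conv \<kappa> f x - kernel_conv \<kappa> f x') \<le> B * (LINT y|lborel. norm (\<kappa> (y + (x - x')) - \<kappa> y))" .
  show "kernel_conv \<kappa> f \<in> borel_measurable borel" unfolding kernel_conv_def by measurable
qed

lemma translate_L1_modulus:
  fixes \<kappa> :: "'a::euclidean_space \<Rightarrow> 'b::{banach, second_countable_topology}"
  assumes km: "\<kappa> \<in> borel_measurable borel" and kint: "integrable lborel \<kappa>"
    and c: "\<And>x. x \<noteq> 0 \<Longrightarrow> isCont \<kappa> x" and e: "e > 0"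
  obtains d where "d > 0" "\<And>h. norm h < d \<Longrightarrow> (LINT y|lborel. norm (\<kappa> (y + h) - \<kappa> y)) < e"
proof -
  have "\<exists>d>0. \<forall>h. norm h < d \<longrightarrow> (LINT y|lborel. norm (\<kappa> (y + h) - \<kappa> y)) < e"
  proof (rule ccontr)
    assume no: "\<not> ?thesis"
    have "\<exists>h. norm h < inverse (real (Suc n)) \<and> e \<le> (LINT y|lborel. norm (\<kappa> (y + h) - \<kappa> y))" for n
      using no by (metis inverse_positive_iff_positive linorder_not_less of_nat_0_less_iff zero_less_Suc)
    then obtain v where v: "\<And>n. norm (v n) < inverse (real (Suc n))" "\<And>n. e \<le> (LINT y|lborel. norm (\<kappa> (y + v n) - \<kappa> y))"
      by metis
    have "v \<longlonglongrightarrow> 0"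
      by (rule Lim_null_comparison[OF always_eventually LIMSEQ_inverse_real_of_nat]) (use v(1) in \<open>auto intro: less_imp_le\<close>)
    from tendsto_translate_L1[OF km kint c this] have "(\<lambda>n. LINT y|lborel. norm (\<kappa> (y + v n) - \<kappa> y)) \<longlonglongrightarrow> 0" by blast
    then have "e \<le> 0" by (rule LIMSEQ_le_const) (use v(2) in auto)
    then show False using e by simp
  qed
  then show ?thesis using that by blast
qed

text \<open>Arzela-Ascoli on the ball of radius r. Outside it all members vanish, so uniform
  convergence on the ball is uniform convergence on the whole space.\<close>

lemma compact_equicontinuous_bcontfun:
  fixes \<tau> :: "'a::euclidean_space \<Rightarrow> real"
  assumes \<tau>: "\<And>e. e > 0 \<Longrightarrow> \<exists>d>0. \<forall>h. norm h < d \<longrightarrow> \<tau> h < e"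
  shows "compact {g :: 'a \<Rightarrow>\<^sub>C complex. (\<forall>x. norm (g x) \<le> M) \<and> (\<forall>x. norm x > r \<longrightarrow> g x = 0)
    \<and> (\<forall>x x'. norm (g x - g x') \<le> \<tau> (x - x'))}" (is "compact ?S")
proof -
  have pw: "(\<lambda>n. apply_bcontfun (f n) x) \<longlonglongrightarrow> apply_bcontfun l x" if "f \<longlonglongrightarrow> l" for f and l :: "'a \<Rightarrow>\<^sub>C complex" and x
    using tendsto_uniform_limitI[OF tendsto_bcontfun_uniform_limit[OF that], of x] by simp
  have cl: "closed ?S"
  proof (unfold closed_sequential_limits, intro allI impI, elim conjE)
    fix f l assume f: "\<forall>n. f n \<in> ?S" and l: "f \<longlonglongrightarrow> l"
    have 1: "norm (l x) \<le> M" for x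
      by (rule LIMSEQ_le_const2[OF tendsto_norm[OF pw[OF l]]]) (use f in auto)
    have 2: "l x = 0" if "norm x > r" for x
    proof -
      have "(\<lambda>n. apply_bcontfun (f n) x) = (\<lambda>_. 0)" using f that by auto
      then show ?thesis using pw[OF l, of x] by (simp add: LIMSEQ_const_iff)
    qed
    have 3: "norm (l x - l x') \<le> \<tau> (x - x')" for x x'
      by (rule LIMSEQ_le_const2[OF tendsto_norm[OF tendsto_diff[OF pw[OF l] pw[OF l]]]]) (use f in auto)
    show "l \<in> ?S" using 1 2 3 by simp
  qed
  show ?thesis unfolding compact_def
  proof (intro allI impI)
    fix f :: "nat \<Rightarrow> 'a \<Rightarrow>\<^sub>C complex" assume f: "\<forall>n. f n \<in> ?S"
    obtain g k where g: "strict_mono (k :: nat \<Rightarrow> nat)"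
      "\<And>e. 0 < e \<Longrightarrow> \<exists>N. \<forall>n x. n \<ge> N \<and> x \<in> cball 0 r \<longrightarrow> norm (apply_bcontfun (f (k n)) x - g x) < e"
    proof (rule Arzela_Ascoli[of "cball (0::'a) r" "\<lambda>n. apply_bcontfun (f n)" M])
      fix x :: 'a and e :: real assume "e > 0"
      then obtain d where d: "d > 0" "\<And>h. norm h < d \<Longrightarrow> \<tau> h < e" using \<tau> by blast
      have "norm (f n x - f n y) < e" if "norm (x - y) < d" for n y
        using d(2)[OF that] f by (metis (mono_tags, lifting) mem_Collect_eq le_less_trans)
      then show "\<exists>d. 0 < d \<and> (\<forall>n y. y \<in> cball 0 r \<and> norm (x - y) < d \<longrightarrow> norm (f n x - f n y) < e)"
        using d(1) by blast
    qed (use f in auto)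
    have "Cauchy (\<lambda>n. f (k n))"
    proof (rule metric_CauchyI)
      fix e :: real assume e: "e > 0"
      obtain N where N: "\<And>n x. n \<ge> N \<Longrightarrow> x \<in> cball 0 r \<Longrightarrow> norm (apply_bcontfun (f (k n)) x - g x) < e / 4"
        using g(2)[of "e / 4"] e by auto
      show "\<exists>N. \<forall>m\<ge>N. \<forall>n\<ge>N. dist (f (k m)) (f (k n)) < e"
      proof (intro exI[of _ N] allI impI)
        fix m n assume mn: "m \<ge> N" "n \<ge> N"
        have "dist (f (k m)) (f (k n)) \<le> e / 2"
        proof (rule dist_bound)
          fix x
          show "dist (f (k m) x) (f (k n) x) \<le> e / 2"
          proof (cases "norm x > r")
            case True
            then show ?thesis using f e by simp
          next
            case False
            then have "norm (f (k m) x - g x) < e / 4" "norm (f (k n) x - g x) < e / 4" using N mn by auto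
            then show ?thesis using norm_triangle_ineq4[of "f (k m) x - g x" "f (k n) x - g x"] by (simp add: dist_norm)
          qed
        qed
        then show "dist (f (k m)) (f (k n)) < e" using e by simp
      qed
    qed
    then obtain l where l: "(\<lambda>n. f (k n)) \<longlonglongrightarrow> l" using Cauchy_convergent convergent_def by blast
    have "l \<in> ?S" by (rule closed_sequentially[OF cl _ l]) (use f in auto)
    then show "\<exists>l\<in>?S. \<exists>r. strict_mono r \<and> (f \<circ> r) \<longlonglongrightarrow> l"
      using g(1) l by (intro bexI[of _ l] exI[of _ k]) (auto simp: o_def)
  qed
qed

lemma sublinear_bound:
  fixes \<theta> E L :: real
  assumes "\<theta> < 1" "0 < \<theta>" "L \<ge> 0"
  obtains R where "R > 0" "\<And>m. m \<ge> R \<Longrightarrow> (m + L) powr \<theta> * E < m"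
proof -
  have "((\<lambda>m. (m + L) powr \<theta> * \<bar>E\<bar> / m) \<longlongrightarrow> 0) at_top" using assms by real_asymp
  then have "\<forall>\<^sub>F m in at_top. (m + L) powr \<theta> * \<bar>E\<bar> / m < 1" by (rule order_tendstoD(2)) simp
  then obtain R where R: "\<And>m. m \<ge> R \<Longrightarrow> (m + L) powr \<theta> * \<bar>E\<bar> / m < 1" by (auto simp: eventually_at_top_linorder)
  show ?thesis
  proof (rule that[of "max R 1"])
    fix m assume m: "m \<ge> max R 1"
    then have "(m + L) powr \<theta> * \<bar>E\<bar> < m" using R[of m] by (simp add: divide_less_eq)
    moreover have "(m + L) powr \<theta> * E \<le> (m + L) powr \<theta> * \<bar>E\<bar>" by (intro mult_left_mono) auto
    ultimately show "(m + L) powr \<theta> * E < m" by linarith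
  qed simp
qed

text \<open>A pair \<open>x = (\<lambda>, v)\<close> encodes \<open>u = v + \<lambda> \<phi>\<close>, which is \<open>tot x\<close> below, so that \<open>v\<close> is continuous although
  \<open>\<phi>\<close> need not be.\<close>

locale hammerstein =
  fixes \<kappa> :: "'a::euclidean_space \<Rightarrow> complex" and q :: "'a \<Rightarrow> real" and \<phi> :: "'a \<Rightarrow> complex"
    and p b c r T \<theta> :: real
  assumes \<kappa>m [measurable]: "\<kappa> \<in> borel_measurable borel" and \<kappa>int: "integrable lborel \<kappa>"
    and \<kappa>c: "\<And>x. x \<noteq> 0 \<Longrightarrow> isCont \<kappa> x" and \<kappa>0: "\<And>x. norm x > T \<Longrightarrow> \<kappa> x = 0"
    and qm [measurable]: "q \<in> borel_measurable borel" and qb: "\<And>x. \<bar>q x\<bar> \<le> b" and q0: "\<And>x. norm x > r \<Longrightarrow> q x = 0"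
    and qneg: "\<And>x. q x \<le> 0"
    and \<phi>m [measurable]: "\<phi> \<in> borel_measurable borel" and \<phi>b: "\<And>x. norm (\<phi> x) \<le> c"
    and p: "p > 2" and \<theta>: "0 < \<theta>" "\<theta> < 1" and \<kappa>s: "integrable lborel (\<lambda>x. norm (\<kappa> x) powr (p / (1 + \<theta>)))"
    and pos: "\<And>f B. f \<in> borel_measurable borel \<Longrightarrow> (\<And>x. norm (f x) \<le> B) \<Longrightarrow> (\<And>x. q x = 0 \<Longrightarrow> f x = 0)
      \<Longrightarrow> 0 \<le> Re (LINT x|lborel. kernel_conv \<kappa> f x * cnj (f x))"
begin

lemma b0: "b \<ge> 0" and c0: "c \<ge> 0"
  using order_trans[OF abs_ge_zero qb] order_trans[OF norm_ge_zero \<phi>b] by blast+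

definition tot :: "real \<times> ('a \<Rightarrow>\<^sub>C complex) \<Rightarrow> 'a \<Rightarrow> complex"
  where "tot x y = apply_bcontfun (snd x) y + of_real (fst x) * \<phi> y"

definition src :: "real \<times> ('a \<Rightarrow>\<^sub>C complex) \<Rightarrow> 'a \<Rightarrow> complex"
  where "src x y = of_real (q y) * pow_map p (tot x y)"

lemma tot_measurable [measurable]: "tot x \<in> borel_measurable borel"
proof -
  have [measurable]: "apply_bcontfun (snd x) \<in> borel_measurable borel"
    by (intro borel_measurable_continuous_onI) simp
  show ?thesis unfolding tot_def by measurable
qed

lemma src_measurable [measurable]: "src x \<in> borel_measurable borel"
proof -
  have [measurable]: "pow_map p \<in> borel_measurable borel"
    by (intro borel_measurable_continuous_onI continuous_on_pow_map p)
  show ?thesis unfolding src_def by measurable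
qed

lemma tot_bound: "norm (tot x y) \<le> norm (snd x) + \<bar>fst x\<bar> * c"
proof -
  have "norm (of_real (fst x) * \<phi> y) \<le> \<bar>fst x\<bar> * c"
    using \<phi>b[of y] by (simp add: norm_mult mult_left_mono)
  moreover have "norm (snd x y) \<le> norm (snd x)" by (rule norm_bounded)
  ultimately show ?thesis unfolding tot_def using norm_triangle_ineq order_trans add_mono by meson
qed

lemma tot_diff: "norm (tot x y - tot x' y) \<le> dist x x' * (1 + c)"
proof -
  have d: "dist (fst x) (fst x') \<le> dist x x'" "dist (snd x) (snd x') \<le> dist x x'" by (rule dist_fst_le dist_snd_le)+
  have "norm (of_real (fst x - fst x') * \<phi> y) \<le> dist x x' * c"
    unfolding norm_mult norm_of_real using d(1) \<phi>b[of y] by (intro mult_mono) (auto simp: dist_real_def)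
  moreover have "norm (snd x y - snd x' y) \<le> dist x x'"
    using dist_bounded[of "snd x" y "snd x'"] d(2) by (simp add: dist_norm)
  moreover have "tot x y - tot x' y = (snd x y - snd x' y) + of_real (fst x - fst x') * \<phi> y"
    by (simp add: tot_def algebra_simps)
  ultimately have "norm (tot x y - tot x' y) \<le> dist x x' + dist x x' * c"
    by (simp only:) (rule order_trans[OF norm_triangle_ineq add_mono])
  then show ?thesis by (simp add: distrib_left)
qed

lemma norm_src: "norm (src x y) = \<bar>q y\<bar> * norm (tot x y) powr (p - 1)"
  using p by (simp add: src_def norm_mult norm_pow_map)

lemma src_bound: "norm (src x y) \<le> b * (norm (snd x) + \<bar>fst x\<bar> * c) powr (p - 1)"
  unfolding norm_src using p qb[of y] b0 tot_bound[of x y] by (intro mult_mono powr_mono2) auto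

lemma src_zero: "q y = 0 \<Longrightarrow> src x y = 0"
  by (simp add: src_def)

text \<open>On bounded sets \<open>tot\<close> takes values in a fixed ball, where
  \<open>pow_map p\<close> is uniformly continuous. So d does not depend on y, although \<phi> need
  not be continuous.\<close>

lemma src_uniformly_continuous:
  assumes e: "e > 0"
  obtains d where "d > 0" "\<And>x x' y. \<bar>fst x\<bar> \<le> L \<Longrightarrow> norm (snd x) \<le> M \<Longrightarrow> \<bar>fst x'\<bar> \<le> L \<Longrightarrow> norm (snd x') \<le> M
    \<Longrightarrow> dist x x' < d \<Longrightarrow> norm (src x y - src x' y) \<le> e"
proof -
  define A where "A = M + L * c"
  have "uniformly_continuous_on (cball 0 A) (pow_map p)"
    by (intro compact_uniformly_continuous continuous_on_pow_map p) simp
  moreover have "e / (b + 1) > 0" using e b0 by simp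
  ultimately obtain d where d: "d > 0" "\<And>w w'. w \<in> cball 0 A \<Longrightarrow> w' \<in> cball 0 A \<Longrightarrow> dist w' w < d \<Longrightarrow> dist (pow_map p w') (pow_map p w) < e / (b + 1)"
    unfolding uniformly_continuous_on_def by metis
  show ?thesis
  proof (rule that[of "d / (1 + c)"])
    show "d / (1 + c) > 0" using d(1) c0 by simp
    fix x x' :: "real \<times> ('a \<Rightarrow>\<^sub>C complex)" and y
    assume h: "\<bar>fst x\<bar> \<le> L" "norm (snd x) \<le> M" "\<bar>fst x'\<bar> \<le> L" "norm (snd x') \<le> M" "dist x x' < d / (1 + c)"
    have in_ball: "tot z y \<in> cball 0 A" if "\<bar>fst z\<bar> \<le> L" "norm (snd z) \<le> M" for z
    proof -
      have "norm (tot z y) \<le> norm (snd z) + \<bar>fst z\<bar> * c" by (rule tot_bound)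
      also have "\<dots> \<le> A" unfolding A_def using that c0 by (intro add_mono mult_right_mono) auto
      finally show ?thesis by simp
    qed
    have "norm (tot x y - tot x' y) < d"
      using tot_diff[of x y x'] h(5) c0 by (simp add: less_divide_eq)
    then have "dist (pow_map p (tot x y)) (pow_map p (tot x' y)) < e / (b + 1)"
      by (intro d(2) in_ball h) (simp add: dist_norm)
    then have "\<bar>q y\<bar> * norm (pow_map p (tot x y) - pow_map p (tot x' y)) \<le> b * (e / (b + 1))"
      using qb[of y] b0 by (intro mult_mono) (auto simp: dist_norm)
    also have "\<dots> \<le> e" using b0 e by (simp add: divide_le_eq mult_left_mono)
    finally show "norm (src x y - src x' y) \<le> e"
      unfolding src_def right_diff_distrib[symmetric] norm_mult norm_of_real .
  qed
qed

definition \<tau> :: "'a \<Rightarrow> real" where "\<tau> h = (LINT y|lborel. norm (\<kappa> (y + h) - \<kappa> y))"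
definition \<kappa>1 :: real where "\<kappa>1 = (LINT y|lborel. norm (\<kappa> y))"

lemma \<tau>_modulus: "e > 0 \<Longrightarrow> \<exists>d>0. \<forall>h. norm h < d \<longrightarrow> \<tau> h < e"
  using translate_L1_modulus[OF \<kappa>m \<kappa>int \<kappa>c, of e] unfolding \<tau>_def by metis

lemma \<kappa>1_nonneg: "\<kappa>1 \<ge> 0" unfolding \<kappa>1_def by (intro integral_nonneg_AE) simp

lemma \<tau>_nonneg: "\<tau> h \<ge> 0" unfolding \<tau>_def by (intro integral_nonneg_AE) simp

lemma conv_src_bcontfun: "kernel_conv \<kappa> (src x) \<in> bcontfun"
proof -
  define B where "B = b * (norm (snd x) + \<bar>fst x\<bar> * c) powr (p - 1)"
  note K = kernel_conv[OF \<kappa>m \<kappa>int src_measurable[of x] src_bound[of x], folded B_def]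
  have B0: "B \<ge> 0" using b0 by (simp add: B_def)
  have "isCont (kernel_conv \<kappa> (src x)) z" for z
    unfolding isCont_def LIM_eq
  proof (intro allI impI)
    fix e :: real assume e: "e > 0"
    then obtain d where d: "d > 0" "\<And>h. norm h < d \<Longrightarrow> \<tau> h < e / (B + 1)" using \<tau>_modulus[of "e / (B + 1)"] B0 by auto
    have "norm (kernel_conv \<kappa> (src x) z' - kernel_conv \<kappa> (src x) z) < e" if "norm (z' - z) < d" for z'
    proof -
      have "norm (kernel_conv \<kappa> (src x) z' - kernel_conv \<kappa> (src x) z) \<le> B * \<tau> (z' - z)" using K(3) by (simp add: \<tau>_def)
      also have "\<dots> \<le> (B + 1) * \<tau> (z' - z)" using \<tau>_nonneg by (intro mult_right_mono) auto
      also have "\<dots> < e" using d(2)[OF that] B0 by (simp add: pos_less_divide_eq mult.commute)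
      finally show ?thesis .
    qed
    then show "\<exists>d>0. \<forall>z'. z' \<noteq> z \<and> norm (z' - z) < d \<longrightarrow> norm (kernel_conv \<kappa> (src x) z' - kernel_conv \<kappa> (src x) z) < e"
      using d(1) by blast
  qed
  then have "continuous_on UNIV (kernel_conv \<kappa> (src x))" by (simp add: continuous_at_imp_continuous_on)
  moreover have "bounded (range (kernel_conv \<kappa> (src x)))" using K(2) by (auto simp: bounded_iff)
  ultimately show ?thesis by (simp add: bcontfun_def)
qed

definition F :: "real \<times> ('a \<Rightarrow>\<^sub>C complex) \<Rightarrow> ('a \<Rightarrow>\<^sub>C complex)"
  where "F x = Bcontfun (kernel_conv \<kappa> (src x))"

lemma apply_F: "apply_bcontfun (F x) = kernel_conv \<kappa> (src x)"
  unfolding F_def by (rule Bcontfun_inverse[OF conv_src_bcontfun])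

lemma conv_diff_bound:
  assumes "\<And>y. norm (src x y - src x' y) \<le> B"
  shows "norm (kernel_conv \<kappa> (src x) z - kernel_conv \<kappa> (src x') z) \<le> B * \<kappa>1"
proof -
  have "kernel_conv \<kappa> (src x) z - kernel_conv \<kappa> (src x') z = kernel_conv \<kappa> (\<lambda>y. src x y - src x' y) z"
    using kernel_conv(1)[OF \<kappa>m \<kappa>int src_measurable src_bound] unfolding kernel_conv_def by (simp add: right_diff_distrib)
  then show ?thesis using kernel_conv(2)[OF \<kappa>m \<kappa>int _ assms, where x = z] by (simp add: \<kappa>1_def)
qed

lemma F_continuous: "continuous_on ({0..\<Lambda>} \<times> cball 0 R) F"
  unfolding continuous_on_iff
proof (intro ballI allI impI)
  fix x :: "real \<times> ('a \<Rightarrow>\<^sub>C complex)" and e assume x: "x \<in> {0..\<Lambda>} \<times> cball 0 R" and e: "(e::real) > 0"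
  have "e / (2 * (\<kappa>1 + 1)) > 0" using e \<kappa>1_nonneg by simp
  then obtain d where d: "d > 0" "\<And>x x' y. \<bar>fst x\<bar> \<le> \<Lambda> \<Longrightarrow> norm (snd x) \<le> R \<Longrightarrow> \<bar>fst x'\<bar> \<le> \<Lambda> \<Longrightarrow> norm (snd x') \<le> R
    \<Longrightarrow> dist x x' < d \<Longrightarrow> norm (src x y - src x' y) \<le> e / (2 * (\<kappa>1 + 1))"
    using src_uniformly_continuous[where L = \<Lambda> and M = R] by metis
  have "dist (F x') (F x) < e" if x': "x' \<in> {0..\<Lambda>} \<times> cball 0 R" "dist x' x < d" for x' :: "real \<times> ('a \<Rightarrow>\<^sub>C complex)"
  proof -
    have s: "norm (src x' y - src x y) \<le> e / (2 * (\<kappa>1 + 1))" for y using d(2)[of x' x] x x' by auto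
    have "dist (F x') (F x) \<le> e / (2 * (\<kappa>1 + 1)) * \<kappa>1"
      by (rule dist_bound, unfold apply_F dist_norm) (rule conv_diff_bound[OF s])
    also have "\<dots> < e"
    proof -
      have "e * \<kappa>1 < e * (2 * (\<kappa>1 + 1))" using e \<kappa>1_nonneg by (intro mult_strict_left_mono) auto
      then show ?thesis using \<kappa>1_nonneg by (simp add: divide_less_eq)
    qed
    finally show ?thesis .
  qed
  then show "\<exists>d>0. \<forall>x'\<in>{0..\<Lambda>} \<times> cball 0 R. dist x' x < d \<longrightarrow> dist (F x') (F x) < e" using d(1) by blast
qed

text \<open>Size, support and modulus of continuity of a convolution are controlled by the bound B
  of the source; these three conditions cut out a compact set.\<close>

lemma F_compact: "\<exists>K. compact K \<and> F ` ({0..\<Lambda>} \<times> cball 0 R) \<subseteq> K"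
proof -
  define B where "B = b * (R + \<Lambda> * c) powr (p - 1)"
  have B0: "B \<ge> 0" using b0 by (simp add: B_def)
  define K where "K = {g :: 'a \<Rightarrow>\<^sub>C complex. (\<forall>x. norm (g x) \<le> B * \<kappa>1) \<and> (\<forall>x. norm x > T + r \<longrightarrow> g x = 0)
    \<and> (\<forall>x x'. norm (g x - g x') \<le> B * \<tau> (x - x'))}"
  have "compact K" unfolding K_def
  proof (rule compact_equicontinuous_bcontfun)
    fix e :: real assume "e > 0"
    then obtain d where d: "d > 0" "\<And>h. norm h < d \<Longrightarrow> \<tau> h < e / (B + 1)" using \<tau>_modulus[of "e / (B + 1)"] B0 by auto
    have "B * \<tau> h < e" if "norm h < d" for h
    proof -
      have "B * \<tau> h \<le> (B + 1) * \<tau> h" using \<tau>_nonneg by (intro mult_right_mono) auto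
      also have "\<dots> < e" using d(2)[OF that] B0 by (simp add: pos_less_divide_eq mult.commute)
      finally show ?thesis .
    qed
    then show "\<exists>d>0. \<forall>h. norm h < d \<longrightarrow> B * \<tau> h < e" using d(1) by blast
  qed
  moreover have "F x \<in> K" if x: "x \<in> {0..\<Lambda>} \<times> cball 0 R" for x
  proof -
    have sb: "norm (src x y) \<le> B" for y
    proof -
      have "norm (snd x) + \<bar>fst x\<bar> * c \<le> R + \<Lambda> * c" using x c0 by (intro add_mono mult_right_mono) auto
      then have "b * (norm (snd x) + \<bar>fst x\<bar> * c) powr (p - 1) \<le> B"
        unfolding B_def using p b0 c0 by (intro mult_left_mono powr_mono2) auto
      then show ?thesis using src_bound[of x y] by linarith
    qed
    note K = kernel_conv[OF \<kappa>m \<kappa>int src_measurable sb]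
    have z: "kernel_conv \<kappa> (src x) y = 0" if y: "norm y > T + r" for y
    proof -
      have "\<kappa> (y - t) * src x t = 0" for t
      proof (cases "norm t > r")
        case False
        then have "norm (y - t) > T" using y norm_triangle_ineq2[of y t] by linarith
        then show ?thesis using \<kappa>0 by simp
      qed (simp add: src_zero q0)
      then have e: "(\<lambda>t. \<kappa> (y - t) * src x t) = (\<lambda>_. 0)" by blast
      show ?thesis unfolding kernel_conv_def e by simp
    qed
    show ?thesis unfolding K_def mem_Collect_eq apply_F using K(2,3) z by (simp add: \<kappa>1_def \<tau>_def)
  qed
  ultimately show ?thesis by blast
qed

section \<open>A priori bounds\<close>

definition energy :: "real \<times> ('a \<Rightarrow>\<^sub>C complex) \<Rightarrow> 'a \<Rightarrow> real"
  where "energy x y = \<bar>q y\<bar> * norm (tot x y) powr p"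

lemma energy_integrable: "integrable lborel (energy x)"
proof (rule integrable_bounded_support)
  show "energy x \<in> borel_measurable borel" unfolding energy_def by measurable
  show "norm (energy x y) \<le> b * (norm (snd x) + \<bar>fst x\<bar> * c) powr p" for y
    unfolding energy_def using p qb[of y] b0 tot_bound[of x y] by (simp add: abs_mult) (intro mult_mono powr_mono2, auto)
  show "energy x y = 0" if "norm y > r" for y using q0[OF that] by (simp add: energy_def)
qed

lemma q_integrable: "integrable lborel (\<lambda>y. \<bar>q y\<bar>)"
  by (rule integrable_bounded_support[of _ b r]) (auto simp: qb q0)

lemma src_integrable: "integrable lborel (src x)"
  by (rule integrable_bounded_support[OF src_measurable src_bound, where r = r]) (simp add: src_zero q0)

lemma energy_le_linear:
  assumes lam: "lam \<ge> 0" and t: "0 \<le> t" and v: "v = t *\<^sub>R F (lam, v)"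
  shows "(LINT y|lborel. energy (lam, v) y) \<le> lam * c * (LINT y|lborel. norm (src (lam, v) y))"
proof -
  define f where "f = src (lam, v)"
  have fm [measurable]: "f \<in> borel_measurable borel" unfolding f_def by measurable
  note K = kernel_conv[OF \<kappa>m \<kappa>int src_measurable[of "(lam, v)"] src_bound[of "(lam, v)"], folded f_def]
  have fint: "integrable lborel f" unfolding f_def by (rule src_integrable)
  have [measurable]: "cnj \<in> borel_measurable borel"
    by (intro borel_measurable_continuous_onI continuous_intros)
  have fi: "integrable lborel (\<lambda>y. h y * cnj (f y))"
    if [measurable]: "h \<in> borel_measurable borel" and h: "\<And>y. norm (h y) \<le> B" for h B
  proof (rule Bochner_Integration.integrable_bound[OF integrable_mult_right[OF integrable_norm[OF fint], of B] _ AE_I2])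
    show "(\<lambda>y. h y * cnj (f y)) \<in> borel_measurable lborel" by measurable
    show "norm (h y * cnj (f y)) \<le> norm (B * norm (f y))" for y
      using mult_right_mono[OF h norm_ge_zero[of "f y"]] order_trans[OF norm_ge_zero h] by (simp add: norm_mult abs_mult)
  qed
  have i1: "integrable lborel (\<lambda>y. kernel_conv \<kappa> f y * cnj (f y))" by (rule fi[OF K(4) K(2)])
  have i2: "integrable lborel (\<lambda>y. \<phi> y * cnj (f y))" by (rule fi[OF \<phi>m \<phi>b])
  \<comment> \<open>As q \<le> 0, the product of u with the conjugate of its source is minus the
    energy density; inserting the equation for u splits it into the quadratic form and the term with
    \<phi>.\<close>
  have pt: "complex_of_real (- energy (lam, v) y) = of_real t * (kernel_conv \<kappa> f y * cnj (f y)) + of_real lam * (\<phi> y * cnj (f y))" for y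
  proof -
    have "v y = t *\<^sub>R kernel_conv \<kappa> f y" using arg_cong[OF v, of "\<lambda>v. apply_bcontfun v y"] by (simp add: apply_F f_def)
    then have "tot (lam, v) y = of_real t * kernel_conv \<kappa> f y + of_real lam * \<phi> y" by (simp add: tot_def scaleR_conv_of_real)
    moreover have "tot (lam, v) y * cnj (f y) = of_real (- energy (lam, v) y)"
    proof -
      have "tot (lam, v) y * cnj (f y) = of_real (q y) * (tot (lam, v) y * cnj (pow_map p (tot (lam, v) y)))"
        by (simp add: f_def src_def)
      also have "\<dots> = of_real (- energy (lam, v) y)" using qneg[of y] by (simp add: mult_cnj_pow_map[OF p] energy_def)
      finally show ?thesis .
    qed
    ultimately show ?thesis by (simp add: algebra_simps)
  qed
  have "complex_of_real (LINT y|lborel. - energy (lam, v) y) = (LINT y|lborel. complex_of_real (- energy (lam, v) y))"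
    by (rule integral_complex_of_real[symmetric])
  also have "\<dots> = of_real t * (LINT y|lborel. kernel_conv \<kappa> f y * cnj (f y)) + of_real lam * (LINT y|lborel. \<phi> y * cnj (f y))"
    unfolding pt using i1 i2 by simp
  finally have eq: "- (LINT y|lborel. energy (lam, v) y) = t * Re (LINT y|lborel. kernel_conv \<kappa> f y * cnj (f y)) + lam * Re (LINT y|lborel. \<phi> y * cnj (f y))"
    by (simp add: complex_eq_iff)
  have "0 \<le> Re (LINT y|lborel. kernel_conv \<kappa> f y * cnj (f y))"
    by (rule pos[OF fm]) (auto simp: f_def src_zero intro: src_bound)
  then have "(LINT y|lborel. energy (lam, v) y) \<le> lam * - Re (LINT y|lborel. \<phi> y * cnj (f y))"
    using eq mult_nonneg_nonneg[OF t] unfolding mult_minus_right by fastforce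
  also have "\<dots> \<le> lam * (c * (LINT y|lborel. norm (f y)))"
  proof (rule mult_left_mono[OF _ lam])
    have "- Re (LINT y|lborel. \<phi> y * cnj (f y)) \<le> norm (LINT y|lborel. \<phi> y * cnj (f y))"
      using abs_Re_le_cmod[of "LINT y|lborel. \<phi> y * cnj (f y)"] by linarith
    also have "\<dots> \<le> (LINT y|lborel. norm (\<phi> y * cnj (f y)))" by (rule integral_norm_bound)
    also have "\<dots> \<le> (LINT y|lborel. c * norm (f y))"
      by (rule integral_mono[OF integrable_norm[OF i2] integrable_mult_right[OF integrable_norm[OF fint]]])
         (simp add: norm_mult mult_right_mono \<phi>b)
    finally show "- Re (LINT y|lborel. \<phi> y * cnj (f y)) \<le> c * (LINT y|lborel. norm (f y))" by simp
  qed
  finally show ?thesis by (simp add: f_def)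
qed

text \<open>With d = \<Lambda> c, the quantity d s^(p - 1) is at most s^p / 2 if s \<ge> 2 d, and at
  most a constant otherwise. The first part is absorbed by the left-hand side.\<close>

lemma energy_bound:
  assumes lam: "lam \<ge> 0" "lam \<le> \<Lambda>" and t: "0 \<le> t" and v: "v = t *\<^sub>R F (lam, v)"
  shows "(LINT y|lborel. energy (lam, v) y) \<le> 2 * (\<Lambda> * c) * (2 * (\<Lambda> * c)) powr (p - 1) * (LINT y|lborel. \<bar>q y\<bar>)"
proof -
  define d where "d = \<Lambda> * c"
  have d0: "d \<ge> 0" using lam c0 by (simp add: d_def)
  have pt: "d * s powr (p - 1) \<le> s powr p / 2 + d * (2 * d) powr (p - 1)" if s: "s \<ge> 0" for s
  proof (cases "s \<ge> 2 * d")
    case True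
    have "s powr p = s * s powr (p - 1)"
      using s by (cases "s = 0") (simp_all add: powr_mult_base)
    then have "d * s powr (p - 1) \<le> s powr p / 2" using mult_right_mono[OF True, of "s powr (p - 1)"] by simp
    moreover have "0 \<le> d * (2 * d) powr (p - 1)" using d0 by simp
    ultimately show ?thesis by linarith
  next
    case False
    then have "d * s powr (p - 1) \<le> d * (2 * d) powr (p - 1)" using s d0 p by (intro mult_left_mono powr_mono2) auto
    moreover have "0 \<le> s powr p / 2" by simp
    ultimately show ?thesis by linarith
  qed
  define E where "E = (LINT y|lborel. energy (lam, v) y)"
  have "E \<le> lam * c * (LINT y|lborel. norm (src (lam, v) y))" unfolding E_def by (rule energy_le_linear[OF lam(1) t v])
  also have "\<dots> \<le> d * (LINT y|lborel. norm (src (lam, v) y))"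
    unfolding d_def using lam c0 by (intro mult_right_mono) auto
  also have "\<dots> = (LINT y|lborel. d * norm (src (lam, v) y))" by simp
  also have "\<dots> \<le> (LINT y|lborel. energy (lam, v) y / 2 + d * (2 * d) powr (p - 1) * \<bar>q y\<bar>)"
  proof (rule integral_mono)
    show "integrable lborel (\<lambda>y. d * norm (src (lam, v) y))" using integrable_norm[OF src_integrable] by simp
    show "integrable lborel (\<lambda>y. energy (lam, v) y / 2 + d * (2 * d) powr (p - 1) * \<bar>q y\<bar>)"
      using energy_integrable q_integrable by simp
    show "d * norm (src (lam, v) y) \<le> energy (lam, v) y / 2 + d * (2 * d) powr (p - 1) * \<bar>q y\<bar>" for y
      using mult_left_mono[OF pt[OF norm_ge_zero[of "tot (lam, v) y"]] abs_ge_zero[of "q y"]]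
      by (simp add: norm_src energy_def algebra_simps)
  qed
  also have "\<dots> = E / 2 + d * (2 * d) powr (p - 1) * (LINT y|lborel. \<bar>q y\<bar>)"
    using energy_integrable q_integrable by (simp add: E_def)
  finally show ?thesis by (simp add: E_def d_def)
qed

text \<open>For \<lambda> = 0 the bound \<open>energy_le_linear\<close> makes the energy vanish, so
  the source is 0 almost everywhere and so is its convolution.\<close>

lemma solution_at_0:
  assumes v: "v = F (0, v)" shows "v = 0"
proof -
  have E: "(LINT y|lborel. energy (0, v) y) \<le> 0"
    using energy_le_linear[of 0 1 v] v by simp
  have nn: "0 \<le> energy (0, v) y" for y by (simp add: energy_def)
  have "(LINT y|lborel. energy (0, v) y) = 0" using E integral_nonneg_AE[OF AE_I2, of lborel "energy (0, v)"] nn by (intro antisym) auto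
  then have "AE y in lborel. energy (0, v) y = 0"
    using integral_nonneg_eq_0_iff_AE[OF energy_integrable AE_I2[OF nn]] by simp
  then have ae: "AE y in lborel. src (0, v) y = 0"
    by eventually_elim (auto simp: energy_def src_def pow_map_def)
  have "kernel_conv \<kappa> (src (0, v)) x = 0" for x
  proof -
    have "kernel_conv \<kappa> (src (0, v)) x = (LINT (y::'a)|lborel. 0)"
      unfolding kernel_conv_def
    proof (rule Bochner_Integration.integral_cong_AE)
      show "AE y in lborel. \<kappa> (x - y) * src (0, v) y = 0" using ae by eventually_elim simp
    qed measurable
    then show ?thesis by simp
  qed
  then have "apply_bcontfun (F (0, v)) x = 0" for x by (simp add: apply_F)
  then show ?thesis using v by (metis bcontfun_eqI zero_bcontfun.rep_eq)
qed

lemma F_0: "F (0, 0) = 0"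
proof (rule bcontfun_eqI)
  have "src (0, 0) y = 0" for y by (simp add: src_def tot_def pow_map_def)
  then show "apply_bcontfun (F (0, 0)) x = apply_bcontfun 0 x" for x by (simp add: apply_F kernel_conv_def)
qed

text \<open>From |\<kappa>| |u|^(p - 1) the factor |u|^\<theta> is taken out and bounded by
  M^\<theta>. Young's inequality with the exponents p / (1 + \<theta>) and p / (p - 1 - \<theta>)
  splits the rest into a power of the kernel and the energy density.\<close>

lemma sup_bound:
  assumes lam: "lam \<ge> 0" "lam \<le> \<Lambda>" and t: "0 \<le> t" "t \<le> 1" and v: "v = t *\<^sub>R F (lam, v)"
  shows "norm v \<le> (norm v + \<Lambda> * c) powr \<theta> * (b * (LINT y|lborel. norm (\<kappa> y) powr (p / (1 + \<theta>)))
    + 2 * (\<Lambda> * c) * (2 * (\<Lambda> * c)) powr (p - 1) * (LINT y|lborel. \<bar>q y\<bar>))"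
proof (rule norm_bound)
  fix x
  define s where "s = p / (1 + \<theta>)"
  define f where "f = src (lam, v)"
  define M where "M = norm v + \<Lambda> * c"
  have uM: "norm (tot (lam, v) y) \<le> M" for y
  proof -
    have "norm (tot (lam, v) y) \<le> norm v + \<bar>lam\<bar> * c" using tot_bound[of "(lam, v)" y] by simp
    also have "\<dots> \<le> M" unfolding M_def using lam c0 by (intro add_mono mult_right_mono) auto
    finally show ?thesis .
  qed
  have s1: "s > 1" using p \<theta> by (simp add: s_def)
  have young: "a * u powr (p - 1 - \<theta>) \<le> a powr s + u powr p" if au: "a \<ge> 0" "u \<ge> 0" for a u
  proof -
    define s' where "s' = p / (p - 1 - \<theta>)"
    have s'1: "s' > 1" using p \<theta> by (simp add: s'_def)
    have "1 / s + 1 / s' = 1" using p \<theta> by (simp add: s_def s'_def add_divide_distrib[symmetric])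
    then have "a * u powr (p - 1 - \<theta>) \<le> a powr s / s + (u powr (p - 1 - \<theta>)) powr s' / s'"
      using s1 s'1 au by (intro Youngs_inequality) auto
    also have "(u powr (p - 1 - \<theta>)) powr s' = u powr p" using p \<theta> by (simp add: powr_powr s'_def)
    also have "a powr s / s \<le> a powr s" using s1 by (simp add: divide_le_eq mult_le_cancel_left1)
    also have "u powr p / s' \<le> u powr p" using s'1 by (simp add: divide_le_eq mult_le_cancel_left1)
    finally show ?thesis by simp
  qed
  have ks: "integrable lborel (\<lambda>y. norm (\<kappa> (x - y)) powr s)"
    "(LINT y|lborel. norm (\<kappa> (x - y)) powr s) = (LINT y|lborel. norm (\<kappa> y) powr s)"
    using lborel_translate_integral(3,4)[of "\<lambda>y. norm (\<kappa> y) powr s" x] \<kappa>s by (simp_all add: s_def)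
  have ki: "integrable lborel (\<lambda>y. \<kappa> (x - y) * f y)"
    unfolding f_def by (rule kernel_conv(1)[OF \<kappa>m \<kappa>int src_measurable src_bound])
  have "v x = t *\<^sub>R kernel_conv \<kappa> f x" using arg_cong[OF v, of "\<lambda>v. apply_bcontfun v x"] by (simp add: apply_F f_def)
  then have "norm (v x) \<le> norm (kernel_conv \<kappa> f x)" using t by (simp add: mult_left_le_one_le)
  also have "\<dots> \<le> (LINT y|lborel. norm (\<kappa> (x - y) * f y))" unfolding kernel_conv_def by (rule integral_norm_bound)
  also have "\<dots> \<le> (LINT y|lborel. M powr \<theta> * (b * norm (\<kappa> (x - y)) powr s + energy (lam, v) y))"
  proof (rule integral_mono[OF integrable_norm[OF ki]])
    show "integrable lborel (\<lambda>y. M powr \<theta> * (b * norm (\<kappa> (x - y)) powr s + energy (lam, v) y))"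
      using ks(1) energy_integrable by simp
    fix y
    define u where "u = norm (tot (lam, v) y)"
    have u: "0 \<le> u" "u \<le> M" using uM by (auto simp: u_def)
    have "p - 1 = \<theta> + (p - 1 - \<theta>)" by simp
    then have "norm (\<kappa> (x - y) * f y) = u powr \<theta> * (\<bar>q y\<bar> * (norm (\<kappa> (x - y)) * u powr (p - 1 - \<theta>)))"
      unfolding norm_mult f_def norm_src u_def[symmetric] by (metis powr_add mult.left_commute mult.commute)
    also have "\<dots> \<le> M powr \<theta> * (\<bar>q y\<bar> * (norm (\<kappa> (x - y)) powr s + u powr p))"
      using u \<theta> young[of "norm (\<kappa> (x - y))" u] by (intro mult_mono powr_mono2 mult_nonneg_nonneg) auto
    also have "\<dots> \<le> M powr \<theta> * (b * norm (\<kappa> (x - y)) powr s + energy (lam, v) y)"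
      unfolding energy_def u_def[symmetric] distrib_left using qb[of y] by (intro mult_left_mono add_mono mult_right_mono) auto
    finally show "norm (\<kappa> (x - y) * f y) \<le> M powr \<theta> * (b * norm (\<kappa> (x - y)) powr s + energy (lam, v) y)" .
  qed
  also have "\<dots> = M powr \<theta> * (b * (LINT y|lborel. norm (\<kappa> y) powr s) + (LINT y|lborel. energy (lam, v) y))"
    using ks energy_integrable by simp
  also have "\<dots> \<le> M powr \<theta> * (b * (LINT y|lborel. norm (\<kappa> y) powr s)
    + 2 * (\<Lambda> * c) * (2 * (\<Lambda> * c)) powr (p - 1) * (LINT y|lborel. \<bar>q y\<bar>))"
    by (intro mult_left_mono add_left_mono energy_bound[OF lam t(1) v]) auto
  finally show "norm (v x) \<le> (norm v + \<Lambda> * c) powr \<theta> * (b * (LINT y|lborel. norm (\<kappa> y) powr (p / (1 + \<theta>)))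
    + 2 * (\<Lambda> * c) * (2 * (\<Lambda> * c)) powr (p - 1) * (LINT y|lborel. \<bar>q y\<bar>))" by (simp add: M_def s_def)
qed

theorem component_reaches:
  assumes \<Lambda>: "\<Lambda> > 0"
  obtains v where "(\<Lambda>, v) \<in> connected_component_set {x. 0 \<le> fst x \<and> snd x = F x} (0, 0)"
proof -
  \<comment> \<open>From R on the inequality of \<open>sup_bound\<close> fails, since its right-hand
    side grows with the exponent \<theta> < 1 only.\<close>
  obtain R where R: "R > 0" "\<And>m. m \<ge> R \<Longrightarrow> (m + \<Lambda> * c) powr \<theta> * (b * (LINT y|lborel. norm (\<kappa> y) powr (p / (1 + \<theta>)))
    + 2 * (\<Lambda> * c) * (2 * (\<Lambda> * c)) powr (p - 1) * (LINT y|lborel. \<bar>q y\<bar>)) < m"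
    using sublinear_bound[OF \<theta>(2,1), of "\<Lambda> * c"] \<Lambda> c0 by (metis less_imp_le mult_nonneg_nonneg)
  obtain K where K: "compact K" "F ` ({0..\<Lambda>} \<times> cball 0 R) \<subseteq> K" using F_compact by blast
  have ap: "norm v < R" if "lam \<in> {0..\<Lambda>}" "t \<in> {0..1}" "norm v \<le> R" "v = t *\<^sub>R F (lam, v)" for lam t v
  proof (rule ccontr)
    assume "\<not> norm v < R"
    then show False using R(2)[of "norm v"] sup_bound[of lam \<Lambda> t v] that(1,2) that(4) by auto
  qed
  obtain v where "(\<Lambda>, v) \<in> connected_component_set {x \<in> {0..\<Lambda>} \<times> cball 0 R. snd x = F x} (0, 0)"
  proof (rule fixed_point_continuation[OF \<Lambda> R(1) F_continuous K _ F_0])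
    show "norm v < R" if "lam \<in> {0..\<Lambda>}" "t \<in> {0..1}" "norm v \<le> R" "v = t *\<^sub>R F (lam, v)" for lam t v
      by (rule ap[OF that])
    show "v = 0" if "v = F (0, v)" for v by (rule solution_at_0[OF that])
  qed
  moreover have "connected_component_set {x \<in> {0..\<Lambda>} \<times> cball 0 R. snd x = F x} (0, 0)
      \<subseteq> connected_component_set {x. 0 \<le> fst x \<and> snd x = F x} (0, 0)"
    by (rule connected_component_mono) auto
  ultimately show ?thesis using that by blast
qed

end

section \<open>The nonlinear Helmholtz equation\<close>

text \<open>The substitution y = x + w turns the double integral into \<kappa> tested with the
  autocorrelation of g; evenness of \<kappa> absorbs the sign.\<close>

lemma positive_definite_double_integral:
  fixes \<kappa> g :: "'a::euclidean_space \<Rightarrow> real"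
  assumes km [measurable]: "\<kappa> \<in> borel_measurable borel" and int: "integrable lborel \<kappa>"
    and c: "\<And>x. x \<noteq> 0 \<Longrightarrow> isCont \<kappa> x" and even: "\<And>x. \<kappa> (- x) = \<kappa> x"
    and pos: "\<And>\<xi>. 0 \<le> (LINT v|lborel. cos (\<xi> \<bullet> v) * \<kappa> v)"
    and gm [measurable]: "g \<in> borel_measurable borel" and g: "integrable lborel g" and B: "\<And>x. \<bar>g x\<bar> \<le> B"
  shows "0 \<le> (LINT x|lborel. LINT y|lborel. \<kappa> (x - y) * (g y * g x))"
proof -
  have B0: "B \<ge> 0" using order_trans[OF abs_ge_zero B] .
  have P: "integrable (lborel \<Otimes>\<^sub>M lborel) (\<lambda>(x::'a, w). \<kappa> w * (g x * g (x + w)))"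
  proof (rule Bochner_Integration.integrable_bound)
    show "integrable (lborel \<Otimes>\<^sub>M lborel) (\<lambda>(x::'a, w). B * (g x * \<kappa> w))"
    proof (rule lborel_pair.Fubini_integrable)
      show "(\<lambda>(x::'a, w). B * (g x * \<kappa> w)) \<in> borel_measurable (lborel \<Otimes>\<^sub>M lborel)" by measurable
      show "integrable lborel (\<lambda>x. LINT w|lborel. norm (case (x, w) of (x, w) \<Rightarrow> B * (g x * \<kappa> w)))"
        using g by (simp add: abs_mult)
      show "AE x in lborel. integrable lborel (\<lambda>w. case (x, w) of (x, w) \<Rightarrow> B * (g x * \<kappa> w))"
        using int by simp
    qed
    have "norm (\<kappa> w * (g x * g (x + w))) \<le> norm (B * (g x * \<kappa> w))" for x w
      using mult_right_mono[OF B[of "x + w"], of "\<bar>g x\<bar> * \<bar>\<kappa> w\<bar>"] B0 by (simp add: abs_mult mult_ac)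
    then show "AE z in lborel \<Otimes>\<^sub>M lborel. norm (case z of (x, w) \<Rightarrow> \<kappa> w * (g x * g (x + w))) \<le> norm (case z of (x, w) \<Rightarrow> B * (g x * \<kappa> w))"
      by (auto intro!: AE_I2)
  qed measurable
  have "(LINT y|lborel. \<kappa> (x - y) * (g y * g x)) = (LINT w|lborel. \<kappa> w * (g x * g (x + w)))" for x
  proof -
    have "(\<lambda>y. \<kappa> (x - y) * (g y * g x)) \<in> borel_measurable borel" by measurable
    from lborel_translate_integral(2)[OF this, of x] show ?thesis
      using even by (simp add: mult_ac add.commute)
  qed
  then have "(LINT x|lborel. LINT y|lborel. \<kappa> (x - y) * (g y * g x)) = (LINT x|lborel. LINT w|lborel. \<kappa> w * (g x * g (x + w)))"
    by simp
  also have "\<dots> = (LINT w|lborel. LINT x|lborel. \<kappa> w * (g x * g (x + w)))"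
    by (rule lborel_pair.Fubini_integral[OF P, symmetric])
  also have "\<dots> = (LINT w|lborel. \<kappa> w * cross_corr g g w)" by (simp add: cross_corr_def)
  also have "\<dots> \<ge> 0" by (rule positive_definite_kernel[OF km int c pos gm g B])
  finally show ?thesis .
qed

text \<open>For points of K the real part of the kernel is a multiple of
  \<open>bessel_kernel\<close>, by the diameter bound, so the real and the imaginary part of f each
  contribute a nonnegative form. The imaginary part of the kernel is even, and its two mixed terms
  cancel.\<close>

lemma helmholtz_positive_definite:
  fixes f :: "'a::euclidean_space \<Rightarrow> complex"
  assumes n: "n \<ge> 1" and k: "k > 0" and N: "DIM('a) = n + 2"
    and T: "T > 0" and K: "\<And>x. x \<in> K \<Longrightarrow> 2 * norm x \<le> T"
    and diam: "\<And>x y. x \<in> K \<Longrightarrow> y \<in> K \<Longrightarrow> k * dist x y \<le> first_zero_bessel_Y (real n / 2)"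
    and fm [measurable]: "f \<in> borel_measurable borel" and B: "\<And>x. norm (f x) \<le> B" and f0: "\<And>x. x \<notin> K \<Longrightarrow> f x = 0"
  shows "0 \<le> Re (LINT x|lborel. kernel_conv (cutoff_Phi k T) f x * cnj (f x))"
proof -
  note Phi = cutoff_Phi[OF n k N T]
  define \<kappa> where "\<kappa> = (cutoff_Phi k T :: 'a \<Rightarrow> complex)"
  have km [measurable]: "\<kappa> \<in> borel_measurable borel" and kint: "integrable lborel \<kappa>" unfolding \<kappa>_def by (rule Phi)+
  have keven: "\<kappa> (- x) = \<kappa> x" for x by (simp add: \<kappa>_def cutoff_Phi_def helmholtz_Phi_minus)
  have B0: "B \<ge> 0" using order_trans[OF norm_ge_zero B] .
  have cm [measurable]: "cnj \<in> borel_measurable borel"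
    by (intro borel_measurable_continuous_onI continuous_intros)
  have fint: "integrable lborel f"
  proof (rule integrable_bounded_support[OF fm B])
    show "f x = 0" if "norm x > T" for x
      using f0[of x] K[of x] that T by (metis norm_ge_zero linorder_not_le mult_2 add_le_same_cancel1 order_trans less_le_not_le le_add_same_cancel1)
  qed
  define a where "a = (k / (2 * pi)) powr (real n / 2) / 4"
  define \<beta> where "\<beta> = (\<lambda>x::'a. bessel_kernel n k (norm x))"
  have \<beta>m [measurable]: "\<beta> \<in> borel_measurable borel"
    unfolding \<beta>_def using borel_measurable_bessel_kernel[OF n k] by measurable
  have \<beta>int: "integrable lborel \<beta>" unfolding \<beta>_def by (rule bessel_kernel_integrable[OF n k N])
  have \<beta>c: "isCont \<beta> x" if "x \<noteq> 0" for x
    unfolding \<beta>_def by (rule isCont_o2[where f = norm and g = "bessel_kernel n k"], intro continuous_intros)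
      (use that in \<open>auto intro!: isCont_bessel_kernel n k\<close>)
  have Rek: "Re (\<kappa> (x - y)) = a * \<beta> (x - y)" if xy: "x \<in> K" "y \<in> K" for x y
  proof -
    have "norm (x - y) \<le> T" using norm_triangle_ineq4[of x y] K[OF xy(1)] K[OF xy(2)] by linarith
    then have "\<kappa> (x - y) = helmholtz_Phi k (x - y)" unfolding \<kappa>_def by (rule Phi(3))
    then show ?thesis using Re_helmholtz_Phi[OF n k N, of "x - y"] diam[OF xy]
      by (simp add: a_def \<beta>_def dist_norm)
  qed
  have P: "integrable (lborel \<Otimes>\<^sub>M lborel) (\<lambda>(x::'a, y). \<psi> (x - y) * (g y * h x))"
    if \<psi>m [measurable]: "\<psi> \<in> borel_measurable borel" and \<psi>: "integrable lborel \<psi>"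
      and gm [measurable]: "g \<in> borel_measurable borel" and gB: "\<And>x. \<bar>g x\<bar> \<le> B"
      and hm [measurable]: "h \<in> borel_measurable borel" and h: "integrable lborel h" for \<psi> g h :: "'a \<Rightarrow> real"
  proof (rule Bochner_Integration.integrable_bound)
    show "integrable (lborel \<Otimes>\<^sub>M lborel) (\<lambda>(x::'a, y). B * (h x * \<psi> (x - y)))"
    proof (rule lborel_pair.Fubini_integrable)
      show "(\<lambda>(x::'a, y). B * (h x * \<psi> (x - y))) \<in> borel_measurable (lborel \<Otimes>\<^sub>M lborel)" by measurable
      have "(LINT y|lborel. \<bar>\<psi> (x - y)\<bar>) = (LINT y|lborel. \<bar>\<psi> y\<bar>)" for x
        by (rule lborel_translate_integral(4)) measurable
      then show "integrable lborel (\<lambda>x. LINT y|lborel. norm (case (x, y) of (x, y) \<Rightarrow> B * (h x * \<psi> (x - y))))"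
        using h by (simp add: abs_mult)
      show "AE x in lborel. integrable lborel (\<lambda>y. case (x, y) of (x, y) \<Rightarrow> B * (h x * \<psi> (x - y)))"
        using \<psi> lborel_translate_integral(3)[OF \<psi>m] by simp
    qed
    have "norm (\<psi> (x - y) * (g y * h x)) \<le> norm (B * (h x * \<psi> (x - y)))" for x y
      using mult_right_mono[OF gB[of y], of "\<bar>h x\<bar> * \<bar>\<psi> (x - y)\<bar>"] B0 by (simp add: abs_mult mult_ac)
    then show "AE z in lborel \<Otimes>\<^sub>M lborel. norm (case z of (x, y) \<Rightarrow> \<psi> (x - y) * (g y * h x)) \<le> norm (case z of (x, y) \<Rightarrow> B * (h x * \<psi> (x - y)))"
      by (auto intro!: AE_I2)
  qed measurable
  define A where "A = (\<lambda>(\<psi>::'a \<Rightarrow> real) g h. LINT x|lborel. LINT y|lborel. \<psi> (x - y) * (g y * h x))"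
  define f1 where "f1 = (\<lambda>x. Re (f x))"
  define f2 where "f2 = (\<lambda>x. Im (f x))"
  define \<kappa>1 where "\<kappa>1 = (\<lambda>x. Re (\<kappa> x))"
  define \<kappa>2 where "\<kappa>2 = (\<lambda>x. Im (\<kappa> x))"
  have m [measurable]: "f1 \<in> borel_measurable borel" "f2 \<in> borel_measurable borel" "\<kappa>1 \<in> borel_measurable borel" "\<kappa>2 \<in> borel_measurable borel"
    unfolding f1_def f2_def \<kappa>1_def \<kappa>2_def by measurable
  have i: "integrable lborel f1" "integrable lborel f2" "integrable lborel \<kappa>1" "integrable lborel \<kappa>2"
    unfolding f1_def f2_def \<kappa>1_def \<kappa>2_def by (intro integrable_Re integrable_Im fint kint)+
  have b: "\<bar>f1 x\<bar> \<le> B" "\<bar>f2 x\<bar> \<le> B" for x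
    unfolding f1_def f2_def using order_trans[OF abs_Re_le_cmod B] order_trans[OF abs_Im_le_cmod B] by auto
  have sym: "A \<kappa>2 f2 f1 = A \<kappa>2 f1 f2"
  proof -
    have "A \<kappa>2 f2 f1 = (LINT y|lborel. LINT x|lborel. \<kappa>2 (x - y) * (f2 y * f1 x))"
      unfolding A_def by (rule lborel_pair.Fubini_integral[OF P[OF m(4) i(4) m(2) b(2) m(1) i(1)], symmetric])
    also have "\<dots> = A \<kappa>2 f1 f2"
      unfolding A_def using keven[of "_ - _"] by (simp add: \<kappa>2_def mult.commute)
    finally show ?thesis .
  qed
  have pos: "A \<kappa>1 g g \<ge> 0" if gm: "g \<in> borel_measurable borel" and g: "integrable lborel g" and gB: "\<And>x. \<bar>g x\<bar> \<le> B"
    and g0: "\<And>x. x \<notin> K \<Longrightarrow> g x = 0" for g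
  proof -
    have "\<kappa>1 (x - y) * (g y * g x) = a * (\<beta> (x - y) * (g y * g x))" for x y
      using Rek[of x y] g0[of x] g0[of y] by (cases "x \<in> K \<and> y \<in> K") (auto simp: \<kappa>1_def)
    then have "A \<kappa>1 g g = a * (LINT x|lborel. LINT y|lborel. \<beta> (x - y) * (g y * g x))"
      unfolding A_def by (simp only: integral_mult_right_zero)
    moreover have "0 \<le> (LINT x|lborel. LINT y|lborel. \<beta> (x - y) * (g y * g x))"
    proof (rule positive_definite_double_integral[OF \<beta>m \<beta>int \<beta>c _ _ gm g gB])
      show "0 \<le> (LINT v|lborel. cos (\<xi> \<bullet> v) * \<beta> v)" for \<xi>
        unfolding \<beta>_def by (rule bessel_kernel_FT_nonneg[OF n k N])
    qed (simp_all add: \<beta>_def)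
    moreover have "a \<ge> 0" by (simp add: a_def)
    ultimately show ?thesis by simp
  qed
  have ki: "integrable lborel (\<lambda>y. \<kappa> (x - y) * f y)" for x by (rule kernel_conv(1)[OF km kint fm B])
  have kb: "norm (kernel_conv \<kappa> f x) \<le> B * (LINT y|lborel. norm (\<kappa> y))" for x by (rule kernel_conv(2)[OF km kint fm B])
  have oi: "integrable lborel (\<lambda>x. kernel_conv \<kappa> f x * cnj (f x))"
  proof (rule Bochner_Integration.integrable_bound[OF integrable_mult_right[OF integrable_norm[OF fint], of "B * (LINT y|lborel. norm (\<kappa> y))"] _ AE_I2])
    have [measurable]: "kernel_conv \<kappa> f \<in> borel_measurable borel" by (rule kernel_conv(4)[OF km kint fm B])
    show "(\<lambda>x. kernel_conv \<kappa> f x * cnj (f x)) \<in> borel_measurable lborel" by measurable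
    show "norm (kernel_conv \<kappa> f x * cnj (f x)) \<le> norm (B * (LINT y|lborel. norm (\<kappa> y)) * norm (f x))" for x
      using mult_right_mono[OF kb norm_ge_zero[of "f x"]] order_trans[OF norm_ge_zero kb] B0 by (simp add: norm_mult abs_mult)
  qed
  have inner: "Re (kernel_conv \<kappa> f x * cnj (f x)) =
      (LINT y|lborel. \<kappa>1 (x - y) * (f1 y * f1 x)) + (LINT y|lborel. \<kappa>1 (x - y) * (f2 y * f2 x))
      + ((LINT y|lborel. \<kappa>2 (x - y) * (f1 y * f2 x)) - (LINT y|lborel. \<kappa>2 (x - y) * (f2 y * f1 x)))" for x
  proof -
    have q: "integrable lborel (\<lambda>y. \<psi> (x - y) * (g y * z))"
      if \<psi>: "integrable lborel \<psi>" and \<psi>m [measurable]: "\<psi> \<in> borel_measurable borel"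
        and [measurable]: "g \<in> borel_measurable borel" and gB: "\<And>x. \<bar>g x\<bar> \<le> B" for \<psi> g :: "'a \<Rightarrow> real" and z
    proof (rule Bochner_Integration.integrable_bound[OF _ _ AE_I2])
      show "integrable lborel (\<lambda>y. B * \<bar>z\<bar> * \<psi> (x - y))" using \<psi> lborel_translate_integral(3)[OF \<psi>m] by simp
      show "norm (\<psi> (x - y) * (g y * z)) \<le> norm (B * \<bar>z\<bar> * \<psi> (x - y))" for y
        using mult_right_mono[OF gB[of y], of "\<bar>z\<bar> * \<bar>\<psi> (x - y)\<bar>"] B0 by (simp add: abs_mult mult_ac)
    qed measurable
    have "Re (kernel_conv \<kappa> f x * cnj (f x)) = (LINT y|lborel. Re (\<kappa> (x - y) * f y * cnj (f x)))"
      unfolding kernel_conv_def using ki[of x] by (subst integral_Re) simp_all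
    also have "\<dots> = (LINT y|lborel. \<kappa>1 (x - y) * (f1 y * f1 x) + \<kappa>1 (x - y) * (f2 y * f2 x)
      + (\<kappa>2 (x - y) * (f1 y * f2 x) - \<kappa>2 (x - y) * (f2 y * f1 x)))"
      by (simp add: \<kappa>1_def \<kappa>2_def f1_def f2_def algebra_simps)
    also have "\<dots> = (LINT y|lborel. \<kappa>1 (x - y) * (f1 y * f1 x)) + (LINT y|lborel. \<kappa>1 (x - y) * (f2 y * f2 x))
      + ((LINT y|lborel. \<kappa>2 (x - y) * (f1 y * f2 x)) - (LINT y|lborel. \<kappa>2 (x - y) * (f2 y * f1 x)))"
      using q[OF i(3) m(3) m(1) b(1)] q[OF i(3) m(3) m(2) b(2)] q[OF i(4) m(4) m(1) b(1)] q[OF i(4) m(4) m(2) b(2)]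
      by simp
    finally show ?thesis .
  qed
  have out: "integrable lborel (\<lambda>x. LINT y|lborel. \<psi> (x - y) * (g y * h x))"
    if "\<psi> \<in> borel_measurable borel" "integrable lborel \<psi>" "g \<in> borel_measurable borel" "\<And>x. \<bar>g x\<bar> \<le> B"
      "h \<in> borel_measurable borel" "integrable lborel h" for \<psi> g h :: "'a \<Rightarrow> real"
    using lborel_pair.integrable_fst[OF P[OF that]] .
  have "Re (LINT x|lborel. kernel_conv \<kappa> f x * cnj (f x)) = (LINT x|lborel. Re (kernel_conv \<kappa> f x * cnj (f x)))"
    using oi by (rule integral_Re[symmetric])
  also have "\<dots> = A \<kappa>1 f1 f1 + A \<kappa>1 f2 f2 + (A \<kappa>2 f1 f2 - A \<kappa>2 f2 f1)"
    unfolding inner A_def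
    using out[OF m(3) i(3) m(1) b(1) m(1) i(1)] out[OF m(3) i(3) m(2) b(2) m(2) i(2)]
      out[OF m(4) i(4) m(1) b(1) m(2) i(2)] out[OF m(4) i(4) m(2) b(2) m(1) i(1)] by simp
  also have "\<dots> = A \<kappa>1 f1 f1 + A \<kappa>1 f2 f2" using sym by simp
  also have "\<dots> \<ge> 0"
    by (intro add_nonneg_nonneg pos m i b) (simp_all add: f1_def f2_def f0)
  finally show ?thesis by (simp add: \<kappa>_def)
qed

text \<open>The complement of the support is a union of possibly uncountably many open sets;
  Lindelof's theorem reduces it to a countable one.\<close>

lemma ess_support_AE: "AE x in lebesgue. x \<notin> ess_support f \<longrightarrow> rep_linfty f x = 0"
proof -
  define \<F> where "\<F> = {U. open U \<and> (AE x in lebesgue. x \<in> U \<longrightarrow> rep_linfty f x = 0)}"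
  obtain \<F>' where F': "\<F>' \<subseteq> \<F>" "countable \<F>'" "\<Union>\<F>' = \<Union>\<F>"
    using Lindelof[of \<F>] by (auto simp: \<F>_def)
  have "AE x in lebesgue. \<forall>U\<in>\<F>'. x \<in> U \<longrightarrow> rep_linfty f x = 0"
    using F' by (subst AE_ball_countable) (auto simp: \<F>_def)
  then show ?thesis
  proof eventually_elim
    case (elim x)
    then show ?case using F'(3) by (auto simp: ess_support_def \<F>_def)
  qed
qed

lemma closed_ess_support: "closed (ess_support f)"
  unfolding ess_support_def by (intro closed_Compl open_Union) auto

text \<open>The locale asks for bounds, signs and supports at every point, so a Borel representative
  is clipped and set to 0 off the support, which changes it on a null set only.\<close>

lemma borel_representative_real:
  fixes Q :: "('a::euclidean_space, real) linfty"
  assumes neg: "AE x in lebesgue. rep_linfty Q x \<le> 0"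
  obtains q b where "q \<in> borel_measurable borel" "\<And>x. \<bar>q x\<bar> \<le> b" "\<And>x. x \<notin> ess_support Q \<Longrightarrow> q x = 0" "\<And>x. q x \<le> 0"
    "AE x in lebesgue. rep_linfty Q x = q x"
proof -
  obtain b where b: "AE x in lebesgue. \<bar>rep_linfty Q x\<bar> \<le> b" and m: "rep_linfty Q \<in> borel_measurable lebesgue"
    using ess_bounded_rep_linfty[of Q] unfolding ess_bounded_iff by auto
  obtain g where g [measurable]: "g \<in> borel_measurable lborel" and ae: "AE x in lborel. rep_linfty Q x = g x"
    using completion_ex_borel_measurable_real[OF m] by blast
  define q where "q = (\<lambda>x. if x \<in> ess_support Q then max (- \<bar>b\<bar>) (min 0 (g x)) else 0)"
  have [measurable]: "ess_support Q \<in> sets borel" by (rule borel_closed[OF closed_ess_support])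
  show ?thesis
  proof (rule that[of q "\<bar>b\<bar>"])
    show "q \<in> borel_measurable borel" using g unfolding q_def by measurable
    show "AE x in lebesgue. rep_linfty Q x = q x"
      using b neg AE_completion[OF ae] ess_support_AE[of Q]
    proof eventually_elim
      case (elim x)
      then show ?case by (auto simp: q_def max_def min_def)
    qed
  qed (auto simp: q_def)
qed

lemma borel_representative_complex:
  fixes \<phi> :: "('a::euclidean_space, complex) linfty"
  obtains g c where "g \<in> borel_measurable borel" "\<And>x. norm (g x) \<le> c" "AE x in lebesgue. rep_linfty \<phi> x = g x"
proof -
  obtain c where c: "AE x in lebesgue. norm (rep_linfty \<phi> x) \<le> c" and m: "rep_linfty \<phi> \<in> borel_measurable lebesgue"
    using ess_bounded_rep_linfty[of \<phi>] unfolding ess_bounded_iff by auto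
  have m12: "(\<lambda>x. Re (rep_linfty \<phi> x)) \<in> borel_measurable lebesgue" "(\<lambda>x. Im (rep_linfty \<phi> x)) \<in> borel_measurable lebesgue"
    using m by measurable
  obtain g1 g2 where [measurable]: "g1 \<in> borel_measurable lborel" "g2 \<in> borel_measurable lborel"
    and ae: "AE x in lborel. Re (rep_linfty \<phi> x) = g1 x" "AE x in lborel. Im (rep_linfty \<phi> x) = g2 x"
    using completion_ex_borel_measurable_real[OF m12(1)] completion_ex_borel_measurable_real[OF m12(2)] by blast
  define g0 where "g0 = (\<lambda>x. complex_of_real (g1 x) + \<i> * complex_of_real (g2 x))"
  have g0m: "g0 \<in> borel_measurable lborel" unfolding g0_def by measurable
  define g where "g = (\<lambda>x. if norm (g0 x) \<le> \<bar>c\<bar> then g0 x else 0)"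
  show ?thesis
  proof (rule that[of g "\<bar>c\<bar>"])
    show "g \<in> borel_measurable borel" using g0m unfolding g_def by measurable
    show "AE x in lebesgue. rep_linfty \<phi> x = g x"
      using c AE_completion[OF ae(1)] AE_completion[OF ae(2)]
    proof eventually_elim
      case (elim x)
      then have "g0 x = rep_linfty \<phi> x" by (simp add: g0_def complex_eq_iff)
      then show ?case using elim(1) by (simp add: g_def)
    qed
  qed (auto simp: g_def)
qed

text \<open>Off the ball of radius T the fundamental solution is bounded by 2 C. So on sources
  supported in a fixed ball it acts like an integrable kernel plus a bounded one, uniformly in
  x.\<close>

lemma helmholtz_Phi_conv_bound:
  fixes T k r :: real
  assumes n: "n \<ge> 1" and k: "k > 0" and N: "DIM('a::euclidean_space) = n + 2" and T: "T \<ge> 1"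
  shows "\<exists>D\<ge>0. \<forall>(f :: 'a \<Rightarrow> complex) B x. f \<in> borel_measurable borel \<longrightarrow> (\<forall>y. norm (f y) \<le> B) \<longrightarrow> (\<forall>y. norm y > r \<longrightarrow> f y = 0)
    \<longrightarrow> integrable lborel (\<lambda>y::'a. helmholtz_Phi k (x - y) * f y) \<and> norm (LINT y|lborel. helmholtz_Phi k (x - y) * f y) \<le> B * D"
proof -
  have T0: "T > 0" using T by simp
  note Phi = cutoff_Phi[OF n k N T0]
  note [measurable] = borel_measurable_helmholtz_Phi[OF n k N] Phi(1)
  obtain C where C: "C > 0" "\<And>x::'a. x \<noteq> 0 \<Longrightarrow> norm (helmholtz_Phi k x) \<le> C * (norm x powr - real n + 1)"
    using helmholtz_Phi_bound[OF n k N] by metis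
  have bd: "norm (helmholtz_Phi k x) \<le> norm (cutoff_Phi k T x) + 2 * C" for x :: 'a
  proof (cases "norm x \<le> T")
    case True
    then show ?thesis using Phi(3) C(1) by simp
  next
    case False
    then have x: "norm x \<ge> 1" using T by simp
    then have "norm x powr - real n \<le> 1"
      using powr_mono[of "- real n" 0 "norm x"] by (cases "x = 0") auto
    then have "C * (norm x powr - real n + 1) \<le> C * 2" using C(1) by (intro mult_left_mono) auto
    moreover have "x \<noteq> 0" using x by auto
    ultimately show ?thesis using C(2)[of x] norm_ge_zero[of "cutoff_Phi k T x"] by linarith
  qed
  define h where "h = (\<lambda>x y::'a. norm (cutoff_Phi k T (x - y)) + 2 * C * indicator (cball 0 r) y)"
  have ci: "integrable lborel (\<lambda>y::'a. 2 * C * indicator (cball 0 r) y)"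
    using borel_integrable_compact[of "cball (0::'a) r" "\<lambda>_. 1::real"] by simp
  have ki: "integrable lborel (\<lambda>y::'a. norm (cutoff_Phi k T (x - y)))" for x :: 'a
    using lborel_translate_integral(3)[OF Phi(1)] Phi(6) by (intro integrable_norm) simp
  have hi: "integrable lborel (h x)" for x unfolding h_def using ci ki by simp
  define D where "D = (LINT y|lborel. norm (cutoff_Phi k T (y::'a))) + (LINT (y::'a)|lborel. 2 * C * indicator (cball 0 r) y)"
  have hD: "integral\<^sup>L lborel (h x) = D" for x
  proof -
    have "(\<lambda>y::'a. norm (cutoff_Phi k T y)) \<in> borel_measurable borel" by measurable
    from lborel_translate_integral(4)[OF this, of x] show ?thesis unfolding h_def D_def
      using ci ki[of x] by (subst Bochner_Integration.integral_add) simp_all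
  qed
  have h0: "h x y \<ge> 0" for x y using C(1) by (simp add: h_def)
  show ?thesis
  proof (intro exI[of _ D] conjI allI impI)
    show "D \<ge> 0" unfolding hD[of 0, symmetric] by (intro integral_nonneg_AE AE_I2 h0)
    fix f :: "'a \<Rightarrow> complex" and B :: real and x :: 'a
    assume fm [measurable]: "f \<in> borel_measurable borel" and "\<forall>y. norm (f y) \<le> B" and "\<forall>y. norm y > r \<longrightarrow> f y = 0"
    then have B: "\<And>y. norm (f y) \<le> B" and r: "\<And>y. norm y > r \<Longrightarrow> f y = 0" by auto
    have B0: "B \<ge> 0" using order_trans[OF norm_ge_zero B] .
    have le: "norm (helmholtz_Phi k (x - y) * f y) \<le> B * h x y" for y
    proof (cases "norm y > r")
      case False
      then have "norm (helmholtz_Phi k (x - y)) \<le> h x y" using bd[of "x - y"] by (simp add: h_def)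
      then show ?thesis unfolding norm_mult mult.commute[of B] using B h0 by (intro mult_mono) auto
    qed (use r B0 h0 in simp)
    show i: "integrable lborel (\<lambda>y. helmholtz_Phi k (x - y) * f y)"
    proof (rule Bochner_Integration.integrable_bound[OF integrable_mult_right[OF hi[of x], of B] _ AE_I2])
      show "norm (helmholtz_Phi k (x - y) * f y) \<le> norm (B * h x y)" for y
        using le[of y] B0 h0[of x y] by simp
    qed measurable
    have "norm (LINT y|lborel. helmholtz_Phi k (x - y) * f y) \<le> (LINT y|lborel. norm (helmholtz_Phi k (x - y) * f y))"
      by (rule integral_norm_bound)
    also have "\<dots> \<le> (LINT y|lborel. B * h x y)"
      by (rule integral_mono[OF integrable_norm[OF i] integrable_mult_right[OF hi] le])
    also have "\<dots> = B * D" by (simp add: hD)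
    finally show "norm (LINT y|lborel. helmholtz_Phi k (x - y) * f y) \<le> B * D" .
  qed
qed

lemma norm_abs_linfty_diff_le:
  assumes "ess_bounded f" "ess_bounded g" "\<And>x. norm (f x - g x) \<le> B"
  shows "norm (abs_linfty f - abs_linfty g) \<le> B"
proof -
  have "abs_linfty f - abs_linfty g = abs_linfty (\<lambda>x. f x - g x)"
    using assms(1,2) by (intro minus_linfty.abs_eq) auto
  also have "norm \<dots> = real_of_ereal (esssup lebesgue (\<lambda>x. ereal (norm (f x - g x))))"
    using ess_bounded_minus[OF assms(1,2)] by (intro norm_linfty.abs_eq) auto
  also have "\<dots> \<le> B"
    by (rule esssup_norm_bounds(3)[OF ess_bounded_minus[OF assms(1,2)]]) (simp add: assms(3))
  finally show ?thesis .
qed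

text \<open>The locale solves the equation with the cutoff kernel, whose convolution is correct only
  near the support of Q. The function \<open>U x\<close> convolves the same source with the full
  fundamental solution, and \<open>\<Psi>\<close> carries the connected set of solutions over
  continuously.\<close>

theorem helmholtz_component:
  fixes Q :: "('a::euclidean_space, real) linfty" and \<phi> :: "('a, complex) linfty"
  assumes n: "n \<ge> 1" and N: "DIM('a) = n + 2" and k: "k > 0" and p: "2 < p" "p < 2 * (real n + 2) / real n"
    and supp: "compact (ess_support Q)" and neg: "AE x in lebesgue. rep_linfty Q x \<le> 0"
    and diam: "diameter (ess_support Q) \<le> first_zero_bessel_Y (real n / 2) / k" and \<Lambda>: "\<Lambda> > 0"
  shows "\<exists>u. (\<Lambda>, u) \<in> connected_component_set (nl_helmholtz_solutions k p Q \<phi>) (0, 0)"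
proof -
  obtain q b where qm: "q \<in> borel_measurable borel" and qb: "\<And>x. \<bar>q x\<bar> \<le> b" and qK: "\<And>x. x \<notin> ess_support Q \<Longrightarrow> q x = 0"
    and qneg: "\<And>x. q x \<le> 0" and qae: "AE x in lebesgue. rep_linfty Q x = q x"
    using borel_representative_real[OF neg] by blast
  obtain g c where gm: "g \<in> borel_measurable borel" and gc: "\<And>x. norm (g x) \<le> c" and gae: "AE x in lebesgue. rep_linfty \<phi> x = g x"
    using borel_representative_complex[of \<phi>] by blast
  obtain r0 where "\<And>x. x \<in> ess_support Q \<Longrightarrow> norm x \<le> r0" using compact_imp_bounded[OF supp] unfolding bounded_iff by blast
  define r where "r = max r0 0"
  have r: "r \<ge> 0" "\<And>x. x \<in> ess_support Q \<Longrightarrow> norm x \<le> r" using \<open>\<And>x. x \<in> ess_support Q \<Longrightarrow> norm x \<le> r0\<close> by (auto simp: r_def le_max_iff_disj)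
  \<comment> \<open>Differences of points in the ball of radius r, which contains the support, have
    length at most 2 r.\<close>
  define T where "T = 2 * r + 1"
  have T: "T > 0" "T \<ge> 1" using r(1) by (auto simp: T_def)
  note Phi = cutoff_Phi[OF n k N T(1)]
  define \<kappa> where "\<kappa> = (cutoff_Phi k T :: 'a \<Rightarrow> complex)"
  \<comment> \<open>The midpoint between max 0 (n p / (n + 2) - 1) and 1, which gives n p / (1 +
    \<theta>) < n + 2. Subcriticality of p keeps it below 1.\<close>
  define \<theta> where "\<theta> = (max 0 (real n * p / (real n + 2) - 1) + 1) / 2"
  have n0: "real n > 0" using n by simp
  have "real n * p < 2 * (real n + 2)" using p(2) n0 by (simp add: less_divide_eq mult.commute)
  then have "real n * p / (real n + 2) < 2" by (simp add: divide_less_eq)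
  moreover have "0 < (max 0 (t - 1) + 1) / 2" "(max 0 (t - 1) + 1) / 2 < 1" "t < 1 + (max 0 (t - 1) + 1) / 2" if "t < 2" for t :: real
    using that by (cases "t \<le> 1"; simp)+
  ultimately have \<theta>: "0 < \<theta>" "\<theta> < 1" "real n * p / (real n + 2) < 1 + \<theta>" unfolding \<theta>_def by blast+
  have s: "p / (1 + \<theta>) \<ge> 1" "real n * (p / (1 + \<theta>)) < real n + 2"
    using p(1) \<theta> n0 by (simp_all add: field_simps)
  have dm: "k * dist x y \<le> first_zero_bessel_Y (real n / 2)" if "x \<in> ess_support Q" "y \<in> ess_support Q" for x y
  proof -
    have "dist x y \<le> first_zero_bessel_Y (real n / 2) / k"
      using diameter_bounded_bound[OF compact_imp_bounded[OF supp] that] diam by linarith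
    then show ?thesis using k by (simp add: le_divide_eq mult.commute)
  qed
  interpret hammerstein \<kappa> q g p b c r "T + 1" \<theta>
  proof
    show "0 \<le> Re (LINT x|lborel. kernel_conv \<kappa> f x * cnj (f x))"
      if "f \<in> borel_measurable borel" "\<And>x. norm (f x) \<le> B" "\<And>x. q x = 0 \<Longrightarrow> f x = 0" for f B
      unfolding \<kappa>_def
    proof (rule helmholtz_positive_definite[OF n k N T(1) _ dm that(1,2)])
      show "2 * norm x \<le> T" if "x \<in> ess_support Q" for x using r(2)[OF that] by (simp add: T_def)
      show "f x = 0" if "x \<notin> ess_support Q" for x using qK[OF that] \<open>\<And>x. q x = 0 \<Longrightarrow> f x = 0\<close> by blast
    qed
    show "q x = 0" if "norm x > r" for x using qK[of x] r(2)[of x] that by linarith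
    show "integrable lborel (\<lambda>x. norm (\<kappa> x) powr (p / (1 + \<theta>)))" unfolding \<kappa>_def by (rule Phi(5)[OF s])
  qed (use qm qb qneg gm gc p(1) \<theta> Phi(1,2,4,6) in \<open>auto simp: \<kappa>_def\<close>)
  obtain v where v: "(\<Lambda>, v) \<in> connected_component_set {x. 0 \<le> fst x \<and> snd x = F x} (0, 0)"
    using component_reaches[OF \<Lambda>] .
  then obtain C where C: "connected C" "C \<subseteq> {x. 0 \<le> fst x \<and> snd x = F x}" "(0, 0) \<in> C" "(\<Lambda>, v) \<in> C"
    by (auto simp: connected_component_def)
  obtain D where D0: "D \<ge> 0" and D1: "\<forall>(f :: 'a \<Rightarrow> complex) B x. f \<in> borel_measurable borel \<longrightarrow> (\<forall>y. norm (f y) \<le> B) \<longrightarrow> (\<forall>y. norm y > r \<longrightarrow> f y = 0)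
    \<longrightarrow> integrable lborel (\<lambda>y::'a. helmholtz_Phi k (x - y) * f y) \<and> norm (LINT y|lborel. helmholtz_Phi k (x - y) * f y) \<le> B * D"
    using helmholtz_Phi_conv_bound[OF n k N T(2)] by blast
  have D: "integrable lborel (\<lambda>y::'a. helmholtz_Phi k (x - y) * f y)" "norm (LINT y|lborel. helmholtz_Phi k (x - y) * f y) \<le> B * D"
    if "f \<in> borel_measurable borel" "\<And>y. norm (f y) \<le> B" "\<And>y. norm y > r \<Longrightarrow> f y = 0" for f B x
    using D1[rule_format, OF that] by blast+
  note [measurable] = borel_measurable_helmholtz_Phi[OF n k N]
  define U where "U = (\<lambda>x z. (LINT y|lborel. helmholtz_Phi k (z - y) * src x y) + of_real (fst x) * g z)"
  have s0: "src x y = 0" if "norm y > r" for x y using q0[OF that] by (rule src_zero)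
  note DS = D[OF src_measurable src_bound s0]
  have Um [measurable]: "U x \<in> borel_measurable borel" for x unfolding U_def by measurable
  have Ub: "norm (U x z) \<le> b * (norm (snd x) + \<bar>fst x\<bar> * c) powr (p - 1) * D + \<bar>fst x\<bar> * c" for x z
    unfolding U_def using DS(2)[of z x] \<phi>b[of z]
    by (intro order_trans[OF norm_triangle_ineq] add_mono) (auto simp: norm_mult mult_left_mono)
  have Ueb: "ess_bounded (U x)" for x
    unfolding ess_bounded_iff using Ub[of x] by (auto intro!: measurable_completion exI AE_I2)
  define \<Psi> where "\<Psi> = (\<lambda>x. (fst x, abs_linfty (U x)))"
  have cont: "continuous_on C \<Psi>"
    unfolding continuous_on_iff
  proof (intro ballI allI impI)
    fix x e assume x: "x \<in> C" and e: "(e::real) > 0"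
    define \<epsilon> where "\<epsilon> = e / (4 * (D + 1))"
    have \<epsilon>: "\<epsilon> > 0" using e D0 by (simp add: \<epsilon>_def)
    have \<epsilon>D: "\<epsilon> * D \<le> e / 4" using e D0 by (simp add: \<epsilon>_def divide_le_eq mult_left_mono)
    obtain d where d: "d > 0" "\<And>x1 x2 y. \<bar>fst x1\<bar> \<le> \<bar>fst x\<bar> + 1 \<Longrightarrow> norm (snd x1) \<le> norm (snd x) + 1 \<Longrightarrow> \<bar>fst x2\<bar> \<le> \<bar>fst x\<bar> + 1
      \<Longrightarrow> norm (snd x2) \<le> norm (snd x) + 1 \<Longrightarrow> dist x1 x2 < d \<Longrightarrow> norm (src x1 y - src x2 y) \<le> \<epsilon>"
      using src_uniformly_continuous[OF \<epsilon>, of "\<bar>fst x\<bar> + 1" "norm (snd x) + 1"] by metis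
    define d' where "d' = min (min d 1) (e / (4 * (c + 1)))"
    have d': "d' > 0" "d' \<le> d" "d' \<le> 1" using d(1) e c0 by (auto simp: d'_def)
    have d'c: "d' * (c + 1) \<le> e / 4"
    proof -
      have "d' * (c + 1) \<le> e / (4 * (c + 1)) * (c + 1)" using c0 by (intro mult_right_mono) (auto simp: d'_def)
      also have "\<dots> = e / 4" using c0 by (simp add: field_simps)
      finally show ?thesis .
    qed
    have "dist (\<Psi> x') (\<Psi> x) < e" if x': "dist x' x < d'" for x'
    proof -
      have f1: "\<bar>fst x' - fst x\<bar> < d'" using dist_fst_le[of x' x] x' by (simp add: dist_real_def)
      have f2: "norm (snd x' - snd x) < d'" using dist_snd_le[of x' x] x' by (simp add: dist_norm)
      have sd: "norm (src x' y - src x y) \<le> \<epsilon>" for y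
      proof (rule d(2))
        show "norm (snd x') \<le> norm (snd x) + 1" using f2 d'(3) norm_triangle_ineq2[of "snd x'" "snd x"] by linarith
      qed (use f1 d' x' in auto)
      have "norm (abs_linfty (U x') - abs_linfty (U x)) \<le> \<epsilon> * D + d' * c"
      proof (rule norm_abs_linfty_diff_le[OF Ueb Ueb])
        fix z
        have sm: "(\<lambda>y. src x' y - src x y) \<in> borel_measurable borel" by measurable
        have "(LINT y|lborel. helmholtz_Phi k (z - y) * src x' y) - (LINT y|lborel. helmholtz_Phi k (z - y) * src x y)
          = (LINT y|lborel. helmholtz_Phi k (z - y) * (src x' y - src x y))"
          using DS(1)[of z x'] DS(1)[of z x] by (simp add: right_diff_distrib)
        then have "norm ((LINT y|lborel. helmholtz_Phi k (z - y) * src x' y) - (LINT y|lborel. helmholtz_Phi k (z - y) * src x y)) \<le> \<epsilon> * D"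
          using D(2)[OF sm sd, of z] s0 by simp
        moreover have "norm (of_real (fst x' - fst x) * g z) \<le> d' * c"
          unfolding norm_mult norm_of_real using f1 \<phi>b[of z] d' by (intro mult_mono) auto
        moreover have "U x' z - U x z = ((LINT y|lborel. helmholtz_Phi k (z - y) * src x' y) - (LINT y|lborel. helmholtz_Phi k (z - y) * src x y))
          + of_real (fst x' - fst x) * g z" by (simp add: U_def algebra_simps)
        ultimately show "norm (U x' z - U x z) \<le> \<epsilon> * D + d' * c"
          by (simp only:) (rule order_trans[OF norm_triangle_ineq add_mono])
      qed
      moreover have "dist (\<Psi> x') (\<Psi> x) \<le> \<bar>fst x' - fst x\<bar> + norm (abs_linfty (U x') - abs_linfty (U x))"
        unfolding \<Psi>_def dist_Pair_Pair dist_real_def dist_norm[of "abs_linfty _"] by (rule sqrt_sum_squares_le_sum) auto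
      moreover have "d' * (c + 1) = d' * c + d'" by (simp add: distrib_left)
      ultimately show ?thesis using f1 \<epsilon>D d'c e by linarith
    qed
    then show "\<exists>d>0. \<forall>x'\<in>C. dist x' x < d \<longrightarrow> dist (\<Psi> x') (\<Psi> x) < e" using d'(1) by blast
  qed
  have sol: "\<Psi> x \<in> nl_helmholtz_solutions k p Q \<phi>" if x: "x \<in> C" for x
  proof -
    have x0: "0 \<le> fst x" "snd x = F x" using C(2) x by auto
    \<comment> \<open>The nonlinearity evaluates u only on the support of Q, where both kernels give
      the same convolution; hence \<open>U x\<close> and \<open>tot x\<close> have the same
      source.\<close>
    have Utot: "U x y = tot x y" if y: "norm y \<le> r" for y
    proof -
      have "cutoff_Phi k T (y - t) * src x t = helmholtz_Phi k (y - t) * src x t" for t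
      proof (cases "norm t > r")
        case False
        then have "norm (y - t) \<le> T" using norm_triangle_ineq4[of y t] y by (simp add: T_def)
        then show ?thesis using Phi(3) by simp
      qed (simp add: s0)
      then have "kernel_conv \<kappa> (src x) y = (LINT t|lborel. helmholtz_Phi k (y - t) * src x t)"
        unfolding kernel_conv_def \<kappa>_def by (simp only:)
      then show ?thesis using arg_cong[OF x0(2), of "\<lambda>v. apply_bcontfun v y"] by (simp add: U_def tot_def apply_F)
    qed
    define w where "w = rep_linfty (abs_linfty (U x))"
    have w: "AE y in lebesgue. w y = U x y" unfolding w_def by (rule rep_abs_linfty[OF Ueb])
    have wm [measurable]: "w \<in> borel_measurable lebesgue" and Qm [measurable]: "rep_linfty Q \<in> borel_measurable lebesgue"
      unfolding w_def using ess_bounded_rep_linfty by (auto simp: ess_bounded_def)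
    have srcae: "AE y in lebesgue. of_real (rep_linfty Q y * norm (w y) powr (p - 2)) * w y = src x y"
      using w qae
    proof eventually_elim
      case (elim y)
      then show ?case using Utot[of y] q0[of y]
        by (cases "norm y \<le> r") (auto simp: src_def pow_map_def)
    qed
    have R: "helmholtz_R k (\<lambda>y. of_real (rep_linfty Q y * norm (w y) powr (p - 2)) * w y) z = (LINT y|lborel. helmholtz_Phi k (z - y) * src x y)" for z
    proof -
      have [measurable]: "(\<lambda>y. helmholtz_Phi k (z - y)) \<in> borel_measurable lebesgue" "src x \<in> borel_measurable lebesgue"
        by (rule measurable_completion, measurable)+
      have "helmholtz_R k (\<lambda>y. of_real (rep_linfty Q y * norm (w y) powr (p - 2)) * w y) z = (LINT y|lebesgue. helmholtz_Phi k (z - y) * src x y)"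
        unfolding helmholtz_R_def
      proof (rule Bochner_Integration.integral_cong_AE)
        show "AE y in lebesgue. helmholtz_Phi k (z - y) * (of_real (rep_linfty Q y * norm (w y) powr (p - 2)) * w y) = helmholtz_Phi k (z - y) * src x y"
          using srcae by eventually_elim simp
      qed measurable
      also have "\<dots> = (LINT y|lborel. helmholtz_Phi k (z - y) * src x y)" by (rule integral_completion) measurable
      finally show ?thesis .
    qed
    have "AE z in lebesgue. w z = helmholtz_R k (\<lambda>y. of_real (rep_linfty Q y * norm (w y) powr (p - 2)) * w y) z + of_real (fst x) * rep_linfty \<phi> z"
      using w gae
    proof eventually_elim
      case (elim z)
      then show ?case unfolding R by (simp add: U_def)
    qed
    then show ?thesis using x0(1) by (simp add: \<Psi>_def nl_helmholtz_solutions_def w_def)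
  qed
  have zero: "\<Psi> (0, 0) = (0, 0)"
  proof -
    have "U (0, 0) = (\<lambda>_. 0)" by (simp add: U_def src_def tot_def pow_map_def)
    then show ?thesis by (simp add: \<Psi>_def zero_linfty_def)
  qed
  have "connected (\<Psi> ` C)" by (rule connected_continuous_image[OF cont C(1)])
  moreover have "(0, 0) \<in> \<Psi> ` C" using zero C(3) by force
  moreover have "\<Psi> (\<Lambda>, v) \<in> \<Psi> ` C" using C(4) by blast
  ultimately have "connected_component (nl_helmholtz_solutions k p Q \<phi>) (0, 0) (\<Psi> (\<Lambda>, v))"
    unfolding connected_component_def using sol by blast
  then show ?thesis by (auto simp: \<Psi>_def)
qed

theorem theorem1p6:
  fixes k p :: real
    and Q :: "(real ^ 'n, real) linfty"
    and \<phi> :: "(real ^ 'n, complex) linfty"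
  assumes "CARD('n) \<ge> 3"
    and "k > 0"
    and "2 < p" and "p < 2 * real CARD('n) / (real CARD('n) - 2)"
    and "compact (ess_support Q)" and "Q \<noteq> 0"
    and "AE x in lebesgue. rep_linfty Q x \<le> 0"
    and "diameter (ess_support Q) \<le> first_zero_bessel_Y ((real CARD('n) - 2) / 2) / k"
  shows "(\<forall>lam>0. \<exists>u. (lam, u) \<in> connected_component_set (nl_helmholtz_solutions k p Q \<phi>) (0, 0))
    \<and> (\<exists>u. (1, u) \<in> nl_helmholtz_solutions k p Q \<phi>)"
proof -
  define n where "n = CARD('n) - 2"
  have n: "n \<ge> 1" "CARD('n) = n + 2" using assms(1) by (auto simp: n_def)
  have comp: "\<exists>u. (lam, u) \<in> connected_component_set (nl_helmholtz_solutions k p Q \<phi>) (0, 0)" if "lam > 0" for lam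
    by (rule helmholtz_component[OF n(1) _ assms(2,3) _ assms(5,7) _ that])
       (use assms(4,8) n(2) in \<open>simp_all add: add.commute\<close>)
  moreover obtain u where "(1, u) \<in> connected_component_set (nl_helmholtz_solutions k p Q \<phi>) (0, 0)"
    using comp[of 1] by auto
  ultimately show ?thesis using connected_component_subset by blast
qed

end
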